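(* Let $(\Sigma,\sigma)$ be a transitive countable Markov shift and $\tau\in\mathcal{R}$. Then the space $\mathcal{M}(\Sigma,\sigma,\tau)$ of invariant Borel probability measures of the suspension flow over $(\Sigma,\sigma)$ with roof function $\tau$, endowed with the weak* topology, is affinely homeomorphic to the Poulsen simplex minus a vertex and all of its convex combinations; that is, there are a Poulsen simplex $K$ and an extreme point $v$ of $K$ such that $\mathcal{M}(\Sigma,\sigma,\tau)$ is affinely homeomorphic to $K\setminus\{\lambda x+(1-\lambda)v: x\in K,\ 0\le\lambda<1\}$.
   Context: Let $\mathbb{N}=\{1,2,\dots\}$ and let $B=(B(i,j))_{i,j\in\mathbb{N}}$ be a matrix with entries in $\{0,1\}$ having no zero row and no zero column. The (one-sided) countable Markov shift defined by $B$ is $\Sigma=\{(x_n)_{n\in\mathbb{N}}\in\mathbb{N}^{\mathbb{N}}: B(x_n,x_{n+1})=1 \text{ for all } n\}$ with the shift map $\sigma(x_1,x_2,\dots)=(x_2,x_3,\dots)$. A cylinder of length $n$ is $[a_1\dots a_n]=\{x\in\Sigma: x_j=a_j,\ 1\le j\le n\}$; $\Sigma$ has the topology generated by cylinders. $(\Sigma,\sigma)$ is transitive if for all nonempty open $U,V\subset\Sigma$ there is $n\in\mathbb{N}$ with $U\cap\sigma^{-n}V\ne\emptyset$. For $\phi:\Sigma\to\mathbb{R}$, $var_n(\phi)=\sup\{|\phi(x)-\phi(y)|: x_i=y_i,\ 1\le i\le n\}$. Class $\mathcal{R}$: a positive function $\tau:\Sigma\to\mathbb{R}$ belongs to $\mathcal{R}$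 if (a) $\tau$ is uniformly continuous (i.e. $var_n(\tau)\to0$), bounded away from zero, and $var_2(\tau)<\infty$; (b) $\lim_{k\to\infty}\inf_{x:\,x_1\ge k}\tau(x)=\infty$. Suspension flow: $Y=\{(x,t)\in\Sigma\times\mathbb{R}: 0\le t\le\tau(x)\}$ with $(x,\tau(x))$ and $(\sigma(x),0)$ identified (quotient topology); the semi-flow $\Theta=(\theta_t)_{t\ge0}$ on $Y$ is determined by $\theta_t(x,s)=(x,s+t)$ whenever $s+t\in[0,\tau(x)]$. The weak* topology on probability measures on $Y$ is the coarsest making $\nu\mapsto\int f\,d\nu$ continuous for every bounded continuous $f:Y\to\mathbb{R}$. A Poulsen simplex is a metrizable compact convex Choquet simplex with at least two points whose extreme points are dense; it is unique up to affine homeomorphism. *)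

theory Defs
  imports "HOL-Probability.Probability"
begin

section \<open>Countable Markov shifts\<close>

text \<open>
  The alphabet \<open>{1, 2, \<dots>}\<close> is relabelled as \<open>nat\<close> by \<open>n \<mapsto> n - 1\<close>, and sequences are indexed
  from \<open>0\<close>: the coordinate \<open>x\<^sub>1\<close> of the usual notation is \<open>x 0\<close>.
\<close>

definition transition_matrix :: "(nat \<Rightarrow> nat \<Rightarrow> nat) \<Rightarrow> bool" where
  "transition_matrix B \<longleftrightarrow>
     (\<forall>i j. B i j \<in> {0, 1}) \<and> (\<forall>i. \<exists>j. B i j \<noteq> 0) \<and> (\<forall>j. \<exists>i. B i j \<noteq> 0)"

definition shift_space :: "(nat \<Rightarrow> nat \<Rightarrow> nat) \<Rightarrow> (nat \<Rightarrow> nat) set" where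
  "shift_space B = {x. \<forall>n. B (x n) (x (Suc n)) = 1}"

definition shift_map :: "(nat \<Rightarrow> nat) \<Rightarrow> nat \<Rightarrow> nat" where
  "shift_map x = (\<lambda>n. x (Suc n))"

definition cylinder :: "(nat \<Rightarrow> nat \<Rightarrow> nat) \<Rightarrow> nat list \<Rightarrow> (nat \<Rightarrow> nat) set" where
  "cylinder B a = {x \<in> shift_space B. \<forall>j<length a. x j = a ! j}"

definition shift_topology :: "(nat \<Rightarrow> nat \<Rightarrow> nat) \<Rightarrow> (nat \<Rightarrow> nat) topology" where
  "shift_topology B = topology_generated_by {cylinder B a | a. a \<noteq> []}"

definition transitive_shift :: "(nat \<Rightarrow> nat \<Rightarrow> nat) \<Rightarrow> bool" where
  "transitive_shift B \<longleftrightarrow>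
     (\<forall>U V. openin (shift_topology B) U \<and> U \<noteq> {} \<and> openin (shift_topology B) V \<and> V \<noteq> {} \<longrightarrow>
        (\<exists>n\<ge>1. U \<inter> (shift_map ^^ n) -` V \<noteq> {}))"

lemma topspace_shift_topology [simp]: "topspace (shift_topology B) = shift_space B"
proof -
  have "x \<in> cylinder B [x 0]" if "x \<in> shift_space B" for x
    using that by (simp add: cylinder_def)
  then have "shift_space B \<subseteq> \<Union>{cylinder B a | a. a \<noteq> []}"
    by blast
  moreover have "\<Union>{cylinder B a | a. a \<noteq> []} \<subseteq> shift_space B"
    by (auto simp: cylinder_def)
  ultimately show ?thesis
    unfolding shift_topology_def topology_generated_by_topspace by blast
qed

lemma shift_in_shift_space [simp]: "x \<in> shift_space B \<Longrightarrow> shift_map x \<in> shift_space B"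
  by (simp add: shift_space_def shift_map_def)


section \<open>Roof functions\<close>

text \<open>The variation takes values in \<open>[0, \<infinity>]\<close>, so that an infinite supremum is a genuine value.\<close>

definition variation :: "(nat \<Rightarrow> nat \<Rightarrow> nat) \<Rightarrow> nat \<Rightarrow> ((nat \<Rightarrow> nat) \<Rightarrow> real) \<Rightarrow> ennreal" where
  "variation B n \<phi> =
     (SUP (x, y) \<in> {(x, y). x \<in> shift_space B \<and> y \<in> shift_space B \<and> (\<forall>i<n. x i = y i)}.
        ennreal \<bar>\<phi> x - \<phi> y\<bar>)"

definition class_R :: "(nat \<Rightarrow> nat \<Rightarrow> nat) \<Rightarrow> ((nat \<Rightarrow> nat) \<Rightarrow> real) set" where
  "class_R B = {\<tau>.
     (\<forall>x\<in>shift_space B. \<tau> x > 0) \<and>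
     (\<lambda>n. variation B n \<tau>) \<longlonglongrightarrow> 0 \<and>
     (\<exists>c>0. \<forall>x\<in>shift_space B. c \<le> \<tau> x) \<and>
     variation B 2 \<tau> < \<infinity> \<and>
     (\<lambda>k. INF x\<in>{x \<in> shift_space B. k \<le> x 0}. ereal (\<tau> x)) \<longlonglongrightarrow> \<infinity>}"


section \<open>The suspension space and its semi-flow\<close>

definition quotient_topology :: "'a topology \<Rightarrow> 'a rel \<Rightarrow> 'a set topology" where
  "quotient_topology X R =
     topology (\<lambda>U. U \<subseteq> topspace X // R \<and> openin X {x \<in> topspace X. R `` {x} \<in> U})"

lemma openin_quotient_topology:
  "openin (quotient_topology X R) U \<longleftrightarrow>
     U \<subseteq> topspace X // R \<and> openin X {x \<in> topspace X. R `` {x} \<in> U}"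
proof -
  let ?P = "\<lambda>U. U \<subseteq> topspace X // R \<and> openin X {x \<in> topspace X. R `` {x} \<in> U}"
  have "istopology ?P"
    unfolding istopology_def
  proof (intro conjI allI impI)
    fix S T assume S: "?P S" and T: "?P T"
    have "{x \<in> topspace X. R `` {x} \<in> S \<inter> T} =
        {x \<in> topspace X. R `` {x} \<in> S} \<inter> {x \<in> topspace X. R `` {x} \<in> T}"
      by blast
    then show "openin X {x \<in> topspace X. R `` {x} \<in> S \<inter> T}"
      using S T by auto
    show "S \<inter> T \<subseteq> topspace X // R"
      using S by blast
  next
    fix \<K> assume K: "\<forall>K\<in>\<K>. ?P K"
    have "{x \<in> topspace X. R `` {x} \<in> \<Union>\<K>} = (\<Union>K\<in>\<K>. {x \<in> topspace X. R `` {x} \<in> K})"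
      by blast
    then show "openin X {x \<in> topspace X. R `` {x} \<in> \<Union>\<K>}"
      using K by auto
    show "\<Union>\<K> \<subseteq> topspace X // R"
      using K by blast
  qed
  then show ?thesis
    unfolding quotient_topology_def by simp
qed

lemma topspace_quotient_topology [simp]: "topspace (quotient_topology X R) = topspace X // R"
proof
  show "topspace (quotient_topology X R) \<subseteq> topspace X // R"
    using openin_quotient_topology[of X R] openin_topspace by blast
  have "{x \<in> topspace X. R `` {x} \<in> topspace X // R} = topspace X"
    by (auto intro: quotientI)
  then have "openin (quotient_topology X R) (topspace X // R)"
    by (simp add: openin_quotient_topology)
  then show "topspace X // R \<subseteq> topspace (quotient_topology X R)"
    by (rule openin_subset)
qed

definition suspension_domain ::
    "(nat \<Rightarrow> nat \<Rightarrow> nat) \<Rightarrow> ((nat \<Rightarrow> nat) \<Rightarrow> real) \<Rightarrow> ((nat \<Rightarrow> nat) \<times> real) set" where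
  "suspension_domain B \<tau> = {(x, t). x \<in> shift_space B \<and> 0 \<le> t \<and> t \<le> \<tau> x}"

definition gluing ::
    "(nat \<Rightarrow> nat \<Rightarrow> nat) \<Rightarrow> ((nat \<Rightarrow> nat) \<Rightarrow> real) \<Rightarrow> ((nat \<Rightarrow> nat) \<times> real) rel" where
  "gluing B \<tau> = {((x, \<tau> x), (shift_map x, 0)) | x. x \<in> shift_space B}"

text \<open>The equivalence relation on \<^term>\<open>suspension_domain B \<tau>\<close> generated by the gluing.\<close>

definition suspension_rel ::
    "(nat \<Rightarrow> nat \<Rightarrow> nat) \<Rightarrow> ((nat \<Rightarrow> nat) \<Rightarrow> real) \<Rightarrow> ((nat \<Rightarrow> nat) \<times> real) rel" where
  "suspension_rel B \<tau> =
     (gluing B \<tau> \<union> (gluing B \<tau>)\<inverse>)\<^sup>* \<inter> (suspension_domain B \<tau> \<times> suspension_domain B \<tau>)"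

definition suspension_class ::
    "(nat \<Rightarrow> nat \<Rightarrow> nat) \<Rightarrow> ((nat \<Rightarrow> nat) \<Rightarrow> real) \<Rightarrow> (nat \<Rightarrow> nat) \<times> real \<Rightarrow>
       ((nat \<Rightarrow> nat) \<times> real) set" where
  "suspension_class B \<tau> p = suspension_rel B \<tau> `` {p}"

definition suspension_topology ::
    "(nat \<Rightarrow> nat \<Rightarrow> nat) \<Rightarrow> ((nat \<Rightarrow> nat) \<Rightarrow> real) \<Rightarrow> ((nat \<Rightarrow> nat) \<times> real) set topology" where
  "suspension_topology B \<tau> =
     quotient_topology
       (subtopology (prod_topology (shift_topology B) euclideanreal) (suspension_domain B \<tau>))
       (suspension_rel B \<tau>)"

abbreviation suspension_space ::
    "(nat \<Rightarrow> nat \<Rightarrow> nat) \<Rightarrow> ((nat \<Rightarrow> nat) \<Rightarrow> real) \<Rightarrow> ((nat \<Rightarrow> nat) \<times> real) set set" where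
  "suspension_space B \<tau> \<equiv> topspace (suspension_topology B \<tau>)"

text \<open>
  The semi-flow is given by its defining property; \<open>suspension_semiflow_exists\<close> and
  \<open>suspension_semiflow_unique\<close> below show that it determines \<open>\<theta> t\<close> on the suspension space for
  all \<open>t \<ge> 0\<close>. Values of \<open>\<theta>\<close> for negative times or outside the suspension space are irrelevant.
\<close>

definition suspension_semiflow ::
    "(nat \<Rightarrow> nat \<Rightarrow> nat) \<Rightarrow> ((nat \<Rightarrow> nat) \<Rightarrow> real) \<Rightarrow>
       (real \<Rightarrow> ((nat \<Rightarrow> nat) \<times> real) set \<Rightarrow> ((nat \<Rightarrow> nat) \<times> real) set) \<Rightarrow> bool" where
  "suspension_semiflow B \<tau> \<theta> \<longleftrightarrow>
     (\<forall>t\<ge>0. \<forall>p\<in>suspension_space B \<tau>. \<theta> t p \<in> suspension_space B \<tau>) \<and>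
     (\<forall>p\<in>suspension_space B \<tau>. \<theta> 0 p = p) \<and>
     (\<forall>s\<ge>0. \<forall>t\<ge>0. \<forall>p\<in>suspension_space B \<tau>. \<theta> (s + t) p = \<theta> s (\<theta> t p)) \<and>
     (\<forall>(x, s)\<in>suspension_domain B \<tau>. \<forall>t\<ge>0. s + t \<le> \<tau> x \<longrightarrow>
        \<theta> t (suspension_class B \<tau> (x, s)) = suspension_class B \<tau> (x, s + t))"


section \<open>Invariant measures and the weak* topology\<close>

definition borel_of :: "'a topology \<Rightarrow> 'a measure" where
  "borel_of X = sigma (topspace X) {U. openin X U}"

definition prob_measures_on :: "'a topology \<Rightarrow> 'a measure set" where
  "prob_measures_on X = {\<nu>. sets \<nu> = sets (borel_of X) \<and> prob_space \<nu>}"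

definition weak_star_topology :: "'a topology \<Rightarrow> 'a measure topology" where
  "weak_star_topology X =
     topology_generated_by
       {{\<nu> \<in> prob_measures_on X. (\<integral>y. f y \<partial>\<nu>) \<in> W} | f W.
          continuous_map X euclideanreal f \<and> bounded (f ` topspace X) \<and> open W}"

definition invariant_measures ::
    "(nat \<Rightarrow> nat \<Rightarrow> nat) \<Rightarrow> ((nat \<Rightarrow> nat) \<Rightarrow> real) \<Rightarrow>
       (real \<Rightarrow> ((nat \<Rightarrow> nat) \<times> real) set \<Rightarrow> ((nat \<Rightarrow> nat) \<times> real) set) \<Rightarrow>
       ((nat \<Rightarrow> nat) \<times> real) set measure set" where
  "invariant_measures B \<tau> \<theta> =
     {\<nu> \<in> prob_measures_on (suspension_topology B \<tau>).
        \<forall>t\<ge>0. \<forall>A\<in>sets \<nu>. emeasure \<nu> (\<theta> t -` A \<inter> space \<nu>) = emeasure \<nu> A}"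

text \<open>The convex combination \<open>u \<mu> + (1 - u) \<nu>\<close> of two measures on the same measurable space.\<close>

definition convex_comb_measure :: "real \<Rightarrow> 'a measure \<Rightarrow> 'a measure \<Rightarrow> 'a measure" where
  "convex_comb_measure u \<mu> \<nu> =
     measure_of (space \<mu>) (sets \<mu>) (\<lambda>A. ennreal u * emeasure \<mu> A + ennreal (1 - u) * emeasure \<nu> A)"

lemma
  assumes "sets \<mu> = sets \<nu>"
  shows space_convex_comb_measure: "space (convex_comb_measure u \<mu> \<nu>) = space \<mu>"
    and sets_convex_comb_measure: "sets (convex_comb_measure u \<mu> \<nu>) = sets \<mu>"
    and emeasure_convex_comb_measure:
      "emeasure (convex_comb_measure u \<mu> \<nu>) A =
         ennreal u * emeasure \<mu> A + ennreal (1 - u) * emeasure \<nu> A"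
proof -
  show "space (convex_comb_measure u \<mu> \<nu>) = space \<mu>"
    unfolding convex_comb_measure_def by (simp add: space_measure_of_conv)
  show sets: "sets (convex_comb_measure u \<mu> \<nu>) = sets \<mu>"
    unfolding convex_comb_measure_def by simp
  let ?m = "\<lambda>A. ennreal u * emeasure \<mu> A + ennreal (1 - u) * emeasure \<nu> A"
  show "emeasure (convex_comb_measure u \<mu> \<nu>) A = ?m A"
  proof (cases "A \<in> sets \<mu>")
    case True
    have "countably_additive (sets \<mu>) ?m"
    proof (rule countably_additiveI)
      fix A :: "nat \<Rightarrow> _" assume A: "range A \<subseteq> sets \<mu>" "disjoint_family A"
      then have "range A \<subseteq> sets \<nu>" using assms by simp
      then show "(\<Sum>i. ?m (A i)) = ?m (\<Union>i. A i)"
        using A by (subst suminf_add[symmetric]) (simp_all add: suminf_emeasure)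
    qed
    then show ?thesis
      unfolding convex_comb_measure_def using True
      by (intro emeasure_measure_of_sigma)
        (auto simp: positive_def sets.sigma_algebra_axioms)
  next
    case False
    then show ?thesis
      using sets assms by (simp add: emeasure_notin_sets)
  qed
qed

lemma convex_comb_measure_in_invariant_measures:
  assumes \<mu>: "\<mu> \<in> invariant_measures B \<tau> \<theta>" and \<nu>: "\<nu> \<in> invariant_measures B \<tau> \<theta>"
    and u: "u \<in> {0..1}"
  shows "convex_comb_measure u \<mu> \<nu> \<in> invariant_measures B \<tau> \<theta>"
proof -
  have eq: "sets \<mu> = sets \<nu>" "space \<mu> = space \<nu>"
    using \<mu> \<nu> sets_eq_imp_space_eq[of \<mu> \<nu>] by (auto simp: invariant_measures_def prob_measures_on_def)
  have "prob_space \<mu>" "prob_space \<nu>"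
    using \<mu> \<nu> by (auto simp: invariant_measures_def prob_measures_on_def)
  then have "emeasure \<mu> (space \<mu>) = 1" "emeasure \<nu> (space \<mu>) = 1"
    using prob_space.emeasure_space_1 eq by metis+
  then have "prob_space (convex_comb_measure u \<mu> \<nu>)"
    using u by (intro prob_spaceI)
      (simp add: space_convex_comb_measure emeasure_convex_comb_measure eq ennreal_plus[symmetric]
        del: ennreal_plus)
  then show ?thesis
    using \<mu> \<nu> eq
    by (auto simp: invariant_measures_def prob_measures_on_def sets_convex_comb_measure
        space_convex_comb_measure emeasure_convex_comb_measure)
qed

definition affine_on_measures ::
    "'a measure set \<Rightarrow> ('a measure \<Rightarrow> 'b::real_vector) \<Rightarrow> bool" where
  "affine_on_measures M h \<longleftrightarrow>
     (\<forall>\<mu>\<in>M. \<forall>\<nu>\<in>M. \<forall>u\<in>{0..1}.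
        h (convex_comb_measure u \<mu> \<nu>) = u *\<^sub>R h \<mu> + (1 - u) *\<^sub>R h \<nu>)"


section \<open>The Poulsen simplex\<close>

definition extreme_points :: "'a::real_vector set \<Rightarrow> 'a set" where
  "extreme_points K = {x. x extreme_point_of K}"

text \<open>
  Choquet simplices: every point is the barycentre of exactly one Borel probability measure
  carried by the extreme points. For a metrizable compact convex set the set of extreme points is
  a \<open>G\<^sub>\<delta>\<close>, and this is the usual definition. Metrizability is automatic in a normed space.
\<close>

definition choquet_simplex :: "'a::real_normed_vector set \<Rightarrow> bool" where
  "choquet_simplex K \<longleftrightarrow> compact K \<and> convex K \<and>
     (\<forall>x\<in>K. \<exists>!\<mu>. sets \<mu> = sets borel \<and> prob_space \<mu> \<and> emeasure \<mu> (extreme_points K) = 1 \<and>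
        (\<forall>f::'a \<Rightarrow> real. bounded_linear f \<longrightarrow> (\<integral>y. f y \<partial>\<mu>) = f x))"

definition poulsen_simplex :: "'a::real_normed_vector set \<Rightarrow> bool" where
  "poulsen_simplex K \<longleftrightarrow>
     choquet_simplex K \<and> (\<exists>x\<in>K. \<exists>y\<in>K. x \<noteq> y) \<and> K \<subseteq> closure (extreme_points K)"


section \<open>Existence and uniqueness of the suspension semi-flow\<close>

lemma topspace_suspension:
  "suspension_space B \<tau> = suspension_domain B \<tau> // suspension_rel B \<tau>"
proof -
  have "suspension_domain B \<tau> \<subseteq> shift_space B \<times> UNIV"
    by (auto simp: suspension_domain_def)
  then show ?thesis
    by (simp add: suspension_topology_def topspace_subtopology Int_absorb1)
qed

lemma suspension_space_cases:
  assumes "p \<in> suspension_space B \<tau>"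
  obtains x s where "p = suspension_class B \<tau> (x, s)" "(x, s) \<in> suspension_domain B \<tau>"
  using assms unfolding topspace_suspension suspension_class_def
  by (metis quotientE surj_pair)

lemma suspension_class_in_space:
  "p \<in> suspension_domain B \<tau> \<Longrightarrow> suspension_class B \<tau> p \<in> suspension_space B \<tau>"
  unfolding topspace_suspension suspension_class_def by (rule quotientI)

lemma equiv_suspension_rel: "equiv (suspension_domain B \<tau>) (suspension_rel B \<tau>)"
proof -
  have "sym ((gluing B \<tau> \<union> (gluing B \<tau>)\<inverse>)\<^sup>*)"
    by (intro sym_rtrancl sym_Un_converse)
  then show ?thesis
    unfolding suspension_rel_def
    by (intro equivI) (auto simp: refl_on_def sym_def trans_def intro: rtrancl_trans)
qed

lemma suspension_class_eq_iff:
  assumes "p \<in> suspension_domain B \<tau>" "q \<in> suspension_domain B \<tau>"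
  shows "suspension_class B \<tau> p = suspension_class B \<tau> q \<longleftrightarrow> (p, q) \<in> suspension_rel B \<tau>"
  unfolding suspension_class_def using eq_equiv_class_iff[OF equiv_suspension_rel assms] .

lemma suspension_class_glue:
  assumes "\<forall>x\<in>shift_space B. \<tau> x > 0" "x \<in> shift_space B"
  shows "suspension_class B \<tau> (x, \<tau> x) = suspension_class B \<tau> (shift_map x, 0)"
proof -
  have "(x, \<tau> x) \<in> suspension_domain B \<tau>" "(shift_map x, 0) \<in> suspension_domain B \<tau>"
    using assms shift_in_shift_space[OF assms(2)] by (auto simp: suspension_domain_def less_imp_le)
  moreover have "((x, \<tau> x), (shift_map x, 0)) \<in> gluing B \<tau>"
    using assms(2) by (auto simp: gluing_def)
  ultimately show ?thesis
    by (subst suspension_class_eq_iff) (auto simp: suspension_rel_def)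
qed

lemma suspension_semiflow_unique:
  assumes roof: "\<tau> \<in> class_R B"
    and f: "suspension_semiflow B \<tau> \<theta>" and g: "suspension_semiflow B \<tau> \<theta>'"
    and t: "t \<ge> 0" and p: "p \<in> suspension_space B \<tau>"
  shows "\<theta> t p = \<theta>' t p"
proof -
  obtain c where c: "c > 0" "\<forall>x\<in>shift_space B. c \<le> \<tau> x"
    using roof by (auto simp: class_R_def)
  have pos: "\<forall>x\<in>shift_space B. \<tau> x > 0"
    using roof by (auto simp: class_R_def)
  have space: "\<theta> t p \<in> suspension_space B \<tau>"
    if "suspension_semiflow B \<tau> \<theta>" "t \<ge> 0" "p \<in> suspension_space B \<tau>" for \<theta> t p
    using that unfolding suspension_semiflow_def by blast
  have add: "\<theta> (s + t) p = \<theta> s (\<theta> t p)"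
    if "suspension_semiflow B \<tau> \<theta>" "s \<ge> 0" "t \<ge> 0" "p \<in> suspension_space B \<tau>" for \<theta> s t p
    using that unfolding suspension_semiflow_def by blast
  have loc: "\<theta> t (suspension_class B \<tau> (x, s)) = suspension_class B \<tau> (x, s + t)"
    if "suspension_semiflow B \<tau> \<theta>" "(x, s) \<in> suspension_domain B \<tau>" "t \<ge> 0" "s + t \<le> \<tau> x" for \<theta> x s t
    using that unfolding suspension_semiflow_def by blast
  have short: "\<theta> r p = \<theta>' r p" if r: "0 \<le> r" "r \<le> c" and p: "p \<in> suspension_space B \<tau>" for r p
  proof -
    obtain x s where xs: "p = suspension_class B \<tau> (x, s)" "(x, s) \<in> suspension_domain B \<tau>"
      using p by (rule suspension_space_cases)
    then have x: "x \<in> shift_space B" "0 \<le> s" "s \<le> \<tau> x"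
      by (auto simp: suspension_domain_def)
    show ?thesis
    proof (cases "s + r \<le> \<tau> x")
      case True
      then show ?thesis
        using loc[OF f xs(2)] loc[OF g xs(2)] r xs(1) by simp
    next
      case False
      define a where "a = \<tau> x - s"
      have a: "0 \<le> a" "0 \<le> r - a" "r - a \<le> c" "s + a = \<tau> x"
        using False x r by (auto simp: a_def)
      have x': "(shift_map x, 0) \<in> suspension_domain B \<tau>" "r - a \<le> \<tau> (shift_map x)"
        using x a c pos shift_in_shift_space[OF x(1)]
        by (auto simp: suspension_domain_def less_imp_le intro: order_trans)
      have "\<theta> r p = suspension_class B \<tau> (shift_map x, r - a)" if f: "suspension_semiflow B \<tau> \<theta>" for \<theta>
      proof -
        have "\<theta> r p = \<theta> (r - a) (\<theta> a p)"
          using add[OF f a(2,1) p] by simp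
        also have "\<theta> a p = suspension_class B \<tau> (shift_map x, 0)"
          using loc[OF f xs(2) a(1)] a(4) xs(1) suspension_class_glue[OF pos x(1)] by simp
        also have "\<theta> (r - a) \<dots> = suspension_class B \<tau> (shift_map x, r - a)"
          using loc[OF f x'(1) a(2)] x'(2) by simp
        finally show ?thesis .
      qed
      from this[OF f] this[OF g] show ?thesis
        by simp
    qed
  qed
  have "\<theta> r p = \<theta>' r p" if "0 \<le> r" "r \<le> real n * c" "p \<in> suspension_space B \<tau>" for n r p
    using that
  proof (induction n arbitrary: r p)
    case 0
    then show ?case
      using short[of 0 p] c by auto
  next
    case (Suc n)
    show ?case
    proof (cases "r \<le> c")
      case True
      then show ?thesis
        using short Suc.prems by blast
    next
      case False
      then have r: "0 \<le> r - c" "r - c \<le> real n * c" "0 \<le> c"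
        using Suc.prems c by (auto simp: algebra_simps)
      have "\<theta> r p = \<theta> (r - c) (\<theta> c p)"
        using add[OF f r(1,3) Suc.prems(3)] by simp
      also have "\<dots> = \<theta>' (r - c) (\<theta> c p)"
        using Suc.IH[OF r(1,2)] space[OF f r(3) Suc.prems(3)] by blast
      also have "\<theta> c p = \<theta>' c p"
        using short[of c p] r(3) Suc.prems by simp
      also have "\<theta>' (r - c) (\<theta>' c p) = \<theta>' r p"
        using add[OF g r(1,3) Suc.prems(3)] by simp
      finally show ?thesis .
    qed
  qed
  moreover obtain n where "t \<le> real n * c"
    using reals_Archimedean3[OF c(1)] less_imp_le by blast
  ultimately show ?thesis
    using t p by blast
qed

lemma suspension_semiflow_exists:
  assumes roof: "\<tau> \<in> class_R B"
  shows "\<exists>\<theta>. suspension_semiflow B \<tau> \<theta>"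
proof -
  obtain c where c: "c > 0" "\<forall>x\<in>shift_space B. c \<le> \<tau> x"
    using roof by (auto simp: class_R_def)
  have pos: "\<forall>x\<in>shift_space B. \<tau> x > 0"
    using roof by (auto simp: class_R_def)
  let ?cl = "suspension_class B \<tau>"
  define step where "step = (\<lambda>(x, u). (shift_map x, u - \<tau> x))"
  \<comment> \<open>\<open>Q x u q\<close>: starting at \<open>(x, 0)\<close> and flowing for time \<open>u\<close> one arrives at \<open>q\<close>.\<close>
  define Q where "Q = (\<lambda>x u q. \<exists>n y v. (step ^^ n) (x, u) = (y, v) \<and>
      (y, v) \<in> suspension_domain B \<tau> \<and> q = ?cl (y, v))"
  have stepS: "(step ^^ Suc n) (x, u) = (step ^^ n) (shift_map x, u - \<tau> x)" for n x u
    by (simp add: step_def funpow_Suc_right del: funpow.simps)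
  have neg: "u < 0 \<Longrightarrow> x \<in> shift_space B \<Longrightarrow> (step ^^ n) (x, u) \<notin> suspension_domain B \<tau>" for n x u
  proof (induction n arbitrary: x u)
    case 0
    then show ?case by (simp add: suspension_domain_def)
  next
    case (Suc n)
    then have "\<tau> x > 0" using pos by blast
    then have "u - \<tau> x < 0" using Suc.prems by linarith
    then show ?case
      using Suc.IH Suc.prems shift_in_shift_space unfolding stepS by blast
  qed
  have ex: "\<exists>q. Q x u q" if "x \<in> shift_space B" "0 \<le> u" for x u
  proof -
    obtain N where "u \<le> real N * c"
      using reals_Archimedean3[OF c(1)] less_imp_le by blast
    then have "\<exists>n. (step ^^ n) (x, u) \<in> suspension_domain B \<tau>"
      using that
    proof (induction N arbitrary: x u)
      case 0
      then have "(step ^^ 0) (x, u) \<in> suspension_domain B \<tau>"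
        using pos by (auto simp: suspension_domain_def less_imp_le)
      then show ?case by blast
    next
      case (Suc N)
      show ?case
      proof (cases "u \<le> \<tau> x")
        case True
        then have "(step ^^ 0) (x, u) \<in> suspension_domain B \<tau>"
          using Suc.prems by (auto simp: suspension_domain_def)
        then show ?thesis by blast
      next
        case False
        have "c \<le> \<tau> x" using c Suc.prems by blast
        then have "u - \<tau> x \<le> real N * c"
          using Suc.prems by (simp add: algebra_simps)
        then obtain n where "(step ^^ n) (shift_map x, u - \<tau> x) \<in> suspension_domain B \<tau>"
          using Suc.IH[of "u - \<tau> x" "shift_map x"] False Suc.prems shift_in_shift_space by fastforce
        then show ?thesis
          using stepS by metis
      qed
    qed
    then show ?thesis
      unfolding Q_def by (metis surj_pair)
  qed
  have base: "q = ?cl (x, u)"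
    if "x \<in> shift_space B" "0 \<le> u" "u \<le> \<tau> x" "Q x u q" for x u q
  proof -
    obtain n y v where n: "(step ^^ n) (x, u) = (y, v)" "(y, v) \<in> suspension_domain B \<tau>"
        "q = ?cl (y, v)"
      using \<open>Q x u q\<close> unfolding Q_def by blast
    show ?thesis
    proof (cases n)
      case 0
      then show ?thesis using n by simp
    next
      case (Suc m)
      have *: "(step ^^ m) (shift_map x, u - \<tau> x) = (y, v)"
        using n(1) stepS Suc by simp
      then have eq: "u = \<tau> x"
        using neg[of "u - \<tau> x" "shift_map x" m] n(2) that shift_in_shift_space[OF that(1)] by fastforce
      have "m = 0"
      proof (rule ccontr)
        assume "m \<noteq> 0"
        then obtain k where "m = Suc k" using not0_implies_Suc by blast
        then have "(step ^^ k) (shift_map (shift_map x), - \<tau> (shift_map x)) = (y, v)"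
          using * stepS eq by simp
        then show False
          using neg[of "- \<tau> (shift_map x)" "shift_map (shift_map x)" k] n(2) pos that(1) by fastforce
      qed
      then have "(y, v) = (shift_map x, 0)" using * eq by simp
      then show ?thesis
        using n(3) eq suspension_class_glue[OF pos that(1)] by simp
    qed
  qed
  have Q0: "Q x u (?cl (x, u))" if "(x, u) \<in> suspension_domain B \<tau>" for x u
    unfolding Q_def by (intro exI[of _ 0] exI[of _ x] exI[of _ u]) (use that in simp)
  have Qstep: "Q x (\<tau> x + u) q" if Qs: "Q (shift_map x) u q" for x u q
  proof -
    obtain n y v where "(step ^^ n) (shift_map x, u) = (y, v)" "(y, v) \<in> suspension_domain B \<tau>"
        "q = ?cl (y, v)"
      using Qs unfolding Q_def by blast
    then show ?thesis
      unfolding Q_def by (intro exI[of _ "Suc n"]) (simp add: stepS del: funpow.simps)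
  qed
  have Qback: "Q (shift_map x) (u - \<tau> x) q" if Qs: "Q x u q" "\<tau> x < u" for x u q
  proof -
    obtain n y v where n: "(step ^^ n) (x, u) = (y, v)" "(y, v) \<in> suspension_domain B \<tau>"
        "q = ?cl (y, v)"
      using Qs unfolding Q_def by blast
    then have "n \<noteq> 0" using Qs(2) by (cases n) (auto simp: suspension_domain_def)
    then obtain m where "n = Suc m" using not0_implies_Suc by blast
    then show ?thesis
      using n unfolding Q_def stepS by (metis stepS)
  qed
  have uniq: "q = q'" if "x \<in> shift_space B" "0 \<le> u" "Q x u q" "Q x u q'" for x u q q'
  proof -
    obtain N where "u \<le> real N * c"
      using reals_Archimedean3[OF c(1)] less_imp_le by blast
    then show ?thesis
      using that
    proof (induction N arbitrary: x u)
      case 0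
      then have "u \<le> \<tau> x" using pos by (auto simp: less_imp_le)
      then show ?case using base 0 by metis
    next
      case (Suc N)
      show ?case
      proof (cases "u \<le> \<tau> x")
        case True
        then show ?thesis using base Suc.prems by metis
      next
        case False
        have "c \<le> \<tau> x" using c Suc.prems by blast
        then have "u - \<tau> x \<le> real N * c" "0 \<le> u - \<tau> x"
          using Suc.prems False by (simp_all add: algebra_simps)
        then show ?thesis
          using Suc.IH[of "u - \<tau> x" "shift_map x"] Qback[of x u] False Suc.prems by auto
      qed
    qed
  qed
  define F where "F = (\<lambda>x u. THE q. Q x u q)"
  have FQ: "Q x u (F x u)" if "x \<in> shift_space B" "0 \<le> u" for x u
    unfolding F_def using ex[OF that] uniq[OF that] by (metis theI)
  have FI: "F x u = q" if "x \<in> shift_space B" "0 \<le> u" "Q x u q" for x u q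
    using FQ uniq that by blast
  have Fshift: "F x (\<tau> x + u) = F (shift_map x) u" if "x \<in> shift_space B" "0 \<le> u" for x u
    using that pos by (intro FI Qstep FQ) (auto simp: less_imp_le)
  have Frel: "F x (s + t) = F y (r + t)"
    if rel: "((x, s), (y, r)) \<in> (gluing B \<tau> \<union> (gluing B \<tau>)\<inverse>)\<^sup>*" and t: "0 \<le> t" for x s y r t
  proof -
    have "case (x, s) of (x, s) \<Rightarrow> case (y, r) of (y, r) \<Rightarrow> F x (s + t) = F y (r + t)"
      using rel
    proof (induction rule: rtrancl_induct)
      case base
      then show ?case by simp
    next
      case (step q q')
      then show ?case
        using Fshift[OF _ t] by (auto simp: gluing_def)
    qed
    then show ?thesis by simp
  qed
  define \<theta> where "\<theta> = (\<lambda>t p. let (x, s) = (SOME z. z \<in> suspension_domain B \<tau> \<and> p = ?cl z) in F x (s + t))"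
  have th: "\<theta> t (?cl (x, s)) = F x (s + t)" if d: "(x, s) \<in> suspension_domain B \<tau>" and t: "0 \<le> t" for x s t
  proof -
    define z where "z = (SOME z. z \<in> suspension_domain B \<tau> \<and> ?cl (x, s) = ?cl z)"
    have z: "z \<in> suspension_domain B \<tau> \<and> ?cl (x, s) = ?cl z"
      unfolding z_def by (rule someI[of _ "(x, s)"]) (use d in simp)
    obtain y r where yr: "z = (y, r)" by fastforce
    have "((x, s), (y, r)) \<in> suspension_rel B \<tau>"
      using z yr suspension_class_eq_iff[OF d] by metis
    then have "F x (s + t) = F y (r + t)"
      by (intro Frel t) (auto simp: suspension_rel_def)
    then show ?thesis
      unfolding \<theta>_def z_def[symmetric] yr by simp
  qed
  have Fform: "\<exists>y v. (y, v) \<in> suspension_domain B \<tau> \<and> F x u = ?cl (y, v) \<and>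
      (\<forall>s\<ge>0. F x (u + s) = F y (v + s))" if "x \<in> shift_space B" "0 \<le> u" for x u
  proof -
    obtain N where "u \<le> real N * c"
      using reals_Archimedean3[OF c(1)] less_imp_le by blast
    then show ?thesis
      using that
    proof (induction N arbitrary: x u)
      case 0
      then have "(x, u) \<in> suspension_domain B \<tau>"
        using pos by (auto simp: suspension_domain_def less_imp_le)
      then show ?case using FI[OF 0(2,3) Q0] by blast
    next
      case (Suc N)
      show ?case
      proof (cases "u \<le> \<tau> x")
        case True
        then have "(x, u) \<in> suspension_domain B \<tau>"
          using Suc.prems by (auto simp: suspension_domain_def)
        then show ?thesis using FI[OF Suc.prems(2,3) Q0] by blast
      next
        case False
        have "c \<le> \<tau> x" using c Suc.prems by blast
        then have u: "u - \<tau> x \<le> real N * c" "0 \<le> u - \<tau> x"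
          using Suc.prems False by (simp_all add: algebra_simps)
        obtain y v where yv: "(y, v) \<in> suspension_domain B \<tau>" "F (shift_map x) (u - \<tau> x) = ?cl (y, v)"
            "\<forall>s\<ge>0. F (shift_map x) (u - \<tau> x + s) = F y (v + s)"
          using Suc.IH[OF u(1) shift_in_shift_space[OF Suc.prems(2)] u(2)] by blast
        have "F x (u + s) = F (shift_map x) (u - \<tau> x + s)" if "0 \<le> s" for s
          using Fshift[OF Suc.prems(2), of "u - \<tau> x + s"] that u(2) by (simp add: algebra_simps)
        then show ?thesis
          using yv by (metis add.right_neutral order_refl)
      qed
    qed
  qed
  have "suspension_semiflow B \<tau> \<theta>"
    unfolding suspension_semiflow_def
  proof (intro conjI ballI allI impI)
    fix t :: real and p assume t: "0 \<le> t" and p: "p \<in> suspension_space B \<tau>"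
    obtain x s where xs: "p = ?cl (x, s)" "(x, s) \<in> suspension_domain B \<tau>"
      using p by (rule suspension_space_cases)
    then have x: "x \<in> shift_space B" "0 \<le> s"
      by (auto simp: suspension_domain_def)
    obtain y v where yv: "(y, v) \<in> suspension_domain B \<tau>" "F x (s + t) = ?cl (y, v)"
      using Fform[OF x(1), of "s + t"] x t by auto
    then show "\<theta> t p \<in> suspension_space B \<tau>"
      using th[OF xs(2) t] xs(1) suspension_class_in_space by metis
  next
    fix p assume p: "p \<in> suspension_space B \<tau>"
    obtain x s where xs: "p = ?cl (x, s)" "(x, s) \<in> suspension_domain B \<tau>"
      using p by (rule suspension_space_cases)
    then have "F x s = ?cl (x, s)"
      by (intro FI Q0) (auto simp: suspension_domain_def)
    then show "\<theta> 0 p = p"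
      using th[OF xs(2), of 0] xs(1) by simp
  next
    fix r t :: real and p assume r: "0 \<le> r" and t: "0 \<le> t" and p: "p \<in> suspension_space B \<tau>"
    obtain x s where xs: "p = ?cl (x, s)" "(x, s) \<in> suspension_domain B \<tau>"
      using p by (rule suspension_space_cases)
    then have x: "x \<in> shift_space B" "0 \<le> s + t"
      using t by (auto simp: suspension_domain_def)
    obtain y v where yv: "(y, v) \<in> suspension_domain B \<tau>" "F x (s + t) = ?cl (y, v)"
        "\<forall>r\<ge>0. F x (s + t + r) = F y (v + r)"
      using Fform[OF x] by blast
    have "\<theta> r (\<theta> t p) = F y (v + r)"
      using th[OF xs(2) t] th[OF yv(1) r] xs(1) yv(2) by simp
    also have "\<dots> = F x (s + (r + t))"
      using yv(3) r by (simp add: add_ac)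
    also have "\<dots> = \<theta> (r + t) p"
      using th[OF xs(2), of "r + t"] r t xs(1) by simp
    finally show "\<theta> (r + t) p = \<theta> r (\<theta> t p)" by simp
  next
    fix z assume z: "z \<in> suspension_domain B \<tau>"
    show "case z of (x, s) \<Rightarrow> \<forall>t\<ge>0. s + t \<le> \<tau> x \<longrightarrow> \<theta> t (?cl (x, s)) = ?cl (x, s + t)"
    proof (clarify)
      fix x s t assume zz: "z = (x, s)" and t: "0 \<le> (t::real)" "s + t \<le> \<tau> x"
      have d: "(x, s) \<in> suspension_domain B \<tau>" using z zz by simp
      then have "F x (s + t) = ?cl (x, s + t)"
        using t by (intro FI Q0) (auto simp: suspension_domain_def)
      then show "\<theta> t (?cl (x, s)) = ?cl (x, s + t)"
        using th[OF d t(1)] by simp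
    qed
  qed
  then show ?thesis by blast
qed

end

theory Submission
  imports Defs
begin

text \<open>
  Let \<open>2 c \<le> \<tau>\<close>. A flow-invariant probability measure \<open>\<nu>\<close> is determined by the shift-invariant measure
  \<open>m(A) = \<nu>{(x, s). x \<in> A, s < c}\<close>: by Palm's formula \<open>c \<nu>\<close> is the restriction of \<open>m \<otimes> Lebesgue\<close> to the
  region below the roof. So \<open>\<nu>\<close> ranges over the shift-invariant \<open>m\<close> with \<open>\<integral> \<tau>/c dm = 1\<close>.

  Identify \<open>m\<close> with its masses of cylinders, and let \<open>K\<close> consist of the invariant \<open>m\<close> with
  \<open>\<integral> \<tau>/c dm \<le> 1\<close>. As the roof tends to infinity with the first symbol, no mass escapes within \<open>K\<close>, which is
  therefore compact; the measures of roof mass below \<open>1\<close> are the proper convex combinations with the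
  vertex \<open>0\<close>. The extreme points are \<open>0\<close> and the normalised ergodic measures, so that the ergodic
  decomposition, obtained from Birkhoff's theorem, makes \<open>K\<close> a Choquet simplex. Normalised periodic orbits
  are dense in \<open>K\<close>: concatenating loops shows that their closure is convex, short loops through symbols of
  large roof tend to \<open>0\<close>, and closing up typical orbits at return times approaches every ergodic measure.

  Finally, weak* convergence of the \<open>\<nu>\<close> is convergence of \<open>m\<close> on cylinders. In one direction, cylinder masses
  are integrals of bump functions that vanish at the bottom and at the roof. In the other, integrals of
  nonnegative continuous functions are lower semicontinuous for convergence on cylinders, which
  suffices because it applies to both \<open>C + f\<close> and \<open>C - f\<close>.
\<close>

subsection \<open>Cylinders in the sequence space\<close>

text \<open>The value \<open>c\<close> is half of a lower bound of the roof: the slab of height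
  \<open>c\<close> above the base can then be pushed by time \<open>c\<close> into the slab between
  \<open>c\<close> and \<open>2 * c\<close>, still below every roof, which is how Palm's formula
  reaches the bottom slab. Cylinder masses are embedded into bounded sequences because a Poulsen
  simplex is asked for inside a normed space; damping the coordinates by powers of 1/2 makes
  convergence on cylinders the same as norm convergence on the image. The obstacle is that the space
  is not compact and the roof is unbounded. Roof mass can disappear in a limit, so \<open>K\<close>
  has to contain all defects, and the vertex stands for total loss. Two normalisations coexist:
  empirical measures have mass one, extreme points other than the vertex have roof mass one, and
  \<open>tx\<close> converts between them. This factor appears as a density in the representing
  measures and determines them away from the vertex, whose mass follows from the total. Averages of
  the roof converge because a lower bound from semicontinuity is confronted with equality of
  integrals.\<close>

definition cyl :: "nat list \<Rightarrow> (nat \<Rightarrow> nat) set" where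
  "cyl w = {x. \<forall>j<length w. x j = w ! j}"

definition pre :: "nat \<Rightarrow> (nat \<Rightarrow> nat) \<Rightarrow> nat list" where
  "pre n x = map x [0..<n]"

lemma length_pre [simp]: "length (pre n x) = n"
  by (simp add: pre_def)

lemma nth_pre [simp]: "j < n \<Longrightarrow> pre n x ! j = x j"
  by (simp add: pre_def)

lemma pre_Suc: "pre (Suc n) x = pre n x @ [x n]"
  by (simp add: pre_def)

lemma in_cyl_iff: "x \<in> cyl w \<longleftrightarrow> pre (length w) x = w"
  by (auto simp: cyl_def list_eq_iff_nth_eq)

lemma in_cyl_pre: "y \<in> cyl (pre n x) \<longleftrightarrow> (\<forall>j<n. y j = x j)"
  by (auto simp: cyl_def)

lemma cyl_Nil [simp]: "cyl [] = UNIV"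
  by (simp add: cyl_def)

lemma in_cyl_snoc: "x \<in> cyl (w @ [j]) \<longleftrightarrow> x \<in> cyl w \<and> x (length w) = j"
  by (auto simp: cyl_def nth_append less_Suc_eq)

lemma in_cyl_Cons: "x \<in> cyl (j # w) \<longleftrightarrow> x 0 = j \<and> shift_map x \<in> cyl w"
  unfolding cyl_def shift_map_def using less_Suc_eq_0_disj by auto

lemma cyl_disjoint: "length u = length v \<Longrightarrow> u \<noteq> v \<Longrightarrow> cyl u \<inter> cyl v = {}"
  by (auto simp: in_cyl_iff)

lemma cyl_snoc_Union: "cyl w = (\<Union>j. cyl (w @ [j]))"
  by (auto simp: in_cyl_snoc)

lemma shift_vimage_cyl: "shift_map -` cyl w = (\<Union>j. cyl (j # w))"
  by (auto simp: in_cyl_Cons)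

lemma cyl_Int_cases: "cyl u \<inter> cyl v = {} \<or> cyl u \<inter> cyl v = cyl u \<or> cyl u \<inter> cyl v = cyl v"
proof -
  have *: "cyl u \<inter> cyl v = {} \<or> cyl u \<inter> cyl v = cyl v" if "length u \<le> length v" for u v
  proof (cases "\<forall>j<length u. u ! j = v ! j")
    case True
    then show ?thesis using that by (auto simp: cyl_def)
  next
    case False
    then obtain j where "j < length u" "u ! j \<noteq> v ! j" by auto
    then show ?thesis using that by (force simp: cyl_def)
  qed
  show ?thesis
    using *[of u v] *[of v u] by (metis Int_commute linear)
qed

lemma open_cyl: "open (cyl w)"
proof -
  have "cyl w = (\<Inter>j\<in>{..<length w}. (\<lambda>x. x j) -` {w ! j})"
    by (auto simp: cyl_def)
  moreover have "open ((\<lambda>x::nat \<Rightarrow> nat. x j) -` {w ! j})" for j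
  proof (rule open_vimage)
    show "open {w ! j}" by (rule discrete_topology_class.open_discrete)
  qed (rule continuous_on_product_coordinates)
  ultimately show ?thesis by auto
qed

lemma open_contains_cyl:
  assumes "open U" "x \<in> U"
  obtains n where "cyl (pre n x) \<subseteq> U"
proof -
  obtain X where X: "x \<in> Pi\<^sub>E UNIV X" "finite {i. X i \<noteq> topspace euclidean}" "Pi\<^sub>E UNIV X \<subseteq> U"
    using product_topology_open_contains_basis[of "\<lambda>_. euclidean" UNIV U x] assms
    unfolding open_fun_def by blast
  define n where "n = Suc (Max (insert 0 {i. X i \<noteq> UNIV}))"
  have n: "i < n" if "X i \<noteq> UNIV" for i
    unfolding n_def using X(2) that by (auto intro!: le_imp_less_Suc Max_ge)
  have "y \<in> U" if "y \<in> cyl (pre n x)" for y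
  proof -
    have "y i \<in> X i" for i
    proof (cases "X i = UNIV")
      case False
      then have "y i = x i" using n that by (auto simp: in_cyl_pre)
      then show ?thesis using X(1) by (auto simp: PiE_iff)
    qed simp
    then have "y \<in> Pi\<^sub>E UNIV X" by auto
    then show ?thesis using X(3) by blast
  qed
  then have "cyl (pre n x) \<subseteq> U" by blast
  then show ?thesis by (rule that)
qed

lemma open_eq_Union_cyl:
  assumes "open U"
  shows "U = \<Union>(cyl ` {w. cyl w \<subseteq> U})"
proof -
  have "x \<in> \<Union>(cyl ` {w. cyl w \<subseteq> U})" if "x \<in> U" for x
  proof -
    obtain n where "cyl (pre n x) \<subseteq> U" using open_contains_cyl[OF assms \<open>x \<in> U\<close>] by blast
    moreover have "x \<in> cyl (pre n x)" by (simp add: in_cyl_pre)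
    ultimately show ?thesis by blast
  qed
  then show ?thesis by auto
qed

lemma continuous_on_shift_map: "continuous_on A shift_map"
  unfolding shift_map_def
  by (intro continuous_on_coordinatewise_then_product continuous_on_subset[OF continuous_on_product_coordinates]) simp

lemma shift_map_measurable [measurable]: "shift_map \<in> borel \<rightarrow>\<^sub>M borel"
  by (intro borel_measurable_continuous_onI continuous_on_shift_map)

lemma cyl_in_borel [measurable]: "cyl w \<in> sets borel"
  by (intro borel_open open_cyl)

text \<open>The empty set is included so that intersections stay in the family: two cylinders are
  nested or disjoint.\<close>

definition cyls :: "(nat \<Rightarrow> nat) set set" where
  "cyls = insert {} (range cyl)"

lemma Int_stable_cyls: "Int_stable cyls"
proof (unfold Int_stable_def, intro ballI)
  fix a b assume "a \<in> cyls" "b \<in> cyls"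
  then consider "a = {} \<or> b = {}" | u v where "a = cyl u" "b = cyl v"
    unfolding cyls_def by blast
  then show "a \<inter> b \<in> cyls"
  proof cases
    case 1
    then show ?thesis by (auto simp: cyls_def)
  next
    case 2
    then show ?thesis using cyl_Int_cases[of u v] by (auto simp: cyls_def)
  qed
qed

lemma sets_borel_cyls: "sets (borel :: (nat \<Rightarrow> nat) measure) = sigma_sets UNIV cyls"
proof
  show "sigma_sets UNIV cyls \<subseteq> sets (borel :: (nat \<Rightarrow> nat) measure)"
    by (intro sets.sigma_sets_subset[of _ borel, simplified]) (auto simp: cyls_def)
  have "U \<in> sigma_sets UNIV cyls" if U: "open U" for U
  proof -
    have "countable (cyl ` {w. cyl w \<subseteq> U})" by simp
    moreover have "b \<in> sigma_sets UNIV cyls" if "b \<in> cyl ` {w. cyl w \<subseteq> U}" for b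
    proof (rule sigma_sets.Basic)
      show "b \<in> cyls" using that unfolding cyls_def by blast
    qed
    ultimately have "\<Union>(cyl ` {w. cyl w \<subseteq> U}) \<in> sigma_sets UNIV cyls"
      by (rule sigma_sets_UNION)
    with open_eq_Union_cyl[OF U] show ?thesis by (rule back_subst[of "\<lambda>V. V \<in> sigma_sets UNIV cyls", OF _ sym, rotated])
  qed
  then show "sets (borel :: (nat \<Rightarrow> nat) measure) \<subseteq> sigma_sets UNIV cyls"
    unfolding sets_borel by (intro sigma_sets_mono) blast
qed

lemma measure_eqI_cyl:
  assumes "sets M = sets borel" "sets N = sets borel" "finite_measure M"
    and "\<And>w. emeasure M (cyl w) = emeasure N (cyl w)"
  shows "M = N"
proof (rule measure_eqI_generator_eq[OF Int_stable_cyls, where A = "\<lambda>_. UNIV"])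
  show "emeasure M UNIV \<noteq> \<infinity>"
    using assms(1,3) sets_eq_imp_space_eq[OF assms(1)] finite_measure.emeasure_finite by auto
  show "range (\<lambda>_. UNIV) \<subseteq> cyls" 
    unfolding cyls_def using cyl_Nil by blast
  show "emeasure M X = emeasure N X" if "X \<in> cyls" for X
    using that assms(4) by (auto simp: cyls_def)
qed (use assms sets_borel_cyls in auto)

lemma measurable_into_seq:
  assumes "\<And>w. f -` cyl w \<inter> space M \<in> sets M"
  shows "f \<in> M \<rightarrow>\<^sub>M (borel :: (nat \<Rightarrow> nat) measure)"
proof (rule measurable_sigma_sets[OF sets_borel_cyls])
  show "f -` y \<inter> space M \<in> sets M" if "y \<in> cyls" for y
    using that assms by (auto simp: cyls_def)
qed auto

lemma emeasure_cyl_Cons: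
  assumes "sets M = sets borel"
  shows "(\<Sum>j. emeasure M (cyl (j # w))) = emeasure M (shift_map -` cyl w)"
  by (subst shift_vimage_cyl, subst suminf_emeasure)
    (auto simp: assms disjoint_family_on_def in_cyl_Cons)

subsection \<open>Measures with prescribed values on cylinders\<close>

text \<open>A measure with given cylinder masses is obtained by coding reals: the words cut an
  interval of length \<open>q []\<close> into nested half-open intervals \<open>ivl w\<close> of
  length \<open>q w\<close>, and a real is sent to the sequence of intervals containing it. Lebesgue
  measure is pushed forward along this map.\<close>

locale cyl_weights =
  fixes q :: "nat list \<Rightarrow> real"
  assumes nonneg: "0 \<le> q w"
    and sums_snoc: "(\<lambda>j. q (w @ [j])) sums q w"
begin

text \<open>Total weight of the words of the same length that precede \<open>w\<close>
  lexicographically.\<close>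

definition lft :: "nat list \<Rightarrow> real" where
  "lft w = (\<Sum>k<length w. \<Sum>i<w ! k. q (take k w @ [i]))"

definition ivl :: "nat list \<Rightarrow> real set" where
  "ivl w = {lft w ..< lft w + q w}"

lemma lft_snoc: "lft (w @ [j]) = lft w + (\<Sum>i<j. q (w @ [i]))"
  by (auto simp: lft_def nth_append intro!: sum.cong)

lemma sum_le: "(\<Sum>i<j. q (w @ [i])) \<le> q w"
  using sum_le_suminf[OF sums_summable[OF sums_snoc], of "{..<j}" w] nonneg sums_unique[OF sums_snoc, of w]
  by auto

lemma sum_mono_idx: "i \<le> j \<Longrightarrow> (\<Sum>i<i. q (w @ [i])) \<le> (\<Sum>i<j. q (w @ [i]))"
  by (intro sum_mono2) (auto simp: nonneg)

lemma ivl_snoc_subset: "ivl (w @ [j]) \<subseteq> ivl w"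
proof -
  have "0 \<le> (\<Sum>i<j. q (w @ [i]))" by (intro sum_nonneg nonneg)
  then show ?thesis using sum_le[where j = "Suc j" and w = w] by (auto simp: ivl_def lft_snoc)
qed

text \<open>The half-open shape matters: \<open>u\<close> lies strictly below the right end of
  \<open>ivl w\<close>, so some finite partial sum already passes it, and the first one to do so
  names the child interval.\<close>

lemma ivl_snoc_ex:
  assumes "u \<in> ivl w" shows "\<exists>j. u \<in> ivl (w @ [j])"
proof -
  have "(\<lambda>n. \<Sum>i<n. q (w @ [i])) \<longlonglongrightarrow> q w"
    using sums_snoc unfolding sums_def .
  moreover have "u - lft w < q w" using assms by (auto simp: ivl_def)
  ultimately have "\<forall>\<^sub>F n in sequentially. u - lft w < (\<Sum>i<n. q (w @ [i]))"
    by (rule order_tendstoD(1))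
  then obtain n where n: "u - lft w < (\<Sum>i<n. q (w @ [i]))"
    by (auto simp: eventually_sequentially)
  define m where "m = (LEAST n. u - lft w < (\<Sum>i<n. q (w @ [i])))"
  have m: "u - lft w < (\<Sum>i<m. q (w @ [i]))"
    unfolding m_def using n by (rule LeastI)
  have "m \<noteq> 0"
  proof
    assume "m = 0"
    then show False using m assms by (auto simp: ivl_def)
  qed
  then obtain j where j: "m = Suc j" using not0_implies_Suc by blast
  have "\<not> u - lft w < (\<Sum>i<j. q (w @ [i]))"
    using not_less_Least[of j "\<lambda>n. u - lft w < (\<Sum>i<n. q (w @ [i]))"] j by (simp add: m_def)
  then have "u \<in> ivl (w @ [j])"
    using m j by (simp add: ivl_def lft_snoc)
  then show ?thesis by blast
qed

lemma ivl_snoc_unique: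
  assumes "u \<in> ivl (w @ [i])" "u \<in> ivl (w @ [j])" shows "i = j"
proof -
  have "\<not> i < j" if "u \<in> ivl (w @ [i])" "u \<in> ivl (w @ [j])" for i j
  proof
    assume "i < j"
    then have "(\<Sum>k<Suc i. q (w @ [k])) \<le> (\<Sum>k<j. q (w @ [k]))" by (intro sum_mono_idx) simp
    then show False using that by (auto simp: ivl_def lft_snoc)
  qed
  then show ?thesis using assms by (metis linorder_neqE_nat)
qed

primrec address :: "real \<Rightarrow> nat \<Rightarrow> nat list" where
  "address u 0 = []"
| "address u (Suc n) = address u n @ [SOME j. u \<in> ivl (address u n @ [j])]"

definition point :: "real \<Rightarrow> nat \<Rightarrow> nat" where
  "point u n = last (address u (Suc n))"

lemma pre_point: "pre n (point u) = address u n"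
  by (induction n) (auto simp: pre_Suc point_def, simp add: pre_def)

lemma ivl_address: "u \<in> ivl [] \<Longrightarrow> u \<in> ivl (address u n)"
proof (induction n)
  case (Suc n)
  then show ?case using someI_ex[OF ivl_snoc_ex, of u "address u n"] by simp
qed simp

lemma address_ivl: "u \<in> ivl w \<Longrightarrow> address u (length w) = w"
proof (induction w rule: rev_induct)
  case (snoc j w)
  have "u \<in> ivl w" using snoc.prems ivl_snoc_subset by blast
  then have *: "address u (length w) = w" using snoc.IH by blast
  have "(SOME j. u \<in> ivl (w @ [j])) = j"
    using snoc.prems by (intro some_equality) (auto dest: ivl_snoc_unique)
  then show ?case using * by simp
qed simp

lemma ivl_subset: "ivl w \<subseteq> ivl []"
  by (induction w rule: rev_induct) (use ivl_snoc_subset in auto)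

text \<open>Outside \<open>ivl []\<close> the choices defining \<open>address\<close> are arbitrary,
  whence the intersection.\<close>

lemma point_vimage: "point -` cyl w \<inter> ivl [] = ivl w"
proof -
  have "u \<in> ivl w" if "point u \<in> cyl w" "u \<in> ivl []" for u
    using that ivl_address[of u "length w"] by (simp add: in_cyl_iff pre_point)
  moreover have "point u \<in> cyl w" if "u \<in> ivl w" for u
    using that address_ivl by (simp add: in_cyl_iff pre_point)
  ultimately show ?thesis using ivl_subset[of w] by blast
qed

lemma ex_measure: "\<exists>M. sets M = sets borel \<and> (\<forall>w. emeasure M (cyl w) = ennreal (q w))"
proof -
  let ?L = "restrict_space lborel (ivl [])"
  have sp: "space ?L = ivl []" by (simp add: space_restrict_space)
  have iv: "ivl w \<in> sets ?L" for w
  proof -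
    have "ivl v \<in> sets borel" for v by (simp add: ivl_def)
    then show ?thesis using ivl_subset[of w] by (auto simp: sets_restrict_space_iff)
  qed
  have meas: "point \<in> ?L \<rightarrow>\<^sub>M borel"
    by (intro measurable_into_seq) (use iv in \<open>simp add: sp point_vimage\<close>)
  have "emeasure (distr ?L borel point) (cyl w) = ennreal (q w)" for w
  proof -
    have "emeasure (distr ?L borel point) (cyl w) = emeasure ?L (ivl w)"
      by (subst emeasure_distr[OF meas]) (auto simp: sp point_vimage)
    also have "\<dots> = emeasure lborel (ivl w)"
      using ivl_subset[of w] by (intro emeasure_restrict_space) (auto simp: ivl_def)
    finally show ?thesis using nonneg[of w] by (simp add: ivl_def)
  qed
  then show ?thesis by (intro exI[of _ "distr ?L borel point"]) auto
qed

end

subsection \<open>Birkhoff averages\<close>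

definition birk :: "('a \<Rightarrow> 'a) \<Rightarrow> ('a \<Rightarrow> real) \<Rightarrow> nat \<Rightarrow> 'a \<Rightarrow> real" where
  "birk T f n x = (\<Sum>i<n. f ((T ^^ i) x))"

lemma birk_0 [simp]: "birk T f 0 x = 0"
  by (simp add: birk_def)

lemma birk_Suc: "birk T f (Suc n) x = f x + birk T f n (T x)"
  unfolding birk_def by (subst sum.lessThan_Suc_shift) (simp add: funpow_Suc_right del: funpow.simps)

lemma birk_Suc': "birk T f (Suc n) x = birk T f n x + f ((T ^^ n) x)"
  by (simp add: birk_def)

lemma birk_add: "birk T f (m + n) x = birk T f m x + birk T f n ((T ^^ m) x)"
  by (induction m arbitrary: x) (auto simp: birk_Suc funpow_Suc_right simp del: funpow.simps)

text \<open>The total mass is any finite number, since the base measures are normalised by their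
  roof mass and not by their own.\<close>

locale mpt = finite_measure M for M :: "'a measure" +
  fixes T :: "'a \<Rightarrow> 'a"
  assumes T_measurable [measurable]: "T \<in> M \<rightarrow>\<^sub>M M"
    and distr_T: "distr M M T = M"
begin

lemma T_in_space: "x \<in> space M \<Longrightarrow> T x \<in> space M"
  using T_measurable by (rule measurable_space)

lemma integral_comp_T:
  fixes f :: "'a \<Rightarrow> real"
  assumes "f \<in> borel_measurable M"
  shows "(\<integral>x. f (T x) \<partial>M) = (\<integral>x. f x \<partial>M)"
  using integral_distr[OF T_measurable assms] by (simp add: distr_T)

lemma integrable_comp_T:
  fixes f :: "'a \<Rightarrow> real"
  assumes "integrable M f"
  shows "integrable M (\<lambda>x. f (T x))"
  using assms by (intro integrable_distr[OF T_measurable]) (simp add: distr_T)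

lemma birk_measurable [measurable (raw)]:
  assumes [measurable]: "f \<in> borel_measurable M"
  shows "birk T f n \<in> borel_measurable M"
  unfolding birk_def by measurable

lemma integrable_birk:
  assumes "integrable M f"
  shows "integrable M (birk T f n)"
proof -
  have "integrable M (\<lambda>x. birk T f n x)"
  proof (induction n)
    case (Suc n)
    then show ?case unfolding birk_Suc
      using assms integrable_comp_T[OF Suc] by auto
  qed simp
  then show ?thesis .
qed

lemma integral_birk:
  assumes "integrable M f"
  shows "(\<integral>x. birk T f n x \<partial>M) = real n * (\<integral>x. f x \<partial>M)"
proof (induction n)
  case (Suc n)
  have "integrable M (\<lambda>x. birk T f n (T x))"
    by (intro integrable_comp_T) (use integrable_birk[OF assms] in simp)
  then show ?case unfolding birk_Suc
    using Suc assms integrable_birk[OF assms, of n] integral_comp_T[of "birk T f n"]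
    by (simp add: algebra_simps)
qed simp

text \<open>\<open>pmax g n\<close> is the maximum of \<open>0\<close> and the first \<open>n\<close> Birkhoff sums of \<open>g\<close>.\<close>

primrec pmax :: "('a \<Rightarrow> real) \<Rightarrow> nat \<Rightarrow> 'a \<Rightarrow> real" where
  "pmax g 0 x = 0"
| "pmax g (Suc n) x = max 0 (g x + pmax g n (T x))"

lemma pmax_nonneg: "0 \<le> pmax g n x"
  by (cases n) auto

lemma pmax_mono_Suc: "pmax g n x \<le> pmax g (Suc n) x"
proof (induction n arbitrary: x)
  case (Suc n)
  show ?case using Suc[of "T x"] by (auto simp del: pmax.simps(1)) 
qed simp

lemma pmax_mono: "m \<le> n \<Longrightarrow> pmax g m x \<le> pmax g n x"
  by (rule lift_Suc_mono_le[of "\<lambda>n. pmax g n x"]) (rule pmax_mono_Suc)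

lemma birk_le_pmax: "birk T g n x \<le> pmax g n x"
proof (induction n arbitrary: x)
  case (Suc n)
  show ?case using Suc[of "T x"] by (simp add: birk_Suc max.coboundedI2)
qed simp

lemma integrable_pmax:
  assumes "integrable M g" shows "integrable M (pmax g n)"
proof -
  have "integrable M (\<lambda>x. pmax g n x)"
  proof (induction n)
    case (Suc n)
    then show ?case using assms integrable_comp_T[OF Suc] by auto
  qed simp
  then show ?thesis .
qed

text \<open>Garsia's argument: where \<open>pmax g n\<close> is positive it is at most
  \<open>g\<close> plus \<open>pmax g n\<close> after one step, and elsewhere it vanishes.
  Integrating, the two \<open>pmax\<close> terms cancel by invariance.\<close>

lemma maximal_ergodic_aux:
  assumes g: "integrable M g"
  shows "0 \<le> (\<integral>x. g x * indicator {x \<in> space M. 0 < pmax g n x} x \<partial>M)"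
proof -
  note [measurable] = borel_measurable_integrable[OF g] borel_measurable_integrable[OF integrable_pmax[OF g]]
  let ?E = "{x \<in> space M. 0 < pmax g n x}"
  have iE: "integrable M (\<lambda>x. g x * indicator ?E x)"
    using g by (intro integrable_real_mult_indicator) auto
  have iT: "integrable M (\<lambda>x. pmax g n (T x))"
    by (intro integrable_comp_T) (use integrable_pmax[OF g] in simp)
  have "pmax g n x \<le> g x * indicator ?E x + pmax g n (T x)" if "x \<in> space M" for x
  proof (cases "0 < pmax g n x")
    case True
    then obtain k where k: "n = Suc k" by (cases n) auto
    then have "pmax g n x = g x + pmax g k (T x)" using True by auto
    also have "pmax g k (T x) \<le> pmax g n (T x)" using k by (intro pmax_mono) simp
    finally show ?thesis using True that by simp
  next
    case False
    then show ?thesis using pmax_nonneg[of g n x] pmax_nonneg[of g n "T x"] by simp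
  qed
  then have "(\<integral>x. pmax g n x \<partial>M) \<le> (\<integral>x. g x * indicator ?E x + pmax g n (T x) \<partial>M)"
    using integrable_pmax[OF g] iE iT by (intro integral_mono) auto
  also have "\<dots> = (\<integral>x. g x * indicator ?E x \<partial>M) + (\<integral>x. pmax g n x \<partial>M)"
    using iE iT integral_comp_T[of "pmax g n"] by simp
  finally show ?thesis by simp
qed

text \<open>Cutting \<open>g\<close> off outside the invariant set \<open>A\<close> leaves its
  Birkhoff sums along orbits in \<open>A\<close> unchanged, so the sets where \<open>pmax\<close> is
  positive exhaust \<open>A\<close>, and dominated convergence applies.\<close>

lemma maximal_ergodic:
  assumes g: "integrable M g"
    and A [measurable]: "A \<in> sets M"
    and inv: "\<And>x. x \<in> space M \<Longrightarrow> T x \<in> A \<longleftrightarrow> x \<in> A"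
    and pos: "\<And>x. x \<in> A \<Longrightarrow> \<exists>n. 0 < birk T g n x"
  shows "0 \<le> (\<integral>x. g x * indicator A x \<partial>M)"
proof -
  note [measurable] = borel_measurable_integrable[OF g]
  define h where "h = (\<lambda>x. g x * indicator A x)"
  have h: "integrable M h"
    unfolding h_def using g by (intro integrable_real_mult_indicator) auto
  note [measurable] = borel_measurable_integrable[OF h] borel_measurable_integrable[OF integrable_pmax[OF h]]
  let ?E = "\<lambda>n. {x \<in> space M. 0 < pmax h n x}"
  have off: "pmax h n x = 0" if "x \<in> space M" "x \<notin> A" for n x
    using that
  proof (induction n arbitrary: x)
    case (Suc n)
    then show ?case using inv[of x] T_in_space[of x] by (simp add: h_def)
  qed simp
  have on: "birk T h n x = birk T g n x" if "x \<in> A" for n x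
    using that
  proof (induction n arbitrary: x)
    case (Suc n)
    then have "T x \<in> A" using inv[of x] sets.sets_into_space[OF A] by auto
    then show ?case using Suc by (simp add: birk_Suc h_def)
  qed simp
  have lim: "(\<lambda>n. h x * indicator (?E n) x) \<longlonglongrightarrow> h x" if x: "x \<in> space M" for x
  proof (cases "x \<in> A")
    case True
    then obtain n where n: "0 < birk T h n x" using pos on by metis
    have "h x * indicator (?E m) x = h x" if "m \<ge> n" for m
      using n birk_le_pmax[of h n x] pmax_mono[OF that, of h x] x by (auto simp: indicator_def)
    then show ?thesis
      by (intro tendsto_eventually) (auto simp: eventually_sequentially)
  next
    case False
    then show ?thesis by (simp add: h_def)
  qed
  have "(\<lambda>n. \<integral>x. h x * indicator (?E n) x \<partial>M) \<longlonglongrightarrow> (\<integral>x. h x \<partial>M)"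
  proof (rule integral_dominated_convergence[where w = "\<lambda>x. norm (h x)"])
    show "AE x in M. (\<lambda>n. h x * indicator (?E n) x) \<longlonglongrightarrow> h x" using lim by auto
    show "AE x in M. norm (h x * indicator (?E n) x) \<le> norm (h x)" for n
      by (auto simp: indicator_def)
  qed (use h in auto)
  then show ?thesis
    using maximal_ergodic_aux[OF h] unfolding h_def by (intro LIMSEQ_le_const) auto
qed

definition ravg :: "('a \<Rightarrow> real) \<Rightarrow> nat \<Rightarrow> 'a \<Rightarrow> real" where
  "ravg f n x = birk T f n x / real n"

lemma ravg_measurable [measurable (raw)]:
  assumes [measurable]: "f \<in> borel_measurable M"
  shows "ravg f n \<in> borel_measurable M"
  unfolding ravg_def by measurable

text \<open>The averages from \<open>T x\<close> and from \<open>x\<close> differ by a vanishing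
  term and a factor tending to one; the shifted indices keep all denominators positive.\<close>

lemma ravg_shift: "ereal (ravg f (Suc n) (T x)) =
   ereal (- f x / real (Suc n)) + ereal (real (Suc (Suc n)) / real (Suc n)) * ereal (ravg f (Suc (Suc n)) x)"
proof -
  have "birk T f (Suc n) (T x) = birk T f (Suc (Suc n)) x - f x"
    using birk_Suc[of T f "Suc n" x] by simp
  moreover have "real (Suc (Suc n)) / real (Suc n) * (birk T f (Suc (Suc n)) x / real (Suc (Suc n))) =
      birk T f (Suc (Suc n)) x / real (Suc n)"
    by (simp del: of_nat_Suc)
  ultimately show ?thesis by (simp only: ravg_def times_ereal.simps plus_ereal.simps diff_divide_distrib) simp
qed

lemma
  shows limsup_ravg_T: "limsup (\<lambda>n. ereal (ravg f n (T x))) = limsup (\<lambda>n. ereal (ravg f n x))"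
    and liminf_ravg_T: "liminf (\<lambda>n. ereal (ravg f n (T x))) = liminf (\<lambda>n. ereal (ravg f n x))"
proof -
  have 1: "(\<lambda>n. ereal (- f x / real (Suc n))) \<longlonglongrightarrow> 0"
    unfolding zero_ereal_def by (intro tendsto_ereal) real_asymp
  have 2: "(\<lambda>n. ereal (real (Suc (Suc n)) / real (Suc n))) \<longlonglongrightarrow> 1"
    unfolding one_ereal_def by (intro tendsto_ereal) real_asymp
  have s: "limsup (\<lambda>n. u (Suc n)) = limsup u" "liminf (\<lambda>n. u (Suc n)) = liminf u" for u :: "nat \<Rightarrow> ereal"
    using limsup_shift[of u] liminf_shift[of u] by auto
  have "limsup (\<lambda>n. ereal (ravg f n (T x))) = limsup (\<lambda>n. ereal (ravg f (Suc n) (T x)))"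
    using s(1)[of "\<lambda>n. ereal (ravg f n (T x))"] by simp
  also have "\<dots> = 0 + limsup (\<lambda>n. ereal (real (Suc (Suc n)) / real (Suc n)) * ereal (ravg f (Suc (Suc n)) x))"
    unfolding ravg_shift by (intro ereal_limsup_lim_add[OF 1]) simp
  also have "limsup (\<lambda>n. ereal (real (Suc (Suc n)) / real (Suc n)) * ereal (ravg f (Suc (Suc n)) x))
      = 1 * limsup (\<lambda>n. ereal (ravg f (Suc (Suc n)) x))"
    by (intro ereal_limsup_lim_mult[OF 2]) auto
  finally show "limsup (\<lambda>n. ereal (ravg f n (T x))) = limsup (\<lambda>n. ereal (ravg f n x))"
    using s(1)[of "\<lambda>n. ereal (ravg f n x)"] s(1)[of "\<lambda>n. ereal (ravg f (Suc n) x)"] by simp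
  have "liminf (\<lambda>n. ereal (ravg f n (T x))) = liminf (\<lambda>n. ereal (ravg f (Suc n) (T x)))"
    using s(2)[of "\<lambda>n. ereal (ravg f n (T x))"] by simp
  also have "\<dots> = 0 + liminf (\<lambda>n. ereal (real (Suc (Suc n)) / real (Suc n)) * ereal (ravg f (Suc (Suc n)) x))"
    unfolding ravg_shift by (intro ereal_liminf_lim_add[OF 1]) simp
  also have "liminf (\<lambda>n. ereal (real (Suc (Suc n)) / real (Suc n)) * ereal (ravg f (Suc (Suc n)) x))
      = 1 * liminf (\<lambda>n. ereal (ravg f (Suc (Suc n)) x))"
    by (intro ereal_liminf_lim_mult[OF 2]) auto
  finally show "liminf (\<lambda>n. ereal (ravg f n (T x))) = liminf (\<lambda>n. ereal (ravg f n x))"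
    using s(2)[of "\<lambda>n. ereal (ravg f n x)"] s(2)[of "\<lambda>n. ereal (ravg f (Suc n) x)"] by simp
qed

lemma birk_pos_of_limsup:
  assumes "limsup (\<lambda>n. ereal (ravg f n x)) > ereal b"
  shows "\<exists>n. 0 < birk T (\<lambda>x. f x - b) n x"
proof -
  have "\<exists>\<^sub>F n in sequentially. ereal (ravg f n x) > ereal b"
  proof (rule ccontr)
    assume "\<not> ?thesis"
    then have "\<forall>\<^sub>F n in sequentially. ereal (ravg f n x) \<le> ereal b"
      by (simp add: not_frequently not_less)
    then have "limsup (\<lambda>n. ereal (ravg f n x)) \<le> ereal b" by (rule Limsup_bounded)
    then show False using assms by simp
  qed
  then have "\<exists>n\<ge>1. ereal (ravg f n x) > ereal b"
    unfolding frequently_sequentially by blast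
  then obtain n where n: "n \<ge> 1" "ravg f n x > b" by auto
  then have "birk T f n x > b * real n" by (simp add: ravg_def field_simps)
  moreover have "birk T (\<lambda>x. f x - b) n x = birk T f n x - b * real n"
    by (simp add: birk_def sum_subtractf)
  ultimately show ?thesis by (intro exI[of _ n]) simp
qed

lemma birk_minus: "birk T (\<lambda>x. - f x) n x = - birk T f n x"
  by (simp add: birk_def sum_negf)

text \<open>On the invariant set \<open>E\<close> of points whose averages oscillate across the gap,
  the maximal inequality for \<open>f - b\<close> and for \<open>a - f\<close> bounds the integral
  of \<open>f\<close> over \<open>E\<close> below by \<open>b\<close> times and above by
  \<open>a\<close> times the measure of \<open>E\<close>, which is therefore zero.\<close>

lemma oscillation_null:
  assumes f: "integrable M f" and ab: "a < b"
  shows "AE x in M. \<not> (liminf (\<lambda>n. ereal (ravg f n x)) < ereal a \<and> ereal b < limsup (\<lambda>n. ereal (ravg f n x)))"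
proof -
  note [measurable] = borel_measurable_integrable[OF f]
  define E where "E = {x \<in> space M. liminf (\<lambda>n. ereal (ravg f n x)) < ereal a \<and> ereal b < limsup (\<lambda>n. ereal (ravg f n x))}"
  have E [measurable]: "E \<in> sets M" unfolding E_def by measurable
  have inv: "T x \<in> E \<longleftrightarrow> x \<in> E" if "x \<in> space M" for x
    using that T_in_space by (auto simp: E_def limsup_ravg_T liminf_ravg_T)
  have "\<exists>n. 0 < birk T (\<lambda>x. f x - b) n x" if "x \<in> E" for x
    using that by (intro birk_pos_of_limsup) (auto simp: E_def)
  then have 1: "0 \<le> (\<integral>x. (f x - b) * indicator E x \<partial>M)"
    using f by (intro maximal_ergodic inv) auto
  have "\<exists>n. 0 < birk T (\<lambda>x. a - f x) n x" if "x \<in> E" for x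
  proof -
    have "limsup (\<lambda>n. - ereal (ravg f n x)) > ereal (-a)"
    proof -
      have "- ereal a < - liminf (\<lambda>n. ereal (ravg f n x))"
        using that unfolding E_def ereal_minus_less_minus by simp
      then show ?thesis using ereal_Limsup_uminus[of sequentially "\<lambda>n. ereal (ravg f n x)"] by simp
    qed
    moreover have "- ereal (ravg f n x) = ereal (ravg (\<lambda>x. - f x) n x)" for n
      by (simp add: ravg_def birk_minus)
    ultimately show ?thesis
      using birk_pos_of_limsup[of "-a" "\<lambda>x. - f x" x] by simp
  qed
  then have 2: "0 \<le> (\<integral>x. (a - f x) * indicator E x \<partial>M)"
    using f by (intro maximal_ergodic inv) auto
  have iE: "integrable M (\<lambda>x. f x * indicator E x)"
    using f by (intro integrable_real_mult_indicator) auto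
  have iI: "integrable M (\<lambda>x. r * indicator E x)" for r :: real
    by (intro integrable_mult_right integrable_real_indicator) (auto simp: less_top[symmetric])
  have "(\<integral>x. (f x - b) * indicator E x \<partial>M) = (\<integral>x. f x * indicator E x \<partial>M) - b * measure M E"
    unfolding left_diff_distrib using iE iI by (subst Bochner_Integration.integral_diff) auto
  moreover have "(\<integral>x. (a - f x) * indicator E x \<partial>M) = a * measure M E - (\<integral>x. f x * indicator E x \<partial>M)"
    unfolding left_diff_distrib using iE iI by (subst Bochner_Integration.integral_diff) auto
  ultimately have "0 \<le> (a - b) * measure M E"
    using 1 2 by (simp add: left_diff_distrib)
  then have "measure M E = 0"
    using ab measure_nonneg[of M E] by (simp add: zero_le_mult_iff)
  then have "emeasure M E = 0" by (simp add: emeasure_eq_measure)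
  then have "E \<in> null_sets M" by auto
  then show ?thesis
    by (rule AE_I'[of E]) (auto simp: E_def)
qed

lemma AE_liminf_eq_limsup:
  assumes f: "integrable M f"
  shows "AE x in M. liminf (\<lambda>n. ereal (ravg f n x)) = limsup (\<lambda>n. ereal (ravg f n x))"
proof -
  have "AE x in M. \<forall>a\<in>\<rat>. \<forall>b\<in>\<rat>. a < b \<longrightarrow>
      \<not> (liminf (\<lambda>n. ereal (ravg f n x)) < ereal a \<and> ereal b < limsup (\<lambda>n. ereal (ravg f n x)))"
    using oscillation_null[OF f] by (intro AE_ball_countable[THEN iffD2] ballI countable_rat) (auto intro!: AE_impI)
  then show ?thesis
  proof eventually_elim
    case (elim x)
    show ?case
    proof (rule ccontr)
      assume "liminf (\<lambda>n. ereal (ravg f n x)) \<noteq> limsup (\<lambda>n. ereal (ravg f n x))"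
      then have "liminf (\<lambda>n. ereal (ravg f n x)) < limsup (\<lambda>n. ereal (ravg f n x))"
        using Liminf_le_Limsup[of sequentially "\<lambda>n. ereal (ravg f n x)"] by simp
      then obtain c d where c: "liminf (\<lambda>n. ereal (ravg f n x)) < ereal c" "c < d"
        "ereal d < limsup (\<lambda>n. ereal (ravg f n x))"
        by (metis ereal_dense2 ereal_less_eq(3) less_ereal.simps(1))
      \<comment> \<open>The midpoint keeps the two rational levels apart.\<close>
      define e where "e = (c + d) / 2"
      have e: "c < e" "e < d" using c by (auto simp: e_def)
      obtain a b where ab: "a \<in> \<rat>" "c < a" "a < e" "b \<in> \<rat>" "e < b" "b < d"
        using Rats_dense_in_real[OF e(1)] Rats_dense_in_real[OF e(2)] by blast
      have "liminf (\<lambda>n. ereal (ravg f n x)) < ereal a"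
        using c(1) ab(2) by (meson ereal_less_le less_ereal.simps(1) less_le_trans less_imp_le order.strict_trans)
      moreover have "ereal b < limsup (\<lambda>n. ereal (ravg f n x))"
        using c(3) ab by (meson less_ereal.simps(1) order.strict_trans)
      ultimately show False using elim ab by fastforce
    qed
  qed
qed

text \<open>Bounded averages have finite limits, and dominated convergence preserves the
  integral.\<close>

lemma AE_ravg_convergent:
  assumes f [measurable]: "f \<in> borel_measurable M" and bd: "\<And>x. x \<in> space M \<Longrightarrow> \<bar>f x\<bar> \<le> c"
  shows "AE x in M. convergent (\<lambda>n. ravg f n x)"
    and "(\<integral>x. lim (\<lambda>n. ravg f n x) \<partial>M) = (\<integral>x. f x \<partial>M)"
proof -
  have int: "integrable M f"
    using bd by (intro integrable_const_bound[where B = c]) auto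
  have ravg_bd: "\<bar>ravg f n x\<bar> \<le> \<bar>c\<bar>" if "x \<in> space M" for n x
  proof -
    have "(T ^^ i) x \<in> space M" for i
      using that by (induction i) (auto intro: T_in_space)
    then have "\<bar>birk T f n x\<bar> \<le> (\<Sum>i<n. c)"
      unfolding birk_def by (intro order_trans[OF sum_abs] sum_mono bd)
    also have "\<dots> \<le> real n * \<bar>c\<bar>" by (auto intro: mult_left_mono)
    finally show ?thesis by (cases "n = 0") (auto simp: ravg_def field_simps)
  qed
  show conv: "AE x in M. convergent (\<lambda>n. ravg f n x)"
    using AE_liminf_eq_limsup[OF int] AE_space
  proof eventually_elim
    case (elim x)
    define l where "l = limsup (\<lambda>n. ereal (ravg f n x))"
    have "(\<lambda>n. ereal (ravg f n x)) \<longlonglongrightarrow> l"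
      using elim(1) tendsto_iff_Liminf_eq_Limsup[of sequentially "\<lambda>n. ereal (ravg f n x)" l] by (simp add: l_def)
    moreover have "l \<le> ereal \<bar>c\<bar>" 
      unfolding l_def using ravg_bd[OF elim(2)] by (intro Limsup_bounded) (auto simp: abs_le_iff)
    moreover have "ereal (-\<bar>c\<bar>) \<le> l"
      unfolding l_def elim(1)[symmetric] using ravg_bd[OF elim(2)]
      by (intro Liminf_bounded always_eventually allI) (metis abs_le_iff ereal_less_eq(3) minus_le_iff)
    ultimately show "convergent (\<lambda>n. ravg f n x)"
      by (cases l) (auto simp: convergent_def)
  qed
  have "(\<lambda>n. \<integral>x. ravg f n x \<partial>M) \<longlonglongrightarrow> (\<integral>x. lim (\<lambda>n. ravg f n x) \<partial>M)"
  proof (rule integral_dominated_convergence[where w = "\<lambda>_. \<bar>c\<bar>"])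
    show "AE x in M. (\<lambda>n. ravg f n x) \<longlonglongrightarrow> lim (\<lambda>n. ravg f n x)"
      using conv by eventually_elim (simp add: convergent_LIMSEQ_iff)
    show "AE x in M. norm (ravg f n x) \<le> \<bar>c\<bar>" for n
      using AE_space by eventually_elim (use ravg_bd in auto)
  qed auto
  moreover have "(\<lambda>n. \<integral>x. ravg f n x \<partial>M) \<longlonglongrightarrow> (\<integral>x. f x \<partial>M)"
  proof (rule tendsto_eventually)
    show "\<forall>\<^sub>F n in sequentially. (\<integral>x. ravg f n x \<partial>M) = (\<integral>x. f x \<partial>M)"
      using eventually_gt_at_top[of 0]
      by eventually_elim (simp add: ravg_def integral_birk[OF int])
  qed
  ultimately show "(\<integral>x. lim (\<lambda>n. ravg f n x) \<partial>M) = (\<integral>x. f x \<partial>M)"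
    by (rule LIMSEQ_unique)
qed

text \<open>An integrable nonnegative function whose averages dominate \<open>t\<close> in the limit has averages
  converging to \<open>t\<close> as soon as both functions have the same integral: Fatou's lemma gives the other bound.\<close>

lemma AE_ravg_tendsto:
  assumes f: "integrable M f" and nn: "\<And>x. x \<in> space M \<Longrightarrow> 0 \<le> f x"
    and t [measurable]: "t \<in> borel_measurable M" and t0: "AE x in M. 0 \<le> t x"
    and le: "AE x in M. ereal (t x) \<le> liminf (\<lambda>n. ereal (ravg f n x))"
    and int: "(\<integral>\<^sup>+x. ennreal (t x) \<partial>M) = (\<integral>\<^sup>+x. ennreal (f x) \<partial>M)"
  shows "AE x in M. (\<lambda>n. ravg f n x) \<longlonglongrightarrow> t x"
proof -
  note [measurable] = borel_measurable_integrable[OF f]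
  have pos: "0 \<le> ravg f n x" if "x \<in> space M" for n x
  proof -
    have "(T ^^ i) x \<in> space M" for i
      using that by (induction i) (auto intro: T_in_space)
    then show ?thesis by (auto simp: ravg_def birk_def intro!: divide_nonneg_nonneg sum_nonneg nn)
  qed
  have lim_e: "liminf (\<lambda>n. ennreal (ravg f n x)) = e2ennreal (liminf (\<lambda>n. ereal (ravg f n x)))"
    if "x \<in> space M" for x
  proof -
    have "ennreal (ravg f n x) = e2ennreal (ereal (ravg f n x))" for n
      by (simp add: e2ennreal_ereal)
    then show ?thesis
      using Liminf_compose_continuous_mono[of e2ennreal sequentially "\<lambda>n. ereal (ravg f n x)"]
      by (simp add: continuous_on_e2ennreal mono_def e2ennreal_mono)
  qed
  have le': "AE x in M. ennreal (t x) \<le> liminf (\<lambda>n. ennreal (ravg f n x))"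
    using le AE_space by eventually_elim (metis lim_e e2ennreal_mono e2ennreal_ereal)
  have ravg_int: "(\<integral>\<^sup>+x. ennreal (ravg f n x) \<partial>M) = (\<integral>\<^sup>+x. ennreal (f x) \<partial>M)" if "n > 0" for n
  proof -
    have "integrable M (ravg f n)"
      unfolding ravg_def using integrable_birk[OF f, of n] by (intro integrable_divide) simp
    moreover have "(\<integral>x. ravg f n x \<partial>M) = (\<integral>x. f x \<partial>M)"
      using that by (simp add: ravg_def integral_birk[OF f])
    ultimately show ?thesis
      using f by (simp add: nn_integral_eq_integral AE_I2[OF pos] AE_I2[OF nn])
  qed
  have "(\<integral>\<^sup>+x. liminf (\<lambda>n. ennreal (ravg f n x)) \<partial>M) \<le> liminf (\<lambda>n. \<integral>\<^sup>+x. ennreal (ravg f n x) \<partial>M)"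
    by (intro nn_integral_liminf) auto
  also have "\<dots> = (\<integral>\<^sup>+x. ennreal (f x) \<partial>M)"
    by (intro lim_imp_Liminf tendsto_eventually) (auto simp: eventually_sequentially intro!: exI[of _ 1] ravg_int)
  finally have up: "(\<integral>\<^sup>+x. liminf (\<lambda>n. ennreal (ravg f n x)) \<partial>M) \<le> (\<integral>\<^sup>+x. ennreal (t x) \<partial>M)"
    using int by simp
  have fin: "(\<integral>\<^sup>+x. ennreal (t x) \<partial>M) \<noteq> \<infinity>"
    unfolding int using f nn by (simp add: nn_integral_eq_integral AE_I2)
  have "AE x in M. liminf (\<lambda>n. ennreal (ravg f n x)) - ennreal (t x) = 0"
  proof -
    have "(\<integral>\<^sup>+x. liminf (\<lambda>n. ennreal (ravg f n x)) - ennreal (t x) \<partial>M) =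
        (\<integral>\<^sup>+x. liminf (\<lambda>n. ennreal (ravg f n x)) \<partial>M) - (\<integral>\<^sup>+x. ennreal (t x) \<partial>M)"
      using fin le' by (intro nn_integral_diff) auto
    also have "\<dots> = 0" using up fin by (simp add: diff_eq_0_iff_ennreal less_top)
    finally show ?thesis by (subst (asm) nn_integral_0_iff_AE) auto
  qed
  \<comment> \<open>So far the liminf is at most \<open>t\<close>, hence equal to it; that it is
    also the limsup was shown for every integrable function.\<close>
  then show ?thesis
    using le AE_liminf_eq_limsup[OF f] AE_space t0
  proof eventually_elim
    case (elim x)
    define l where "l = liminf (\<lambda>n. ereal (ravg f n x))"
    have l: "(\<lambda>n. ereal (ravg f n x)) \<longlonglongrightarrow> l"
      using elim(3) tendsto_iff_Liminf_eq_Limsup[of sequentially "\<lambda>n. ereal (ravg f n x)" l] by (simp add: l_def)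
    have "e2ennreal l \<le> ennreal (t x)"
      using elim(1) lim_e[OF elim(4)] unfolding l_def by (metis diff_eq_0_iff_ennreal diff_eq_0_ennreal ennreal_minus_eq_0)
    then have "l \<le> ereal (t x)"
      using elim(2,5) unfolding l_def[symmetric]
      by (cases l) (auto simp: e2ennreal_ereal ennreal_le_iff top_unique)
    then have "l = ereal (t x)" using elim(2) l_def by simp
    then show ?case using l by simp
  qed
qed

end

section \<open>Topology of the shift space and sequential continuity\<close>

lemma closed_shift_space: "closed (shift_space B)"
proof -
  have "open (- shift_space B)"
  proof (rule topological_space_class.openI)
    fix x assume "x \<in> - shift_space B"
    then obtain n where n: "B (x n) (x (Suc n)) \<noteq> 1" by (auto simp: shift_space_def)
    have "cyl (pre (Suc (Suc n)) x) \<subseteq> - shift_space B"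
    proof
      fix y assume "y \<in> cyl (pre (Suc (Suc n)) x)"
      then have "y n = x n" "y (Suc n) = x (Suc n)" unfolding in_cyl_pre by auto
      then have "B (y n) (y (Suc n)) \<noteq> 1" using n by simp
      then show "y \<in> - shift_space B" unfolding shift_space_def by blast
    qed
    moreover have "x \<in> cyl (pre (Suc (Suc n)) x)" by (simp add: in_cyl_pre)
    ultimately show "\<exists>T. open T \<and> x \<in> T \<and> T \<subseteq> - shift_space B"
      using open_cyl by blast
  qed
  then show ?thesis by (simp add: closed_def)
qed

lemma shift_space_borel [measurable]: "shift_space B \<in> sets borel"
  by (intro borel_closed closed_shift_space)

lemma tendsto_fun_iff:
  fixes f :: "'a \<Rightarrow> 'b \<Rightarrow> 'c::topological_space"
  shows "(f \<longlongrightarrow> l) F \<longleftrightarrow> (\<forall>i. ((\<lambda>x. f x i) \<longlongrightarrow> l i) F)"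
  using limitin_componentwise[of "\<lambda>_. euclidean" UNIV f l F]
  by (simp add: euclidean_product_topology)

text \<open>The cylinders around a point form a countable neighbourhood base, so a failure of
  continuity at \<open>x\<close> yields points \<open>y N\<close> that agree with \<open>x\<close>
  in \<open>N\<close> symbols, a convergent sequence contradicting \<open>seq\<close>.\<close>

lemma continuous_on_seqI:
  fixes f :: "(nat \<Rightarrow> nat) \<Rightarrow> 'a::metric_space"
  assumes seq: "\<And>u a. (\<forall>n. u n \<in> X) \<Longrightarrow> a \<in> X \<Longrightarrow> u \<longlonglongrightarrow> a \<Longrightarrow> (\<lambda>n. f (u n)) \<longlonglongrightarrow> f a"
  shows "continuous_on X f"
  unfolding continuous_on_def
proof (rule ballI, rule tendstoI)
  fix x and e :: real assume x: "x \<in> X" and e: "0 < e"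
  have "\<exists>N. \<forall>y\<in>X. y \<in> cyl (pre N x) \<longrightarrow> dist (f y) (f x) < e"
  proof (rule ccontr)
    assume "\<not> ?thesis"
    then have "\<forall>N. \<exists>y. y \<in> X \<and> y \<in> cyl (pre N x) \<and> \<not> dist (f y) (f x) < e" by blast
    then obtain y where y: "\<And>N. y N \<in> X" "\<And>N. y N \<in> cyl (pre N x)" "\<And>N. \<not> dist (f (y N)) (f x) < e" by metis
    have "y \<longlonglongrightarrow> x"
      unfolding tendsto_fun_iff
    proof (intro allI tendsto_eventually)
      show "\<forall>\<^sub>F n in sequentially. y n i = x i" for i
        using eventually_gt_at_top[of i] by eventually_elim (use y(2) in \<open>auto simp: in_cyl_pre\<close>)
    qed
    then have "\<forall>\<^sub>F n in sequentially. dist (f (y n)) (f x) < e"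
      using seq[of y x] x y(1) e by (intro tendstoD) auto
    then show False using y(3) by (auto simp: eventually_sequentially)
  qed
  then obtain N where "\<forall>y\<in>X. y \<in> cyl (pre N x) \<longrightarrow> dist (f y) (f x) < e" by blast
  then show "\<forall>\<^sub>F y in at x within X. dist (f y) (f x) < e"
    unfolding eventually_at_topological
    by (intro exI[of _ "cyl (pre N x)"]) (auto simp: open_cyl in_cyl_pre)
qed

lemma continuous_on_variation:
  fixes f :: "(nat \<Rightarrow> nat) \<Rightarrow> real"
  assumes var: "\<And>n x y. 2 \<le> n \<Longrightarrow> x \<in> S \<Longrightarrow> y \<in> S \<Longrightarrow> (\<And>i. i < n \<Longrightarrow> x i = y i) \<Longrightarrow> \<bar>f x - f y\<bar> \<le> V n"
    and V: "V \<longlonglongrightarrow> 0"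
  shows "continuous_on S f"
proof (rule continuous_on_seqI)
  fix x a assume x: "\<forall>n. x n \<in> S" and a: "a \<in> S" and lim: "x \<longlonglongrightarrow> a"
  show "(\<lambda>n. f (x n)) \<longlonglongrightarrow> f a"
  proof (rule tendstoI)
    fix e :: real assume "0 < e"
    then have "\<forall>\<^sub>F n in sequentially. V n < e \<and> n \<ge> 2"
      using V by (intro eventually_conj order_tendstoD(2) eventually_ge_at_top)
    then obtain N where N: "V N < e" "N \<ge> 2" by (auto simp: eventually_sequentially)
    have "\<forall>\<^sub>F n in sequentially. x n \<in> cyl (pre N a)"
      using lim by (rule topological_tendstoD) (auto simp: open_cyl in_cyl_pre)
    then show "\<forall>\<^sub>F n in sequentially. dist (f (x n)) (f a) < e"
    proof eventually_elim
      case (elim n)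
      then have "\<bar>f (x n) - f a\<bar> \<le> V N"
        using x a N by (intro var) (auto simp: in_cyl_pre)
      then show ?case using N by (simp add: dist_real_def)
    qed
  qed
qed

subsection \<open>Lower semicontinuity of integrals under convergence on cylinders\<close>

lemma nn_integral_pre:
  fixes h :: "nat list \<Rightarrow> ennreal"
  assumes [measurable_cong]: "sets M = sets borel"
  shows "(\<integral>\<^sup>+x. h (pre N x) \<partial>M) = (\<integral>\<^sup>+w. h w * emeasure M (cyl w) \<partial>count_space {w. length w = N})"
proof -
  have "h (pre N x) = (\<integral>\<^sup>+w. h w * indicator (cyl w) x \<partial>count_space {w. length w = N})" for x
  proof -
    have "(\<integral>\<^sup>+w. h w * indicator (cyl w) x \<partial>count_space {w. length w = N}) = (\<Sum>w\<in>{pre N x}. h w * indicator (cyl w) x)"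
      by (intro nn_integral_count_space') (auto simp: in_cyl_iff indicator_def)
    also have "\<dots> = h (pre N x)" by (simp add: in_cyl_pre)
    finally show ?thesis by simp
  qed
  then have "(\<integral>\<^sup>+x. h (pre N x) \<partial>M) = (\<integral>\<^sup>+x. (\<integral>\<^sup>+w. h w * indicator (cyl w) x \<partial>count_space {w. length w = N}) \<partial>M)"
    by simp
  also have "\<dots> = (\<integral>\<^sup>+w. (\<integral>\<^sup>+x. h w * indicator (cyl w) x \<partial>M) \<partial>count_space {w. length w = N})"
    by (rule nn_integral_count_space_nn_integral) auto
  also have "\<dots> = (\<integral>\<^sup>+w. h w * emeasure M (cyl w) \<partial>count_space {w. length w = N})"
    by (intro nn_integral_cong nn_integral_cmult_indicator) (simp add: assms)
  finally show ?thesis .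
qed

text \<open>Replace \<open>g\<close> by its infimum \<open>low\<close> over the cylinders of length
  \<open>N\<close>: by lower semicontinuity these approximations increase to \<open>g\<close>, and
  the integral of each is a series in cylinder masses, to which Fatou's lemma for the counting
  measure applies.\<close>

lemma nn_integral_liminf_cyl:
  fixes g :: "(nat \<Rightarrow> nat) \<Rightarrow> ennreal" and M :: "nat \<Rightarrow> (nat \<Rightarrow> nat) measure"
  assumes sets: "\<And>n. sets (M n) = sets borel" "sets m = sets borel"
    and X: "\<And>n. AE x in M n. x \<in> X" "AE x in m. x \<in> X"
    and lsc: "\<And>x a. x \<in> X \<Longrightarrow> a < g x \<Longrightarrow> \<exists>N. \<forall>y\<in>X. (\<forall>j<N. y j = x j) \<longrightarrow> a < g y"
    and conv: "\<And>w. (\<lambda>n. emeasure (M n) (cyl w)) \<longlonglongrightarrow> emeasure m (cyl w)"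
  shows "(\<integral>\<^sup>+x. g x \<partial>m) \<le> liminf (\<lambda>n. \<integral>\<^sup>+x. g x \<partial>M n)"
proof -
  note [measurable_cong] = sets
  define low where "low w = (INF y\<in>cyl w \<inter> X. g y)" for w
  have pre_meas: "(\<lambda>x. low (pre N x)) \<in> borel_measurable borel" for N
  proof -
    have "pre N \<in> borel \<rightarrow>\<^sub>M count_space UNIV"
    proof (subst measurable_count_space_eq2_countable, safe)
      fix w :: "nat list"
      have "pre N -` {w} \<inter> space borel = (if length w = N then cyl w else {})"
        by (auto simp: in_cyl_iff)
      then show "pre N -` {w} \<inter> space borel \<in> sets borel" by auto
    qed auto
    then show ?thesis by (rule measurable_compose) simp
  qed
  have low_le: "low (pre N x) \<le> g x" if "x \<in> X" for N x
    unfolding low_def using that by (intro INF_lower) (auto simp: in_cyl_pre)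
  have inc: "incseq (\<lambda>N x. low (pre N x))"
  proof (intro incseq_SucI le_funI)
    show "low (pre N x) \<le> low (pre (Suc N) x)" for N x
      unfolding low_def by (intro INF_superset_mono) (auto simp: in_cyl_pre)
  qed
  have SUP: "(SUP N. low (pre N x)) = g x" if x: "x \<in> X" for x
  proof (rule antisym)
    show "(SUP N. low (pre N x)) \<le> g x" using low_le[OF x] by (intro SUP_least)
    show "g x \<le> (SUP N. low (pre N x))"
    proof (rule dense_le)
      fix a assume "a < g x"
      then obtain N where "\<forall>y\<in>X. (\<forall>j<N. y j = x j) \<longrightarrow> a < g y" using lsc[OF x] by blast
      then have "a \<le> low (pre N x)" unfolding low_def by (intro INF_greatest) (auto simp: in_cyl_pre less_imp_le)
      then show "a \<le> (SUP N. low (pre N x))" by (rule SUP_upper2[rotated]) simp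
    qed
  qed
  have each: "(\<integral>\<^sup>+x. low (pre N x) \<partial>m) \<le> liminf (\<lambda>n. \<integral>\<^sup>+x. g x \<partial>M n)" for N
  proof -
    \<comment> \<open>The infimum \<open>low w\<close> may be infinite, for instance over an empty
      intersection with \<open>X\<close>. If the limit mass is zero the left side vanishes; if it is
      positive, the masses are eventually positive and both products are infinite.\<close>
    have lim: "low w * emeasure m (cyl w) \<le> liminf (\<lambda>n. low w * emeasure (M n) (cyl w))" for w
    proof (cases "emeasure m (cyl w) = 0")
      case False
      then have pos: "\<forall>\<^sub>F n in sequentially. emeasure (M n) (cyl w) > 0"
        using conv[of w] by (intro order_tendstoD(1)[of _ "emeasure m (cyl w)"]) (auto simp: zero_less_iff_neq_zero)
      have "(\<lambda>n. low w * emeasure (M n) (cyl w)) \<longlonglongrightarrow> low w * emeasure m (cyl w)"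
      proof (cases "low w = \<infinity>")
        case True
        have "\<forall>\<^sub>F n in sequentially. low w * emeasure (M n) (cyl w) = low w * emeasure m (cyl w)"
          using pos by eventually_elim (use True False in \<open>simp add: ennreal_top_mult\<close>)
        then show ?thesis by (rule tendsto_eventually)
      next
        case False
        then show ?thesis
          using conv[of w] by (intro ennreal_tendsto_cmult) (auto simp: less_top)
      qed
      then have "liminf (\<lambda>n. low w * emeasure (M n) (cyl w)) = low w * emeasure m (cyl w)"
        by (intro lim_imp_Liminf) auto
      then show ?thesis by simp
    qed simp
    have "(\<integral>\<^sup>+x. low (pre N x) \<partial>m) = (\<integral>\<^sup>+w. low w * emeasure m (cyl w) \<partial>count_space {w. length w = N})"
      by (rule nn_integral_pre[OF sets(2)])
    also have "\<dots> \<le> (\<integral>\<^sup>+w. liminf (\<lambda>n. low w * emeasure (M n) (cyl w)) \<partial>count_space {w. length w = N})"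
      by (intro nn_integral_mono lim)
    also have "\<dots> \<le> liminf (\<lambda>n. \<integral>\<^sup>+w. low w * emeasure (M n) (cyl w) \<partial>count_space {w. length w = N})"
      by (intro nn_integral_liminf) simp
    also have "\<dots> = liminf (\<lambda>n. \<integral>\<^sup>+x. low (pre N x) \<partial>M n)"
      by (simp add: nn_integral_pre[OF sets(1)])
    also have "\<dots> \<le> liminf (\<lambda>n. \<integral>\<^sup>+x. g x \<partial>M n)"
    proof (rule Liminf_mono[OF always_eventually], rule allI, rule nn_integral_mono_AE)
      show "AE x in M n. low (pre N x) \<le> g x" for n
        using X(1)[of n] by eventually_elim (rule low_le)
    qed
    finally show ?thesis .
  qed
  have "(\<integral>\<^sup>+x. g x \<partial>m) = (\<integral>\<^sup>+x. (SUP N. low (pre N x)) \<partial>m)"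
    using X(2) by (intro nn_integral_cong_AE) (auto elim!: eventually_mono simp: SUP)
  also have "\<dots> = (SUP N. \<integral>\<^sup>+x. low (pre N x) \<partial>m)"
    using inc pre_meas by (intro nn_integral_monotone_convergence_SUP) auto
  also have "\<dots> \<le> liminf (\<lambda>n. \<integral>\<^sup>+x. g x \<partial>M n)"
    using each by (intro SUP_least)
  finally show ?thesis .
qed

lemma lsc_of_continuous:
  fixes g :: "(nat \<Rightarrow> nat) \<Rightarrow> real"
  assumes "continuous_on X g" "x \<in> X" "a < ennreal (g x)"
  shows "\<exists>N. \<forall>y\<in>X. (\<forall>j<N. y j = x j) \<longrightarrow> a < ennreal (g y)"
proof -
  have "continuous_on X (\<lambda>x. ennreal (g x))"
    using assms(1) by (intro continuous_on_ennreal)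
  moreover have "open {a<..}" by simp
  ultimately obtain A where A: "open A" "A \<inter> X = (\<lambda>x. ennreal (g x)) -` {a<..} \<inter> X"
    unfolding continuous_on_open_invariant by blast
  have "x \<in> A" using A(2) assms(2,3) by auto
  then obtain N where "cyl (pre N x) \<subseteq> A" using open_contains_cyl[OF A(1)] by blast
  moreover have "a < ennreal (g y)" if "y \<in> A" "y \<in> X" for y
    using A(2) that by blast
  ultimately show ?thesis by (intro exI[of _ N]) (auto simp: in_cyl_pre[symmetric])
qed

subsection \<open>Invariant measures of bounded roof mass\<close>

text \<open>The first variation may be infinite, hence \<open>2 \<le> n\<close>; off the shift space \<open>tau\<close> is set to \<open>1\<close> so that
  \<open>1 \<le> tau\<close> holds throughout.\<close>

locale roof_system =
  fixes B :: "nat \<Rightarrow> nat \<Rightarrow> nat" and tau :: "(nat \<Rightarrow> nat) \<Rightarrow> real" and V :: "nat \<Rightarrow> real"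
  assumes tau_ge1: "1 \<le> tau x"
    and tau_outside: "x \<notin> shift_space B \<Longrightarrow> tau x = 1"
    and tau_var: "2 \<le> n \<Longrightarrow> x \<in> shift_space B \<Longrightarrow> y \<in> shift_space B \<Longrightarrow> (\<And>i. i < n \<Longrightarrow> x i = y i) \<Longrightarrow>
        \<bar>tau x - tau y\<bar> \<le> V n"
    and V_tendsto: "V \<longlonglongrightarrow> 0"
    and tau_infty: "\<exists>k. \<forall>x\<in>shift_space B. k \<le> x 0 \<longrightarrow> r \<le> tau x"
    and irreducible: "\<exists>x\<in>shift_space B. x 0 = i \<and> (\<exists>n\<ge>1. x n = j)"
begin

abbreviation "X \<equiv> shift_space B"

lemma continuous_tau: "continuous_on X tau"
  by (rule continuous_on_variation[OF tau_var V_tendsto])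

lemma tau_measurable [measurable]: "tau \<in> borel_measurable borel"
proof -
  have "(\<lambda>x. if x \<in> X then tau x else 1) \<in> borel_measurable borel"
    by (intro borel_measurable_continuous_on_if continuous_tau) auto
  moreover have "(\<lambda>x. if x \<in> X then tau x else 1) = tau"
    using tau_outside by auto
  ultimately show ?thesis by simp
qed

lemma tau_nonneg: "0 \<le> tau x"
  using tau_ge1[of x] by linarith

definition invm :: "(nat \<Rightarrow> nat) measure \<Rightarrow> bool" where
  "invm m \<longleftrightarrow> sets m = sets borel \<and> finite_measure m \<and> (AE x in m. x \<in> X) \<and> distr m borel shift_map = m"

lemma invmD:
  assumes "invm m"
  shows "sets m = sets borel" "space m = UNIV" "finite_measure m" "AE x in m. x \<in> X"
    "distr m borel shift_map = m" "mpt m shift_map"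
proof -
  show 1: "sets m = sets borel" "finite_measure m" "AE x in m. x \<in> X" "distr m borel shift_map = m"
    using assms by (auto simp: invm_def)
  show "space m = UNIV" using sets_eq_imp_space_eq[OF 1(1)] by simp
  have "distr m m shift_map = m"
    using 1(4) distr_cong[of m m m borel shift_map shift_map] 1(1) by simp
  moreover have "shift_map \<in> m \<rightarrow>\<^sub>M m"
    using shift_map_measurable 1(1) measurable_cong_sets by blast
  ultimately show "mpt m shift_map"
    using 1(2) unfolding mpt_def mpt_axioms_def by blast
qed

lemma emeasure_shift_vimage:
  assumes "invm m" "A \<in> sets borel"
  shows "emeasure m (shift_map -` A) = emeasure m A"
proof -
  have "emeasure m A = emeasure (distr m borel shift_map) A" using invmD(5)[OF assms(1)] by simp
  also have "\<dots> = emeasure m (shift_map -` A \<inter> space m)"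
    using assms invmD(1)[OF assms(1)] by (intro emeasure_distr) (auto simp: measurable_cong_sets[OF invmD(1)[OF assms(1)] refl])
  finally show ?thesis using invmD(2)[OF assms(1)] by simp
qed

lemma invmI:
  assumes "sets m = sets borel" "finite_measure m" "AE x in m. x \<in> X"
    "\<And>w. emeasure m (shift_map -` cyl w) = emeasure m (cyl w)"
  shows "invm m"
  unfolding invm_def
proof (intro conjI assms)
  have sp: "space m = UNIV" using sets_eq_imp_space_eq[OF assms(1)] by simp
  have meas: "shift_map \<in> m \<rightarrow>\<^sub>M borel"
    using shift_map_measurable assms(1) measurable_cong_sets by blast
  show "distr m borel shift_map = m"
  proof (rule measure_eqI_cyl)
    show "finite_measure (distr m borel shift_map)"
      using finite_measure.finite_measure_distr[OF assms(2) meas] .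
    show "emeasure (distr m borel shift_map) (cyl w) = emeasure m (cyl w)" for w
      using assms(4)[of w] by (simp add: emeasure_distr[OF meas] sp)
  qed (use assms(1) in auto)
qed

definition wt :: "(nat \<Rightarrow> nat) measure \<Rightarrow> nat list \<Rightarrow> real" where
  "wt m w = measure m (cyl w)"

lemma emeasure_cyl: "finite_measure m \<Longrightarrow> emeasure m (cyl w) = ennreal (wt m w)"
  by (simp add: wt_def finite_measure.emeasure_eq_measure)

lemma wt_nonneg: "0 \<le> wt m w"
  by (simp add: wt_def)

lemma wt_inj: "sets m = sets borel \<Longrightarrow> sets m' = sets borel \<Longrightarrow> finite_measure m \<Longrightarrow> finite_measure m' \<Longrightarrow>
    wt m = wt m' \<Longrightarrow> m = m'"
  by (rule measure_eqI_cyl) (auto simp: emeasure_cyl)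

text \<open>The roof integral is only lower semicontinuous under convergence on cylinders; the
  inequality, unlike equality, survives limits.\<close>

definition IM :: "(nat \<Rightarrow> nat) measure set" where
  "IM = {m. invm m \<and> (\<integral>\<^sup>+x. tau x \<partial>m) \<le> 1}"

lemma IM_D:
  assumes "m \<in> IM" shows "invm m" "(\<integral>\<^sup>+x. tau x \<partial>m) \<le> 1" "emeasure m UNIV \<le> 1" "measure m UNIV \<le> 1"
proof -
  show 1: "invm m" "(\<integral>\<^sup>+x. tau x \<partial>m) \<le> 1" using assms by (auto simp: IM_def)
  have "emeasure m UNIV = (\<integral>\<^sup>+x. 1 \<partial>m)" using invmD(2)[OF 1(1)] by simp
  also have "\<dots> \<le> (\<integral>\<^sup>+x. tau x \<partial>m)" using tau_ge1 by (intro nn_integral_mono) simp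
  finally show 2: "emeasure m UNIV \<le> 1" using 1(2) by simp
  then show "measure m UNIV \<le> 1"
    using invmD(3)[OF 1(1)] by (simp add: finite_measure.emeasure_eq_measure)
qed

lemma wt_le_1: "m \<in> IM \<Longrightarrow> wt m w \<le> 1"
proof -
  assume m: "m \<in> IM"
  interpret finite_measure m using invmD(3)[OF IM_D(1)[OF m]] .
  have "wt m w \<le> measure m UNIV"
    unfolding wt_def using invmD(1)[OF IM_D(1)[OF m]] by (intro finite_measure_mono) auto
  then show ?thesis using IM_D(4)[OF m] by simp
qed

text \<open>The first sum expresses additivity of the masses, the second shift invariance, the last
  clause that the measure lives on the shift space.\<close>

definition good :: "(nat list \<Rightarrow> real) \<Rightarrow> bool" where
  "good q \<longleftrightarrow> (\<forall>w. 0 \<le> q w) \<and> (\<forall>w. (\<lambda>j. q (w @ [j])) sums q w) \<and> (\<forall>w. (\<lambda>j. q (j # w)) sums q w) \<and>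
     (\<forall>w. cyl w \<inter> X = {} \<longrightarrow> q w = 0)"

definition meas_of :: "(nat list \<Rightarrow> real) \<Rightarrow> (nat \<Rightarrow> nat) measure" where
  "meas_of q = (SOME M. sets M = sets borel \<and> (\<forall>w. emeasure M (cyl w) = ennreal (q w)))"

lemma meas_of:
  assumes "good q"
  shows "sets (meas_of q) = sets borel" "emeasure (meas_of q) (cyl w) = ennreal (q w)"
    "wt (meas_of q) = q" "invm (meas_of q)"
proof -
  interpret cyl_weights q
    using assms by unfold_locales (auto simp: good_def)
  have *: "sets (meas_of q) = sets borel \<and> (\<forall>w. emeasure (meas_of q) (cyl w) = ennreal (q w))"
    unfolding meas_of_def by (rule someI_ex[OF ex_measure])
  then show s: "sets (meas_of q) = sets borel" and e: "emeasure (meas_of q) (cyl w) = ennreal (q w)" for w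
    by auto
  show "wt (meas_of q) = q" using e nonneg by (auto simp: wt_def measure_def)
  have sp: "space (meas_of q) = UNIV" using sets_eq_imp_space_eq[OF s] by simp
  have fin: "finite_measure (meas_of q)"
    using e[of "[]"] sp by (intro finite_measureI) simp
  show "invm (meas_of q)"
  proof (rule invmI[OF s fin])
    \<comment> \<open>The complement of the shift space is open, hence a countable union of
      cylinders, here of mass zero.\<close>
    have "(\<Union>w\<in>{w. cyl w \<subseteq> - X}. cyl w) \<in> null_sets (meas_of q)"
    proof (rule null_sets_UN')
      fix w assume "w \<in> {w. cyl w \<subseteq> - X}"
      then have "cyl w \<inter> X = {}" by blast
      then show "cyl w \<in> null_sets (meas_of q)" using assms e s by (auto simp: good_def null_sets_def)
    qed auto
    moreover have "\<Union>(cyl ` {w. cyl w \<subseteq> - X}) = - X"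
      by (rule open_eq_Union_cyl[symmetric]) (simp add: closed_shift_space open_Compl)
    ultimately have "- X \<in> null_sets (meas_of q)" by simp
    then show "AE x in meas_of q. x \<in> X"
      by (rule AE_I') auto
    show "emeasure (meas_of q) (shift_map -` cyl w) = emeasure (meas_of q) (cyl w)" for w
    proof -
      have sm: "(\<lambda>j. q (j # w)) sums q w" using assms by (auto simp: good_def)
      have "(\<Sum>j. ennreal (q (j # w))) = ennreal (q w)"
        using sm nonneg by (subst suminf_ennreal2) (auto simp: sums_iff)
      then show ?thesis
        unfolding emeasure_cyl_Cons[OF s, of w, symmetric] e .
    qed
  qed
qed

lemma ge_coord_measurable [measurable]: "{x::nat \<Rightarrow> nat. J \<le> x i} \<in> sets borel"
proof -
  have "{x \<in> space borel. J \<le> (x::nat \<Rightarrow> nat) i} \<in> sets borel" by measurable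
  then show ?thesis by simp
qed

lemma emeasure_coord_ge:
  assumes m: "invm m"
  shows "emeasure m {x. J \<le> x i} = emeasure m {x. J \<le> x 0}"
proof (induction i)
  case (Suc i)
  have "{x. J \<le> x (Suc i)} = shift_map -` {x. J \<le> x i}" by (auto simp: shift_map_def)
  then show ?case using emeasure_shift_vimage[OF m ge_coord_measurable[of J i]] Suc by simp
qed simp

text \<open>Chebyshev's inequality at coordinate \<open>0\<close>; invariance carries the bound to
  every coordinate.\<close>

lemma markov_tau:
  assumes m: "m \<in> IM" and J: "\<forall>x\<in>X. J \<le> x 0 \<longrightarrow> r \<le> tau x" and r: "0 < r"
  shows "measure m {x. J \<le> x i} \<le> 1 / r"
proof -
  note im = IM_D(1)[OF m]
  note [measurable_cong] = invmD(1)[OF im]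
  interpret finite_measure m using invmD(3)[OF im] .
  have "ennreal r * emeasure m {x. J \<le> x 0} = (\<integral>\<^sup>+x. ennreal r * indicator {x. J \<le> x 0} x \<partial>m)"
    using invmD(1)[OF im] by (subst nn_integral_cmult_indicator) auto
  also have "\<dots> \<le> (\<integral>\<^sup>+x. tau x \<partial>m)"
  proof (rule nn_integral_mono_AE)
    show "AE x in m. ennreal r * indicator {x. J \<le> x 0} x \<le> ennreal (tau x)"
      using invmD(4)[OF im] by eventually_elim (use J in \<open>auto simp: indicator_def intro: ennreal_leI\<close>)
  qed
  also have "\<dots> \<le> 1" using IM_D(2)[OF m] .
  finally have "r * measure m {x. J \<le> x 0} \<le> 1"
    using r by (simp add: emeasure_eq_measure ennreal_mult'[symmetric])
  moreover have "measure m {x. J \<le> x i} = measure m {x. J \<le> x 0}"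
    using emeasure_coord_ge[OF im, of J i] by (simp add: measure_def)
  ultimately show ?thesis using r by (simp add: field_simps)
qed

text \<open>Tightness: \<open>J0\<close> depends neither on the measure nor on the word, so the
  series in \<open>good\<close> converge uniformly over \<open>IM\<close> and survive limits of
  weights.\<close>

lemma uniform_tails:
  assumes e: "0 < e"
  shows "\<exists>J0. \<forall>J\<ge>J0. \<forall>m\<in>IM. \<forall>w.
     \<bar>wt m w - (\<Sum>j<J. wt m (w @ [j]))\<bar> \<le> e \<and> \<bar>wt m w - (\<Sum>j<J. wt m (j # w))\<bar> \<le> e"
proof -
  obtain J0 where J0: "\<forall>x\<in>X. J0 \<le> x 0 \<longrightarrow> 1 / e \<le> tau x" using tau_infty by blast
  show ?thesis
  proof (intro exI[of _ J0] allI impI ballI)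
    fix J m w assume J: "J0 \<le> J" and m: "m \<in> IM"
    note im = IM_D(1)[OF m]
    note s = invmD(1)[OF im]
    interpret finite_measure m using invmD(3)[OF im] .
    have tail: "measure m {x. J \<le> x i} \<le> e" for i
      using markov_tau[OF m, of J "1 / e" i] J0 J e by auto
    \<comment> \<open>One estimate for both kinds of extension: \<open>i\<close> is the position of
      the new letter, the last for appended and the first for prepended letters.\<close>
    have ineq: "\<bar>measure m C - (\<Sum>j<J. measure m (A j))\<bar> \<le> e"
      if A: "\<And>j. A j \<in> sets borel" and C: "C \<in> sets borel" and sub: "\<And>j. A j \<subseteq> C" "C \<subseteq> (\<Union>j<J. A j) \<union> {x. J \<le> x i}"
        and dis: "\<And>j k. j \<noteq> k \<Longrightarrow> A j \<inter> A k = {}" for A C i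
    proof -
      have eq: "(\<Sum>j<J. measure m (A j)) = measure m (\<Union>j<J. A j)"
        using dis A s by (intro finite_measure_finite_Union[symmetric]) (auto simp: disjoint_family_on_def)
      have "measure m (\<Union>j<J. A j) \<le> measure m C"
        using sub A C s by (intro finite_measure_mono) auto
      moreover have "measure m C \<le> measure m ((\<Union>j<J. A j) \<union> {x. J \<le> x i})"
        using sub A C s by (intro finite_measure_mono) auto
      moreover have "measure m ((\<Union>j<J. A j) \<union> {x. J \<le> x i}) \<le> measure m (\<Union>j<J. A j) + measure m {x. J \<le> x i}"
        using A s by (intro measure_Un_le) auto
      ultimately show ?thesis using tail[of i] e unfolding eq by auto
    qed
    have 1: "\<bar>wt m w - (\<Sum>j<J. wt m (w @ [j]))\<bar> \<le> e"
      unfolding wt_def by (rule ineq[where i = "length w"]) (auto simp: in_cyl_snoc not_less)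
    have "\<bar>measure m (shift_map -` cyl w) - (\<Sum>j<J. wt m (j # w))\<bar> \<le> e"
      unfolding wt_def
      by (rule ineq[where i = 0]) (auto simp: in_cyl_Cons not_less intro: measurable_sets_borel[OF shift_map_measurable])
    moreover have "measure m (shift_map -` cyl w) = wt m w"
      using emeasure_shift_vimage[OF im, of "cyl w"] by (simp add: wt_def measure_def)
    ultimately show "\<bar>wt m w - (\<Sum>j<J. wt m (w @ [j]))\<bar> \<le> e \<and> \<bar>wt m w - (\<Sum>j<J. wt m (j # w))\<bar> \<le> e"
      using 1 by simp
  qed
qed

lemma wt_limit:
  assumes m: "\<And>n. m n \<in> IM" and lim: "\<And>w. (\<lambda>n. wt (m n) w) \<longlonglongrightarrow> q w"
  shows "good q" "meas_of q \<in> IM"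
proof -
  have sums: "(\<lambda>j. q (ext w j)) sums q w"
    if ext: "\<And>e. 0 < e \<Longrightarrow> \<exists>J0. \<forall>J\<ge>J0. \<forall>m\<in>IM. \<bar>wt m w - (\<Sum>j<J. wt m (ext w j))\<bar> \<le> e" for ext w
    unfolding sums_def
  proof (rule LIMSEQ_I)
    fix e :: real assume "0 < e"
    then obtain J0 where J0: "\<And>J m. J \<ge> J0 \<Longrightarrow> m \<in> IM \<Longrightarrow> \<bar>wt m w - (\<Sum>j<J. wt m (ext w j))\<bar> \<le> e / 2"
      using ext[of "e / 2"] by auto
    have "norm ((\<Sum>j<J. q (ext w j)) - q w) < e" if "J \<ge> J0" for J
    proof -
      have "(\<lambda>n. \<bar>wt (m n) w - (\<Sum>j<J. wt (m n) (ext w j))\<bar>) \<longlonglongrightarrow> \<bar>q w - (\<Sum>j<J. q (ext w j))\<bar>"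
        by (intro tendsto_intros lim)
      then have "\<bar>q w - (\<Sum>j<J. q (ext w j))\<bar> \<le> e / 2"
        by (rule LIMSEQ_le_const2) (use J0[OF that m] in blast)
      then show ?thesis using \<open>0 < e\<close> by (simp add: abs_minus_commute)
    qed
    then show "\<exists>no. \<forall>n\<ge>no. norm ((\<Sum>j<n. q (ext w j)) - q w) < e" by blast
  qed
  have null: "wt (m n) w = 0" if "cyl w \<inter> X = {}" for n w
  proof -
    note im = IM_D(1)[OF m[of n]]
    have "AE x in m n. x \<notin> cyl w"
      using invmD(4)[OF im] by eventually_elim (use that in blast)
    then have "emeasure (m n) (cyl w) = 0"
      using emeasure_eq_0_AE[of "\<lambda>x. x \<in> cyl w" "m n"] invmD(2)[OF im] by simp
    then show ?thesis by (simp add: wt_def measure_def)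
  qed
  show good: "good q"
    unfolding good_def
  proof (intro conjI allI impI)
    show "0 \<le> q w" for w by (rule LIMSEQ_le_const[OF lim]) (auto simp: wt_nonneg)
    show "(\<lambda>j. q (w @ [j])) sums q w" for w
      by (rule sums[where ext = "\<lambda>w j. w @ [j]"]) (use uniform_tails in meson)
    show "(\<lambda>j. q (j # w)) sums q w" for w
      by (rule sums[where ext = "\<lambda>w j. j # w"]) (use uniform_tails in meson)
    show "q w = 0" if "cyl w \<inter> X = {}" for w
      using lim[of w] null[OF that] by (simp add: LIMSEQ_const_iff)
  qed
  have "(\<integral>\<^sup>+x. tau x \<partial>meas_of q) \<le> liminf (\<lambda>n. \<integral>\<^sup>+x. tau x \<partial>m n)"
  proof (rule nn_integral_liminf_cyl)
    show "AE x in m n. x \<in> X" "sets (m n) = sets borel" for n using invmD[OF IM_D(1)[OF m]] by auto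
    show "AE x in meas_of q. x \<in> X" "sets (meas_of q) = sets borel" using meas_of(4)[OF good] invmD by auto
    show "\<exists>N. \<forall>y\<in>X. (\<forall>j<N. y j = x j) \<longrightarrow> a < ennreal (tau y)" if "x \<in> X" "a < ennreal (tau x)" for x a
      by (rule lsc_of_continuous[OF continuous_tau that])
    show "(\<lambda>n. emeasure (m n) (cyl w)) \<longlonglongrightarrow> emeasure (meas_of q) (cyl w)" for w
      unfolding meas_of(2)[OF good] emeasure_cyl[OF invmD(3)[OF IM_D(1)[OF m]]]
      by (intro tendsto_ennrealI lim)
  qed
  also have "\<dots> \<le> 1"
    using IM_D(2)[OF m] by (intro Liminf_le) (auto simp: always_eventually)
  finally show "meas_of q \<in> IM" using meas_of(4)[OF good] by (simp add: IM_def)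
qed

end

subsection \<open>Barycentres in compact convex sets\<close>

lemma non_extreme_midpoint:
  fixes K :: "'a::real_normed_vector set"
  assumes K: "convex K" and x: "x \<in> K" and ne: "\<not> x extreme_point_of K"
  obtains a b where "a \<in> K" "b \<in> K" "a \<noteq> b" "x = midpoint a b"
proof -
  obtain a b where ab: "a \<in> K" "b \<in> K" "x \<in> open_segment a b"
    using x ne by (auto simp: extreme_point_of_def)
  then obtain t where t: "0 < t" "t < 1" "x = (1 - t) *\<^sub>R a + t *\<^sub>R b" "a \<noteq> b"
    by (auto simp: in_segment)
  \<comment> \<open>The shorter of the two arms, so that the segment symmetric about
    \<open>x\<close> stays between \<open>a\<close> and \<open>b\<close>.\<close>
  define s where "s = min t (1 - t)"
  have s: "0 < s" "s \<le> t" "s \<le> 1 - t" using t by (auto simp: s_def)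
  let ?p = "\<lambda>r. (1 - r) *\<^sub>R a + r *\<^sub>R b"
  have p: "?p r \<in> K" if "0 \<le> r" "r \<le> 1" for r
    using K ab that by (intro convexD) auto
  show ?thesis
  proof (rule that)
    show "?p (t - s) \<in> K" "?p (t + s) \<in> K" using s t by (auto intro!: p)
    have p_eq: "?p r = a + r *\<^sub>R (b - a)" for r
      by (simp add: algebra_simps)
    have "?p (t + s) - ?p (t - s) = ((t + s) - (t - s)) *\<^sub>R (b - a)"
      unfolding p_eq by (simp only: scaleR_left_diff_distrib add_diff_cancel_left)
    then have "?p (t + s) - ?p (t - s) = (2 * s) *\<^sub>R (b - a)" by simp
    moreover have "(2 * s) *\<^sub>R (b - a) \<noteq> 0" using s t by simp
    ultimately show "?p (t - s) \<noteq> ?p (t + s)" by force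
    have "?p (t - s) + ?p (t + s) = 2 *\<^sub>R x"
      unfolding t(3) p_eq scaleR_2 by (simp only: scaleR_add_left scaleR_left_diff_distrib) simp
    then show "x = midpoint (?p (t - s)) (?p (t + s))"
      by (simp add: midpoint_def)
  qed
qed

text \<open>A non-extreme point is the midpoint of two distinct points of \<open>K\<close>, and the
  midpoints of pairs at distance at least \<open>1 / Suc n\<close> form a compact set; so the
  extreme points are what remains of \<open>K\<close> after removing countably many compact
  sets.\<close>

lemma extreme_points_borel:
  fixes K :: "'a::real_normed_vector set"
  assumes K: "compact K" "convex K"
  shows "extreme_points K \<in> sets borel"
proof -
  define P where "P n = (K \<times> K) \<inter> {z. 1 / real (Suc n) \<le> dist (fst z) (snd z)}" for n
  have "compact (P n)" for n
    unfolding P_def using K(1)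
    by (intro compact_Int_closed compact_Times closed_Collect_le continuous_intros)
  then have "compact ((\<lambda>z. midpoint (fst z) (snd z)) ` P n)" for n
    unfolding midpoint_def by (intro compact_continuous_image continuous_intros)
  then have borel: "(\<lambda>z. midpoint (fst z) (snd z)) ` P n \<in> sets borel" for n
    by (intro borel_closed compact_imp_closed)
  have "extreme_points K = K - (\<Union>n. (\<lambda>z. midpoint (fst z) (snd z)) ` P n)"
  proof safe
    fix x assume "x \<in> extreme_points K"
    then show "x \<in> K" by (simp add: extreme_points_def extreme_point_of_def)
  next
    fix n and a b :: 'a
    assume "midpoint (fst (a, b)) (snd (a, b)) \<in> extreme_points K" and P: "(a, b) \<in> P n"
    then have ex: "midpoint a b extreme_point_of K" by (simp add: extreme_points_def)
    have "a \<in> K" "b \<in> K" "a \<noteq> b" using P by (auto simp: P_def)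
    moreover have "midpoint a b \<in> open_segment a b" using \<open>a \<noteq> b\<close> by simp
    ultimately show False using ex unfolding extreme_point_of_def by blast
  next
    fix x assume x: "x \<in> K" "x \<notin> (\<Union>n. (\<lambda>z. midpoint (fst z) (snd z)) ` P n)"
    show "x \<in> extreme_points K"
    proof (rule ccontr)
      assume "x \<notin> extreme_points K"
      then obtain a b where ab: "a \<in> K" "b \<in> K" "a \<noteq> b" "x = midpoint a b"
        using non_extreme_midpoint[OF K(2) x(1)] by (auto simp: extreme_points_def)
      obtain n where "1 / real (Suc n) < dist a b"
        using reals_Archimedean[of "dist a b"] ab(3) by (auto simp: inverse_eq_divide)
      then have "(a, b) \<in> P n" using ab by (simp add: P_def)
      then have "x \<in> (\<lambda>z. midpoint (fst z) (snd z)) ` P n" using ab(4) by force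
      then show False using x(2) by blast
    qed
  qed
  then show ?thesis
    using borel borel_closed[OF compact_imp_closed[OF K(1)]] by (simp only:) (intro sets.Diff sets.countable_UN; blast)
qed

text \<open>A finite net, made disjoint, splits the mass into pieces of radius \<open>e\<close>. The
  same combination serves every Lipschitz \<open>g\<close>, with an error proportional to its
  constant; this uniformity later locates the barycentre in norm.\<close>

lemma barycentre_approx:
  fixes C :: "'a::metric_space set" and \<mu> :: "'a measure"
  assumes C: "compact C" and sets: "sets \<mu> = sets borel" and "prob_space \<mu>" and AE: "AE y in \<mu>. y \<in> C" and e: "0 < e"
  obtains n :: nat and u :: "nat \<Rightarrow> real" and c where
    "\<And>i. i < n \<Longrightarrow> 0 \<le> u i \<and> c i \<in> C" "(\<Sum>i<n. u i) = 1"
    "\<And>(g::'a \<Rightarrow> real) L. g \<in> borel_measurable borel \<Longrightarrow> (\<And>x y. x \<in> C \<Longrightarrow> y \<in> C \<Longrightarrow> \<bar>g x - g y\<bar> \<le> L * dist x y) \<Longrightarrow>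
       0 \<le> L \<Longrightarrow> \<bar>(\<integral>y. g y \<partial>\<mu>) - (\<Sum>i<n. u i * g (c i))\<bar> \<le> L * e"
proof -
  interpret prob_space \<mu> by fact
  note [measurable_cong] = sets
  obtain F where F: "finite F" "F \<subseteq> C" "C \<subseteq> (\<Union>x\<in>F. ball x e)"
    using compactE_image[OF C, of C "\<lambda>x. ball x e"] e by (metis UN_I centre_in_ball open_ball subsetI)
  obtain xs where xs: "set xs = F" using finite_list[OF F(1)] by blast
  define n where "n = length xs"
  define P where "P i = {y \<in> C. dist (xs ! i) y < e \<and> (\<forall>j<i. \<not> dist (xs ! j) y < e)}" for i
  have C_borel: "C \<in> sets borel" using C by (intro borel_closed compact_imp_closed)
  have P: "P i \<in> sets borel" for i
  proof -
    have "P i = C \<inter> (ball (xs ! i) e - (\<Union>j<i. ball (xs ! j) e))" by (auto simp: P_def)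
    also have "\<dots> \<in> sets borel"
      using C_borel by (intro sets.Int[OF C_borel] sets.Diff borel_open open_UN) auto
    finally show ?thesis .
  qed
  have Pex: "\<exists>!i. i < n \<and> y \<in> P i" if y: "y \<in> C" for y
  proof -
    have "\<exists>i. i < n \<and> dist (xs ! i) y < e"
    proof -
      obtain z where "z \<in> F" "dist z y < e" using F(3) y by (auto simp: ball_def)
      then show ?thesis using xs by (auto simp: n_def in_set_conv_nth)
    qed
    then obtain i where i: "i < n \<and> dist (xs ! i) y < e" and min: "\<And>j. j < i \<Longrightarrow> \<not> (j < n \<and> dist (xs ! j) y < e)"
      using exists_least_iff[of "\<lambda>i. i < n \<and> dist (xs ! i) y < e"] by blast
    show ?thesis
    proof (rule ex1I[of _ i])
      show "i < n \<and> y \<in> P i" using i min y by (auto simp: P_def)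
      show "j = i" if "j < n \<and> y \<in> P j" for j
        using that i min[of j] by (cases rule: linorder_cases[of i j]) (auto simp: P_def)
    qed
  qed
  define u where "u i = measure \<mu> (P i)" for i
  have key: "\<bar>(\<integral>y. g y \<partial>\<mu>) - (\<Sum>i<n. u i * g (xs ! i))\<bar> \<le> L * e"
    if g [measurable]: "g \<in> borel_measurable borel" and L: "\<And>x y. x \<in> C \<Longrightarrow> y \<in> C \<Longrightarrow> \<bar>g x - g y\<bar> \<le> L * dist x y" "0 \<le> L" for g L
  proof -
    define s where "s y = (\<Sum>i<n. g (xs ! i) * indicator (P i) y)" for y
    have Pm: "P i \<in> sets \<mu>" for i using P sets by simp
    have ind: "integrable \<mu> (\<lambda>y. r * indicator (P i) y)" for i and r :: real
      using Pm by (intro integrable_mult_right integrable_real_indicator) (auto simp: less_top[symmetric])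
    have s_int: "integrable \<mu> s"
      unfolding s_def using ind by (intro Bochner_Integration.integrable_sum) simp
    have "(\<integral>y. s y \<partial>\<mu>) = (\<Sum>i<n. (\<integral>y. g (xs ! i) * indicator (P i) y \<partial>\<mu>))"
      unfolding s_def using ind by (intro Bochner_Integration.integral_sum) simp
    also have "\<dots> = (\<Sum>i<n. u i * g (xs ! i))"
      using Pm by (intro sum.cong refl) (simp add: u_def mult.commute)
    finally have s_eq: "(\<integral>y. s y \<partial>\<mu>) = (\<Sum>i<n. u i * g (xs ! i))" .
    have close: "\<bar>g y - s y\<bar> \<le> L * e" if y: "y \<in> C" for y
    proof -
      obtain i where i: "i < n \<and> y \<in> P i" and un': "\<forall>j. j < n \<and> y \<in> P j \<longrightarrow> j = i"
        using Pex[OF y] by (rule ex1E)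
      have un: "j = i" if "j < n" "y \<in> P j" for j using un' that by blast
      have ind: "indicator (P j) y = (if j = i then 1 else 0 :: real)" if "j < n" for j
      proof (cases "j = i")
        case False
        then have "y \<notin> P j" using un[OF that] by blast
        then show ?thesis using False by simp
      qed (use i in simp)
      have "s y = (\<Sum>j<n. if j = i then g (xs ! j) else 0)"
        unfolding s_def by (intro sum.cong refl) (simp add: ind)
      also have "\<dots> = g (xs ! i)" using i by simp
      finally have "\<bar>g y - s y\<bar> \<le> L * dist y (xs ! i)"
        using L(1)[OF y, of "xs ! i"] i F(2) xs nth_mem[of i xs] by (auto simp: n_def)
      also have "\<dots> \<le> L * e"
        using conjunct2[OF i] L(2) by (intro mult_left_mono) (auto simp: P_def dist_commute)
      finally show ?thesis .
    qed
    have diff: "integrable \<mu> (\<lambda>y. g y - s y)"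
    proof (rule integrable_const_bound[of _ "L * e"])
      show "AE y in \<mu>. norm (g y - s y) \<le> L * e" using AE by eventually_elim (use close in simp)
      show "(\<lambda>y. g y - s y) \<in> borel_measurable \<mu>" using s_int by auto
    qed
    have "integrable \<mu> (\<lambda>y. (g y - s y) + s y)" using diff s_int by (rule Bochner_Integration.integrable_add)
    then have "(\<integral>y. g y \<partial>\<mu>) - (\<integral>y. s y \<partial>\<mu>) = (\<integral>y. g y - s y \<partial>\<mu>)"
      using s_int by (subst Bochner_Integration.integral_diff) auto
    also have "\<bar>\<dots>\<bar> \<le> (\<integral>y. \<bar>g y - s y\<bar> \<partial>\<mu>)" by (rule integral_abs_bound)
    also have "\<dots> \<le> (\<integral>y. L * e \<partial>\<mu>)"
      using diff AE by (intro integral_mono_AE) (auto elim!: eventually_mono simp: close)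
    finally show ?thesis by (simp add: s_eq prob_space)
  qed
  show ?thesis
  proof (rule that[of n u "\<lambda>i. xs ! i"])
    show "0 \<le> u i \<and> xs ! i \<in> C" if "i < n" for i
      using that F(2) xs by (auto simp: u_def n_def)
    show "(\<Sum>i<n. u i) = 1"
    proof -
      \<comment> \<open>Test with the constant function one, which has Lipschitz constant
        zero.\<close>
      have "\<bar>(\<integral>y. 1 \<partial>\<mu>) - (\<Sum>i<n. u i * 1)\<bar> \<le> 0 * e" by (rule key) auto
      then show ?thesis by (simp add: prob_space)
    qed
  qed (rule key)
qed

subsection \<open>Embedding weights into the bounded sequences\<close>

text \<open>\<open>from_nat\<close> enumerates the words. The clamp to the unit interval makes the
  sequence bounded for every \<open>q\<close> and, together with the damping, bounds all tails
  uniformly.\<close>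

definition emb :: "(nat list \<Rightarrow> real) \<Rightarrow> (nat \<Rightarrow>\<^sub>C real)" where
  "emb q = Bcontfun (\<lambda>k. (1/2)^k * max 0 (min 1 (q (from_nat k))))"

lemma emb_apply: "apply_bcontfun (emb q) k = (1/2)^k * max 0 (min 1 (q (from_nat k)))"
proof -
  have "(1/2)^k * max 0 (min 1 r) \<le> (1::real)" for k r
    by (intro mult_le_one) (auto simp: power_le_one)
  then have "(\<lambda>k. (1/2)^k * max 0 (min 1 (q (from_nat k)))) \<in> bcontfun"
    by (intro bcontfun_normI[where b = 1]) (auto simp: continuous_on_discrete)
  then show ?thesis by (simp add: emb_def Bcontfun_inverse)
qed

definition cube :: "(nat list \<Rightarrow> real) set" where
  "cube = {q. \<forall>w. 0 \<le> q w \<and> q w \<le> 1}"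

lemma emb_apply_cube: "q \<in> cube \<Longrightarrow> apply_bcontfun (emb q) k = (1/2)^k * q (from_nat k)"
  by (simp add: emb_apply cube_def)

lemma emb_eq_iff: "q \<in> cube \<Longrightarrow> q' \<in> cube \<Longrightarrow> emb q = emb q' \<longleftrightarrow> q = q'"
proof
  assume q: "q \<in> cube" "q' \<in> cube" and eq: "emb q = emb q'"
  have "q w = q' w" for w
  proof -
    have "(1/2)^(to_nat w) * q w = (1/2)^(to_nat w) * q' w"
      using emb_apply_cube[OF q(1), of "to_nat w"] emb_apply_cube[OF q(2), of "to_nat w"] eq by simp
    then show ?thesis by simp
  qed
  then show "q = q'" by blast
qed simp

lemma emb_tendsto:
  assumes lim: "\<And>w. (\<lambda>n. q n w) \<longlonglongrightarrow> l w"
  shows "(\<lambda>n. emb (q n)) \<longlonglongrightarrow> emb l"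
proof (rule metric_LIMSEQ_I)
  fix e :: real assume e: "0 < e"
  \<comment> \<open>From \<open>N\<close> on two embedded coordinates differ by at most
    \<open>(1/2)^N\<close>, thanks to the clamp; finitely many coordinates remain.\<close>
  obtain N where N: "(1/2)^N < e / 2" using real_arch_pow_inv[of "e/2" "1/2"] e by auto
  have "(\<lambda>n. apply_bcontfun (emb (q n)) k) \<longlonglongrightarrow> apply_bcontfun (emb l) k" for k
    unfolding emb_apply by (intro tendsto_intros lim)
  then have "\<forall>\<^sub>F n in sequentially. dist (apply_bcontfun (emb (q n)) k) (apply_bcontfun (emb l) k) < e / 2" for k
    using e by (intro tendstoD) auto
  then have "\<forall>\<^sub>F n in sequentially. \<forall>k\<in>{..<N}. dist (apply_bcontfun (emb (q n)) k) (apply_bcontfun (emb l) k) < e / 2"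
    by (intro eventually_ball_finite) auto
  then obtain n0 where n0: "\<And>n k. n \<ge> n0 \<Longrightarrow> k < N \<Longrightarrow> dist (apply_bcontfun (emb (q n)) k) (apply_bcontfun (emb l) k) < e / 2"
    unfolding eventually_sequentially by blast
  have "dist (emb (q n)) (emb l) < e" if n: "n \<ge> n0" for n
  proof -
    have "dist (emb (q n)) (emb l) \<le> e / 2"
    proof (rule dist_bound)
      fix k show "dist (apply_bcontfun (emb (q n)) k) (apply_bcontfun (emb l) k) \<le> e / 2"
      proof (cases "k < N")
        case True then show ?thesis using n0[OF n True] by simp
      next
        case False
        have "dist (apply_bcontfun (emb (q n)) k) (apply_bcontfun (emb l) k) =
            (1/2)^k * \<bar>max 0 (min 1 (q n (from_nat k))) - max 0 (min 1 (l (from_nat k)))\<bar>"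
          unfolding emb_apply dist_real_def by (simp add: abs_mult flip: right_diff_distrib)
        also have "\<dots> \<le> (1/2)^k * 1" by (intro mult_left_mono) auto
        also have "\<dots> \<le> (1/2)^N" using False by (simp add: power_decreasing)
        finally show ?thesis using N by simp
      qed
    qed
    then show ?thesis using e by simp
  qed
  then show "\<exists>no. \<forall>n\<ge>no. dist (emb (q n)) (emb l) < e" by blast
qed

lemma continuous_emb: "continuous_on S emb"
proof (rule continuous_on_sequentiallyI)
  fix q l assume "q \<longlonglongrightarrow> (l :: nat list \<Rightarrow> real)"
  then show "(\<lambda>n. emb (q n)) \<longlonglongrightarrow> emb l"
    by (intro emb_tendsto) (auto simp: tendsto_fun_iff)
qed

lemma emb_tendsto_iff:
  assumes "\<And>n. q n \<in> cube" "l \<in> cube" "(\<lambda>n. emb (q n)) \<longlonglongrightarrow> emb l"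
  shows "(\<lambda>n. q n w) \<longlonglongrightarrow> l w"
proof -
  let ?k = "to_nat w"
  have "(\<lambda>n. apply_bcontfun (emb (q n)) ?k) \<longlonglongrightarrow> apply_bcontfun (emb l) ?k"
  proof (rule tendstoI)
    fix e :: real assume "0 < e"
    then have "\<forall>\<^sub>F n in sequentially. dist (emb (q n)) (emb l) < e" by (rule tendstoD[OF assms(3)])
    then show "\<forall>\<^sub>F n in sequentially. dist (apply_bcontfun (emb (q n)) ?k) (apply_bcontfun (emb l) ?k) < e"
      by eventually_elim (rule dist_fun_lt_imp_dist_val_lt)
  qed
  then have "(\<lambda>n. 2^?k * ((1/2)^?k * q n w)) \<longlonglongrightarrow> 2^?k * ((1/2)^?k * l w)"
    using assms by (intro tendsto_mult_left) (simp add: emb_apply_cube)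
  then show ?thesis by (simp add: power_one_over)
qed

lemma compact_cube: "compact cube"
proof -
  have "compactin (product_topology (\<lambda>_. euclidean) UNIV) (PiE UNIV (\<lambda>_::nat list. {0..1::real}))"
    by (subst compactin_PiE) auto
  moreover have "PiE UNIV (\<lambda>_::nat list. {0..1::real}) = cube"
    by (auto simp: cube_def PiE_def Pi_def)
  ultimately show ?thesis by (simp add: euclidean_product_topology)
qed

text \<open>Affinity is claimed on the cube, where the clamp in \<open>emb\<close> is
  inactive.\<close>

lemma emb_affine:
  assumes "q1 \<in> cube" "q2 \<in> cube" "0 \<le> u" "u \<le> 1" and q: "\<And>w. q w = u * q1 w + (1 - u) * q2 w"
  shows "q \<in> cube" "emb q = u *\<^sub>R emb q1 + (1 - u) *\<^sub>R emb q2"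
proof -
  show c: "q \<in> cube"
    using assms unfolding cube_def q by (auto intro: convex_bound_le[of _ 1])
  show "emb q = u *\<^sub>R emb q1 + (1 - u) *\<^sub>R emb q2"
    by (rule bcontfun_eqI) (simp add: emb_apply_cube[OF c] emb_apply_cube[OF assms(1)] emb_apply_cube[OF assms(2)]
        plus_bcontfun.rep_eq scaleR_bcontfun.rep_eq q algebra_simps)
qed

lemma emb_zero: "emb (\<lambda>_. 0) = 0"
  by (rule bcontfun_eqI) (simp add: emb_apply)

subsection \<open>Convex combinations of measures\<close>

lemma nn_integral_convex_comb:
  assumes s: "sets \<mu> = sets \<nu>" and f: "f \<in> borel_measurable \<mu>"
  shows "(\<integral>\<^sup>+x. f x \<partial>convex_comb_measure u \<mu> \<nu>) =
    ennreal u * (\<integral>\<^sup>+x. f x \<partial>\<mu>) + ennreal (1 - u) * (\<integral>\<^sup>+x. f x \<partial>\<nu>)"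
proof -
  have ms: "borel_measurable \<nu> = (borel_measurable \<mu> :: ('a \<Rightarrow> ennreal) set)"
    "borel_measurable (convex_comb_measure u \<mu> \<nu>) = (borel_measurable \<mu> :: ('a \<Rightarrow> ennreal) set)"
    using s sets_convex_comb_measure[OF s] by (auto intro!: measurable_cong_sets)
  show ?thesis
    using f
proof (induction rule: borel_measurable_induct)
  case (cong f g)
  then show ?case
    using sets_eq_imp_space_eq[OF s] by (simp add: space_convex_comb_measure[OF s] cong: nn_integral_cong_simp)
next
  case (set A)
  then show ?case using s
    by (simp add: sets_convex_comb_measure emeasure_convex_comb_measure)
next
  case (mult f c)
  have m: "f \<in> borel_measurable \<nu>" "f \<in> borel_measurable (convex_comb_measure u \<mu> \<nu>)"
    using mult(2) unfolding ms by auto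
  show ?case
    using mult m by (simp add: nn_integral_cmult distrib_left mult.left_commute)
next
  case (add f g)
  then show ?case
    using s by (simp add: nn_integral_add ms ring_distribs add_ac)
next
  case (seq U)
  have m: "U i \<in> borel_measurable \<nu>" "U i \<in> borel_measurable (convex_comb_measure u \<mu> \<nu>)" for i
    using seq(1)[of i] unfolding ms by auto
  have S: "Sup (range U) x = (SUP i. U i x)" for x by (simp add: SUP_apply image_comp)
  have inc: "incseq (\<lambda>i. \<integral>\<^sup>+x. U i x \<partial>M)" for M
    using seq(3) by (auto simp: incseq_def le_fun_def intro!: nn_integral_mono)
  have "(\<integral>\<^sup>+x. Sup (range U) x \<partial>convex_comb_measure u \<mu> \<nu>) = (SUP i. \<integral>\<^sup>+x. U i x \<partial>convex_comb_measure u \<mu> \<nu>)"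
    unfolding S using seq m by (intro nn_integral_monotone_convergence_SUP) auto
  also have "\<dots> = (SUP i. ennreal u * (\<integral>\<^sup>+x. U i x \<partial>\<mu>) + ennreal (1 - u) * (\<integral>\<^sup>+x. U i x \<partial>\<nu>))"
    using seq by simp
  also have "\<dots> = (SUP i. ennreal u * (\<integral>\<^sup>+x. U i x \<partial>\<mu>)) + (SUP i. ennreal (1 - u) * (\<integral>\<^sup>+x. U i x \<partial>\<nu>))"
    using inc by (intro ennreal_SUP_add) (auto simp: incseq_def intro!: mult_left_mono)
  also have "\<dots> = ennreal u * (SUP i. \<integral>\<^sup>+x. U i x \<partial>\<mu>) + ennreal (1 - u) * (SUP i. \<integral>\<^sup>+x. U i x \<partial>\<nu>)"
    by (simp add: SUP_mult_left_ennreal)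
  also have "\<dots> = ennreal u * (\<integral>\<^sup>+x. Sup (range U) x \<partial>\<mu>) + ennreal (1 - u) * (\<integral>\<^sup>+x. Sup (range U) x \<partial>\<nu>)"
    unfolding S using seq m by (subst (1 2) nn_integral_monotone_convergence_SUP) auto
  finally show ?case .
qed
qed

section \<open>The compact convex set of weights\<close>

context roof_system
begin

lemma IM_finite: "m \<in> IM \<Longrightarrow> finite_measure m"
  using IM_D(1) invmD(3) by blast

lemma IM_sets: "m \<in> IM \<Longrightarrow> sets m = sets borel"
  using IM_D(1) invmD(1) by blast

lemma wt_in_cube: "m \<in> IM \<Longrightarrow> wt m \<in> cube"
  by (simp add: cube_def wt_nonneg wt_le_1)

lemma convex_comb_IM:
  assumes m1: "m1 \<in> IM" and m2: "m2 \<in> IM" and u: "0 \<le> u" "u \<le> 1"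
  shows "convex_comb_measure u m1 m2 \<in> IM"
    "wt (convex_comb_measure u m1 m2) w = u * wt m1 w + (1 - u) * wt m2 w"
    "(\<integral>\<^sup>+x. tau x \<partial>convex_comb_measure u m1 m2) = ennreal u * (\<integral>\<^sup>+x. tau x \<partial>m1) + ennreal (1 - u) * (\<integral>\<^sup>+x. tau x \<partial>m2)"
proof -
  let ?m = "convex_comb_measure u m1 m2"
  note s1 = IM_sets[OF m1] and s2 = IM_sets[OF m2]
  have s: "sets m1 = sets m2" by (simp add: s1 s2)
  have e: "emeasure ?m A = ennreal u * emeasure m1 A + ennreal (1 - u) * emeasure m2 A" for A
    by (rule emeasure_convex_comb_measure[OF s])
  have sm: "sets ?m = sets borel" using sets_convex_comb_measure[OF s] s1 by simp
  have spm: "space ?m = UNIV" using sets_eq_imp_space_eq[OF sm] by simp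
  have fin: "finite_measure ?m"
    using finite_measure.emeasure_finite[OF IM_finite[OF m1]] finite_measure.emeasure_finite[OF IM_finite[OF m2]]
    by (intro finite_measureI) (auto simp: e ennreal_mult_eq_top_iff)
  have em: "emeasure m1 A = ennreal (measure m1 A)" "emeasure m2 A = ennreal (measure m2 A)" for A
    using IM_finite m1 m2 by (auto simp: finite_measure.emeasure_eq_measure)
  show "wt ?m w = u * wt m1 w + (1 - u) * wt m2 w" for w
  proof -
    have "emeasure ?m (cyl w) = ennreal (u * wt m1 w + (1 - u) * wt m2 w)"
      using u by (simp add: e em wt_def ennreal_mult'[symmetric] ennreal_plus[symmetric] del: ennreal_plus)
    then show ?thesis using u wt_nonneg
      unfolding wt_def[of ?m] by (intro measure_eq_emeasure_eq_ennreal) auto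
  qed
  show I: "(\<integral>\<^sup>+x. tau x \<partial>?m) = ennreal u * (\<integral>\<^sup>+x. tau x \<partial>m1) + ennreal (1 - u) * (\<integral>\<^sup>+x. tau x \<partial>m2)"
    using s1 by (intro nn_integral_convex_comb s) (simp add: measurable_cong_sets[OF s1 refl])
  have "ennreal u * (\<integral>\<^sup>+x. tau x \<partial>m1) + ennreal (1 - u) * (\<integral>\<^sup>+x. tau x \<partial>m2) \<le> ennreal u * 1 + ennreal (1 - u) * 1"
    using IM_D(2)[OF m1] IM_D(2)[OF m2] by (intro add_mono mult_left_mono) auto
  also have "\<dots> = 1" using u by (simp add: ennreal_plus[symmetric] del: ennreal_plus)
  finally have le: "(\<integral>\<^sup>+x. tau x \<partial>?m) \<le> 1" using I by simp
  have nX: "- X \<in> sets m1" "- X \<in> sets m2" using s1 s2 by auto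
  have "emeasure m1 (- X) = 0" "emeasure m2 (- X) = 0"
    using invmD(4)[OF IM_D(1)[OF m1]] invmD(4)[OF IM_D(1)[OF m2]]
      emeasure_eq_0_AE[of "\<lambda>x. x \<notin> X" m1] emeasure_eq_0_AE[of "\<lambda>x. x \<notin> X" m2]
      invmD(2)[OF IM_D(1)[OF m1]] invmD(2)[OF IM_D(1)[OF m2]] by (auto simp: Compl_eq)
  then have "emeasure ?m (- X) = 0" by (simp add: e)
  then have "AE x in ?m. x \<in> X"
    using sm by (intro AE_I'[of "- X"]) (auto simp: null_sets_def)
  then have "invm ?m"
    using emeasure_shift_vimage[OF IM_D(1)[OF m1]] emeasure_shift_vimage[OF IM_D(1)[OF m2]]
    by (intro invmI sm fin) (auto simp: e)
  then show "?m \<in> IM" using le by (simp add: IM_def)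
qed

lemma scale_IM:
  assumes m: "invm m" and r: "0 \<le> r" and le: "ennreal r * (\<integral>\<^sup>+x. tau x \<partial>m) \<le> 1"
  shows "scale_measure r m \<in> IM" "wt (scale_measure r m) w = r * wt m w"
    "(\<integral>\<^sup>+x. tau x \<partial>scale_measure r m) = ennreal r * (\<integral>\<^sup>+x. tau x \<partial>m)"
proof -
  let ?m = "scale_measure r m"
  note s = invmD(1)[OF m]
  interpret finite_measure m using invmD(3)[OF m] .
  show I: "(\<integral>\<^sup>+x. tau x \<partial>?m) = ennreal r * (\<integral>\<^sup>+x. tau x \<partial>m)"
    using s by (intro nn_integral_scale_measure) (simp add: measurable_cong_sets[OF s refl])
  show "wt ?m w = r * wt m w" using r by (simp add: wt_def measure_scale_measure)
  have "invm ?m"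
  proof (rule invmI)
    show "finite_measure ?m"
      by (intro finite_measureI) (auto simp: ennreal_mult_eq_top_iff emeasure_finite)
    show "AE x in ?m. x \<in> X"
    proof -
      have "- X \<in> null_sets ?m"
        using invmD(4)[OF m] emeasure_eq_0_AE[of "\<lambda>x. x \<notin> X" m] invmD(2)[OF m] s
        by (auto simp: null_sets_def Compl_eq)
      then show ?thesis by (rule AE_I') auto
    qed
  qed (use s emeasure_shift_vimage[OF m] in auto)
  then show "?m \<in> IM" using I le by (simp add: IM_def)
qed

definition zm :: "(nat \<Rightarrow> nat) measure" where "zm = null_measure borel"

lemma zm: "zm \<in> IM" "wt zm = (\<lambda>_. 0)"
proof -
  have "invm zm"
    by (rule invmI) (auto simp: zm_def null_sets_def intro!: AE_I'[of UNIV] finite_measureI)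
  then show "zm \<in> IM" by (simp add: IM_def zm_def)
  show "wt zm = (\<lambda>_. 0)" by (auto simp: wt_def zm_def measure_def)
qed

definition K :: "(nat \<Rightarrow>\<^sub>C real) set" where
  "K = emb ` wt ` IM"

lemma compact_K: "compact K"
proof -
  have "closed (wt ` IM)"
    unfolding closed_sequential_limits
  proof (intro allI impI, elim conjE)
    fix q l assume q: "\<forall>n. q n \<in> wt ` IM" and lim: "q \<longlonglongrightarrow> l"
    from q obtain m where m: "\<And>n. m n \<in> IM" "\<And>n. q n = wt (m n)"
      unfolding image_iff by metis
    have "(\<lambda>n. wt (m n) w) \<longlonglongrightarrow> l w" for w
      using lim m(2) by (simp add: tendsto_fun_iff)
    from wt_limit[OF m(1) this] meas_of(3) show "l \<in> wt ` IM" by (metis image_eqI)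
  qed
  then have "compact (cube \<inter> wt ` IM)" using compact_cube by (rule compact_Int_closed[rotated])
  moreover have "cube \<inter> wt ` IM = wt ` IM" using wt_in_cube by auto
  ultimately show ?thesis
    unfolding K_def by (intro compact_continuous_image continuous_emb) simp
qed

lemma K_comb:
  assumes "m1 \<in> IM" "m2 \<in> IM" "0 \<le> u" "u \<le> 1"
  shows "emb (wt (convex_comb_measure u m1 m2)) = u *\<^sub>R emb (wt m1) + (1 - u) *\<^sub>R emb (wt m2)"
  by (rule emb_affine(2)) (use assms convex_comb_IM wt_in_cube in auto)

lemma convex_K: "convex K"
  unfolding convex_alt
proof (intro ballI allI impI, elim conjE)
  fix x y and u :: real assume "x \<in> K" "y \<in> K" "0 \<le> u" "u \<le> 1"
  then obtain m1 m2 where m: "m1 \<in> IM" "m2 \<in> IM" "x = emb (wt m1)" "y = emb (wt m2)" by (auto simp: K_def)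
  have "(1 - u) *\<^sub>R x + u *\<^sub>R y = emb (wt (convex_comb_measure u m2 m1))"
    using K_comb[OF m(2,1) \<open>0 \<le> u\<close> \<open>u \<le> 1\<close>] m by (simp add: add.commute)
  then show "(1 - u) *\<^sub>R x + u *\<^sub>R y \<in> K"
    unfolding K_def using convex_comb_IM(1)[OF m(2,1) \<open>0 \<le> u\<close> \<open>u \<le> 1\<close>] by blast
qed

lemma emb_wt_inj: "m \<in> IM \<Longrightarrow> m' \<in> IM \<Longrightarrow> emb (wt m) = emb (wt m') \<longleftrightarrow> m = m'"
  using emb_eq_iff[OF wt_in_cube wt_in_cube] wt_inj[OF IM_sets IM_sets IM_finite IM_finite] by blast

lemma zero_in_K: "0 \<in> K"
  unfolding K_def using zm emb_zero by (metis image_eqI)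

end

subsection \<open>Empirical measures\<close>

lemma AE_eq_of_nn_integral_eq:
  assumes [measurable]: "f \<in> borel_measurable M" "g \<in> borel_measurable M"
    and le: "AE x in M. f x \<le> g x" and eq: "(\<integral>\<^sup>+x. f x \<partial>M) = (\<integral>\<^sup>+x. g x \<partial>M)" and fin: "(\<integral>\<^sup>+x. f x \<partial>M) \<noteq> \<infinity>"
  shows "AE x in M. f x = (g x :: ennreal)"
proof -
  have "(\<integral>\<^sup>+x. g x - f x \<partial>M) = (\<integral>\<^sup>+x. g x \<partial>M) - (\<integral>\<^sup>+x. f x \<partial>M)"
    using fin le by (intro nn_integral_diff) auto
  also have "\<dots> = 0" using eq fin by (simp add: diff_eq_0_iff_ennreal less_top)
  finally have "AE x in M. g x - f x = 0" by (subst (asm) nn_integral_0_iff_AE) auto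
  moreover have "AE x in M. f x \<noteq> \<infinity>"
    using fin by (intro nn_integral_PInf_AE) auto
  ultimately show ?thesis
    using le by eventually_elim (auto simp: diff_eq_0_iff_ennreal top_unique less_top[symmetric])
qed

definition cavg :: "(nat \<Rightarrow> nat) set \<Rightarrow> nat \<Rightarrow> (nat \<Rightarrow> nat) \<Rightarrow> real" where
  "cavg C n x = birk shift_map (indicator C) n x / real n"

definition lmt :: "(nat \<Rightarrow> nat) set \<Rightarrow> (nat \<Rightarrow> nat) \<Rightarrow> real" where
  "lmt C x = lim (\<lambda>n. cavg C n x)"

abbreviation qx :: "(nat \<Rightarrow> nat) \<Rightarrow> nat list \<Rightarrow> real" where
  "qx x w \<equiv> lmt (cyl w) x"

definition convs :: "(nat \<Rightarrow> nat) set \<Rightarrow> (nat \<Rightarrow> nat) \<Rightarrow> bool" where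
  "convs C x \<longleftrightarrow> convergent (\<lambda>n. cavg C n x)"

lemma convs_lmt: "convs C x \<Longrightarrow> (\<lambda>n. cavg C n x) \<longlonglongrightarrow> lmt C x"
  by (simp add: convs_def lmt_def convergent_LIMSEQ_iff)

lemma cavg_measurable [measurable]:
  assumes [measurable]: "C \<in> sets borel"
  shows "cavg C n \<in> borel_measurable borel"
  unfolding cavg_def birk_def by measurable

lemma lmt_measurable [measurable]:
  assumes [measurable]: "C \<in> sets borel"
  shows "lmt C \<in> borel_measurable borel"
  unfolding lmt_def by measurable

lemma cavg_nonneg: "0 \<le> cavg C n x"
  by (auto simp: cavg_def birk_def intro!: divide_nonneg_nonneg sum_nonneg)

lemma cavg_le_1: "cavg C n x \<le> 1"
proof -
  have "birk shift_map (indicator C) n x \<le> (\<Sum>i<n. 1)"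
    unfolding birk_def by (intro sum_mono) (auto simp: indicator_def)
  then show "cavg C n x \<le> 1" by (auto simp: cavg_def divide_le_eq_1)
qed

lemma lmt_nonneg: "convs C x \<Longrightarrow> 0 \<le> lmt C x"
  by (rule LIMSEQ_le_const[OF convs_lmt]) (auto simp: cavg_nonneg)

lemma lmt_le_1: "convs C x \<Longrightarrow> lmt C x \<le> 1"
  by (rule LIMSEQ_le_const2[OF convs_lmt]) (auto simp: cavg_le_1)

text \<open>Stated for every \<open>l\<close> and in both directions: the two sequences then have
  the same limits, so even the unspecified value of \<open>lim\<close> without convergence is shift
  invariant, and \<open>lmt_shift\<close> holds at every point.\<close>

lemma tendsto_cavg_shift:
  "(\<lambda>n. cavg C n (shift_map x)) \<longlonglongrightarrow> l \<longleftrightarrow> (\<lambda>n. cavg C n x) \<longlonglongrightarrow> l"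
proof -
  have eq: "cavg C (Suc n) (shift_map x) = (real (Suc (Suc n)) / real (Suc n)) * cavg C (Suc (Suc n)) x - indicator C x / real (Suc n)" for n
  proof -
    have "birk shift_map (indicator C) (Suc n) (shift_map x) = birk shift_map (indicator C) (Suc (Suc n)) x - (indicator C x :: real)"
      using birk_Suc[of shift_map "indicator C" "Suc n" x] by simp
    then show ?thesis by (simp add: cavg_def diff_divide_distrib)
  qed
  have eq': "cavg C (Suc (Suc n)) x = (real (Suc n) / real (Suc (Suc n))) * cavg C (Suc n) (shift_map x) + indicator C x / real (Suc (Suc n))" for n
  proof -
    have "birk shift_map (indicator C) (Suc (Suc n)) x = birk shift_map (indicator C) (Suc n) (shift_map x) + (indicator C x :: real)"
      using birk_Suc[of shift_map "indicator C" "Suc n" x] by simp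
    then show ?thesis unfolding cavg_def by (simp add: add_divide_distrib del: of_nat_Suc)
  qed
  have i: "(\<lambda>n. c / real (Suc n)) \<longlonglongrightarrow> 0" "(\<lambda>n. c / real (Suc (Suc n))) \<longlonglongrightarrow> 0" for c :: real
    by (real_asymp, real_asymp)
  have r: "(\<lambda>n. real (Suc (Suc n)) / real (Suc n)) \<longlonglongrightarrow> 1" "(\<lambda>n. real (Suc n) / real (Suc (Suc n))) \<longlonglongrightarrow> 1"
    by (real_asymp, real_asymp)
  show ?thesis
  proof
    assume "(\<lambda>n. cavg C n x) \<longlonglongrightarrow> l"
    then have "(\<lambda>n. cavg C (Suc (Suc n)) x) \<longlonglongrightarrow> l" by (rule LIMSEQ_Suc[OF LIMSEQ_Suc])
    then have "(\<lambda>n. cavg C (Suc n) (shift_map x)) \<longlonglongrightarrow> 1 * l - 0"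
      unfolding eq by (rule tendsto_diff[OF tendsto_mult[OF r(1)] i(1)])
    then have "(\<lambda>n. cavg C (Suc n) (shift_map x)) \<longlonglongrightarrow> l" by simp
    then show "(\<lambda>n. cavg C n (shift_map x)) \<longlonglongrightarrow> l" by (rule LIMSEQ_imp_Suc)
  next
    assume "(\<lambda>n. cavg C n (shift_map x)) \<longlonglongrightarrow> l"
    then have "(\<lambda>n. cavg C (Suc n) (shift_map x)) \<longlonglongrightarrow> l" by (rule LIMSEQ_Suc)
    then have "(\<lambda>n. cavg C (Suc (Suc n)) x) \<longlonglongrightarrow> 1 * l + 0"
      unfolding eq' by (rule tendsto_add[OF tendsto_mult[OF r(2)] i(2)])
    then have "(\<lambda>n. cavg C (Suc (Suc n)) x) \<longlonglongrightarrow> l" by simp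
    then have "(\<lambda>n. cavg C (Suc n) x) \<longlonglongrightarrow> l" by (rule LIMSEQ_imp_Suc)
    then show "(\<lambda>n. cavg C n x) \<longlonglongrightarrow> l" by (rule LIMSEQ_imp_Suc)
  qed
qed

lemma lmt_shift: "lmt C (shift_map x) = lmt C x"
  by (simp add: lmt_def lim_def tendsto_cavg_shift)

lemma cavg_shift_vimage: "cavg (shift_map -` C) n x = cavg C n (shift_map x)"
proof -
  have "indicator (shift_map -` C) ((shift_map ^^ i) x) = (indicator C ((shift_map ^^ i) (shift_map x)) :: real)" for i
    by (simp add: indicator_def funpow_swap1)
  then show ?thesis by (simp add: cavg_def birk_def)
qed

lemma lmt_shift_vimage: "lmt (shift_map -` C) x = lmt C x"
  using lmt_shift[of C x] by (simp add: lmt_def cavg_shift_vimage)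

lemma lmt_UNIV: "lmt UNIV x = 1"
proof -
  have "\<forall>\<^sub>F n in sequentially. cavg UNIV n x = 1"
    using eventually_gt_at_top[of 0] by eventually_elim (simp add: cavg_def birk_def)
  then have "(\<lambda>n. cavg UNIV n x) \<longlonglongrightarrow> 1" by (rule tendsto_eventually)
  then show ?thesis unfolding lmt_def by (rule limI)
qed

context roof_system
begin

lemma measurable_invm: "invm m \<Longrightarrow> f \<in> borel_measurable borel \<Longrightarrow> f \<in> borel_measurable m"
  using invmD(1) measurable_cong_sets by blast

lemma
  assumes m: "invm m" and C: "C \<in> sets borel"
  shows AE_convs: "AE x in m. convs C x"
    and nn_integral_lmt: "(\<integral>\<^sup>+x. ennreal (lmt C x) \<partial>m) = emeasure m C"
    and integral_lmt: "(\<integral>x. lmt C x \<partial>m) = measure m C"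
proof -
  interpret mpt m shift_map using invmD(6)[OF m] .
  have meas: "(indicator C :: _ \<Rightarrow> real) \<in> borel_measurable m"
    using C invmD(1)[OF m] by simp
  have r: "ravg (indicator C) n x = cavg C n x" for n x by (simp add: ravg_def cavg_def)
  show conv: "AE x in m. convs C x"
    using AE_ravg_convergent(1)[OF meas, of 1] unfolding r convs_def by (simp add: indicator_def)
  have int: "(\<integral>x. lmt C x \<partial>m) = (\<integral>x. indicator C x \<partial>m)"
    using AE_ravg_convergent(2)[OF meas, of 1] unfolding r lmt_def by (simp add: indicator_def)
  then show int': "(\<integral>x. lmt C x \<partial>m) = measure m C"
    using C invmD(1,2)[OF m] by simp
  have "integrable m (lmt C)"
  proof (rule integrable_const_bound[of _ 1])
    show "AE x in m. norm (lmt C x) \<le> 1"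
      using conv by eventually_elim (simp add: lmt_nonneg lmt_le_1)
    show "lmt C \<in> borel_measurable m" using measurable_invm[OF m lmt_measurable[OF C]] .
  qed
  moreover have "AE x in m. 0 \<le> lmt C x"
    using conv by eventually_elim (rule lmt_nonneg)
  ultimately show "(\<integral>\<^sup>+x. ennreal (lmt C x) \<partial>m) = emeasure m C"
    using int' by (simp add: nn_integral_eq_integral emeasure_eq_measure)
qed

text \<open>Finite partial sums give one inequality wherever the averages converge. Both sides have
  the mass of the union as integral, hence they agree almost everywhere.\<close>

lemma AE_lmt_sums:
  fixes A :: "nat \<Rightarrow> (nat \<Rightarrow> nat) set"
  assumes m: "invm m" and A: "\<And>j. A j \<in> sets borel" and dis: "disjoint_family A"
  shows "AE x in m. (\<lambda>j. lmt (A j) x) sums lmt (\<Union>j. A j) x"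
proof -
  let ?U = "\<Union>j. A j"
  note bm = measurable_invm[OF m]
  have U: "?U \<in> sets borel" using A by auto
  have conv: "AE x in m. convs ?U x \<and> (\<forall>j. convs (A j) x)"
    using AE_convs[OF m U] AE_convs[OF m A] by (auto simp: AE_all_countable)
  have le: "AE x in m. (\<Sum>j. ennreal (lmt (A j) x)) \<le> ennreal (lmt ?U x)"
    using conv
  proof eventually_elim
    case (elim x)
    have "(\<Sum>j<J. ennreal (lmt (A j) x)) \<le> ennreal (lmt ?U x)" for J
    proof -
      have "(\<Sum>j<J. lmt (A j) x) \<le> lmt ?U x"
      proof (rule LIMSEQ_le)
        show "(\<lambda>n. \<Sum>j<J. cavg (A j) n x) \<longlonglongrightarrow> (\<Sum>j<J. lmt (A j) x)"
          using elim by (intro tendsto_sum convs_lmt) auto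
        show "(\<lambda>n. cavg ?U n x) \<longlonglongrightarrow> lmt ?U x" using elim by (intro convs_lmt) auto
        have "(\<Sum>j<J. cavg (A j) n x) \<le> cavg ?U n x" for n
        proof -
          have "(\<Sum>j<J. indicator (A j) y) \<le> (indicator ?U y :: real)" for y
          proof -
            have "(\<Sum>j<J. indicator (A j) y) = (indicator (\<Union>j<J. A j) y :: real)"
              using dis by (intro indicator_UN_disjoint[symmetric] disjoint_family_on_mono[OF _ dis]) auto
            also have "\<dots> \<le> indicator ?U y" by (auto simp: indicator_def)
            finally show ?thesis .
          qed
          then have "(\<Sum>i<n. \<Sum>j<J. indicator (A j) ((shift_map ^^ i) x)) \<le> (\<Sum>i<n. indicator ?U ((shift_map ^^ i) x) :: real)"
            by (intro sum_mono)
          then show ?thesis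
            unfolding cavg_def birk_def by (subst (asm) sum.swap) (simp add: divide_right_mono flip: sum_divide_distrib)
        qed
        then show "\<exists>N. \<forall>n\<ge>N. (\<Sum>j<J. cavg (A j) n x) \<le> cavg ?U n x" by blast
      qed
      then show ?thesis using elim lmt_nonneg by (simp add: sum_ennreal ennreal_leI)
    qed
    then show ?case by (intro suminf_le_const) auto
  qed
  have "AE x in m. (\<Sum>j. ennreal (lmt (A j) x)) = ennreal (lmt ?U x)"
  proof (rule AE_eq_of_nn_integral_eq[OF _ _ le])
    have "(\<integral>\<^sup>+x. (\<Sum>j. ennreal (lmt (A j) x)) \<partial>m) = (\<Sum>j. \<integral>\<^sup>+x. ennreal (lmt (A j) x) \<partial>m)"
      by (intro nn_integral_suminf bm measurable_compose[OF lmt_measurable[OF A] measurable_ennreal])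
    also have "\<dots> = emeasure m ?U"
      using A dis invmD(1)[OF m] by (simp add: nn_integral_lmt[OF m A] suminf_emeasure image_subset_iff)
    finally show "(\<integral>\<^sup>+x. (\<Sum>j. ennreal (lmt (A j) x)) \<partial>m) = (\<integral>\<^sup>+x. ennreal (lmt ?U x) \<partial>m)"
      "(\<integral>\<^sup>+x. (\<Sum>j. ennreal (lmt (A j) x)) \<partial>m) \<noteq> \<infinity>"
      using nn_integral_lmt[OF m U] finite_measure.emeasure_finite[OF invmD(3)[OF m], of ?U] by auto
  qed (rule bm, use A U in measurable)+
  then show ?thesis
    using conv
  proof eventually_elim
    case (elim x)
    have "(\<lambda>j. ennreal (lmt (A j) x)) sums ennreal (lmt ?U x)"
      using elim(1) by (metis summableI summable_sums)
    then show ?case using elim(2) lmt_nonneg by simp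
  qed
qed

text \<open>Limit frequencies add up over appended letters by the previous lemma. Prepended letters
  exhaust the preimage of the cylinder under the shift, whose frequency is that of the cylinder
  itself; this is the invariance of the empirical measure.\<close>

lemma AE_good:
  assumes m: "invm m"
  shows "AE x in m. good (qx x) \<and> (\<forall>w. convs (cyl w) x)"
proof -
  have "AE x in m. (\<lambda>j. qx x (w @ [j])) sums qx x w" for w
  proof -
    have "AE x in m. (\<lambda>j. lmt (cyl (w @ [j])) x) sums lmt (\<Union>j. cyl (w @ [j])) x"
      by (rule AE_lmt_sums[OF m]) (auto simp: disjoint_family_on_def in_cyl_snoc)
    then show ?thesis unfolding cyl_snoc_Union[symmetric] .
  qed
  moreover have "AE x in m. (\<lambda>j. qx x (j # w)) sums qx x w" for w
  proof -
    have "AE x in m. (\<lambda>j. lmt (cyl (j # w)) x) sums lmt (\<Union>j. cyl (j # w)) x"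
      by (rule AE_lmt_sums[OF m]) (auto simp: disjoint_family_on_def in_cyl_Cons)
    then show ?thesis unfolding shift_vimage_cyl[symmetric] lmt_shift_vimage .
  qed
  ultimately have "AE x in m. \<forall>w. (\<lambda>j. qx x (w @ [j])) sums qx x w \<and> (\<lambda>j. qx x (j # w)) sums qx x w \<and> convs (cyl w) x"
    using AE_convs[OF m cyl_in_borel] by (auto simp: AE_all_countable)
  then show ?thesis using invmD(4)[OF m]
  proof eventually_elim
    case (elim x)
    have "qx x w = 0" if w: "cyl w \<inter> X = {}" for w
    proof -
      have "(shift_map ^^ i) x \<in> X" for i using elim(2) by (induction i) auto
      then have "(shift_map ^^ i) x \<notin> cyl w" for i using w by blast
      then have "cavg (cyl w) n x = 0" for n by (simp add: cavg_def birk_def)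
      then show ?thesis by (simp add: lmt_def)
    qed
    then show ?case using elim(1) lmt_nonneg by (auto simp: good_def)
  qed
qed

text \<open>The zero measure as default makes this a total kernel of subprobability
  measures.\<close>

definition kq :: "(nat list \<Rightarrow> real) \<Rightarrow> (nat \<Rightarrow> nat) measure" where
  "kq q = (if good q \<and> q [] \<le> 1 then meas_of q else zm)"

text \<open>In \<open>ennreal\<close> the sums have values for all arguments, so this form is
  visibly measurable in \<open>r\<close>.\<close>

lemma good_iff: "good r \<longleftrightarrow> (\<forall>w. 0 \<le> r w) \<and> (\<forall>w. (\<Sum>j. ennreal (r (w @ [j]))) = ennreal (r w)) \<and>
     (\<forall>w. (\<Sum>j. ennreal (r (j # w))) = ennreal (r w)) \<and> (\<forall>w. cyl w \<inter> X = {} \<longrightarrow> r w = 0)"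
proof (cases "\<forall>w. 0 \<le> r w")
  case True
  have "(f sums s) \<longleftrightarrow> (\<Sum>j. ennreal (f j)) = ennreal s" if "\<And>j. 0 \<le> f j" "0 \<le> s" for f :: "nat \<Rightarrow> real" and s
  proof -
    have "(f sums s) \<longleftrightarrow> (\<lambda>i. ennreal (f i)) sums ennreal s" using that by simp
    also have "\<dots> \<longleftrightarrow> (\<Sum>j. ennreal (f j)) = ennreal s" by (simp add: sums_iff)
    finally show ?thesis .
  qed
  then have "(\<lambda>j. r (g j)) sums r w \<longleftrightarrow> (\<Sum>j. ennreal (r (g j))) = ennreal (r w)" for g :: "nat \<Rightarrow> nat list" and w
    using True by simp
  then show ?thesis unfolding good_def by simp
next
  case False
  then show ?thesis unfolding good_def by blast
qed

lemma kq_measurable: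
  assumes [measurable]: "\<And>w. (\<lambda>x. q x w) \<in> borel_measurable M"
  shows "(\<lambda>x. kq (q x)) \<in> M \<rightarrow>\<^sub>M subprob_algebra borel"
proof (rule measurable_subprob_algebra_generated[OF sets_borel_cyls Int_stable_cyls])
  define G where "G x \<longleftrightarrow> good (q x) \<and> q x [] \<le> 1" for x
  have G: "Measurable.pred M G"
    unfolding G_def good_iff by measurable
  have em: "emeasure (kq (q x)) (cyl w) = (if G x then ennreal (q x w) else 0)" for x w
    by (simp add: kq_def G_def meas_of zm_def)
  show "(\<lambda>x. emeasure (kq (q x)) A) \<in> borel_measurable M" if A: "A \<in> cyls" for A
  proof (cases "A = {}")
    case False
    then obtain w where "A = cyl w" using A by (auto simp: cyls_def)
    then show ?thesis using G by (simp add: em)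
  qed simp
  show "(\<lambda>x. emeasure (kq (q x)) UNIV) \<in> borel_measurable M"
    using G em[of _ "[]"] by simp
  show s: "sets (kq (q x)) = sets borel" for x by (simp add: kq_def meas_of zm_def)
  show "subprob_space (kq (q x))" for x
  proof (rule subprob_spaceI)
    have sp: "space (kq (q x)) = UNIV" using sets_eq_imp_space_eq[OF s] by simp
    then show "emeasure (kq (q x)) (space (kq (q x))) \<le> 1"
      using em[of x "[]"] by (simp add: G_def)
    show "space (kq (q x)) \<noteq> {}" using sp by simp
  qed
qed simp

abbreviation emp :: "(nat \<Rightarrow> nat) \<Rightarrow> (nat \<Rightarrow> nat) measure" where
  "emp x \<equiv> kq (qx x)"

lemma emp_measurable [measurable]: "emp \<in> borel \<rightarrow>\<^sub>M subprob_algebra borel"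
  by (rule kq_measurable) simp

lemma emp_good:
  assumes "good (qx x)"
  shows "emp x = meas_of (qx x)" "invm (emp x)" "wt (emp x) = qx x" "emeasure (emp x) UNIV = 1"
proof -
  show 1: "emp x = meas_of (qx x)" using assms by (simp add: kq_def lmt_UNIV)
  show "invm (emp x)" "wt (emp x) = qx x" using meas_of[OF assms] 1 by auto
  show "emeasure (emp x) UNIV = 1"
    using meas_of(2)[OF assms, of "[]"] 1 by (simp add: lmt_UNIV)
qed

text \<open>The limit frequency of a cylinder has the mass of the cylinder as integral, so
  \<open>m\<close> is the mixture of its empirical measures.\<close>

lemma bind_emp:
  assumes m: "invm m"
  shows "m \<bind> emp = m"
proof -
  have em: "emp \<in> m \<rightarrow>\<^sub>M subprob_algebra borel"
    using emp_measurable invmD(1)[OF m] measurable_cong_sets by blast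
  have sp: "space m \<noteq> {}" using invmD(2)[OF m] by simp
  have "m = m \<bind> emp"
  proof (rule measure_eqI_cyl)
    show "sets (m \<bind> emp) = sets borel"
      by (rule sets_bind[OF _ sp]) (use em sets_kernel[OF em] in auto)
    show "emeasure m (cyl w) = emeasure (m \<bind> emp) (cyl w)" for w
    proof -
      have "emeasure (m \<bind> emp) (cyl w) = (\<integral>\<^sup>+x. emeasure (emp x) (cyl w) \<partial>m)"
        by (rule emeasure_bind[OF sp em]) simp
      also have "\<dots> = (\<integral>\<^sup>+x. ennreal (qx x w) \<partial>m)"
        using AE_good[OF m]
        by (intro nn_integral_cong_AE) (auto elim!: eventually_mono simp: emp_good(1) meas_of(2))
      also have "\<dots> = emeasure m (cyl w)" by (rule nn_integral_lmt[OF m]) simp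
      finally show ?thesis by simp
    qed
  qed (use invmD[OF m] in auto)
  then show ?thesis by simp
qed

lemma nn_integral_emp:
  assumes m: "invm m" and f: "f \<in> borel_measurable borel"
  shows "(\<integral>\<^sup>+x. \<integral>\<^sup>+y. f y \<partial>emp x \<partial>m) = (\<integral>\<^sup>+x. f x \<partial>m)"
proof -
  have em: "emp \<in> m \<rightarrow>\<^sub>M subprob_algebra borel"
    using emp_measurable invmD(1)[OF m] measurable_cong_sets by blast
  show ?thesis
    using nn_integral_bind[OF f em] by (simp add: bind_emp[OF m])
qed

text \<open>Ergodicity of the empirical measures: the function \<open>y \<mapsto> qx y w\<close> has mean \<open>qx x w\<close> under
  \<open>emp x\<close>, and on average over \<open>m\<close> its variance vanishes because \<open>m\<close> is the mixture of the \<open>emp x\<close>.\<close>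

lemma AE_emp_ergodic:
  assumes m: "invm m"
  shows "AE x in m. good (qx x) \<and> (\<forall>w. convs (cyl w) x) \<and> (AE y in emp x. \<forall>w. qx y w = qx x w)"
proof -
  note bm = measurable_invm[OF m]
  have key: "AE x in m. AE y in emp x. qx y w = qx x w" for w
  proof -
    \<comment> \<open>The truncation keeps \<open>g\<close> bounded also where the averages diverge;
      elsewhere it changes nothing.\<close>
    define g where "g y = max 0 (min 1 (qx y w))" for y
    have g [measurable]: "g \<in> borel_measurable borel" unfolding g_def by measurable
    have g01: "0 \<le> g y" "g y \<le> 1" for y by (auto simp: g_def)
    have gq: "convs (cyl w) y \<Longrightarrow> g y = qx y w" for y using lmt_nonneg lmt_le_1 by (simp add: g_def)
    have var: "(\<integral>y. (g y - g x)\<^sup>2 \<partial>emp x) = (\<integral>y. (g y)\<^sup>2 \<partial>emp x) - (g x)\<^sup>2"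
      if x: "good (qx x)" "convs (cyl w) x" for x
    proof -
      note em = emp_good(2)[OF x(1)]
      interpret finite_measure "emp x" using invmD(3)[OF em] .
      have gm: "g \<in> borel_measurable (emp x)" by (rule measurable_invm[OF em g])
      have one: "measure (emp x) UNIV = 1" using emp_good(4)[OF x(1)] by (simp add: measure_def)
      have i1: "integrable (emp x) g"
        using g01 gm by (intro integrable_const_bound[of _ 1]) auto
      have i2: "integrable (emp x) (\<lambda>y. (g y)\<^sup>2)"
        using g01 gm by (intro integrable_const_bound[of _ 1]) (auto simp: power_le_one)
      have "(\<integral>y. g y \<partial>emp x) = (\<integral>y. qx y w \<partial>emp x)"
        using AE_convs[OF em cyl_in_borel[of w]] gm measurable_invm[OF em lmt_measurable[OF cyl_in_borel[of w]]]
        by (intro integral_cong_AE) (auto elim!: eventually_mono simp: gq)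
      also have "\<dots> = wt (emp x) w" by (simp add: integral_lmt[OF em] wt_def)
      also have "\<dots> = g x" using emp_good(3)[OF x(1)] gq[OF x(2)] by simp
      finally have mean: "(\<integral>y. g y \<partial>emp x) = g x" .
      have "(\<integral>y. (g y - g x)\<^sup>2 \<partial>emp x) = (\<integral>y. (g y)\<^sup>2 - 2 * g x * g y + (g x)\<^sup>2 \<partial>emp x)"
        by (intro Bochner_Integration.integral_cong) (auto simp: power2_diff algebra_simps)
      also have "\<dots> = (\<integral>y. (g y)\<^sup>2 \<partial>emp x) - 2 * g x * g x + (g x)\<^sup>2 * measure (emp x) UNIV"
        using i1 i2 mean invmD(2)[OF em] by simp
      finally show ?thesis using one by (simp add: power2_eq_square)
    qed
    have F: "(\<integral>\<^sup>+y. ennreal ((g y)\<^sup>2) \<partial>emp x) = ennreal (\<integral>y. (g y)\<^sup>2 \<partial>emp x)" and i3: "integrable (emp x) (\<lambda>y. (g y - g x)\<^sup>2)"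
      if x: "good (qx x)" "convs (cyl w) x" for x
    proof -
      note em = emp_good(2)[OF x(1)]
      interpret finite_measure "emp x" using invmD(3)[OF em] .
      have gm: "g \<in> borel_measurable (emp x)" by (rule measurable_invm[OF em g])
      have i2: "integrable (emp x) (\<lambda>y. (g y)\<^sup>2)"
        using g01 gm by (intro integrable_const_bound[of _ 1]) (auto simp: power_le_one)
      then show "(\<integral>\<^sup>+y. ennreal ((g y)\<^sup>2) \<partial>emp x) = ennreal (\<integral>y. (g y)\<^sup>2 \<partial>emp x)"
        by (intro nn_integral_eq_integral) auto
      have "\<bar>g y - g x\<bar> \<le> 1" for y using g01[of x] g01[of y] by linarith
      then have "(g y - g x)\<^sup>2 \<le> 1" for y by (simp add: abs_square_le_1)
      then show "integrable (emp x) (\<lambda>y. (g y - g x)\<^sup>2)"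
        using gm by (intro integrable_const_bound[of _ 1]) auto
    qed
    have "AE x in m. ennreal ((g x)\<^sup>2) = (\<integral>\<^sup>+y. ennreal ((g y)\<^sup>2) \<partial>emp x)"
    proof (rule AE_eq_of_nn_integral_eq)
      show "AE x in m. ennreal ((g x)\<^sup>2) \<le> (\<integral>\<^sup>+y. ennreal ((g y)\<^sup>2) \<partial>emp x)"
        using AE_good[OF m]
      proof eventually_elim
        case (elim x)
        then have x: "good (qx x)" "convs (cyl w) x" by auto
        have "0 \<le> (\<integral>y. (g y - g x)\<^sup>2 \<partial>emp x)" by (intro integral_nonneg_AE) auto
        then show ?case unfolding F[OF x] using var[OF x] by (intro ennreal_leI) simp
      qed
      show "(\<integral>\<^sup>+x. ennreal ((g x)\<^sup>2) \<partial>m) = (\<integral>\<^sup>+x. \<integral>\<^sup>+y. ennreal ((g y)\<^sup>2) \<partial>emp x \<partial>m)"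
        by (rule nn_integral_emp[OF m, symmetric]) measurable
      have "(\<integral>\<^sup>+x. ennreal ((g x)\<^sup>2) \<partial>m) \<le> (\<integral>\<^sup>+x. 1 \<partial>m)"
        using g01 by (intro nn_integral_mono) (simp add: power_le_one)
      also have "\<dots> < \<infinity>"
        using finite_measure.emeasure_finite[OF invmD(3)[OF m], of UNIV] invmD(2)[OF m] by (simp add: less_top)
      finally show "(\<integral>\<^sup>+x. ennreal ((g x)\<^sup>2) \<partial>m) \<noteq> \<infinity>" by simp
    qed (rule bm, measurable)+
    then show ?thesis using AE_good[OF m]
    proof eventually_elim
      case (elim x)
      then have x: "good (qx x)" "convs (cyl w) x" by auto
      have "0 \<le> (\<integral>y. (g y)\<^sup>2 \<partial>emp x)" by (intro integral_nonneg_AE) auto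
      then have "(\<integral>y. (g y)\<^sup>2 \<partial>emp x) = (g x)\<^sup>2"
        using elim(1) unfolding F[OF x] by simp
      then have "(\<integral>y. (g y - g x)\<^sup>2 \<partial>emp x) = 0" using var[OF x] by simp
      then have "AE y in emp x. (g y - g x)\<^sup>2 = 0"
        using integral_nonneg_eq_0_iff_AE[OF i3[OF x]] by simp
      then show ?case
        using AE_convs[OF emp_good(2)[OF x(1)] cyl_in_borel[of w]]
        by eventually_elim (use gq gq[OF x(2)] in auto)
    qed
  qed
  have "AE x in m. \<forall>w. AE y in emp x. qx y w = qx x w" using key by (simp add: AE_all_countable)
  then show ?thesis using AE_good[OF m]
    by eventually_elim (simp add: AE_all_countable)
qed

end

subsection \<open>Extreme points\<close>

text \<open>Every coordinate functional has norm at most one, so a single finite convex combination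
  from \<open>barycentre_approx\<close> matches all coordinates of \<open>x\<close> to within
  \<open>e\<close>, that is, lies within \<open>e\<close> of \<open>x\<close> in norm. Its values
  under bounded functionals and its membership in \<open>C\<close> then pass to the limit.\<close>

lemma
  fixes C :: "(nat \<Rightarrow>\<^sub>C real) set" and \<mu> :: "(nat \<Rightarrow>\<^sub>C real) measure"
  assumes C: "compact C" and s: "sets \<mu> = sets borel" and p: "prob_space \<mu>" and AE: "AE y in \<mu>. y \<in> C"
    and coord: "\<And>k. (\<integral>y. apply_bcontfun y k \<partial>\<mu>) = apply_bcontfun x k"
  shows barycentre_linear: "bounded_linear (f :: _ \<Rightarrow> real) \<Longrightarrow> (\<integral>y. f y \<partial>\<mu>) = f x"
    and barycentre_convex: "convex C \<Longrightarrow> x \<in> C"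
proof -
  have nb: "\<bar>apply_bcontfun y k\<bar> \<le> norm y" for y :: "nat \<Rightarrow>\<^sub>C real" and k
    using norm_bounded[of y k] by simp
  have lin: "bounded_linear (\<lambda>y::nat \<Rightarrow>\<^sub>C real. apply_bcontfun y k)" for k
    by (rule bounded_linear_intro[where K = 1])
      (auto simp: plus_bcontfun.rep_eq scaleR_bcontfun.rep_eq nb)
  have meas: "f \<in> borel_measurable borel" if "bounded_linear f" for f :: "(nat \<Rightarrow>\<^sub>C real) \<Rightarrow> real"
    by (intro borel_measurable_continuous_onI linear_continuous_on that)
  have near: "\<exists>(n::nat) u c. (\<forall>i<n. 0 \<le> u i \<and> c i \<in> C) \<and> (\<Sum>i<n. u i) = 1 \<and> norm ((\<Sum>i<n. u i *\<^sub>R c i) - x) \<le> e \<and>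
     (\<forall>f :: _ \<Rightarrow> real. bounded_linear f \<longrightarrow> \<bar>(\<integral>y. f y \<partial>\<mu>) - f (\<Sum>i<n. u i *\<^sub>R c i)\<bar> \<le> onorm f * e)" if e: "0 < e" for e
  proof -
    obtain n :: nat and u c where nu: "\<And>i. i < n \<Longrightarrow> 0 \<le> u i \<and> c i \<in> C" "(\<Sum>i<n. u i) = 1"
      and app: "\<And>(g::(nat \<Rightarrow>\<^sub>C real) \<Rightarrow> real) L. g \<in> borel_measurable borel \<Longrightarrow> (\<And>x y. x \<in> C \<Longrightarrow> y \<in> C \<Longrightarrow> \<bar>g x - g y\<bar> \<le> L * dist x y) \<Longrightarrow>
        0 \<le> L \<Longrightarrow> \<bar>(\<integral>y. g y \<partial>\<mu>) - (\<Sum>i<n. u i * g (c i))\<bar> \<le> L * e"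
      using barycentre_approx[OF C s p AE e] by blast
    let ?z = "\<Sum>i<n. u i *\<^sub>R c i"
    have f: "\<bar>(\<integral>y. f y \<partial>\<mu>) - f ?z\<bar> \<le> onorm f * e" if f: "bounded_linear f" for f :: "_ \<Rightarrow> real"
    proof -
      interpret bounded_linear f by fact
      have "f ?z = (\<Sum>i<n. u i * f (c i))" by (simp add: sum scale)
      moreover have "\<bar>(\<integral>y. f y \<partial>\<mu>) - (\<Sum>i<n. u i * f (c i))\<bar> \<le> onorm f * e"
      proof (rule app[OF meas[OF f]])
        show "\<bar>f x - f y\<bar> \<le> onorm f * dist x y" for x y
          using onorm[OF f, of "x - y"] by (simp add: diff dist_norm)
      qed (rule onorm_pos_le[OF f])
      ultimately show ?thesis by simp
    qed
    have "norm (?z - x) \<le> e"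
    proof (rule norm_bound)
      fix k
      have on: "onorm (\<lambda>y::nat \<Rightarrow>\<^sub>C real. apply_bcontfun y k) \<le> 1"
        by (rule onorm_bound) (auto simp: nb)
      have "norm (apply_bcontfun (?z - x) k) = \<bar>(\<integral>y. apply_bcontfun y k \<partial>\<mu>) - apply_bcontfun ?z k\<bar>"
        by (simp add: minus_bcontfun.rep_eq coord abs_minus_commute)
      also have "\<dots> \<le> onorm (\<lambda>y::nat \<Rightarrow>\<^sub>C real. apply_bcontfun y k) * e" by (rule f[OF lin])
      also have "\<dots> \<le> 1 * e" using on e by (intro mult_right_mono) auto
      finally show "norm (apply_bcontfun (?z - x) k) \<le> e" by simp
    qed
    then show ?thesis using nu f by (intro exI[of _ n] exI[of _ u] exI[of _ c] conjI allI impI) auto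
  qed
  show "(\<integral>y. f y \<partial>\<mu>) = f x" if f: "bounded_linear f" for f :: "_ \<Rightarrow> real"
  proof -
    interpret bounded_linear f by fact
    have on: "0 \<le> onorm f" by (rule onorm_pos_le[OF f])
    have "\<bar>(\<integral>y. f y \<partial>\<mu>) - f x\<bar> \<le> 0 + e" if e: "0 < e" for e
    proof -
      \<comment> \<open>Two errors of size \<open>onorm f * d\<close> have to fit below
        \<open>e\<close>; the summand one guards against a zero functional.\<close>
      define d where "d = e / (2 * onorm f + 1)"
      have d: "0 < d" "2 * onorm f * d \<le> e" using e on by (auto simp: d_def field_simps)
      obtain z where z: "norm (z - x) \<le> d" "\<bar>(\<integral>y. f y \<partial>\<mu>) - f z\<bar> \<le> onorm f * d"
        using near[OF d(1)] f by blast
      have "\<bar>f z - f x\<bar> \<le> onorm f * norm (z - x)"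
        using onorm[OF f, of "z - x"] by (simp add: diff)
      also have "\<dots> \<le> onorm f * d" using z(1) on by (rule mult_left_mono)
      finally show ?thesis using z(2) d(2) by linarith
    qed
    then have "\<bar>(\<integral>y. f y \<partial>\<mu>) - f x\<bar> \<le> 0" by (rule field_le_epsilon)
    then show ?thesis by simp
  qed
  show "x \<in> C" if cv: "convex C"
  proof -
    have "x \<in> closure C"
      unfolding closure_approachable
    proof (intro allI impI)
      fix e :: real assume "0 < e"
      then obtain n :: nat and u c where nu: "\<forall>i<n. 0 \<le> u i \<and> c i \<in> C" "(\<Sum>i<n. u i) = 1" "norm ((\<Sum>i<n. u i *\<^sub>R c i) - x) \<le> e / 2"
        using near[of "e / 2"] by auto
      have "(\<Sum>i<n. u i *\<^sub>R c i) \<in> C"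
        using nu by (intro convex_sum cv) auto
      then show "\<exists>y\<in>C. dist y x < e"
        using nu(3) \<open>0 < e\<close> by (intro bexI[of _ "\<Sum>i<n. u i *\<^sub>R c i"]) (auto simp: dist_norm)
    qed
    then show ?thesis using C by (simp add: compact_imp_closed)
  qed
qed

context roof_system
begin

lemma zm_iff: "m \<in> IM \<Longrightarrow> m = zm \<longleftrightarrow> measure m UNIV = 0"
proof
  assume m: "m \<in> IM" and z: "measure m UNIV = 0"
  interpret finite_measure m by (rule IM_finite[OF m])
  have "wt m w \<le> measure m UNIV" for w
    unfolding wt_def using IM_sets[OF m] by (intro finite_measure_mono) auto
  then have "wt m w = 0" for w using z wt_nonneg[of m w] by (metis antisym)
  then have "wt m = wt zm" using zm(2) by auto
  then show "m = zm" by (rule wt_inj[OF IM_sets[OF m] IM_sets[OF zm(1)] IM_finite[OF m] IM_finite[OF zm(1)]])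
qed (use zm(2) in \<open>auto simp: zm_def measure_def\<close>)

text \<open>The hypothesis says that \<open>m\<close> is ergodic: cylinder averages are almost surely constant.\<close>

lemma extreme_if_constant_averages:
  assumes m: "m \<in> IM" and tot: "(\<integral>\<^sup>+x. tau x \<partial>m) = 1" and c: "AE y in m. \<forall>w. qx y w = c w"
  shows "emb (wt m) extreme_point_of K"
proof -
  have pos: "measure m UNIV \<noteq> 0"
  proof
    assume "measure m UNIV = 0"
    then have "m = zm" using zm_iff[OF m] by simp
    then show False using tot by (simp add: zm_def)
  qed
  \<comment> \<open>Constant averages make all cylinder masses proportional to the total mass, so
    the measure is determined by its roof mass.\<close>
  have const: "wt m' w = c w * measure m' UNIV" if m': "m' \<in> IM" and AE: "AE y in m'. \<forall>w. qx y w = c w" for m' w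
  proof -
    have "wt m' w = (\<integral>y. qx y w \<partial>m')" by (simp add: integral_lmt[OF IM_D(1)[OF m']] wt_def)
    also have "\<dots> = (\<integral>y. c w \<partial>m')"
      using AE measurable_invm[OF IM_D(1)[OF m'] lmt_measurable[OF cyl_in_borel[of w]]]
      by (intro integral_cong_AE) (auto elim!: eventually_mono)
    finally show ?thesis using invmD(2)[OF IM_D(1)[OF m']] by (simp add: mult.commute)
  qed
  have unique: "m' = m" if m': "m' \<in> IM" and AE: "AE y in m'. \<forall>w. qx y w = c w" and t': "(\<integral>\<^sup>+x. tau x \<partial>m') = 1" for m'
  proof -
    define r where "r = measure m' UNIV / measure m UNIV"
    have r: "0 \<le> r" by (simp add: r_def)
    note sc = invmD(1)[OF IM_D(1)[OF m]]
    have eq: "m' = scale_measure r m"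
    proof (rule wt_inj)
      show "wt m' = wt (scale_measure r m)"
      proof
        fix w
        have "wt (scale_measure r m) w = r * wt m w" using r by (simp add: wt_def measure_scale_measure)
        also have "\<dots> = wt m' w" unfolding const[OF m' AE] const[OF m c] using pos by (simp add: r_def)
        finally show "wt m' w = wt (scale_measure r m) w" by simp
      qed
      show "finite_measure (scale_measure r m)"
        using finite_measure.emeasure_finite[OF IM_finite[OF m]] by (intro finite_measureI) (auto simp: ennreal_mult_eq_top_iff)
    qed (use m m' IM_sets IM_finite in auto)
    have "(\<integral>\<^sup>+x. tau x \<partial>m') = ennreal r * (\<integral>\<^sup>+x. tau x \<partial>m)"
      unfolding eq by (intro nn_integral_scale_measure measurable_invm[OF IM_D(1)[OF m]]) simp
    then have "r = 1" using t' tot r by simp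
    then show ?thesis using eq by (simp add: scale_measure_1)
  qed
  show ?thesis
    unfolding extreme_point_of_def
  proof (intro conjI ballI notI)
    show "emb (wt m) \<in> K" using m by (auto simp: K_def)
    fix a b assume "a \<in> K" "b \<in> K" and seg: "emb (wt m) \<in> open_segment a b"
    then obtain m1 m2 where mm: "m1 \<in> IM" "m2 \<in> IM" "a = emb (wt m1)" "b = emb (wt m2)" by (auto simp: K_def)
    from seg obtain u where u: "0 < u" "u < 1" "emb (wt m) = (1 - u) *\<^sub>R a + u *\<^sub>R b" and ab: "a \<noteq> b"
      by (auto simp: in_segment)
    note cc = convex_comb_IM[OF mm(2,1), of u]
    have "emb (wt m) = emb (wt (convex_comb_measure u m2 m1))"
      using K_comb[OF mm(2,1), of u] u mm by (simp add: add.commute)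
    then have m_eq: "m = convex_comb_measure u m2 m1"
      using emb_wt_inj[OF m cc(1)] u by simp
    have e: "emeasure m A = ennreal u * emeasure m2 A + ennreal (1 - u) * emeasure m1 A" for A
      unfolding m_eq using IM_sets mm by (intro emeasure_convex_comb_measure) auto
    have tt: "ennreal u * (\<integral>\<^sup>+x. tau x \<partial>m2) + ennreal (1 - u) * (\<integral>\<^sup>+x. tau x \<partial>m1) = 1"
      using tot cc(3) u unfolding m_eq by simp
    obtain t1 where t1: "(\<integral>\<^sup>+x. tau x \<partial>m1) = ennreal t1" "0 \<le> t1" "t1 \<le> 1"
      using IM_D(2)[OF mm(1)] by (cases "\<integral>\<^sup>+x. tau x \<partial>m1") (auto simp: top_unique)
    obtain t2 where t2: "(\<integral>\<^sup>+x. tau x \<partial>m2) = ennreal t2" "0 \<le> t2" "t2 \<le> 1"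
      using IM_D(2)[OF mm(2)] by (cases "\<integral>\<^sup>+x. tau x \<partial>m2") (auto simp: top_unique)
    have "ennreal (u * t2 + (1 - u) * t1) = ennreal 1"
      using tt u t1 t2 by (simp add: ennreal_mult'[symmetric] ennreal_plus[symmetric] del: ennreal_plus)
    then have sum1: "u * t2 + (1 - u) * t1 = 1" using u t1 t2 by (subst (asm) ennreal_inj) auto
    \<comment> \<open>Neither roof mass exceeds one, so a proper combination equal to one forces
      both to be one.\<close>
    define p where "p = u * t2"
    define q where "q = (1 - u) * t1"
    have "p \<le> u" "q \<le> 1 - u" using u t1 t2 by (auto simp: p_def q_def intro!: mult_left_le)
    moreover have "p + q = 1" using sum1 by (simp add: p_def q_def)
    ultimately have "p = u" "q = 1 - u" by simp_all
    then have *: "u * t2 = u" and "(1 - u) * t1 = 1 - u" by (simp_all add: p_def q_def)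
    note * = * this
    have t12: "t1 = 1" "t2 = 1" using u * by auto
    \<comment> \<open>Both parts are bounded by multiples of \<open>m\<close>, so its null sets are
      null for them.\<close>
    have ac: "AE y in m'. P y" if hP: "AE y in m. P y" and m': "m' = m1 \<or> m' = m2" for m' P
    proof -
      obtain N where N: "{y \<in> space m. \<not> P y} \<subseteq> N" "emeasure m N = 0" "N \<in> sets m"
        using AE_E[OF hP] by blast
      have "emeasure m1 N = 0" "emeasure m2 N = 0" using N(2) u unfolding e by auto
      then have "N \<in> null_sets m'" using N(3) m' mm m IM_sets by (auto simp: null_sets_def)
      moreover have "{y \<in> space m'. \<not> P y} \<subseteq> N"
        using N(1) m' mm m invmD(2)[OF IM_D(1)] by auto
      ultimately show ?thesis by (rule AE_I')
    qed
    have "m1 = m" "m2 = m" using unique ac[OF c] mm t1 t2 t12 by auto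
    then show False using ab mm by simp
  qed
qed

lemma restrict_IM:
  assumes m: "m \<in> IM" and A: "A \<in> sets borel" and inv: "\<And>x. shift_map x \<in> A \<longleftrightarrow> x \<in> A"
  shows "invm (density m (indicator A))" "C \<in> sets borel \<Longrightarrow> emeasure (density m (indicator A)) C = emeasure m (A \<inter> C)"
    "f \<in> borel_measurable borel \<Longrightarrow> (\<integral>\<^sup>+x. f x \<partial>density m (indicator A)) = (\<integral>\<^sup>+x. f x * indicator A x \<partial>m)"
proof -
  note s = IM_sets[OF m] and im = IM_D(1)[OF m]
  have e: "emeasure (density m (indicator A)) C = emeasure m (A \<inter> C)" if "C \<in> sets borel" for C
  proof -
    have "emeasure (density m (indicator A)) C = (\<integral>\<^sup>+x. indicator A x * indicator C x \<partial>m)"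
      using A s that by (subst emeasure_density) auto
    also have "\<dots> = (\<integral>\<^sup>+x. indicator (A \<inter> C) x \<partial>m)" by (simp add: indicator_inter_arith)
    also have "\<dots> = emeasure m (A \<inter> C)" using A s that by simp
    finally show ?thesis .
  qed
  then show "C \<in> sets borel \<Longrightarrow> emeasure (density m (indicator A)) C = emeasure m (A \<inter> C)" .
  show "(\<integral>\<^sup>+x. f x \<partial>density m (indicator A)) = (\<integral>\<^sup>+x. f x * indicator A x \<partial>m)" if "f \<in> borel_measurable borel"
    using A s measurable_invm[OF im that] by (subst nn_integral_density) (auto simp: mult.commute)
  have sp: "space (density m (indicator A)) = UNIV" using invmD(2)[OF im] by simp
  show "invm (density m (indicator A))"
  proof (rule invmI)
    show "finite_measure (density m (indicator A))"
      using finite_measure.emeasure_finite[OF IM_finite[OF m]] by (intro finite_measureI) (simp add: sp e invmD(2)[OF im])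
    show "AE x in density m (indicator A). x \<in> X"
      using A s invmD(4)[OF im] by (subst AE_density) (auto elim!: eventually_mono)
    fix w
    have "A \<inter> shift_map -` cyl w = shift_map -` (A \<inter> cyl w)" using inv by auto
    then show "emeasure (density m (indicator A)) (shift_map -` cyl w) = emeasure (density m (indicator A)) (cyl w)"
      using emeasure_shift_vimage[OF im, of "A \<inter> cyl w"] A
      by (simp add: e measurable_sets_borel[OF shift_map_measurable])
  qed (use s in simp)
qed

lemma tau_pos_mass:
  assumes m: "m \<in> IM"
  shows "emeasure m UNIV \<le> (\<integral>\<^sup>+x. tau x \<partial>m)"
proof -
  have "emeasure m UNIV = (\<integral>\<^sup>+x. 1 \<partial>m)" using invmD(2)[OF IM_D(1)[OF m]] by simp
  also have "\<dots> \<le> (\<integral>\<^sup>+x. tau x \<partial>m)" using tau_ge1 by (intro nn_integral_mono) simp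
  finally show ?thesis .
qed

text \<open>A measure of roof mass strictly between zero and one lies inside the segment from the
  zero measure to its own normalisation.\<close>

lemma extreme_total:
  assumes m: "m \<in> IM" and ex: "emb (wt m) extreme_point_of K" and nz: "m \<noteq> zm"
  shows "(\<integral>\<^sup>+x. tau x \<partial>m) = 1"
proof (rule ccontr)
  assume ne: "(\<integral>\<^sup>+x. tau x \<partial>m) \<noteq> 1"
  obtain s where s: "(\<integral>\<^sup>+x. tau x \<partial>m) = ennreal s" "0 \<le> s" "s \<le> 1"
    using IM_D(2)[OF m] by (cases "\<integral>\<^sup>+x. tau x \<partial>m") (auto simp: top_unique)
  have "measure m UNIV \<noteq> 0" using nz zm_iff[OF m] by simp
  then have "emeasure m UNIV \<noteq> 0" by (auto simp: measure_def)
  then have "s \<noteq> 0" using tau_pos_mass[OF m] s by auto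
  then have s01: "0 < s" "s < 1" using s ne by auto
  have le: "ennreal (1 / s) * (\<integral>\<^sup>+x. tau x \<partial>m) \<le> 1"
    using s s01 by (simp add: ennreal_mult'[symmetric])
  let ?m = "scale_measure (1 / s) m"
  note sc = scale_IM[OF IM_D(1)[OF m] _ le]
  have m': "?m \<in> IM" using sc(1) s01 by simp
  have "emb (wt m) = s *\<^sub>R emb (wt ?m) + (1 - s) *\<^sub>R emb (wt zm)"
    by (rule emb_affine(2)[OF wt_in_cube[OF m'] wt_in_cube[OF zm(1)]]) (use s01 sc(2) zm(2) in auto)
  then have seg: "emb (wt m) = (1 - s) *\<^sub>R emb (wt zm) + s *\<^sub>R emb (wt ?m)" by simp
  have "?m \<noteq> zm"
  proof
    assume "?m = zm"
    then have "measure ?m UNIV = 0" using zm_iff[OF m'] by simp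
    then show False using \<open>measure m UNIV \<noteq> 0\<close> s01 by (simp add: measure_scale_measure)
  qed
  then have "emb (wt zm) \<noteq> emb (wt ?m)" using emb_wt_inj[OF zm(1) m'] by auto
  then have "emb (wt m) \<in> open_segment (emb (wt zm)) (emb (wt ?m))"
    using s01 seg by (auto simp: in_segment)
  then show False using ex m' zm(1) unfolding extreme_point_of_def K_def by blast
qed

text \<open>A nontrivial invariant set would split \<open>m\<close> into two restrictions. They are
  renormalised to roof mass one, so the coefficients of the combination are the roof masses
  \<open>a\<close> and \<open>b\<close> of the parts, not their masses.\<close>

lemma extreme_ergodic:
  assumes m: "m \<in> IM" and ex: "emb (wt m) extreme_point_of K" and nz: "m \<noteq> zm"
    and A: "A \<in> sets borel" and inv: "\<And>x. shift_map x \<in> A \<longleftrightarrow> x \<in> A"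
  shows "emeasure m A = 0 \<or> emeasure m (- A) = 0"
proof (rule ccontr)
  assume "\<not> ?thesis"
  then have pos: "emeasure m A \<noteq> 0" "emeasure m (- A) \<noteq> 0" by auto
  have A': "- A \<in> sets borel" "\<And>x. shift_map x \<in> - A \<longleftrightarrow> x \<in> - A" using A inv by auto
  note r1 = restrict_IM[OF m A inv] and r2 = restrict_IM[OF m A']
  let ?T = "\<lambda>C. \<integral>\<^sup>+x. ennreal (tau x) * indicator C x \<partial>m"
  note tm = measurable_invm[OF IM_D(1)[OF m]]
  have tA: "?T C \<noteq> 0" if "C \<in> sets borel" "emeasure m C \<noteq> 0" for C
  proof -
    have "emeasure m C = (\<integral>\<^sup>+x. indicator C x \<partial>m)" using that IM_sets[OF m] by simp
    also have "\<dots> \<le> ?T C" using tau_ge1 by (intro nn_integral_mono) (auto simp: indicator_def)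
    finally show ?thesis using that by auto
  qed
  have sum: "?T A + ?T (- A) = 1"
  proof -
    have "?T A + ?T (- A) = (\<integral>\<^sup>+x. ennreal (tau x) * indicator A x + ennreal (tau x) * indicator (- A) x \<partial>m)"
      by (rule nn_integral_add[symmetric]) (rule tm, use A in measurable)+
    also have "\<dots> = (\<integral>\<^sup>+x. tau x \<partial>m)" by (intro nn_integral_cong) (auto simp: indicator_def)
    finally show ?thesis using extreme_total[OF m ex nz] by simp
  qed
  then have "?T A \<le> 1" "?T (- A) \<le> 1" by (metis add_increasing2 order_refl zero_le, metis add_increasing order_refl zero_le)
  then obtain a b where ab: "?T A = ennreal a" "0 \<le> a" "?T (- A) = ennreal b" "0 \<le> b"
    by (cases "?T A"; cases "?T (- A)") (auto simp: top_unique)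
  have "ennreal (a + b) = ennreal 1" using sum ab by (simp add: ennreal_plus[symmetric] del: ennreal_plus)
  then have sumr: "a + b = 1" using ab by (subst (asm) ennreal_inj) auto
  have "a \<noteq> 0" "b \<noteq> 0" using tA[OF A pos(1)] tA[OF A'(1) pos(2)] ab by auto
  then have a01: "0 < a" "0 < b" using ab by auto
  let ?m1 = "scale_measure (1 / a) (density m (indicator A))"
  let ?m2 = "scale_measure (1 / b) (density m (indicator (- A)))"
  have T1: "(\<integral>\<^sup>+x. tau x \<partial>density m (indicator A)) = ennreal a"
    using r1(3)[of "\<lambda>x. ennreal (tau x)"] ab by simp
  have T2: "(\<integral>\<^sup>+x. tau x \<partial>density m (indicator (- A))) = ennreal b"
    using r2(3)[of "\<lambda>x. ennreal (tau x)"] ab by simp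
  have m1: "?m1 \<in> IM" "wt ?m1 w = 1 / a * wt (density m (indicator A)) w" for w
    using scale_IM[OF r1(1), of "1 / a"] T1 a01 by (auto simp: ennreal_mult'[symmetric])
  have m2: "?m2 \<in> IM" "wt ?m2 w = 1 / b * wt (density m (indicator (- A))) w" for w
    using scale_IM[OF r2(1), of "1 / b"] T2 a01 by (auto simp: ennreal_mult'[symmetric])
  have fin: "emeasure m C = ennreal (measure m C)" for C using IM_finite[OF m] by (simp add: finite_measure.emeasure_eq_measure)
  have d1: "measure (density m (indicator A)) C = measure m (A \<inter> C)" if "C \<in> sets borel" for C
    using r1(2)[OF that] by (simp add: measure_def)
  have d2: "measure (density m (indicator (- A))) C = measure m (- A \<inter> C)" if "C \<in> sets borel" for C
    using r2(2)[OF that] by (simp add: measure_def)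
  have split: "wt m w = a * wt ?m1 w + (1 - a) * wt ?m2 w" for w
  proof -
    interpret finite_measure m by (rule IM_finite[OF m])
    have "wt m w = measure m ((A \<inter> cyl w) \<union> (- A \<inter> cyl w))"
      unfolding wt_def by (intro arg_cong[where f = "measure m"]) auto
    also have "measure m ((A \<inter> cyl w) \<union> (- A \<inter> cyl w)) = measure m (A \<inter> cyl w) + measure m (- A \<inter> cyl w)"
      using A IM_sets[OF m] by (intro finite_measure_Union) auto
    finally have "wt m w = measure m (A \<inter> cyl w) + measure m (- A \<inter> cyl w)" .
    moreover have "1 - a = b" using sumr by simp
    ultimately show ?thesis using a01 unfolding m1 m2 wt_def by (simp add: d1 d2)
  qed
  have "emb (wt m) = a *\<^sub>R emb (wt ?m1) + (1 - a) *\<^sub>R emb (wt ?m2)"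
    by (rule emb_affine(2)[OF wt_in_cube[OF m1(1)] wt_in_cube[OF m2(1)]]) (use a01 sumr in simp, use a01 sumr in simp, rule split)
  then have seg: "emb (wt m) = (1 - a) *\<^sub>R emb (wt ?m2) + a *\<^sub>R emb (wt ?m1)" by simp
  have "?m1 \<noteq> ?m2"
  proof
    assume eq: "?m1 = ?m2"
    have "measure ?m1 A = 1 / a * measure m A" using d1[OF A] a01 by (simp add: measure_scale_measure)
    moreover have "measure ?m2 A = 0" using d2[OF A] a01 by (simp add: measure_scale_measure)
    ultimately have "measure m A = 0" using eq a01 by simp
    then show False using pos fin by simp
  qed
  then have "emb (wt ?m2) \<noteq> emb (wt ?m1)" using emb_wt_inj[OF m2(1) m1(1)] by auto
  then have "emb (wt m) \<in> open_segment (emb (wt ?m2)) (emb (wt ?m1))"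
    using a01 sumr seg by (auto simp: in_segment)
  then show False using ex m1(1) m2(1) unfolding extreme_point_of_def K_def by blast
qed

text \<open>The points with frequency below the mean form an invariant set, null or of full measure.
  In either case the deviation from the mean has constant sign and integral zero.\<close>

lemma extreme_constant_averages:
  assumes m: "m \<in> IM" and ex: "emb (wt m) extreme_point_of K" and nz: "m \<noteq> zm"
  shows "AE y in m. \<forall>w. qx y w = wt m w / measure m UNIV"
proof -
  note im = IM_D(1)[OF m]
  interpret finite_measure m by (rule IM_finite[OF m])
  have pos: "measure m UNIV \<noteq> 0" using nz zm_iff[OF m] by simp
  then have pos': "0 < measure m UNIV" using measure_nonneg[of m UNIV] by linarith
  have "AE y in m. qx y w = wt m w / measure m UNIV" for w
  proof -
    define c where "c = wt m w / measure m UNIV"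
    define A where "A = {y. qx y w < c}"
    have "{y \<in> space borel. qx y w < c} \<in> sets borel" by measurable
    then have A: "A \<in> sets borel" by (simp add: A_def)
    have meas: "(\<lambda>y. qx y w) \<in> borel_measurable m" by (rule measurable_invm[OF im]) measurable
    have int: "integrable m (\<lambda>y. qx y w)"
      using AE_convs[OF im cyl_in_borel[of w]] meas
      by (intro integrable_const_bound[of _ 1]) (auto elim!: eventually_mono simp: lmt_nonneg lmt_le_1)
    have mean: "(\<integral>y. qx y w - c \<partial>m) = 0"
      using int pos invmD(2)[OF im] integral_lmt[OF im cyl_in_borel[of w]] by (simp add: c_def wt_def)
    have int': "integrable m (\<lambda>y. qx y w - c)" using int by simp
    from extreme_ergodic[OF m ex nz A] have "emeasure m A = 0 \<or> emeasure m (- A) = 0"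
      by (simp add: A_def lmt_shift)
    then show ?thesis
    proof
      assume "emeasure m A = 0"
      then have "AE y in m. 0 \<le> qx y w - c"
        using A IM_sets[OF m] by (intro AE_I'[of A]) (auto simp: A_def null_sets_def)
      then have "AE y in m. qx y w - c = 0"
        using integral_nonneg_eq_0_iff_AE[OF int'] mean by simp
      then show ?thesis by (simp add: c_def)
    next
      assume z: "emeasure m (- A) = 0"
      then have neg: "AE y in m. qx y w < c"
        using A IM_sets[OF m] by (intro AE_I'[of "- A"]) (auto simp: A_def null_sets_def)
      then have "AE y in m. 0 \<le> c - qx y w" by eventually_elim simp
      moreover have "(\<integral>y. c - qx y w \<partial>m) = 0"
        using int pos invmD(2)[OF im] integral_lmt[OF im cyl_in_borel[of w]] by (simp add: c_def wt_def)
      ultimately have "AE y in m. c - qx y w = 0"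
        using integral_nonneg_eq_0_iff_AE[of m "\<lambda>y. c - qx y w"] int by simp
      then show ?thesis by eventually_elim (simp add: c_def)
    qed
  qed
  then show ?thesis by (simp add: AE_all_countable)
qed

end

subsection \<open>The simplex property\<close>

context roof_system
begin

definition tx :: "(nat \<Rightarrow> nat) \<Rightarrow> ennreal" where
  "tx x = (\<integral>\<^sup>+y. tau y \<partial>emp x)"

text \<open>The extreme point generated by \<open>x\<close>: the empirical measure has mass one and
  is divided by its roof mass \<open>tx x\<close>.\<close>

definition pt :: "(nat \<Rightarrow> nat) \<Rightarrow> (nat \<Rightarrow>\<^sub>C real)" where
  "pt x = emb (\<lambda>w. qx x w / enn2real (tx x))"

lemma tx_measurable [measurable]: "tx \<in> borel_measurable borel"
  unfolding tx_def by measurable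

lemma emb_measurable: "emb \<in> borel_measurable borel"
  by (intro borel_measurable_continuous_onI continuous_emb)

lemma pt_measurable [measurable]: "pt \<in> borel_measurable borel"
proof -
  have "(\<lambda>x w. qx x w / enn2real (tx x)) \<in> borel_measurable borel"
    by (rule measurable_coordinatewise_then_product) measurable
  then show ?thesis
    unfolding pt_def by (rule measurable_compose[OF _ emb_measurable])
qed

lemma nn_integral_tx:
  assumes "invm m"
  shows "(\<integral>\<^sup>+x. tx x \<partial>m) = (\<integral>\<^sup>+x. tau x \<partial>m)"
  unfolding tx_def by (rule nn_integral_emp[OF assms]) measurable

text \<open>Empirical measures are almost surely ergodic, and their roof mass is finite because its
  integral is the roof mass of \<open>m\<close>; after normalisation the criterion for extreme
  points applies. The last two clauses undo the normalisation and record that \<open>emb\<close>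
  does not clamp here.\<close>

lemma AE_pt_extreme:
  assumes m: "m \<in> IM"
  shows "AE x in m. 1 \<le> tx x \<and> tx x \<noteq> \<infinity> \<and> pt x extreme_point_of K \<and>
     (\<forall>w. apply_bcontfun (pt x) (to_nat w) * enn2real (tx x) = (1/2)^(to_nat w) * qx x w) \<and>
     (\<forall>w. 0 \<le> qx x w / enn2real (tx x) \<and> qx x w / enn2real (tx x) \<le> 1)"
proof -
  note im = IM_D(1)[OF m]
  have "(\<integral>\<^sup>+x. tx x \<partial>m) \<noteq> \<infinity>"
    using IM_D(2)[OF m] nn_integral_tx[OF im] by (auto simp: top_unique)
  then have "AE x in m. tx x \<noteq> \<infinity>"
    by (intro nn_integral_PInf_AE measurable_invm[OF im]) measurable
  then show ?thesis using AE_emp_ergodic[OF im]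
  proof eventually_elim
    case (elim x)
    then have g: "good (qx x)" and erg: "AE y in emp x. \<forall>w. qx y w = qx x w" by auto
    note e = emp_good[OF g]
    have "1 = (\<integral>\<^sup>+y. 1 \<partial>emp x)" using e(4) invmD(2)[OF e(2)] by simp
    also have "\<dots> \<le> tx x" unfolding tx_def using tau_ge1 by (intro nn_integral_mono) simp
    finally have t1: "1 \<le> tx x" .
    define t where "t = enn2real (tx x)"
    have tt: "tx x = ennreal t" "0 \<le> t" using elim(1) by (auto simp: t_def less_top)
    then have t: "1 \<le> t" using t1 by simp
    have le: "ennreal (1 / t) * (\<integral>\<^sup>+y. tau y \<partial>emp x) = 1"
      using tt t unfolding tx_def[symmetric] by (simp add: ennreal_mult'[symmetric])
    let ?m = "scale_measure (1 / t) (emp x)"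
    note sc = scale_IM[OF e(2), of "1 / t"]
    have IM: "?m \<in> IM" using sc(1) t le by simp
    have wt: "wt ?m = (\<lambda>w. qx x w / t)" using sc(2) t le e(3) by auto
    have pt: "pt x = emb (wt ?m)" unfolding pt_def wt by (simp add: t_def)
    have ex: "pt x extreme_point_of K"
      unfolding pt
    proof (rule extreme_if_constant_averages[OF IM])
      show "(\<integral>\<^sup>+y. tau y \<partial>?m) = 1" using sc(3) t le by simp
      obtain N where N: "{y \<in> space (emp x). \<not> (\<forall>w. qx y w = qx x w)} \<subseteq> N" "emeasure (emp x) N = 0" "N \<in> sets (emp x)"
        using AE_E[OF erg] by blast
      have "N \<in> null_sets ?m" using N(2,3) by (simp add: null_sets_def)
      then show "AE y in ?m. \<forall>w. qx y w = qx x w"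
        by (rule AE_I') (use N(1) invmD(2)[OF e(2)] invmD(2)[OF IM_D(1)[OF IM]] in simp)
    qed
    have c: "wt ?m \<in> cube" by (rule wt_in_cube[OF IM])
    have "apply_bcontfun (pt x) (to_nat w) * t = (1/2)^(to_nat w) * qx x w" for w
      unfolding pt emb_apply_cube[OF c] using t by (simp add: wt)
    moreover have "\<forall>w. 0 \<le> qx x w / t \<and> qx x w / t \<le> 1"
      using c unfolding cube_def wt by simp
    ultimately show ?case using t1 elim(1) ex by (simp add: t_def)
  qed
qed

text \<open>The condition imposed on \<open>\<mu>\<close> by the definition of Choquet simplices,
  for this \<open>K\<close>.\<close>

definition represents :: "(nat \<Rightarrow>\<^sub>C real) measure \<Rightarrow> (nat \<Rightarrow>\<^sub>C real) \<Rightarrow> bool" where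
  "represents \<mu> x \<longleftrightarrow> sets \<mu> = sets borel \<and> prob_space \<mu> \<and> emeasure \<mu> (extreme_points K) = 1 \<and>
     (\<forall>f::_ \<Rightarrow> real. bounded_linear f \<longrightarrow> (\<integral>y. f y \<partial>\<mu>) = f x)"

lemma extreme_points_subset: "extreme_points K \<subseteq> K"
  by (auto simp: extreme_points_def extreme_point_of_def)

text \<open>The coordinates of all points of \<open>K\<close> are nonnegative, so a proper
  combination vanishes only if both points do.\<close>

lemma zero_extreme: "0 extreme_point_of K"
  unfolding extreme_point_of_def
proof (intro conjI ballI notI)
  show "0 \<in> K" by (rule zero_in_K)
  fix a b assume ab: "a \<in> K" "b \<in> K" "0 \<in> open_segment a b"
  then obtain u where u: "0 < u" "u < 1" "0 = (1 - u) *\<^sub>R a + u *\<^sub>R b" and ne: "a \<noteq> b" by (auto simp: in_segment)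
  have nn: "0 \<le> apply_bcontfun y k" if "y \<in> K" for y k
    using that by (auto simp: K_def emb_apply)
  have "apply_bcontfun a k = 0 \<and> apply_bcontfun b k = 0" for k
  proof -
    have "0 = apply_bcontfun ((1 - u) *\<^sub>R a + u *\<^sub>R b) k" using u(3) by simp
    then have "0 = (1 - u) * apply_bcontfun a k + u * apply_bcontfun b k"
      by (simp add: plus_bcontfun.rep_eq scaleR_bcontfun.rep_eq)
    moreover have "0 \<le> (1 - u) * apply_bcontfun a k" "0 \<le> u * apply_bcontfun b k"
      using nn ab u by auto
    ultimately have "(1 - u) * apply_bcontfun a k = 0" "u * apply_bcontfun b k = 0" by linarith+
    then show ?thesis using u by auto
  qed
  then have "a = b" by (intro bcontfun_eqI) simp
  then show False using ne by simp
qed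

text \<open>Push the measure with density \<open>tx\<close> with respect to \<open>m\<close> forward
  along \<open>pt\<close>: the density undoes the division in \<open>pt\<close>, so the barycentre
  is the point of \<open>m\<close>. Its mass is the roof mass \<open>s\<close> of \<open>m\<close>;
  the missing \<open>1 - s\<close> is placed at the vertex. The first part is normalised to
  \<open>\<mu>1\<close> and then mixed in with weight \<open>s\<close>.\<close>

lemma exists_representation:
  assumes m: "m \<in> IM"
  shows "\<exists>\<mu>. represents \<mu> (emb (wt m))"
proof -
  note im = IM_D(1)[OF m]
  note bm = measurable_invm[OF im]
  have ext_borel: "extreme_points K \<in> sets borel" by (rule extreme_points_borel[OF compact_K convex_K])
  have lin: "bounded_linear f \<Longrightarrow> (f :: (nat \<Rightarrow>\<^sub>C real) \<Rightarrow> real) \<in> borel_measurable borel" for f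
    by (intro borel_measurable_continuous_onI linear_continuous_on)
  have coord_meas: "(\<lambda>y::nat \<Rightarrow>\<^sub>C real. apply_bcontfun y k) \<in> borel_measurable borel" for k
  proof (rule lin, rule bounded_linear_intro[where K = 1])
    show "norm (apply_bcontfun x k) \<le> norm x * 1" for x :: "nat \<Rightarrow>\<^sub>C real" using norm_bounded[of x k] by simp
  qed (auto simp: plus_bcontfun.rep_eq scaleR_bcontfun.rep_eq)
  let ?d0 = "return borel (0 :: nat \<Rightarrow>\<^sub>C real)"
  have d0: "prob_space ?d0" by (rule prob_space_return) simp
  have rep: "represents \<mu> (emb (wt m))"
    if s: "sets \<mu> = sets borel" and p: "prob_space \<mu>" and e: "emeasure \<mu> (extreme_points K) = 1"
      and c: "\<And>w. (\<integral>\<^sup>+y. ennreal (apply_bcontfun y (to_nat w)) \<partial>\<mu>) = ennreal ((1/2)^(to_nat w) * wt m w)" for \<mu>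
    unfolding represents_def
  proof (intro conjI s p e allI impI)
    interpret prob_space \<mu> by (rule p)
    have AE: "AE y in \<mu>. y \<in> K"
    proof -
      have "AE y in \<mu>. y \<in> extreme_points K"
        using e ext_borel s by (subst AE_in_set_eq_1) (auto simp: measure_def)
      then show ?thesis by eventually_elim (use extreme_points_subset in auto)
    qed
    fix f :: "(nat \<Rightarrow>\<^sub>C real) \<Rightarrow> real" assume f: "bounded_linear f"
    show "(\<integral>y. f y \<partial>\<mu>) = f (emb (wt m))"
    proof (rule barycentre_linear[OF compact_K s p AE _ f])
      fix k
      define w where "w = (from_nat k :: nat list)"
      have nn: "AE y in \<mu>. 0 \<le> apply_bcontfun y j" for j
        using AE by eventually_elim (auto simp: K_def emb_apply)
      \<comment> \<open>An index \<open>k\<close> need not be \<open>to_nat\<close> of the word it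
        stands for; its coordinate is a fixed multiple of the one at
        \<open>to_nat w\<close>.\<close>
      have kw: "AE y in \<mu>. apply_bcontfun y k = (1/2)^k * 2^(to_nat w) * apply_bcontfun y (to_nat w)"
        using AE
      proof eventually_elim
        case (elim y)
        then obtain m' where "y = emb (wt m')" "m' \<in> IM" by (auto simp: K_def)
        then show ?case by (simp add: emb_apply_cube[OF wt_in_cube] w_def power_one_over)
      qed
      have "(\<integral>y. apply_bcontfun y (to_nat w) \<partial>\<mu>) = (1/2)^(to_nat w) * wt m w"
        using c[of w] nn coord_meas[of "to_nat w"] wt_nonneg[of m w] s
        by (intro integral_eq_nn_integral[THEN trans]) auto
      moreover have "(\<integral>y. apply_bcontfun y k \<partial>\<mu>) = (\<integral>y. (1/2)^k * 2^(to_nat w) * apply_bcontfun y (to_nat w) \<partial>\<mu>)"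
        using kw coord_meas s by (intro integral_cong_AE) auto
      ultimately show "(\<integral>y. apply_bcontfun y k \<partial>\<mu>) = apply_bcontfun (emb (wt m)) k"
        by (simp add: emb_apply_cube[OF wt_in_cube[OF m]] w_def power_one_over)
    qed
  qed
  show ?thesis
  proof (cases "m = zm")
    case True
    have "represents ?d0 (emb (wt m))"
    proof (rule rep)
      show "emeasure ?d0 (extreme_points K) = 1"
        using ext_borel zero_extreme by (simp add: extreme_points_def)
      show "(\<integral>\<^sup>+y. ennreal (apply_bcontfun y (to_nat w)) \<partial>?d0) = ennreal ((1/2)^(to_nat w) * wt m w)" for w
        using coord_meas by (simp add: nn_integral_return True zm)
    qed (use d0 in auto)
    then show ?thesis by blast
  next
    case False
    obtain s where s: "(\<integral>\<^sup>+x. tau x \<partial>m) = ennreal s" "0 \<le> s" "s \<le> 1"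
      using IM_D(2)[OF m] by (cases "\<integral>\<^sup>+x. tau x \<partial>m") (auto simp: top_unique)
    have "measure m UNIV \<noteq> 0" using False zm_iff[OF m] by simp
    then have "emeasure m UNIV \<noteq> 0" by (auto simp: measure_def)
    then have "s \<noteq> 0" using tau_pos_mass[OF m] s by auto
    then have s0: "0 < s" using s by simp
    define D where "D = density m (\<lambda>x. ennreal (1 / s) * tx x)"
    have dens: "(\<lambda>x. ennreal (1 / s) * tx x) \<in> borel_measurable m" by (rule bm) measurable
    have sD: "sets D = sets borel" using IM_sets[OF m] by (simp add: D_def)
    have spD: "space D = UNIV" using sets_eq_imp_space_eq[OF sD] by simp
    have ptD: "pt \<in> D \<rightarrow>\<^sub>M borel" using pt_measurable sD measurable_cong_sets by blast
    define \<mu>1 where "\<mu>1 = distr D borel pt"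
    have I1: "(\<integral>\<^sup>+y. f y \<partial>\<mu>1) = ennreal (1 / s) * (\<integral>\<^sup>+x. tx x * f (pt x) \<partial>m)" if f: "f \<in> borel_measurable borel" for f
    proof -
      have fp: "(\<lambda>x. f (pt x)) \<in> borel_measurable borel" using f by measurable
      have "(\<integral>\<^sup>+y. f y \<partial>\<mu>1) = (\<integral>\<^sup>+x. f (pt x) \<partial>D)"
        unfolding \<mu>1_def by (rule nn_integral_distr[OF ptD]) (simp add: f)
      also have "\<dots> = (\<integral>\<^sup>+x. ennreal (1 / s) * tx x * f (pt x) \<partial>m)"
        unfolding D_def by (intro nn_integral_density dens bm[OF fp])
      also have "\<dots> = ennreal (1 / s) * (\<integral>\<^sup>+x. tx x * f (pt x) \<partial>m)"
        unfolding mult.assoc by (intro nn_integral_cmult bm borel_measurable_times_ennreal tx_measurable fp)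
      finally show ?thesis .
    qed
    have full: "emeasure \<mu>1 A = 1" if A: "A \<in> sets borel" and AE: "AE x in m. pt x \<in> A" for A
    proof -
      have "emeasure \<mu>1 A = (\<integral>\<^sup>+y. indicator A y \<partial>\<mu>1)" using A by (simp add: \<mu>1_def)
      also have "\<dots> = ennreal (1 / s) * (\<integral>\<^sup>+x. tx x * indicator A (pt x) \<partial>m)" using A by (intro I1) simp
      also have "(\<integral>\<^sup>+x. tx x * indicator A (pt x) \<partial>m) = (\<integral>\<^sup>+x. tx x \<partial>m)"
        using AE by (intro nn_integral_cong_AE) (auto elim!: eventually_mono)
      also have "\<dots> = ennreal s" using nn_integral_tx[OF im] s by simp
      finally show ?thesis using s0 by (simp add: ennreal_mult'[symmetric])
    qed
    have s1: "sets \<mu>1 = sets borel" by (simp add: \<mu>1_def)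
    have p1: "prob_space \<mu>1"
      using full[of UNIV] s1 sets_eq_imp_space_eq[OF s1] by (intro prob_spaceI) simp
    let ?\<mu> = "convex_comb_measure s \<mu>1 ?d0"
    have ss: "sets \<mu>1 = sets ?d0" using s1 by simp
    have em: "emeasure ?\<mu> A = ennreal s * emeasure \<mu>1 A + ennreal (1 - s) * emeasure ?d0 A" for A
      by (rule emeasure_convex_comb_measure[OF ss])
    have ones: "ennreal s * 1 + ennreal (1 - s) * 1 = 1"
      using s by (simp add: ennreal_plus[symmetric] del: ennreal_plus)
    have "represents ?\<mu> (emb (wt m))"
    proof (rule rep)
      show sm: "sets ?\<mu> = sets borel" using sets_convex_comb_measure[OF ss] s1 by simp
      have "emeasure ?\<mu> UNIV = 1"
        unfolding em using full[of UNIV] ones by simp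
      then show "prob_space ?\<mu>" using sets_eq_imp_space_eq[OF sm] by (intro prob_spaceI) simp
      have "AE x in m. pt x \<in> extreme_points K"
        using AE_pt_extreme[OF m] by eventually_elim (simp add: extreme_points_def)
      then show "emeasure ?\<mu> (extreme_points K) = 1"
        unfolding em using full[OF ext_borel] ones ext_borel zero_extreme by (simp add: extreme_points_def)
      fix w :: "nat list"
      let ?k = "to_nat w"
      have c: "(\<lambda>y::nat \<Rightarrow>\<^sub>C real. ennreal (apply_bcontfun y ?k)) \<in> borel_measurable borel" using coord_meas by simp
      have "(\<integral>\<^sup>+y. ennreal (apply_bcontfun y ?k) \<partial>?\<mu>) =
          ennreal s * (\<integral>\<^sup>+y. ennreal (apply_bcontfun y ?k) \<partial>\<mu>1) + ennreal (1 - s) * (\<integral>\<^sup>+y. ennreal (apply_bcontfun y ?k) \<partial>?d0)"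
        using c measurable_cong_sets[OF s1 refl] by (intro nn_integral_convex_comb[OF ss]) blast
      also have "(\<integral>\<^sup>+y. ennreal (apply_bcontfun y ?k) \<partial>?d0) = 0" using c by (simp add: nn_integral_return)
      also have "(\<integral>\<^sup>+y. ennreal (apply_bcontfun y ?k) \<partial>\<mu>1) = ennreal (1 / s) * (\<integral>\<^sup>+x. tx x * ennreal (apply_bcontfun (pt x) ?k) \<partial>m)"
        by (rule I1[OF c])
      also have "(\<integral>\<^sup>+x. tx x * ennreal (apply_bcontfun (pt x) ?k) \<partial>m) = (\<integral>\<^sup>+x. ennreal ((1/2)^?k) * ennreal (qx x w) \<partial>m)"
      proof (rule nn_integral_cong_AE)
        show "AE x in m. tx x * ennreal (apply_bcontfun (pt x) ?k) = ennreal ((1/2)^?k) * ennreal (qx x w)"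
          using AE_pt_extreme[OF m]
        proof eventually_elim
          case (elim x)
          have "tx x = ennreal (enn2real (tx x))" using elim by (simp add: less_top)
          then have "tx x * ennreal (apply_bcontfun (pt x) ?k) = ennreal (enn2real (tx x) * apply_bcontfun (pt x) ?k)"
            by (metis ennreal_mult' enn2real_nonneg)
          also have "enn2real (tx x) * apply_bcontfun (pt x) ?k = (1/2)^?k * qx x w" using elim by (simp add: mult.commute)
          finally show ?case by (simp add: ennreal_mult')
        qed
      qed
      also have "\<dots> = ennreal ((1/2)^?k) * emeasure m (cyl w)"
        using nn_integral_lmt[OF im cyl_in_borel[of w]]
        by (subst nn_integral_cmult) (auto intro!: bm)
      also have "emeasure m (cyl w) = ennreal (wt m w)" by (rule emeasure_cyl[OF IM_finite[OF m]])
      also have "ennreal s * (ennreal (1 / s) * (ennreal ((1/2)^?k) * ennreal (wt m w))) + ennreal (1 - s) * 0 = ennreal ((1/2)^?k * wt m w)"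
        using s0 by (simp add: ennreal_mult'[symmetric])
      finally show "(\<integral>\<^sup>+y. ennreal (apply_bcontfun y ?k) \<partial>?\<mu>) = ennreal ((1/2)^?k * wt m w)" .
    qed
    then show ?thesis by blast
  qed
qed

text \<open>Left inverse of \<open>emb\<close> on the cube, linear in \<open>y\<close> so that
  barycentre conditions apply to it.\<close>

definition dec :: "(nat \<Rightarrow>\<^sub>C real) \<Rightarrow> nat list \<Rightarrow> real" where
  "dec y w = 2^(to_nat w) * apply_bcontfun y (to_nat w)"

lemma dec_emb: "q \<in> cube \<Longrightarrow> dec (emb q) = q"
  by (auto simp: dec_def emb_apply_cube power_one_over)

lemma good_wt:
  assumes m: "m \<in> IM" shows "good (wt m)"
  using wt_limit(1)[of "\<lambda>_. m" "wt m"] m by simp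

lemma kq_wt: "m \<in> IM \<Longrightarrow> kq (wt m) = m"
  using good_wt[of m] meas_of[OF good_wt[of m]] wt_le_1[of m "[]"]
  by (auto simp: kq_def intro!: wt_inj IM_sets IM_finite invmD(3) IM_D(1))

text \<open>For such an \<open>m\<close> the averages are almost surely constant, so almost every
  empirical measure is \<open>m\<close> divided by its mass, and normalising it to roof mass one
  returns \<open>m\<close>.\<close>

lemma extreme_averages:
  assumes m: "m \<in> IM" and ex: "emb (wt m) extreme_point_of K" and nz: "m \<noteq> zm"
  shows "AE x in m. pt x = emb (wt m) \<and> tx x = ennreal (1 / measure m UNIV)"
proof -
  note im = IM_D(1)[OF m]
  interpret finite_measure m by (rule IM_finite[OF m])
  define M where "M = measure m UNIV"
  have "M \<noteq> 0" using nz zm_iff[OF m] by (simp add: M_def)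
  then have M: "0 < M" using measure_nonneg[of m UNIV] by (simp add: M_def less_le)
  show ?thesis
    using extreme_constant_averages[OF m ex nz] AE_good[OF im]
  proof eventually_elim
    case (elim x)
    then have g: "good (qx x)" by simp
    note e = emp_good[OF g]
    have "emp x = scale_measure (1 / M) m"
    proof (rule wt_inj)
      show "wt (emp x) = wt (scale_measure (1 / M) m)"
        using elim(1) e(3) M by (auto simp: wt_def measure_scale_measure M_def)
      show "finite_measure (scale_measure (1 / M) m)"
        by (intro finite_measureI) (auto simp: ennreal_mult_eq_top_iff emeasure_finite)
      show "finite_measure (emp x)" "sets (emp x) = sets borel" using invmD[OF e(2)] by auto
    qed (use IM_sets[OF m] in simp)
    then have "tx x = ennreal (1 / M) * (\<integral>\<^sup>+x. tau x \<partial>m)"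
      unfolding tx_def by (simp add: nn_integral_scale_measure measurable_invm[OF im])
    then have t: "tx x = ennreal (1 / M)" using extreme_total[OF m ex nz] by simp
    have "(\<lambda>w. qx x w / enn2real (tx x)) = wt m"
      unfolding t using elim(1) M by (auto simp: M_def)
    then show ?case using t by (simp add: pt_def M_def)
  qed
qed

text \<open>The right side does not involve \<open>\<mu>\<close>, which yields uniqueness. Testing
  the barycentre with the linear maps \<open>dec\<close> shows that \<open>m\<close> is the mixture
  under \<open>\<mu>\<close> of the measures coded by the points \<open>y\<close>. For the measure
  coded by an extreme \<open>y\<close> other than zero, \<open>pt\<close> is almost surely
  \<open>y\<close> and \<open>tx\<close> has integral one, so the inner integral is the indicator of
  \<open>A\<close>; at zero the coded measure vanishes, hence the hypothesis on
  \<open>A\<close>.\<close>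

lemma representation_formula:
  assumes m: "m \<in> IM" and rep: "represents \<mu> (emb (wt m))" and A: "A \<in> sets borel" and A0: "0 \<notin> A"
  shows "emeasure \<mu> A = (\<integral>\<^sup>+x. indicator A (pt x) * tx x \<partial>m)"
proof -
  note im = IM_D(1)[OF m]
  have s: "sets \<mu> = sets borel" and p: "prob_space \<mu>" and e: "emeasure \<mu> (extreme_points K) = 1"
    and lin: "\<And>f::(nat \<Rightarrow>\<^sub>C real) \<Rightarrow> real. bounded_linear f \<Longrightarrow> (\<integral>y. f y \<partial>\<mu>) = f (emb (wt m))"
    using rep by (auto simp: represents_def)
  interpret prob_space \<mu> by (rule p)
  have sp: "space \<mu> = UNIV" using sets_eq_imp_space_eq[OF s] by simp
  have ext_borel: "extreme_points K \<in> sets borel" by (rule extreme_points_borel[OF compact_K convex_K])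
  have AE: "AE y in \<mu>. y \<in> extreme_points K"
    using e ext_borel s by (subst AE_in_set_eq_1) (auto simp: measure_def)
  have dec_lin: "bounded_linear (\<lambda>y. dec y w)" for w
  proof (rule bounded_linear_intro[where K = "2^(to_nat w)"])
    show "norm (dec x w) \<le> norm x * 2^(to_nat w)" for x
      using norm_bounded[of x "to_nat w"] by (simp add: dec_def abs_mult mult.commute)
  qed (auto simp: dec_def plus_bcontfun.rep_eq scaleR_bcontfun.rep_eq algebra_simps)
  have dec_meas: "(\<lambda>y. dec y w) \<in> borel_measurable borel" for w
    by (rule borel_measurable_continuous_onI, rule linear_continuous_on, rule dec_lin)
  have ker: "(\<lambda>y. kq (dec y)) \<in> \<mu> \<rightarrow>\<^sub>M subprob_algebra borel"
    unfolding measurable_cong_sets[OF s refl] by (rule kq_measurable) (rule dec_meas)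
  have kq_dec: "kq (dec (emb (wt m'))) = m'" if "m' \<in> IM" for m'
    using that by (simp add: dec_emb[OF wt_in_cube] kq_wt)
  have m_eq: "m = \<mu> \<bind> (\<lambda>y. kq (dec y))"
  proof (rule measure_eqI_cyl)
    show "sets (\<mu> \<bind> (\<lambda>y. kq (dec y))) = sets borel"
      by (rule sets_bind) (use sets_kernel[OF ker] sp in auto)
    fix w
    have dw: "AE y in \<mu>. 0 \<le> dec y w \<and> dec y w \<le> 1"
      using AE
    proof eventually_elim
      case (elim y)
      then obtain m' where "y = emb (wt m')" "m' \<in> IM" using extreme_points_subset by (auto simp: K_def)
      then show ?case using wt_nonneg wt_le_1 by (simp add: dec_emb[OF wt_in_cube])
    qed
    have "emeasure (\<mu> \<bind> (\<lambda>y. kq (dec y))) (cyl w) = (\<integral>\<^sup>+y. emeasure (kq (dec y)) (cyl w) \<partial>\<mu>)"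
      by (rule emeasure_bind[OF _ ker]) (auto simp: sp)
    also have "\<dots> = (\<integral>\<^sup>+y. ennreal (dec y w) \<partial>\<mu>)"
    proof (rule nn_integral_cong_AE)
      show "AE y in \<mu>. emeasure (kq (dec y)) (cyl w) = ennreal (dec y w)"
        using AE
      proof eventually_elim
        case (elim y)
        then obtain m' where "y = emb (wt m')" "m' \<in> IM" using extreme_points_subset by (auto simp: K_def)
        then show ?case by (simp add: kq_wt dec_emb[OF wt_in_cube] emeasure_cyl[OF IM_finite])
      qed
    qed
    also have "\<dots> = ennreal (\<integral>y. dec y w \<partial>\<mu>)"
    proof (rule nn_integral_eq_integral)
      have "AE y in \<mu>. norm (dec y w) \<le> 1" using dw by eventually_elim simp
      moreover have "(\<lambda>y. dec y w) \<in> borel_measurable \<mu>"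
        unfolding measurable_cong_sets[OF s refl] by (rule dec_meas)
      ultimately show "integrable \<mu> (\<lambda>y. dec y w)" by (rule integrable_const_bound)
    qed (use dw in \<open>auto elim!: eventually_mono\<close>)
    also have "(\<integral>y. dec y w \<partial>\<mu>) = wt m w"
      by (subst lin[OF dec_lin]) (simp add: dec_emb[OF wt_in_cube[OF m]])
    finally show "emeasure m (cyl w) = emeasure (\<mu> \<bind> (\<lambda>y. kq (dec y))) (cyl w)"
      by (simp add: emeasure_cyl[OF IM_finite[OF m]])
  qed (use IM_sets[OF m] IM_finite[OF m] in auto)
  have "(\<integral>\<^sup>+x. indicator A (pt x) * tx x \<partial>m) = (\<integral>\<^sup>+y. \<integral>\<^sup>+x. indicator A (pt x) * tx x \<partial>kq (dec y) \<partial>\<mu>)"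
    by (subst m_eq, rule nn_integral_bind[OF _ ker]) (use A in measurable)
  also have "\<dots> = (\<integral>\<^sup>+y. indicator A y \<partial>\<mu>)"
  proof (rule nn_integral_cong_AE)
    show "AE y in \<mu>. (\<integral>\<^sup>+x. indicator A (pt x) * tx x \<partial>kq (dec y)) = indicator A y"
      using AE
    proof eventually_elim
      case (elim y)
      then obtain m' where y: "y = emb (wt m')" and m': "m' \<in> IM" using extreme_points_subset by (auto simp: K_def)
      have kq: "kq (dec y) = m'" using kq_dec[OF m'] y by simp
      show ?case
      proof (cases "m' = zm")
        case True
        then have "y = 0" using y emb_zero by (simp add: zm)
        then show ?thesis using A0 kq True by (simp add: zm_def)
      next
        case False
        have "emb (wt m') extreme_point_of K" using elim y by (simp add: extreme_points_def)
        from extreme_averages[OF m' this False]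
        have "AE x in m'. indicator A (pt x) * tx x = indicator A y * ennreal (1 / measure m' UNIV)"
          by eventually_elim (simp add: y)
        then have "(\<integral>\<^sup>+x. indicator A (pt x) * tx x \<partial>m') = (\<integral>\<^sup>+x. indicator A y * ennreal (1 / measure m' UNIV) \<partial>m')"
          by (rule nn_integral_cong_AE)
        also have "\<dots> = indicator A y * (ennreal (1 / measure m' UNIV) * emeasure m' UNIV)"
          using invmD(2)[OF IM_D(1)[OF m']] by (simp add: mult.assoc)
        also have "ennreal (1 / measure m' UNIV) * emeasure m' UNIV = 1"
          using False zm_iff[OF m'] finite_measure.emeasure_eq_measure[OF IM_finite[OF m']]
          by (simp add: ennreal_mult'[symmetric])
        finally show ?thesis using kq by simp
      qed
    qed
  qed
  also have "\<dots> = emeasure \<mu> A" using A s by simp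
  finally show ?thesis by simp
qed

lemma unique_representation:
  assumes m: "m \<in> IM" and r1: "represents \<mu>1 (emb (wt m))" and r2: "represents \<mu>2 (emb (wt m))"
  shows "\<mu>1 = \<mu>2"
proof (rule measure_eqI)
  have s: "sets \<mu>1 = sets borel" "sets \<mu>2 = sets borel" and p: "prob_space \<mu>1" "prob_space \<mu>2"
    using r1 r2 by (auto simp: represents_def)
  then show "sets \<mu>1 = sets \<mu>2" by simp
  have sp: "space \<mu>1 = UNIV" "space \<mu>2 = UNIV" using s[THEN sets_eq_imp_space_eq] by auto
  have eq: "emeasure \<mu>1 C = emeasure \<mu>2 C" if "C \<in> sets borel" "0 \<notin> C" for C
    using representation_formula[OF m r1 that] representation_formula[OF m r2 that] by simp
  fix A assume "A \<in> sets \<mu>1"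
  then have A: "A \<in> sets borel" using s by simp
  show "emeasure \<mu>1 A = emeasure \<mu>2 A"
  proof (cases "0 \<in> A")
    case False
    then show ?thesis using eq A by simp
  next
    \<comment> \<open>Pass to the complement, which avoids the vertex; the total mass one does the
      rest.\<close>
    case True
    interpret p1: prob_space \<mu>1 by (rule p(1))
    interpret p2: prob_space \<mu>2 by (rule p(2))
    have "emeasure \<mu>1 (- A) = emeasure \<mu>2 (- A)" using True eq[of "- A"] A by auto
    then have "measure \<mu>1 (- A) = measure \<mu>2 (- A)" by (simp add: measure_def)
    moreover have "measure \<mu>1 (- A) = 1 - measure \<mu>1 A" "measure \<mu>2 (- A) = 1 - measure \<mu>2 A"
      using p1.prob_compl[of A] p2.prob_compl[of A] A s sp by (auto simp: Compl_eq_Diff_UNIV)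
    ultimately have "measure \<mu>1 A = measure \<mu>2 A" by simp
    then show ?thesis by (simp add: p1.emeasure_eq_measure p2.emeasure_eq_measure)
  qed
qed

lemma choquet_K: "choquet_simplex K"
  unfolding choquet_simplex_def
proof (intro conjI ballI compact_K convex_K)
  fix x assume "x \<in> K"
  then obtain m where x: "x = emb (wt m)" and m: "m \<in> IM" by (auto simp: K_def)
  show "\<exists>!\<mu>. sets \<mu> = sets borel \<and> prob_space \<mu> \<and> emeasure \<mu> (extreme_points K) = 1 \<and>
      (\<forall>f::_ \<Rightarrow> real. bounded_linear f \<longrightarrow> (\<integral>y. f y \<partial>\<mu>) = f x)"
    using exists_representation[OF m] unique_representation[OF m]
    unfolding x represents_def[symmetric] by blast
qed

end

subsection \<open>Periodic orbits\<close>

lemma shift_pow: "(shift_map ^^ i) x j = x (i + j)"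
  by (induction i arbitrary: j) (auto simp: shift_map_def)

lemma cesaro_zero:
  fixes a :: "nat \<Rightarrow> real"
  assumes a: "a \<longlonglongrightarrow> 0" and nn: "\<And>j. 0 \<le> a j"
  shows "(\<lambda>n. (\<Sum>j<n. a j) / real n) \<longlonglongrightarrow> 0"
proof (rule LIMSEQ_I)
  fix e :: real assume e: "0 < e"
  then obtain N where N: "\<And>j. j \<ge> N \<Longrightarrow> a j < e / 2"
    using order_tendstoD(2)[OF a, of "e / 2"] by (auto simp: eventually_sequentially)
  define C where "C = (\<Sum>j<N. a j)"
  have C: "0 \<le> C" unfolding C_def by (intro sum_nonneg nn)
  have le: "(\<Sum>j<n. a j) \<le> C + real n * (e / 2)" for n
  proof (induction n)
    case (Suc n)
    show ?case
    proof (cases "n < N")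
      case True
      then have "(\<Sum>j<Suc n. a j) \<le> C" unfolding C_def by (intro sum_mono2) (auto simp: nn)
      moreover have "0 \<le> real (Suc n) * (e / 2)" using e by simp
      ultimately show ?thesis by linarith
    next
      case False
      have "real (Suc n) * (e / 2) = real n * (e / 2) + e / 2" by (simp add: distrib_right)
      moreover have "a n < e / 2" using False N[of n] by simp
      moreover have "(\<Sum>j<Suc n. a j) = (\<Sum>j<n. a j) + a n" by simp
      ultimately show ?thesis using Suc by linarith
    qed
  qed (simp add: C)
  obtain n0 :: nat where n0: "2 * C / e < real n0" using reals_Archimedean2 by blast
  have "norm ((\<Sum>j<n. a j) / real n - 0) < e" if n: "n \<ge> Suc n0" for n
  proof -
    have "2 * C / e < real n" using n n0 by linarith
    then have "C < real n * (e / 2)" using e by (simp add: field_simps)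
    then have "(\<Sum>j<n. a j) < real n * e" using le[of n] by (simp add: field_simps)
    moreover have "0 \<le> (\<Sum>j<n. a j)" by (intro sum_nonneg nn)
    ultimately show ?thesis using n by (simp add: divide_less_eq mult.commute)
  qed
  then show "\<exists>no. \<forall>n\<ge>no. norm ((\<Sum>j<n. a j) / real n - 0) < e" by blast
qed

definition splice :: "(nat \<Rightarrow> nat) \<Rightarrow> nat \<Rightarrow> (nat \<Rightarrow> nat) \<Rightarrow> nat \<Rightarrow> nat" where
  "splice x n y i = (if i < n then x i else y (i - n))"

definition periodize :: "(nat \<Rightarrow> nat) \<Rightarrow> nat \<Rightarrow> nat \<Rightarrow> nat" where
  "periodize x n i = x (i mod n)"

text \<open>The symbol at the junction is shared, so each transition already occurs in
  \<open>x\<close> or in \<open>y\<close>.\<close>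

lemma splice_in: "x \<in> shift_space B \<Longrightarrow> y \<in> shift_space B \<Longrightarrow> x n = y 0 \<Longrightarrow> splice x n y \<in> shift_space B"
proof -
  assume x: "x \<in> shift_space B" and y: "y \<in> shift_space B" and xy: "x n = y 0"
  have "B (splice x n y i) (splice x n y (Suc i)) = 1" for i
  proof (cases "Suc i < n")
    case True
    then show ?thesis using x by (simp add: splice_def shift_space_def)
  next
    case False
    show ?thesis
    proof (cases "i < n")
      case True
      then have "Suc i = n" using False by simp
      moreover have "B (x i) (x (Suc i)) = 1" using x by (simp add: shift_space_def)
      ultimately show ?thesis using xy by (auto simp: splice_def)
    next
      case F: False
      then show ?thesis using y False by (simp add: splice_def shift_space_def Suc_diff_le)
    qed
  qed
  then show ?thesis by (simp add: shift_space_def)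
qed

lemma splice_eq: "x n = y 0 \<Longrightarrow> i \<le> n \<Longrightarrow> splice x n y i = x i"
  by (auto simp: splice_def)

lemma shift_splice: "(shift_map ^^ n) (splice x n y) = y"
  by (auto simp: shift_pow splice_def)

lemma splice_add: "splice x n y (n + m) = y m"
  by (simp add: splice_def)

lemma periodize_in:
  assumes "x \<in> shift_space B" "x n = x 0" "0 < n"
  shows "periodize x n \<in> shift_space B"
proof -
  have "B (periodize x n i) (periodize x n (Suc i)) = 1" for i
  proof -
    have "B (x (i mod n)) (x (Suc (i mod n))) = 1" using assms(1) by (simp add: shift_space_def)
    moreover have "periodize x n (Suc i) = x (Suc (i mod n))"
      using assms(2) by (auto simp: periodize_def mod_Suc)
    ultimately show ?thesis by (simp add: periodize_def)
  qed
  then show ?thesis by (simp add: shift_space_def)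
qed

lemma periodize_eq: "x n = x 0 \<Longrightarrow> i \<le> n \<Longrightarrow> periodize x n i = x i"
  by (cases "i = n") (auto simp: periodize_def)

lemma shift_periodize: "(shift_map ^^ n) (periodize x n) = periodize x n"
  by (auto simp: shift_pow periodize_def)

lemma period_mult:
  assumes "(shift_map ^^ n) x = x" shows "(shift_map ^^ (k * n)) x = x"
  by (induction k) (use assms in \<open>auto simp: funpow_add\<close>)

lemma birk_period_mult:
  assumes "(shift_map ^^ n) x = x" shows "birk shift_map f (k * n) x = real k * birk shift_map f n x"
proof (induction k)
  case (Suc k)
  have "birk shift_map f (Suc k * n) x = birk shift_map f (n + k * n) x" by simp
  also have "\<dots> = birk shift_map f n x + birk shift_map f (k * n) x" unfolding birk_add assms ..
  finally show ?case using Suc by (simp add: algebra_simps)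
qed simp

lemma nat_floor_ratio:
  assumes "0 \<le> c"
  shows "(\<lambda>j. real (nat \<lfloor>real j * c\<rfloor>) / real j) \<longlonglongrightarrow> c"
proof (rule tendsto_sandwich)
  show "\<forall>\<^sub>F j in sequentially. c - 1 / real j \<le> real (nat \<lfloor>real j * c\<rfloor>) / real j"
    using eventually_gt_at_top[of 0]
  proof eventually_elim
    case (elim j)
    have "real j * c - 1 \<le> real (nat \<lfloor>real j * c\<rfloor>)" using assms by linarith
    then have "(real j * c - 1) / real j \<le> real (nat \<lfloor>real j * c\<rfloor>) / real j" by (rule divide_right_mono) simp
    then show ?case using elim by (simp add: diff_divide_distrib)
  qed
  show "\<forall>\<^sub>F j in sequentially. real (nat \<lfloor>real j * c\<rfloor>) / real j \<le> c"
    using eventually_gt_at_top[of 0]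
  proof eventually_elim
    case (elim j)
    have "real (nat \<lfloor>real j * c\<rfloor>) \<le> real j * c" using assms by simp
    then show ?case using elim by (simp add: divide_le_eq mult.commute)
  qed
  have "(\<lambda>j. c - 1 / real j) \<longlonglongrightarrow> c - 0" by (intro tendsto_intros lim_1_over_n)
  then show "(\<lambda>j. c - 1 / real j) \<longlonglongrightarrow> c" by simp
qed simp

text \<open>Orbit points are counted with multiplicity, so the total mass is
  \<open>n\<close>.\<close>

definition orbm :: "nat \<Rightarrow> (nat \<Rightarrow> nat) \<Rightarrow> (nat \<Rightarrow> nat) measure" where
  "orbm n x = distr (count_space {..<n}) borel (\<lambda>i. (shift_map ^^ i) x)"

lemma sets_orbm [simp]: "sets (orbm n x) = sets borel" and space_orbm [simp]: "space (orbm n x) = UNIV"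
  by (simp_all add: orbm_def)

lemma nn_integral_orbm:
  assumes "f \<in> borel_measurable borel"
  shows "(\<integral>\<^sup>+y. f y \<partial>orbm n x) = (\<Sum>i<n. f ((shift_map ^^ i) x))"
  unfolding orbm_def using assms by (subst nn_integral_distr) (auto simp: nn_integral_count_space_finite)

lemma emeasure_orbm:
  assumes A: "A \<in> sets borel"
  shows "emeasure (orbm n x) A = ennreal (birk shift_map (indicator A) n x)"
proof -
  have "emeasure (orbm n x) A = (\<integral>\<^sup>+y. indicator A y \<partial>orbm n x)" using A by simp
  also have "\<dots> = (\<Sum>i<n. indicator A ((shift_map ^^ i) x))" using A by (intro nn_integral_orbm) simp
  also have "\<dots> = (\<Sum>i<n. ennreal (indicator A ((shift_map ^^ i) x)))"
    by (intro sum.cong) (auto simp: indicator_def)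
  also have "\<dots> = ennreal (birk shift_map (indicator A) n x)" by (simp add: birk_def sum_ennreal)
  finally show ?thesis .
qed

lemma finite_orbm: "finite_measure (orbm n x)"
  by (intro finite_measureI) (simp add: emeasure_orbm)

lemma AE_orbm: "(\<And>i. i < n \<Longrightarrow> P ((shift_map ^^ i) x)) \<Longrightarrow> Measurable.pred borel P \<Longrightarrow> AE y in orbm n x. P y"
  unfolding orbm_def by (subst AE_distr_iff) (auto simp: AE_count_space pred_def)

context roof_system
begin

lemma orbit_in: "x \<in> X \<Longrightarrow> (shift_map ^^ i) x \<in> X"
  by (induction i) auto

lemma birk_tau_ge: "real n \<le> birk shift_map tau n x"
proof -
  have "(\<Sum>i<n. 1) \<le> birk shift_map tau n x" unfolding birk_def by (intro sum_mono tau_ge1)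
  then show ?thesis by simp
qed

lemma nn_integral_tau_orbm: "(\<integral>\<^sup>+y. tau y \<partial>orbm n x) = ennreal (birk shift_map tau n x)"
  by (subst nn_integral_orbm) (auto simp: birk_def sum_ennreal tau_nonneg)

text \<open>Weights of the orbit measure after normalisation to roof mass one.\<close>

definition dq :: "nat \<Rightarrow> (nat \<Rightarrow> nat) \<Rightarrow> nat list \<Rightarrow> real" where
  "dq n y w = birk shift_map (indicator (cyl w)) n y / birk shift_map tau n y"

definition periodic :: "nat \<Rightarrow> (nat \<Rightarrow> nat) \<Rightarrow> bool" where
  "periodic n y \<longleftrightarrow> y \<in> X \<and> 0 < n \<and> (shift_map ^^ n) y = y"

lemma invm_orbm:
  assumes "periodic n y" shows "invm (orbm n y)"
proof (rule invmI)
  have y: "y \<in> X" "(shift_map ^^ n) y = y" using assms by (auto simp: periodic_def)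
  show "AE x in orbm n y. x \<in> X"
    by (rule AE_orbm) (use y orbit_in in auto)
  fix w
  have "birk shift_map (indicator (shift_map -` cyl w)) n y = birk shift_map (indicator (cyl w)) n (shift_map y)"
    by (simp add: birk_def indicator_def funpow_swap1)
  also have "\<dots> = birk shift_map (indicator (cyl w)) (Suc n) y - indicator (cyl w) y"
    by (simp add: birk_Suc)
  also have "\<dots> = birk shift_map (indicator (cyl w)) n y"
    unfolding birk_Suc' y(2) by simp
  finally show "emeasure (orbm n y) (shift_map -` cyl w) = emeasure (orbm n y) (cyl w)"
    by (simp add: emeasure_orbm measurable_sets_borel[OF shift_map_measurable])
qed (auto simp: finite_orbm)

text \<open>Limit frequencies are constant along an orbit, so the criterion for extremality applies
  to the orbit measure.\<close>

lemma periodic_extreme: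
  assumes p: "periodic n y"
  shows "emb (dq n y) extreme_point_of K" "dq n y \<in> cube" "0 < dq n y []"
proof -
  have n: "0 < n" using p by (simp add: periodic_def)
  define S where "S = birk shift_map tau n y"
  have S: "0 < S" "real n \<le> S" using birk_tau_ge[of n y] n by (auto simp: S_def)
  have one: "ennreal (1 / S) * (\<integral>\<^sup>+x. tau x \<partial>orbm n y) = 1"
    unfolding nn_integral_tau_orbm S_def[symmetric] using S by (simp add: ennreal_mult'[symmetric])
  let ?m = "scale_measure (1 / S) (orbm n y)"
  note sc = scale_IM[OF invm_orbm[OF p], of "1 / S"]
  have IM: "?m \<in> IM" using sc(1) one S by simp
  have wt: "wt ?m = dq n y"
  proof
    fix w
    have "wt (orbm n y) w = birk shift_map (indicator (cyl w)) n y"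
      unfolding wt_def by (intro measure_eq_emeasure_eq_ennreal) (auto simp: emeasure_orbm birk_def intro!: sum_nonneg)
    then show "wt ?m w = dq n y w" using sc(2)[of w] one S by (simp add: dq_def S_def)
  qed
  show "emb (dq n y) extreme_point_of K"
    unfolding wt[symmetric]
  proof (rule extreme_if_constant_averages[OF IM, where c = "qx y"])
    show "(\<integral>\<^sup>+x. tau x \<partial>?m) = 1" using sc(3) one S by simp
    have lm: "lmt C ((shift_map ^^ i) y) = lmt C y" for C i by (induction i) (auto simp: lmt_shift)
    have "AE x in orbm n y. \<forall>w. qx x w = qx y w"
      by (rule AE_orbm) (auto simp: lm)
    then obtain N where N: "{x \<in> space (orbm n y). \<not> (\<forall>w. qx x w = qx y w)} \<subseteq> N" "emeasure (orbm n y) N = 0" "N \<in> sets (orbm n y)"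
      by (rule AE_E)
    have "N \<in> null_sets ?m" using N(2,3) by (simp add: null_sets_def)
    then show "AE x in ?m. \<forall>w. qx x w = qx y w"
      by (rule AE_I') (use N(1) invmD(2)[OF IM_D(1)[OF IM]] in simp)
  qed
  show "dq n y \<in> cube" unfolding wt[symmetric] by (rule wt_in_cube[OF IM])
  have "birk shift_map (indicator (cyl [])) n y = real n" by (simp add: birk_def)
  then show "0 < dq n y []" using n S by (simp add: dq_def S_def)
qed

text \<open>Agreement up to and including index \<open>n\<close> leaves two common symbols even at
  the last step, the least number for which the variation of the roof is controlled. The errors
  \<open>L n\<close> are sublinear, and monotone so that the pieces of a concatenation can be
  compared with its full length.\<close>

definition tame :: "((nat \<Rightarrow> nat) \<Rightarrow> real) \<Rightarrow> (nat \<Rightarrow> real) \<Rightarrow> bool" where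
  "tame f L \<longleftrightarrow> (\<forall>n. 0 \<le> L n) \<and> mono L \<and> (\<lambda>n. L n / real n) \<longlonglongrightarrow> 0 \<and>
     (\<forall>n. \<forall>x\<in>X. \<forall>y\<in>X. (\<forall>i\<le>n. x i = y i) \<longrightarrow> \<bar>birk shift_map f n x - birk shift_map f n y\<bar> \<le> L n)"

text \<open>At step \<open>i\<close> the shifted points still share \<open>n - Suc i + 2\<close>
  symbols, so the errors are terms of a null sequence read backwards, and their averages
  vanish.\<close>

lemma tameI:
  assumes W: "W \<longlonglongrightarrow> 0"
    and f: "\<And>n x y. 2 \<le> n \<Longrightarrow> x \<in> X \<Longrightarrow> y \<in> X \<Longrightarrow> (\<And>i. i < n \<Longrightarrow> x i = y i) \<Longrightarrow> \<bar>f x - f y\<bar> \<le> W n"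
  shows "tame f (\<lambda>n. \<Sum>j<n. \<bar>W (j + 2)\<bar>)"
  unfolding tame_def
proof (intro conjI allI ballI impI)
  show "mono (\<lambda>n. \<Sum>j<n. \<bar>W (j + 2)\<bar>)" by (intro monoI sum_mono2) auto
  have "(\<lambda>j. \<bar>W (j + 2)\<bar>) \<longlonglongrightarrow> 0"
    using LIMSEQ_ignore_initial_segment[OF W, of 2] by (simp add: tendsto_rabs_zero)
  then show "(\<lambda>n. (\<Sum>j<n. \<bar>W (j + 2)\<bar>) / real n) \<longlonglongrightarrow> 0" by (rule cesaro_zero) simp
  fix n x y assume x: "x \<in> X" and y: "y \<in> X" and eq: "\<forall>i\<le>n. x i = y i"
  have "\<bar>birk shift_map f n x - birk shift_map f n y\<bar> \<le> (\<Sum>i<n. \<bar>f ((shift_map ^^ i) x) - f ((shift_map ^^ i) y)\<bar>)"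
    unfolding birk_def sum_subtractf[symmetric] by (rule sum_abs)
  also have "\<dots> \<le> (\<Sum>i<n. \<bar>W ((n - Suc i) + 2)\<bar>)"
  proof (rule sum_mono)
    fix i assume i: "i \<in> {..<n}"
    have "\<bar>f ((shift_map ^^ i) x) - f ((shift_map ^^ i) y)\<bar> \<le> W ((n - Suc i) + 2)"
      using i eq by (intro f orbit_in x y) (auto simp: shift_pow)
    then show "\<bar>f ((shift_map ^^ i) x) - f ((shift_map ^^ i) y)\<bar> \<le> \<bar>W ((n - Suc i) + 2)\<bar>" by linarith
  qed
  also have "\<dots> = (\<Sum>j<n. \<bar>W (j + 2)\<bar>)"
    using sum.nat_diff_reindex[of "\<lambda>j. \<bar>W (j + 2)\<bar>" n] by simp
  finally show "\<bar>birk shift_map f n x - birk shift_map f n y\<bar> \<le> (\<Sum>j<n. \<bar>W (j + 2)\<bar>)" .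
qed (auto intro: sum_nonneg)

lemma tame_tau: "\<exists>L. tame tau L"
  using tameI[OF V_tendsto, of tau] tau_var by blast

lemma tame_cyl: "\<exists>L. tame (indicator (cyl w)) L"
proof -
  let ?W = "\<lambda>n. if length w \<le> n then 0 else 1 :: real"
  have "?W \<longlonglongrightarrow> 0"
    by (intro tendsto_eventually) (auto simp: eventually_sequentially)
  moreover have "\<bar>indicator (cyl w) x - indicator (cyl w) y\<bar> \<le> ?W n" if "\<And>i. i < n \<Longrightarrow> x i = y i" for n x y
  proof (cases "length w \<le> n")
    case True
    then have "x \<in> cyl w \<longleftrightarrow> y \<in> cyl w" using that by (auto simp: cyl_def)
    then show ?thesis by (simp add: indicator_def)
  qed (auto simp: indicator_def)
  ultimately show ?thesis using tameI[of ?W "indicator (cyl w)"] by blast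
qed

lemma tameD:
  assumes "tame f L"
  shows "0 \<le> L n" "m \<le> n \<Longrightarrow> L m \<le> L n" "(\<lambda>n. L n / real n) \<longlonglongrightarrow> 0"
    "x \<in> X \<Longrightarrow> y \<in> X \<Longrightarrow> (\<And>i. i \<le> n \<Longrightarrow> x i = y i) \<Longrightarrow> \<bar>birk shift_map f n x - birk shift_map f n y\<bar> \<le> L n"
  using assms by (auto simp: tame_def mono_def)

lemma birk_splice:
  assumes "tame f L" "x \<in> X" "y \<in> X" "x n = y 0"
  shows "\<bar>birk shift_map f (n + m) (splice x n y) - (birk shift_map f n x + birk shift_map f m y)\<bar> \<le> L n"
proof -
  have "birk shift_map f (n + m) (splice x n y) = birk shift_map f n (splice x n y) + birk shift_map f m y"
    by (simp add: birk_add shift_splice)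
  moreover have "\<bar>birk shift_map f n (splice x n y) - birk shift_map f n x\<bar> \<le> L n"
    using assms by (intro tameD(4)[OF assms(1)] splice_in) (auto simp: splice_eq)
  ultimately show ?thesis by simp
qed

lemma birk_periodize:
  assumes "tame f L" "x \<in> X" "x n = x 0" "0 < n"
  shows "\<bar>birk shift_map f n (periodize x n) - birk shift_map f n x\<bar> \<le> L n"
  using assms by (intro tameD(4)[OF assms(1)] periodize_in) (auto simp: periodize_eq)

lemma dq_tendsto:
  assumes num: "(\<lambda>j. birk shift_map (indicator (cyl w)) (n j) (y j) / r j) \<longlonglongrightarrow> a"
    and den: "(\<lambda>j. birk shift_map tau (n j) (y j) / r j) \<longlonglongrightarrow> t" and t: "t \<noteq> 0"
    and r: "\<And>j::nat. 0 < j \<Longrightarrow> r j \<noteq> 0"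
  shows "(\<lambda>j. dq (n j) (y j) w) \<longlonglongrightarrow> a / t"
proof (rule Lim_transform_eventually)
  show "(\<lambda>j. (birk shift_map (indicator (cyl w)) (n j) (y j) / r j) / (birk shift_map tau (n j) (y j) / r j)) \<longlonglongrightarrow> a / t"
    by (intro tendsto_divide num den t)
  show "\<forall>\<^sub>F j in sequentially. (birk shift_map (indicator (cyl w)) (n j) (y j) / r j) / (birk shift_map tau (n j) (y j) / r j) = dq (n j) (y j) w"
    using eventually_gt_at_top[of 0] by eventually_elim (use r in \<open>simp add: dq_def\<close>)
qed

text \<open>The convex combination is approached by the orbits that follow the first one \<open>k\<close> times, a fixed
  connecting path, the second one \<open>l\<close> times and a fixed path back; the errors in the Birkhoff sums are
  of smaller order than the length.\<close>

lemma periodic_convex: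
  assumes x: "periodic n x" and y: "periodic m y" and u: "0 \<le> u" "u \<le> 1"
  shows "\<exists>N z. (\<forall>j. periodic (N j) (z j)) \<and> (\<forall>w. (\<lambda>j. dq (N j) (z j) w) \<longlonglongrightarrow> u * dq n x w + (1 - u) * dq m y w)"
proof -
  have xX: "x \<in> X" and n: "0 < n" and px: "(shift_map ^^ n) x = x" using x by (auto simp: periodic_def)
  have yX: "y \<in> X" and m: "0 < m" and py: "(shift_map ^^ m) y = y" using y by (auto simp: periodic_def)
  define T1 where "T1 = birk shift_map tau n x"
  define T2 where "T2 = birk shift_map tau m y"
  have T: "0 < T1" "0 < T2" using birk_tau_ge[of n x] birk_tau_ge[of m y] n m by (auto simp: T1_def T2_def)
  obtain c p where c: "c \<in> X" "c 0 = x 0" "1 \<le> p" "c p = y 0" using irreducible by blast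
  obtain d r where d: "d \<in> X" "d 0 = y 0" "1 \<le> r" "d r = x 0" using irreducible by blast
  \<comment> \<open>Repetitions are counted in roof time: after division by \<open>j\<close> the two
    parts contribute roof mass \<open>u\<close> and \<open>1 - u\<close> in the limit.\<close>
  define k where "k j = nat \<lfloor>real j * (u / T1)\<rfloor>" for j
  define l where "l j = nat \<lfloor>real j * ((1 - u) / T2)\<rfloor>" for j
  have kl: "(\<lambda>j. real (k j) / real j) \<longlonglongrightarrow> u / T1" "(\<lambda>j. real (l j) / real j) \<longlonglongrightarrow> (1 - u) / T2"
    unfolding k_def l_def by (rule nat_floor_ratio, use u T in simp)+
  have per_at: "x (k * n) = x 0" "y (k * m) = y 0" for k
    using fun_cong[OF period_mult[OF px, of k], of 0] fun_cong[OF period_mult[OF py, of k], of 0] by (auto simp: shift_pow)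
  define z1 where "z1 j = splice y (l j * m) d" for j
  define z2 where "z2 j = splice c p (z1 j)" for j
  define z3 where "z3 j = splice x (k j * n) (z2 j)" for j
  define N where "N j = k j * n + (p + (l j * m + r))" for j
  have z1: "z1 j \<in> X" "z1 j 0 = y 0" "z1 j (l j * m + r) = x 0" for j
    unfolding z1_def using yX d per_at by (auto intro!: splice_in simp: splice_eq splice_add)
  have z2: "z2 j \<in> X" "z2 j 0 = x 0" "z2 j (p + (l j * m + r)) = x 0" for j
    unfolding z2_def using z1[of j] c by (auto intro!: splice_in simp: splice_eq splice_add)
  have z3: "z3 j \<in> X" "z3 j 0 = x 0" "z3 j (N j) = x 0" for j
    unfolding z3_def N_def using z2[of j] xX per_at by (auto intro!: splice_in simp: splice_eq splice_add)
  have Npos: "0 < N j" for j using c(3) by (simp add: N_def)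
  define z where "z j = periodize (z3 j) (N j)" for j
  have per: "periodic (N j) (z j)" for j
    unfolding periodic_def z_def using z3[of j] Npos by (auto intro!: periodize_in simp: shift_periodize)
  have lim: "(\<lambda>j. birk shift_map f (N j) (z j) / real j) \<longlonglongrightarrow>
      u / T1 * birk shift_map f n x + (1 - u) / T2 * birk shift_map f m y" if f: "tame f L" for f L
  proof -
    let ?S = "birk shift_map f"
    define C where "C = ?S p c + ?S r d"
    define main where "main j = real (k j) * ?S n x + real (l j) * ?S m y + C" for j
    \<comment> \<open>One error comes from closing the path, three from the junctions.\<close>
    have err: "\<bar>?S (N j) (z j) - main j\<bar> \<le> 4 * L (N j)" for j
    proof -
      have 0: "\<bar>?S (N j) (z j) - ?S (N j) (z3 j)\<bar> \<le> L (N j)"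
        unfolding z_def using z3[of j] Npos by (intro birk_periodize[OF f]) auto
      have 1: "\<bar>?S (N j) (z3 j) - (?S (k j * n) x + ?S (p + (l j * m + r)) (z2 j))\<bar> \<le> L (k j * n)"
        unfolding N_def z3_def using xX z2[of j] per_at by (intro birk_splice[OF f]) auto
      have 2: "\<bar>?S (p + (l j * m + r)) (z2 j) - (?S p c + ?S (l j * m + r) (z1 j))\<bar> \<le> L p"
        unfolding z2_def using c z1[of j] by (intro birk_splice[OF f]) auto
      have 3: "\<bar>?S (l j * m + r) (z1 j) - (?S (l j * m) y + ?S r d)\<bar> \<le> L (l j * m)"
        unfolding z1_def using yX d per_at by (intro birk_splice[OF f]) auto
      have Ls: "L (k j * n) \<le> L (N j)" "L p \<le> L (N j)" "L (l j * m) \<le> L (N j)"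
        by (auto intro!: tameD(2)[OF f] simp: N_def)
      have "?S (k j * n) x = real (k j) * ?S n x" "?S (l j * m) y = real (l j) * ?S m y"
        by (simp_all add: birk_period_mult px py)
      then have "main j = ?S (k j * n) x + ?S p c + ?S (l j * m) y + ?S r d"
        by (simp add: main_def C_def)
      then show ?thesis using 0 1 2 3 Ls by linarith
    qed
    have "(\<lambda>j. real (k j) / real j * ?S n x + real (l j) / real j * ?S m y + C / real j) \<longlonglongrightarrow>
        u / T1 * ?S n x + (1 - u) / T2 * ?S m y + 0"
      by (intro tendsto_intros kl lim_const_over_n)
    then have mainlim: "(\<lambda>j. main j / real j) \<longlonglongrightarrow> u / T1 * ?S n x + (1 - u) / T2 * ?S m y"
      by (simp add: main_def add_divide_distrib)
    \<comment> \<open>The lengths grow at most linearly in \<open>j\<close>, so errors sublinear in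
      the length are negligible against \<open>j\<close>.\<close>
    obtain Q :: nat where Q: "real n * (u / T1) + real m * ((1 - u) / T2) + real p + real r \<le> real Q"
      using real_arch_simple by blast
    have NQ: "N j \<le> Q * j" if "0 < j" for j
    proof -
      have "real (N j) = real (k j) * real n + real p + real (l j) * real m + real r" by (simp add: N_def)
      also have "\<dots> \<le> (real j * (u / T1)) * real n + real j * real p + (real j * ((1 - u) / T2)) * real m + real j * real r"
      proof (intro add_mono mult_right_mono)
        show "real (k j) \<le> real j * (u / T1)" unfolding k_def using u T by (intro of_nat_floor) simp
        show "real (l j) \<le> real j * ((1 - u) / T2)" unfolding l_def using u T by (intro of_nat_floor) simp
        have "1 \<le> real j" using that by simp
        then show "real p \<le> real j * real p" "real r \<le> real j * real r"
          using mult_right_mono[of 1 "real j" "real p"] mult_right_mono[of 1 "real j" "real r"] by auto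
      qed auto
      also have "\<dots> = real j * (real n * (u / T1) + real m * ((1 - u) / T2) + real p + real r)" by (simp add: algebra_simps)
      also have "\<dots> \<le> real j * real Q" using Q by (intro mult_left_mono) auto
      finally have "real (N j) \<le> real (Q * j)" by (simp add: mult.commute)
      then show ?thesis by (simp only: of_nat_le_iff)
    qed
    have Q0: "0 < Q" using NQ[of 1] Npos[of 1] by simp
    have "(\<lambda>j. L (j * Q) / real (j * Q)) \<longlonglongrightarrow> 0"
      using LIMSEQ_subseq_LIMSEQ[OF tameD(3)[OF f], of "\<lambda>j. j * Q"] Q0 by (simp add: o_def strict_mono_def)
    then have "(\<lambda>j. 4 * real Q * (L (j * Q) / real (j * Q))) \<longlonglongrightarrow> 4 * real Q * 0" by (rule tendsto_mult_left)
    then have Lq: "(\<lambda>j. 4 * L (j * Q) / real j) \<longlonglongrightarrow> 0" using Q0 by simp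
    have "(\<lambda>j. ?S (N j) (z j) / real j - main j / real j) \<longlonglongrightarrow> 0"
    proof (rule Lim_null_comparison[OF _ Lq])
      show "\<forall>\<^sub>F j in sequentially. norm (?S (N j) (z j) / real j - main j / real j) \<le> 4 * L (j * Q) / real j"
        using eventually_gt_at_top[of 0]
      proof eventually_elim
        case (elim j)
        have "\<bar>?S (N j) (z j) - main j\<bar> \<le> 4 * L (j * Q)"
          using err[of j] tameD(2)[OF f NQ[OF elim]] by (simp add: mult.commute)
        then show ?case by (simp add: divide_right_mono flip: diff_divide_distrib)
      qed
    qed
    from tendsto_add[OF this mainlim] show ?thesis by simp
  qed
  have "(\<lambda>j. dq (N j) (z j) w) \<longlonglongrightarrow> u * dq n x w + (1 - u) * dq m y w" for w
  proof -
    obtain L where L: "tame tau L" using tame_tau by blast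
    obtain L' where L': "tame (indicator (cyl w)) L'" using tame_cyl by blast
    have "u / T1 * birk shift_map tau n x + (1 - u) / T2 * birk shift_map tau m y = 1"
      using T by (simp add: T1_def[symmetric] T2_def[symmetric])
    then have den: "(\<lambda>j. birk shift_map tau (N j) (z j) / real j) \<longlonglongrightarrow> 1" using lim[OF L] by simp
    have "(\<lambda>j. dq (N j) (z j) w) \<longlonglongrightarrow> (u / T1 * birk shift_map (indicator (cyl w)) n x + (1 - u) / T2 * birk shift_map (indicator (cyl w)) m y) / 1"
      by (rule dq_tendsto[OF lim[OF L'] den]) auto
    then show ?thesis by (simp add: dq_def T1_def T2_def)
  qed
  then show ?thesis using per by blast
qed

text \<open>In a path of minimal length no symbol repeats, since the loop between two occurrences
  could be cut out.\<close>

lemma short_path: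
  shows "\<exists>x\<in>X. \<exists>n. x 0 = a \<and> x n = b \<and> inj_on x {..n}"
proof -
  define P where "P n \<longleftrightarrow> (\<exists>x\<in>X. x 0 = a \<and> x n = b)" for n
  have "\<exists>n. P n" using irreducible[of a b] by (auto simp: P_def)
  then have PL: "P (LEAST n. P n)" by (rule LeastI_ex)
  define n where "n = (LEAST n. P n)"
  obtain x where x: "x \<in> X" "x 0 = a" "x n = b" using PL by (auto simp: P_def n_def)
  have no: "x i \<noteq> x j" if ij: "i < j" "j \<le> n" for i j
  proof
    assume eq: "x i = x j"
    let ?z = "splice x i ((shift_map ^^ j) x)"
    have "?z \<in> X" using x eq by (intro splice_in orbit_in) (auto simp: shift_pow)
    moreover have "?z 0 = a" using x eq by (auto simp: splice_def shift_pow)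
    moreover have "?z (i + (n - j)) = b" using x ij unfolding splice_add by (simp add: shift_pow)
    ultimately have "P (i + (n - j))" by (auto simp: P_def)
    then have "n \<le> i + (n - j)" unfolding n_def by (rule Least_le)
    then show False using ij by simp
  qed
  have "inj_on x {..n}"
  proof (rule inj_onI)
    fix i j assume "i \<in> {..n}" "j \<in> {..n}" "x i = x j"
    then show "i = j" using no[of i j] no[of j i] by (cases rule: linorder_cases[of i j]) auto
  qed
  then show ?thesis using x by blast
qed

text \<open>Short loops through symbols with large roof function: every symbol occurs at most twice, so that
  most of the time is spent over large symbols.\<close>

lemma periodic_small:
  assumes e: "0 < e"
  shows "\<exists>n y. periodic n y \<and> (\<forall>w. dq n y w \<le> e)"
proof -
  \<comment> \<open>Let \<open>N\<close> be the length and \<open>S\<close> the roof mass of the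
    loop. At most \<open>2 * J\<close> steps visit symbols below \<open>J\<close>, so
    \<open>S\<close> is at least \<open>M * (N - 2 * J)\<close>. One symbol of roof at least
    \<open>R = 2 * J * M\<close> makes up for the deficit and gives
    \<open>M * N \<le> 2 * S\<close>, that is \<open>N \<le> e * S\<close>.\<close>
  define M where "M = 2 / e"
  have M: "0 < M" using e by (simp add: M_def)
  obtain J where J: "\<And>x. x \<in> X \<Longrightarrow> J \<le> x 0 \<Longrightarrow> M \<le> tau x" using tau_infty[of M] by blast
  define R where "R = 2 * real J * M"
  obtain k0 where k0: "\<And>x. x \<in> X \<Longrightarrow> k0 \<le> x 0 \<Longrightarrow> R \<le> tau x" using tau_infty[of R] by blast
  \<comment> \<open>The successor makes \<open>k\<close> differ from \<open>0\<close>, so the way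
    back is nonempty.\<close>
  define k where "k = Suc k0"
  obtain x n where x: "x \<in> X" "x 0 = 0" "x n = k" "inj_on x {..n}" using short_path[of 0 k] by blast
  obtain y m where y: "y \<in> X" "y 0 = k" "y m = 0" "inj_on y {..m}" using short_path[of k 0] by blast
  have m: "0 < m" using y by (cases m) (auto simp: k_def)
  define z where "z = splice x n y"
  define N where "N = n + m"
  have z: "z \<in> X" "z 0 = 0" "z N = 0" unfolding z_def N_def using x y by (auto intro!: splice_in simp: splice_eq splice_add)
  have N: "0 < N" using m by (simp add: N_def)
  let ?p = "periodize z N"
  have p: "periodic N ?p" unfolding periodic_def using z N by (auto intro!: periodize_in simp: shift_periodize)
  then have pX: "?p \<in> X" by (simp add: periodic_def)
  define S where "S = birk shift_map tau N ?p"
  have p0: "(shift_map ^^ i) ?p 0 = z i" if "i < N" for i using that z by (simp add: shift_pow periodize_eq)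
  have SR: "R \<le> S"
  proof -
    have nN: "n < N" using m by (simp add: N_def)
    have "z n = k" using x y by (simp add: z_def splice_def)
    then have "R \<le> tau ((shift_map ^^ n) ?p)"
      using p0[OF nN] by (intro k0 orbit_in pX) (simp add: k_def)
    also have "\<dots> \<le> (\<Sum>i<N. tau ((shift_map ^^ i) ?p))"
      using nN by (intro member_le_sum) (auto simp: tau_nonneg)
    finally show ?thesis by (simp add: S_def birk_def)
  qed
  have cardx: "card {i\<in>{..<n}. v i < J} \<le> J" if "inj_on v {..n}" for v :: "nat \<Rightarrow> nat" and n
  proof -
    have "card {i\<in>{..<n}. v i < J} \<le> card {..<J}"
      by (rule card_inj_on_le[where f = v]) (auto intro: inj_on_subset[OF that])
    then show ?thesis by simp
  qed
  have low: "card {i\<in>{..<N}. z i < J} \<le> 2 * J"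
  proof -
    have "{i\<in>{..<N}. z i < J} \<subseteq> {i\<in>{..<n}. x i < J} \<union> (\<lambda>i. n + i) ` {i\<in>{..<m}. y i < J}"
    proof
      fix i assume i: "i \<in> {i\<in>{..<N}. z i < J}"
      show "i \<in> {i\<in>{..<n}. x i < J} \<union> (\<lambda>i. n + i) ` {i\<in>{..<m}. y i < J}"
      proof (cases "i < n")
        case False
        then have "i = n + (i - n)" "i - n < m" "y (i - n) < J" using i by (auto simp: z_def N_def splice_def)
        then show ?thesis by blast
      qed (use i in \<open>auto simp: z_def splice_def\<close>)
    qed
    then have "card {i\<in>{..<N}. z i < J} \<le> card ({i\<in>{..<n}. x i < J} \<union> (\<lambda>i. n + i) ` {i\<in>{..<m}. y i < J})"
      by (intro card_mono) auto
    also have "\<dots> \<le> card {i\<in>{..<n}. x i < J} + card ((\<lambda>i. n + i) ` {i\<in>{..<m}. y i < J})" by (rule card_Un_le)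
    also have "\<dots> \<le> J + J" using cardx[OF x(4)] cardx[OF y(4)] card_image_le[of "{i\<in>{..<m}. y i < J}" "\<lambda>i. n + i"]
      by (intro add_mono) auto
    finally show ?thesis by simp
  qed
  have "M * (real N - 2 * real J) \<le> S"
  proof -
    have "card {..<N} = card ({i\<in>{..<N}. z i < J} \<union> {i\<in>{..<N}. J \<le> z i})" by (intro arg_cong[where f = card]) auto
    also have "\<dots> = card {i\<in>{..<N}. z i < J} + card {i\<in>{..<N}. J \<le> z i}" by (intro card_Un_disjoint) auto
    finally have "real N - 2 * real J \<le> real (card {i\<in>{..<N}. J \<le> z i})" using low by simp
    then have "M * (real N - 2 * real J) \<le> M * real (card {i\<in>{..<N}. J \<le> z i})" using M by (intro mult_left_mono) auto
    also have "\<dots> = (\<Sum>i\<in>{i\<in>{..<N}. J \<le> z i}. M)" by simp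
    also have "\<dots> \<le> (\<Sum>i\<in>{i\<in>{..<N}. J \<le> z i}. tau ((shift_map ^^ i) ?p))"
      by (intro sum_mono J orbit_in pX) (auto simp: p0)
    also have "\<dots> \<le> (\<Sum>i<N. tau ((shift_map ^^ i) ?p))" by (intro sum_mono2) (auto simp: tau_nonneg)
    finally show ?thesis by (simp add: S_def birk_def)
  qed
  then have "M * real N \<le> 2 * S" using SR by (simp add: R_def algebra_simps)
  then have NS: "real N \<le> e * S" using e by (simp add: M_def field_simps)
  have S: "0 < S" using birk_tau_ge[of N ?p] N by (simp add: S_def)
  have "dq N ?p w \<le> e" for w
  proof -
    have "birk shift_map (indicator (cyl w)) N ?p \<le> (\<Sum>i<N. 1)"
      unfolding birk_def by (intro sum_mono) (auto simp: indicator_def)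
    then have "birk shift_map (indicator (cyl w)) N ?p \<le> e * S" using NS by simp
    then show ?thesis using S by (simp add: dq_def S_def divide_le_eq)
  qed
  then show ?thesis using p by blast
qed

subsection \<open>Density of the extreme points\<close>

definition PD :: "(nat list \<Rightarrow> real) set" where
  "PD = {dq n y | n y. periodic n y}"

lemma PD_cube: "PD \<subseteq> cube"
  using periodic_extreme(2) by (auto simp: PD_def)

lemma PD_extreme: "emb ` PD \<subseteq> extreme_points K"
  using periodic_extreme(1) by (auto simp: PD_def extreme_points_def)

lemma emb_limit_PD:
  assumes "\<And>j. d j \<in> PD" "\<And>w. (\<lambda>j. d j w) \<longlonglongrightarrow> q w"
  shows "emb q \<in> closure (emb ` PD)"
  unfolding closure_sequential using assms by (intro exI[of _ "\<lambda>j. emb (d j)"]) (auto intro: emb_tendsto)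

lemma convex_closure_PD: "convex (closure (emb ` PD))"
  unfolding convex_alt
proof (intro ballI allI impI, elim conjE)
  fix a b and u :: real assume a: "a \<in> closure (emb ` PD)" and b: "b \<in> closure (emb ` PD)" and u: "0 \<le> u" "u \<le> 1"
  obtain x y where x: "\<And>n. x n \<in> emb ` PD" "x \<longlonglongrightarrow> a" and y: "\<And>n. y n \<in> emb ` PD" "y \<longlonglongrightarrow> b"
    using a b unfolding closure_sequential by blast
  have "(1 - u) *\<^sub>R x n + u *\<^sub>R y n \<in> closure (emb ` PD)" for n
  proof -
    obtain n1 z1 where 1: "x n = emb (dq n1 z1)" "periodic n1 z1" using x(1)[of n] by (auto simp: PD_def)
    obtain n2 z2 where 2: "y n = emb (dq n2 z2)" "periodic n2 z2" using y(1)[of n] by (auto simp: PD_def)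
    obtain N z where Nz: "\<And>j. periodic (N j) (z j)"
        "\<And>w. (\<lambda>j. dq (N j) (z j) w) \<longlonglongrightarrow> (1 - u) * dq n1 z1 w + (1 - (1 - u)) * dq n2 z2 w"
      using periodic_convex[OF 1(2) 2(2), of "1 - u"] u by auto
    let ?q = "\<lambda>w. (1 - u) * dq n1 z1 w + (1 - (1 - u)) * dq n2 z2 w"
    have "emb ?q \<in> closure (emb ` PD)"
      by (rule emb_limit_PD[where d = "\<lambda>j. dq (N j) (z j)"]) (use Nz in \<open>auto simp: PD_def\<close>)
    moreover have "emb ?q = (1 - u) *\<^sub>R emb (dq n1 z1) + (1 - (1 - u)) *\<^sub>R emb (dq n2 z2)"
      by (rule emb_affine(2)[OF periodic_extreme(2)[OF 1(2)] periodic_extreme(2)[OF 2(2)]]) (use u in auto)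
    ultimately show ?thesis using 1 2 by simp
  qed
  moreover have "(\<lambda>n. (1 - u) *\<^sub>R x n + u *\<^sub>R y n) \<longlonglongrightarrow> (1 - u) *\<^sub>R a + u *\<^sub>R b"
    by (intro tendsto_intros x y)
  ultimately show "(1 - u) *\<^sub>R a + u *\<^sub>R b \<in> closure (emb ` PD)"
    by (rule closed_sequentially[OF closed_closure])
qed

lemma zero_in_closure_PD: "0 \<in> closure (emb ` PD)"
proof -
  have "\<exists>d\<in>PD. \<forall>w. d w \<le> 1 / real (Suc j)" for j
    using periodic_small[of "1 / real (Suc j)"] by (auto simp: PD_def)
  then obtain d where d: "\<And>j. d j \<in> PD" "\<And>j w. d j w \<le> 1 / real (Suc j)" by metis
  have "(\<lambda>j. d j w) \<longlonglongrightarrow> 0" for w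
  proof (rule tendsto_sandwich)
    show "\<forall>\<^sub>F j in sequentially. 0 \<le> d j w" using d(1) PD_cube unfolding cube_def by (intro always_eventually) blast
    show "(\<lambda>j. 1 / real (Suc j)) \<longlonglongrightarrow> 0" by (rule LIMSEQ_Suc[OF lim_1_over_n])
    show "\<forall>\<^sub>F j in sequentially. d j w \<le> 1 / real (Suc j)" using d(2) by (intro always_eventually) blast
  qed (rule tendsto_const)
  from emb_limit_PD[of d, OF d(1) this] show ?thesis by (simp add: emb_zero)
qed

text \<open>Poincare recurrence for frequencies: on the invariant set where the cylinder of
  \<open>a\<close> has frequency at most zero, the mass of the cylinder equals the integral of that
  frequency, hence vanishes.\<close>

lemma AE_recurrent:
  assumes m: "m \<in> IM"
  shows "AE x in m. 0 < qx x [x 0]"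
proof -
  note im = IM_D(1)[OF m]
  have "AE x in m. x \<in> cyl [a] \<longrightarrow> 0 < qx x [a]" for a
  proof -
    define A where "A = {x. qx x [a] \<le> 0}"
    have "{x \<in> space borel. qx x [a] \<le> 0} \<in> sets borel" by measurable
    then have A: "A \<in> sets borel" by (simp add: A_def)
    have inv: "shift_map x \<in> A \<longleftrightarrow> x \<in> A" for x by (simp add: A_def lmt_shift)
    note r = restrict_IM[OF m A inv]
    have "emeasure m (A \<inter> cyl [a]) = (\<integral>\<^sup>+x. ennreal (qx x [a]) \<partial>density m (indicator A))"
      using nn_integral_lmt[OF r(1), of "cyl [a]"] r(2)[of "cyl [a]"] by simp
    also have "\<dots> = (\<integral>\<^sup>+x. ennreal (qx x [a]) * indicator A x \<partial>m)"
      by (rule r(3)) measurable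
    also have "\<dots> = (\<integral>\<^sup>+x. 0 \<partial>m)"
      by (intro nn_integral_cong) (auto simp: A_def indicator_def ennreal_neg)
    finally have "emeasure m (A \<inter> cyl [a]) = 0" by simp
    then have "A \<inter> cyl [a] \<in> null_sets m" using A IM_sets[OF m] by (auto simp: null_sets_def)
    then show ?thesis by (rule AE_I') (auto simp: A_def)
  qed
  then have "AE x in m. \<forall>a. x \<in> cyl [a] \<longrightarrow> 0 < qx x [a]" by (simp add: AE_all_countable)
  then show ?thesis by eventually_elim (simp add: cyl_def)
qed

text \<open>The roof is unbounded, so its averages are reached through cylinders. Semicontinuity
  along the empirical distributions \<open>E n\<close> bounds their liminf below by
  \<open>tx\<close>, and \<open>tx\<close> and \<open>tau\<close> have the same integral, which
  forces convergence.\<close>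

lemma AE_tau_average:
  assumes m: "m \<in> IM"
  shows "AE x in m. (\<lambda>n. birk shift_map tau n x / real n) \<longlonglongrightarrow> enn2real (tx x)"
proof -
  note im = IM_D(1)[OF m]
  interpret mpt m shift_map using invmD(6)[OF im] .
  have r: "ravg tau n x = birk shift_map tau n x / real n" for n x by (simp add: ravg_def)
  have fin: "AE x in m. tx x = ennreal (enn2real (tx x))"
    using AE_pt_extreme[OF m] by eventually_elim (simp add: less_top)
  have tm: "tau \<in> borel_measurable m" by (rule measurable_invm[OF im tau_measurable])
  have "AE x in m. (\<lambda>n. ravg tau n x) \<longlonglongrightarrow> enn2real (tx x)"
  proof (rule AE_ravg_tendsto)
    show "integrable m tau"
      using IM_D(2)[OF m] tm tau_nonneg
      by (intro integrableI_nonneg) (auto simp: less_top[symmetric] top_unique)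
    show "(\<lambda>x. enn2real (tx x)) \<in> borel_measurable m" by (rule measurable_invm[OF im]) measurable
    show "AE x in m. 0 \<le> enn2real (tx x)" by simp
    have "(\<integral>\<^sup>+x. ennreal (enn2real (tx x)) \<partial>m) = (\<integral>\<^sup>+x. tx x \<partial>m)"
      by (rule nn_integral_cong_AE) (use fin in \<open>eventually_elim, simp\<close>)
    then show "(\<integral>\<^sup>+x. ennreal (enn2real (tx x)) \<partial>m) = (\<integral>\<^sup>+x. ennreal (tau x) \<partial>m)"
      using nn_integral_tx[OF im] by simp
    show "AE x in m. ereal (enn2real (tx x)) \<le> liminf (\<lambda>n. ereal (ravg tau n x))"
      using fin AE_good[OF im] invmD(4)[OF im]
    proof eventually_elim
      case (elim x)
      then have g: "good (qx x)" and conv: "\<And>w. convs (cyl w) x" by auto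
      note e = emp_good[OF g]
      define E where "E n = scale_measure (1 / real n) (orbm n x)" for n
      have "tx x \<le> liminf (\<lambda>n. \<integral>\<^sup>+y. tau y \<partial>E n)"
        unfolding tx_def
      proof (rule nn_integral_liminf_cyl)
        show "sets (E n) = sets borel" for n by (simp add: E_def)
        show "sets (emp x) = sets borel" "AE y in emp x. y \<in> X" using invmD[OF e(2)] by auto
        show "AE y in E n. y \<in> X" for n
        proof -
          have "AE y in orbm n x. y \<in> X" by (rule AE_orbm) (use elim(3) orbit_in in auto)
          then obtain N where N: "{y \<in> space (orbm n x). y \<notin> X} \<subseteq> N" "emeasure (orbm n x) N = 0" "N \<in> sets (orbm n x)"
            by (rule AE_E)
          have "N \<in> null_sets (E n)" using N(2,3) by (simp add: null_sets_def E_def)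
          then show ?thesis by (rule AE_I') (use N(1) in auto)
        qed
        show "\<exists>N. \<forall>y\<in>X. (\<forall>j<N. y j = z j) \<longrightarrow> a < ennreal (tau y)" if "z \<in> X" "a < ennreal (tau z)" for z a
          by (rule lsc_of_continuous[OF continuous_tau that])
        show "(\<lambda>n. emeasure (E n) (cyl w)) \<longlonglongrightarrow> emeasure (emp x) (cyl w)" for w
        proof -
          have "emeasure (E n) (cyl w) = ennreal (cavg (cyl w) n x)" for n
            by (simp add: E_def emeasure_orbm cavg_def ennreal_mult'[symmetric])
          moreover have "emeasure (emp x) (cyl w) = ennreal (qx x w)"
            using emeasure_cyl[OF invmD(3)[OF e(2)], of w] e(3) by simp
          ultimately show ?thesis using tendsto_ennrealI[OF convs_lmt[OF conv]] by simp
        qed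
      qed
      also have "(\<lambda>n. \<integral>\<^sup>+y. tau y \<partial>E n) = (\<lambda>n. ennreal (ravg tau n x))"
      proof
        fix n
        have "(\<integral>\<^sup>+y. tau y \<partial>E n) = ennreal (1 / real n) * (\<integral>\<^sup>+y. tau y \<partial>orbm n x)"
          unfolding E_def by (intro nn_integral_scale_measure) (simp add: orbm_def)
        then show "(\<integral>\<^sup>+y. tau y \<partial>E n) = ennreal (ravg tau n x)"
          by (simp add: nn_integral_tau_orbm r ennreal_mult'[symmetric])
      qed
      finally have le: "ennreal (enn2real (tx x)) \<le> liminf (\<lambda>n. ennreal (ravg tau n x))" using elim(1) by simp
      show ?case
        unfolding le_Liminf_iff
      proof (intro allI impI)
        fix y assume y: "y < ereal (enn2real (tx x))"
        have nn: "0 \<le> ravg tau n x" for n using birk_tau_ge[of n x] by (simp add: r)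
        show "\<forall>\<^sub>F n in sequentially. y < ereal (ravg tau n x)"
        proof (cases "y < 0")
          case True
          then show ?thesis using nn by (intro always_eventually allI) (metis ereal_less_eq(5) less_le_trans)
        next
          case False
          then obtain s where s: "y = ereal s" "0 \<le> s" using y by (cases y) auto
          then have "ennreal s < ennreal (enn2real (tx x))" using y by (simp add: ennreal_less_iff)
          then have "\<forall>\<^sub>F n in sequentially. ennreal s < ennreal (ravg tau n x)"
            using le unfolding le_Liminf_iff by blast
          then show ?thesis by eventually_elim (use s in \<open>simp add: ennreal_less_iff\<close>)
        qed
      qed
    qed
  qed (use tau_nonneg in auto)
  then show ?thesis by (simp add: r)
qed

text \<open>Typical points return to their first symbol infinitely often. Repeating the initial
  segment up to a return time gives periodic orbits whose averages differ from those of
  \<open>x\<close> by vanishing errors, so their weights tend to those of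
  \<open>pt x\<close>.\<close>

lemma AE_pt_closure:
  assumes m: "m \<in> IM"
  shows "AE x in m. pt x \<in> closure (emb ` PD)"
  using AE_recurrent[OF m] AE_tau_average[OF m] AE_good[OF IM_D(1)[OF m]] AE_pt_extreme[OF m] invmD(4)[OF IM_D(1)[OF m]]
proof eventually_elim
  case (elim x)
  then have conv: "\<And>w. convs (cyl w) x" by auto
  define t where "t = enn2real (tx x)"
  have "tx x = ennreal t" using elim(4) by (simp add: t_def less_top)
  then have "ennreal 1 \<le> ennreal t" using elim(4) by (metis ennreal_1)
  then have t: "1 \<le> t" by (subst (asm) ennreal_le_iff) (auto simp: t_def)
  \<comment> \<open>Finitely many returns would give the first symbol frequency zero.\<close>
  have "\<exists>\<^sub>F n in sequentially. x n = x 0"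
  proof (rule ccontr)
    assume "\<not> ?thesis"
    then obtain N where N: "\<And>n. n \<ge> N \<Longrightarrow> x n \<noteq> x 0" by (auto simp: not_frequently eventually_sequentially)
    have "cavg (cyl [x 0]) n x \<le> real N / real n" for n
    proof -
      have "birk shift_map (indicator (cyl [x 0])) n x \<le> (\<Sum>i<n. if i < N then 1 else 0)"
        unfolding birk_def using N by (intro sum_mono) (auto simp: indicator_def cyl_def shift_pow)
      also have "\<dots> = real (card ({..<n} \<inter> {i. i < N}))" by (simp add: sum.If_cases)
      also have "\<dots> \<le> real N" using card_mono[of "{..<N}" "{..<n} \<inter> {i. i < N}"] by auto
      finally show ?thesis by (simp add: cavg_def divide_right_mono)
    qed
    then have "qx x [x 0] \<le> 0"
      by (intro LIMSEQ_le[OF convs_lmt[OF conv] lim_const_over_n[of "real N"]]) auto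
    then show False using elim(1) by simp
  qed
  then have inf: "infinite {n. x n = x 0}" by (simp add: frequently_cofinite[symmetric] cofinite_eq_sequentially)
  \<comment> \<open>Time \<open>0\<close> is the first element of this set; the successor skips it,
    so that all return times are positive.\<close>
  define n where "n j = enumerate {n. x n = x 0} (Suc j)" for j
  have nx: "x (n j) = x 0" for j using enumerate_in_set[OF inf, of "Suc j"] by (simp add: n_def)
  have mono: "strict_mono n" unfolding n_def strict_mono_def using inf by (simp add: enumerate_mono)
  have npos: "0 < n j" for j using enumerate_mono[OF _ inf, of 0 "Suc j"] by (auto simp: n_def)
  have per: "periodic (n j) (periodize x (n j))" for j
    unfolding periodic_def using elim(5) nx npos by (auto intro!: periodize_in simp: shift_periodize)
  have lim: "(\<lambda>j. birk shift_map f (n j) (periodize x (n j)) / real (n j)) \<longlonglongrightarrow> a"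
    if f: "tame f L" and a: "(\<lambda>n. birk shift_map f n x / real n) \<longlonglongrightarrow> a" for f L a
  proof -
    have 1: "(\<lambda>j. birk shift_map f (n j) x / real (n j)) \<longlonglongrightarrow> a"
      using LIMSEQ_subseq_LIMSEQ[OF a mono] by (simp add: o_def)
    have 2: "(\<lambda>j. L (n j) / real (n j)) \<longlonglongrightarrow> 0"
      using LIMSEQ_subseq_LIMSEQ[OF tameD(3)[OF f] mono] by (simp add: o_def)
    have "(\<lambda>j. birk shift_map f (n j) (periodize x (n j)) / real (n j) - birk shift_map f (n j) x / real (n j)) \<longlonglongrightarrow> 0"
    proof (rule Lim_null_comparison[OF _ 2], rule always_eventually, rule allI)
      fix j
      have "\<bar>birk shift_map f (n j) (periodize x (n j)) - birk shift_map f (n j) x\<bar> \<le> L (n j)"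
        using elim(5) nx npos by (intro birk_periodize[OF f]) auto
      then show "norm (birk shift_map f (n j) (periodize x (n j)) / real (n j) - birk shift_map f (n j) x / real (n j)) \<le> L (n j) / real (n j)"
        by (simp add: divide_right_mono flip: diff_divide_distrib)
    qed
    from tendsto_add[OF this 1] show ?thesis by simp
  qed
  have "(\<lambda>j. dq (n j) (periodize x (n j)) w) \<longlonglongrightarrow> qx x w / t" for w
  proof -
    obtain L where L: "tame tau L" using tame_tau by blast
    obtain L' where L': "tame (indicator (cyl w)) L'" using tame_cyl by blast
    have a: "(\<lambda>n. birk shift_map (indicator (cyl w)) n x / real n) \<longlonglongrightarrow> qx x w"
      using convs_lmt[OF conv] by (simp add: cavg_def)
    show ?thesis
      by (rule dq_tendsto[OF lim[OF L' a] lim[OF L elim(2)[folded t_def]]]) (use t npos in auto)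
  qed
  then show ?case unfolding pt_def t_def[symmetric]
    by (intro emb_limit_PD[where d = "\<lambda>j. dq (n j) (periodize x (n j))"]) (use per in \<open>auto simp: PD_def\<close>)
qed

text \<open>The closure contains zero and almost every \<open>pt y\<close>, so by the representation
  formula it carries the measure representing \<open>x\<close>; a barycentre does not leave a
  compact convex set of full measure.\<close>

lemma K_subset_closure_PD: "K \<subseteq> closure (emb ` PD)"
proof
  fix x assume "x \<in> K"
  then obtain m where x: "x = emb (wt m)" and m: "m \<in> IM" by (auto simp: K_def)
  obtain \<mu> where \<mu>: "represents \<mu> x" using exists_representation[OF m] x by blast
  let ?C = "closure (emb ` PD)"
  have s: "sets \<mu> = sets borel" and p: "prob_space \<mu>"
    and lin: "\<And>f::(nat \<Rightarrow>\<^sub>C real) \<Rightarrow> real. bounded_linear f \<Longrightarrow> (\<integral>y. f y \<partial>\<mu>) = f x"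
    using \<mu> by (auto simp: represents_def)
  have "emeasure \<mu> (- ?C) = (\<integral>\<^sup>+y. indicator (- ?C) (pt y) * tx y \<partial>m)"
    using \<mu> x zero_in_closure_PD by (intro representation_formula[OF m]) auto
  also have "\<dots> = (\<integral>\<^sup>+y. 0 \<partial>m)"
    by (rule nn_integral_cong_AE) (use AE_pt_closure[OF m] in \<open>eventually_elim, simp\<close>)
  finally have "- ?C \<in> null_sets \<mu>" using s by (auto simp: null_sets_def)
  then have AE: "AE y in \<mu>. y \<in> ?C" by (rule AE_I') auto
  have "?C \<subseteq> K"
    using PD_extreme extreme_points_subset compact_K by (intro closure_minimal compact_imp_closed) auto
  then have "compact ?C" using compact_K by (metis closed_closure compact_Int_closed inf.absorb_iff2)
  then show "x \<in> ?C"
  proof (rule barycentre_convex[OF _ s p AE _ convex_closure_PD])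
    fix k
    have "bounded_linear (\<lambda>y::nat \<Rightarrow>\<^sub>C real. apply_bcontfun y k)"
    proof (rule bounded_linear_intro[where K = 1])
      show "norm (apply_bcontfun x k) \<le> norm x * 1" for x :: "nat \<Rightarrow>\<^sub>C real" using norm_bounded[of x k] by simp
    qed (auto simp: plus_bcontfun.rep_eq scaleR_bcontfun.rep_eq)
    then show "(\<integral>y. apply_bcontfun y k \<partial>\<mu>) = apply_bcontfun x k" by (rule lin)
  qed
qed

lemma poulsen_K: "poulsen_simplex K"
  unfolding poulsen_simplex_def
proof (intro conjI choquet_K)
  show "K \<subseteq> closure (extreme_points K)"
    using K_subset_closure_PD closure_mono[OF PD_extreme] by blast
  obtain n y where p: "periodic n y" using periodic_small[of 1] by auto
  note e = periodic_extreme[OF p]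
  have "emb (dq n y) \<noteq> 0"
  proof
    assume "emb (dq n y) = 0"
    moreover have "(\<lambda>_. 0) \<in> cube" by (simp add: cube_def)
    ultimately have "dq n y = (\<lambda>_. 0)" using emb_eq_iff[OF e(2)] emb_zero by metis
    then show False using e(3) by simp
  qed
  moreover have "emb (dq n y) \<in> K" using e(1) by (simp add: extreme_point_of_def)
  ultimately show "\<exists>x\<in>K. \<exists>y\<in>K. x \<noteq> y" using zero_in_K by blast
qed

end

subsection \<open>Coordinates on the suspension space\<close>

lemma cylinder_eq: "cylinder B a = shift_space B \<inter> cyl a"
  by (auto simp: cylinder_def cyl_def)

lemma shift_topology_eq: "shift_topology B = top_of_set (shift_space B)"
proof (rule topology_eq[THEN iffD2], intro allI iffI)
  fix U assume "openin (shift_topology B) U"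
  then have "generate_topology_on {cylinder B a | a. a \<noteq> []} U"
    unfolding shift_topology_def by (rule openin_topology_generated_by)
  then show "openin (top_of_set (shift_space B)) U"
  proof induction
    case (Basis s)
    then show ?case using open_cyl by (auto simp: cylinder_eq openin_open)
  qed auto
next
  fix U assume U: "openin (top_of_set (shift_space B)) U"
  then obtain T where T: "open T" "U = shift_space B \<inter> T" by (auto simp: openin_open)
  have "U = \<Union>{cylinder B a | a. a \<noteq> [] \<and> cylinder B a \<subseteq> U}"
  proof
    show "U \<subseteq> \<Union>{cylinder B a | a. a \<noteq> [] \<and> cylinder B a \<subseteq> U}"
    proof
      fix x assume x: "x \<in> U"
      then obtain n where n: "cyl (pre n x) \<subseteq> T" using open_contains_cyl[OF T(1)] T(2) by blast
      have "cyl (pre (Suc n) x) \<subseteq> cyl (pre n x)" by (auto simp: in_cyl_pre)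
      then have "cylinder B (pre (Suc n) x) \<subseteq> U" using n T(2) by (auto simp: cylinder_eq)
      moreover have "x \<in> cylinder B (pre (Suc n) x)" using x T(2) by (simp add: cylinder_eq in_cyl_pre)
      moreover have "pre (Suc n) x \<noteq> []" by (simp add: pre_def)
      ultimately show "x \<in> \<Union>{cylinder B a | a. a \<noteq> [] \<and> cylinder B a \<subseteq> U}" by blast
    qed
  qed blast
  moreover have "openin (shift_topology B) (\<Union>{cylinder B a | a. a \<noteq> [] \<and> cylinder B a \<subseteq> U})"
    unfolding shift_topology_def by (intro openin_Union) (auto intro: topology_generated_by_Basis)
  ultimately show "openin (shift_topology B) U" by simp
qed

lemma space_borel_of [simp]: "space (borel_of X) = topspace X"
  by (simp add: borel_of_def space_measure_of_conv)

lemma openin_borel_of: "openin X U \<Longrightarrow> U \<in> sets (borel_of X)"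
  unfolding borel_of_def using openin_subset[of X] by (subst sets_measure_of) auto

lemma continuous_map_borel_of:
  assumes "continuous_map X euclidean f"
  shows "f \<in> borel_measurable (borel_of X)"
proof (rule borel_measurableI)
  fix S :: "'b set" assume "open S"
  then have "openin X {x \<in> topspace X. f x \<in> S}" using assms by (auto simp: continuous_map_def)
  moreover have "f -` S \<inter> space (borel_of X) = {x \<in> topspace X. f x \<in> S}" by auto
  ultimately show "f -` S \<inter> space (borel_of X) \<in> sets (borel_of X)" by (simp add: openin_borel_of)
qed

locale susp =
  fixes B :: "nat \<Rightarrow> nat \<Rightarrow> nat" and \<tau> :: "(nat \<Rightarrow> nat) \<Rightarrow> real" and c :: real
    and \<theta> :: "real \<Rightarrow> ((nat \<Rightarrow> nat) \<times> real) set \<Rightarrow> ((nat \<Rightarrow> nat) \<times> real) set"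
  assumes c_pos: "0 < c" and tau_2c: "x \<in> shift_space B \<Longrightarrow> 2 * c \<le> \<tau> x"
    and cont_tau: "continuous_on (shift_space B) \<tau>"
    and nonempty: "shift_space B \<noteq> {}"
    and semiflow: "suspension_semiflow B \<tau> \<theta>"
begin

abbreviation "Sg \<equiv> shift_space B"
abbreviation "D \<equiv> suspension_domain B \<tau>"
abbreviation "cl \<equiv> suspension_class B \<tau>"
abbreviation "YT \<equiv> suspension_topology B \<tau>"
abbreviation "YS \<equiv> suspension_space B \<tau>"
abbreviation "YM \<equiv> borel_of YT"
abbreviation "BP \<equiv> (borel :: (nat \<Rightarrow> nat) measure) \<Otimes>\<^sub>M (borel :: real measure)"

lemma tau_pos: "x \<in> Sg \<Longrightarrow> 0 < \<tau> x"
  using tau_2c[of x] c_pos by linarith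

lemma tau_gt_c: "x \<in> Sg \<Longrightarrow> c < \<tau> x"
  using tau_2c[of x] c_pos by linarith

lemma in_D: "(x, s) \<in> D \<longleftrightarrow> x \<in> Sg \<and> 0 \<le> s \<and> s \<le> \<tau> x"
  by (simp add: suspension_domain_def)

text \<open>Canonical representative with height below the roof. One gluing step suffices, as the
  roof is positive over the new base point.\<close>

definition nf :: "(nat \<Rightarrow> nat) \<times> real \<Rightarrow> (nat \<Rightarrow> nat) \<times> real" where
  "nf p = (if snd p = \<tau> (fst p) then (shift_map (fst p), 0) else p)"

lemma nf_cases: "p \<in> D \<Longrightarrow> fst (nf p) \<in> Sg \<and> 0 \<le> snd (nf p) \<and> snd (nf p) < \<tau> (fst (nf p))"
  by (cases p) (auto simp: nf_def in_D tau_pos)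

lemma cl_nf: "p \<in> D \<Longrightarrow> cl (nf p) = cl p"
  using suspension_class_glue[of B \<tau> "fst p"] tau_pos by (cases p) (auto simp: nf_def in_D)

text \<open>\<open>nf\<close> is unchanged by gluing and leads to an equivalent point, so each class
  has exactly one normal form.\<close>

lemma cl_eq_iff:
  assumes p: "p \<in> D" and q: "q \<in> D"
  shows "cl p = cl q \<longleftrightarrow> nf p = nf q"
proof
  assume "nf p = nf q" then show "cl p = cl q" using cl_nf p q by metis
next
  assume "cl p = cl q"
  then have "(p, q) \<in> (gluing B \<tau> \<union> (gluing B \<tau>)\<inverse>)\<^sup>*"
    using suspension_class_eq_iff[OF p q] by (simp add: suspension_rel_def)
  then show "nf p = nf q"
  proof (induction rule: rtrancl_induct)
    case (step a b)
    have glue: "nf (x, \<tau> x) = nf (shift_map x, 0)" if "x \<in> Sg" for x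
      using tau_pos[OF shift_in_shift_space[OF that]] by (simp add: nf_def)
    then have "nf a = nf b" using step(2) by (auto simp: gluing_def)
    then show ?case using step by simp
  qed simp
qed

definition rp :: "((nat \<Rightarrow> nat) \<times> real) set \<Rightarrow> (nat \<Rightarrow> nat) \<times> real" where
  "rp y = nf (SOME p. p \<in> D \<and> cl p = y)"

lemma rp_cl: "p \<in> D \<Longrightarrow> rp (cl p) = nf p"
proof -
  assume p: "p \<in> D"
  then have "(SOME q. q \<in> D \<and> cl q = cl p) \<in> D \<and> cl (SOME q. q \<in> D \<and> cl q = cl p) = cl p"
    by (intro someI_ex[of "\<lambda>q. q \<in> D \<and> cl q = cl p"]) blast
  then show ?thesis unfolding rp_def using cl_eq_iff p by blast
qed

abbreviation "Xc y \<equiv> fst (rp y)"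
abbreviation "Sc y \<equiv> snd (rp y)"

lemma YS_cases: assumes "y \<in> YS" obtains p where "p \<in> D" "y = cl p"
  using suspension_space_cases[OF assms] by metis

lemma rp_props: "y \<in> YS \<Longrightarrow> Xc y \<in> Sg \<and> 0 \<le> Sc y \<and> Sc y < \<tau> (Xc y)"
  by (erule YS_cases) (simp add: rp_cl nf_cases)

lemma rp_D: "y \<in> YS \<Longrightarrow> rp y \<in> D"
  using rp_props[of y] by (cases "rp y") (auto simp: in_D)

lemma cl_rp: "y \<in> YS \<Longrightarrow> cl (Xc y, Sc y) = y"
  by (erule YS_cases) (simp add: rp_cl cl_nf)

lemma cl_in: "p \<in> D \<Longrightarrow> cl p \<in> YS"
  by (rule suspension_class_in_space)

lemma rp_cl_less: "x \<in> Sg \<Longrightarrow> 0 \<le> s \<Longrightarrow> s < \<tau> x \<Longrightarrow> rp (cl (x, s)) = (x, s)"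
  by (subst rp_cl) (auto simp: in_D nf_def)

lemma openin_YT: "openin YT U \<longleftrightarrow> U \<subseteq> YS \<and> openin (top_of_set D) {p \<in> D. cl p \<in> U}"
proof -
  have "subtopology (prod_topology (shift_topology B) euclideanreal) D = top_of_set D"
  proof -
    have "prod_topology (shift_topology B) euclideanreal = top_of_set (Sg \<times> UNIV)"
      by (simp add: shift_topology_eq prod_topology_subtopology)
    moreover have "(Sg \<times> UNIV) \<inter> D = D" by (auto simp: suspension_domain_def)
    ultimately show ?thesis by (simp add: subtopology_subtopology)
  qed
  then have YT: "YT = quotient_topology (top_of_set D) (suspension_rel B \<tau>)"
    by (simp add: suspension_topology_def)
  show ?thesis
    unfolding YT openin_quotient_topology by (simp add: suspension_class_def)
qed

lemma continuous_map_YT: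
  fixes g :: "(nat \<Rightarrow> nat) \<times> real \<Rightarrow> real"
  assumes g: "continuous_on D g" and glue: "\<And>x. x \<in> Sg \<Longrightarrow> g (x, \<tau> x) = g (shift_map x, 0)"
  shows "continuous_map YT euclideanreal (\<lambda>y. g (rp y))"
  unfolding continuous_map_def
proof (intro conjI allI impI)
  fix U :: "real set" assume "openin euclideanreal U"
  then have U: "open U" by simp
  have gnf: "g (nf p) = g p" if "p \<in> D" for p
    using that glue by (cases p) (auto simp: nf_def in_D)
  have "{p \<in> D. cl p \<in> {y \<in> YS. g (rp y) \<in> U}} = D \<inter> g -` U"
    using gnf by (auto simp: rp_cl cl_in)
  then show "openin YT {y \<in> YS. g (rp y) \<in> U}"
    unfolding openin_YT using continuous_openin_preimage_gen[OF g U] by auto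
qed simp

lemma continuous_on_cl:
  assumes f: "continuous_map YT euclideanreal f"
  shows "continuous_on D (\<lambda>p. f (cl p))"
  unfolding continuous_openin_preimage_eq
proof (intro allI impI)
  fix U :: "real set" assume "open U"
  then have "openin YT {y \<in> YS. f y \<in> U}" using f by (auto simp: continuous_map_def)
  then have "openin (top_of_set D) {p \<in> D. cl p \<in> {y \<in> YS. f y \<in> U}}" by (simp add: openin_YT)
  moreover have "{p \<in> D. cl p \<in> {y \<in> YS. f y \<in> U}} = D \<inter> (\<lambda>p. f (cl p)) -` U" by (auto simp: cl_in)
  ultimately show "openin (top_of_set D) (D \<inter> (\<lambda>p. f (cl p)) -` U)" by simp
qed

lemma cont_fst: "continuous_on D (\<lambda>p. fst p)"
  by (rule continuous_on_fst[OF continuous_on_id])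

lemma cont_fst_shift: "continuous_on D (\<lambda>p. shift_map (fst p))"
  by (rule continuous_on_compose2[OF continuous_on_shift_map[of UNIV] cont_fst]) auto

lemma cont_tau_fst: "continuous_on D (\<lambda>p. \<tau> (fst p))"
  by (rule continuous_on_compose2[OF cont_tau cont_fst]) (auto simp: suspension_domain_def)

lemma cont_ind_cyl: "continuous_on A (indicator (cyl w) :: _ \<Rightarrow> real)"
proof -
  have "closed (cyl w)"
  proof -
    have "- cyl w = \<Union>(cyl ` {v. length v = length w \<and> v \<noteq> w})"
    proof safe
      fix x assume "x \<notin> cyl w"
      then show "x \<in> \<Union>(cyl ` {v. length v = length w \<and> v \<noteq> w})"
        by (intro UN_I[of "pre (length w) x"]) (auto simp: in_cyl_iff)
    next
      fix x v assume "x \<in> cyl v" "length v = length w" "v \<noteq> w" "x \<in> cyl w"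
      then show False using cyl_disjoint[of v w] by blast
    qed
    then show ?thesis using open_cyl by (auto simp: closed_def)
  qed
  have "continuous_on UNIV (indicator (cyl w) :: _ \<Rightarrow> real)"
    unfolding continuous_on_open_vimage[OF open_UNIV]
  proof (intro allI impI)
    fix U :: "real set" assume "open U"
    have "indicator (cyl w) -` U \<inter> UNIV = (if 1 \<in> U then cyl w else {}) \<union> (if 0 \<in> U then - cyl w else {})"
      by (auto simp: indicator_def of_bool_def split: if_splits)
    moreover have "open \<dots>" using open_cyl[of w] \<open>closed (cyl w)\<close> by (auto simp: closed_def)
    ultimately show "open (indicator (cyl w) -` U \<inter> UNIV)" by simp
  qed
  then show ?thesis by (rule continuous_on_subset) simp
qed

lemma cont_ind_fst: "continuous_on D (\<lambda>p. indicator (cyl w) (fst p) :: real)"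
  by (rule continuous_on_compose2[OF cont_ind_cyl[of UNIV] cont_fst]) auto

lemma cont_ind_shift: "continuous_on D (\<lambda>p. indicator (cyl w) (shift_map (fst p)) :: real)"
  by (rule continuous_on_compose2[OF cont_ind_cyl[of UNIV] cont_fst_shift]) auto

lemma tau_ne0: "p \<in> D \<Longrightarrow> \<tau> (fst p) \<noteq> 0"
  using tau_pos[of "fst p"] by (auto simp: suspension_domain_def)

text \<open>Both coordinates of the representative in \<open>{(x, s). 0 \<le> s < \<tau> x}\<close> are Borel, because they can be read
  off from continuous functions on the quotient.\<close>

lemma rp_measurable [measurable]: "rp \<in> YM \<rightarrow>\<^sub>M BP"
proof -
  \<comment> \<open>Distance to the nearer end of the fibre; it vanishes at both ends, so
    multiplying by it makes functions compatible with the gluing.\<close>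
  define b where "b p = min (snd p) (\<tau> (fst p) - snd p)" for p :: "(nat \<Rightarrow> nat) \<times> real"
  have b: "continuous_map YT euclideanreal (\<lambda>y. b (rp y))"
  proof (rule continuous_map_YT)
    show "continuous_on D b" unfolding b_def by (intro continuous_intros cont_tau_fst)
    show "b (x, \<tau> x) = b (shift_map x, 0)" if "x \<in> Sg" for x
      using that tau_pos[of x] tau_pos[OF shift_in_shift_space[OF that]] by (simp add: b_def)
  qed
  have k: "continuous_map YT euclideanreal (\<lambda>y. (\<lambda>p. snd p * b p) (rp y))"
  proof (rule continuous_map_YT)
    show "continuous_on D (\<lambda>p. snd p * b p)" unfolding b_def by (intro continuous_intros cont_tau_fst)
    show "snd (x, \<tau> x) * b (x, \<tau> x) = snd (shift_map x, 0::real) * b (shift_map x, 0)" if "x \<in> Sg" for x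
      using that tau_pos[of x] by (simp add: b_def)
  qed
  have g: "continuous_map YT euclideanreal (\<lambda>y. (\<lambda>p. indicator (cyl w) (fst p) * b p) (rp y))" for w
  proof (rule continuous_map_YT)
    show "continuous_on D (\<lambda>p. indicator (cyl w) (fst p) * b p)"
      unfolding b_def by (intro continuous_intros cont_tau_fst cont_ind_fst)
    show "indicator (cyl w) (fst (x, \<tau> x)) * b (x, \<tau> x) = indicator (cyl w) (fst (shift_map x, 0::real)) * b (shift_map x, 0)" if "x \<in> Sg" for x
      using that tau_pos[of x] tau_pos[OF shift_in_shift_space[OF that]] by (simp add: b_def)
  qed
  \<comment> \<open>Interpolates along the fibre between the indicators at \<open>x\<close> and at
    its shift; it tests the base point at height zero, where products with \<open>b\<close> give no
    information.\<close>
  define h where "h w p = indicator (cyl w) (fst p) * (1 - snd p / \<tau> (fst p)) + indicator (cyl w) (shift_map (fst p)) * (snd p / \<tau> (fst p))"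
    for w and p :: "(nat \<Rightarrow> nat) \<times> real"
  have h: "continuous_map YT euclideanreal (\<lambda>y. h w (rp y))" for w
  proof (rule continuous_map_YT)
    show "continuous_on D (h w)"
      unfolding h_def by (intro continuous_intros cont_tau_fst cont_ind_fst cont_ind_shift) (use tau_ne0 in blast)+
    show "h w (x, \<tau> x) = h w (shift_map x, 0)" if "x \<in> Sg" for x
      using that tau_pos[of x] by (simp add: h_def)
  qed
  note [measurable] = continuous_map_borel_of[OF b] continuous_map_borel_of[OF k]
    continuous_map_borel_of[OF g] continuous_map_borel_of[OF h]
  have b0: "b (rp y) = 0 \<longleftrightarrow> Sc y = 0" "0 \<le> b (rp y)" if "y \<in> YS" for y
    using rp_props[OF that] by (auto simp: b_def min_def)
  have "(\<lambda>y. Sc y) \<in> borel_measurable YM"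
  proof (rule measurable_cong[THEN iffD2])
    \<comment> \<open>The quotient is correct even at height zero, where it reads
      \<open>0 / 0 = 0\<close>.\<close>
    show "Sc y = (Sc y * b (rp y)) / b (rp y)" if "y \<in> space YM" for y
      using b0[of y] that by (cases "b (rp y) = 0") auto
    show "(\<lambda>y. (Sc y * b (rp y)) / b (rp y)) \<in> borel_measurable YM" by measurable
  qed
  moreover have "(\<lambda>y. Xc y) \<in> YM \<rightarrow>\<^sub>M borel"
  proof (rule measurable_into_seq)
    fix w
    have "(\<lambda>y. Xc y) -` cyl w \<inter> space YM =
        {y \<in> space YM. 0 < indicator (cyl w) (Xc y) * b (rp y) \<or> (b (rp y) = 0 \<and> h w (rp y) = 1)}"
    proof -
      have "Xc y \<in> cyl w \<longleftrightarrow> 0 < indicator (cyl w) (Xc y) * b (rp y) \<or> (b (rp y) = 0 \<and> h w (rp y) = 1)" if "y \<in> YS" for y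
      proof (cases "b (rp y) = 0")
        case True
        then have "h w (rp y) = indicator (cyl w) (Xc y)" using b0[OF that] by (simp add: h_def)
        then show ?thesis using True by (simp add: indicator_def)
      next
        case False
        then have "0 < b (rp y)" using b0[OF that] by linarith
        then show ?thesis using False by (simp add: indicator_def)
      qed
      then show ?thesis by auto
    qed
    also have "\<dots> \<in> sets YM" by measurable
    finally show "(\<lambda>y. Xc y) -` cyl w \<inter> space YM \<in> sets YM" .
  qed
  ultimately have "(\<lambda>y. (Xc y, Sc y)) \<in> YM \<rightarrow>\<^sub>M BP" by (rule measurable_Pair[rotated])
  then show ?thesis by simp
qed

text \<open>\<open>\<tau>\<close> is constrained only on the shift space; a constant outside makes
  it Borel on the whole space.\<close>

definition tb :: "(nat \<Rightarrow> nat) \<Rightarrow> real" where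
  "tb x = (if x \<in> Sg then \<tau> x else 1)"

lemma tb_measurable [measurable]: "tb \<in> borel_measurable borel"
  unfolding tb_def by (intro borel_measurable_continuous_on_if cont_tau) auto

lemma D_eq: "D = {p \<in> space BP. fst p \<in> Sg \<and> 0 \<le> snd p \<and> snd p \<le> tb (fst p)}"
  by (auto simp: suspension_domain_def tb_def space_pair_measure)

lemma D_sets [measurable]: "D \<in> sets BP"
proof -
  have [measurable]: "Measurable.pred BP (\<lambda>p. fst p \<in> Sg)" by measurable
  show ?thesis unfolding D_eq by measurable
qed

definition p0 :: "(nat \<Rightarrow> nat) \<times> real" where
  "p0 = (SOME p. p \<in> D)"

lemma p0: "p0 \<in> D"
proof -
  obtain x where "x \<in> Sg" using nonempty by blast
  then have "(x, 0) \<in> D" using tau_pos by (simp add: in_D less_imp_le)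
  then show ?thesis unfolding p0_def by (rule someI)
qed

text \<open>Total version of \<open>cl\<close> with a fixed class as default, measurable on the
  whole product.\<close>

definition clt :: "(nat \<Rightarrow> nat) \<times> real \<Rightarrow> ((nat \<Rightarrow> nat) \<times> real) set" where
  "clt p = (if p \<in> D then cl p else cl p0)"

lemma clt_in: "clt p \<in> YS"
  by (simp add: clt_def cl_in p0)

lemma clt_measurable [measurable]: "clt \<in> BP \<rightarrow>\<^sub>M YM"
  unfolding borel_of_def
proof (rule measurable_measure_of)
  show "{U. openin YT U} \<subseteq> Pow YS" using openin_subset by auto
  show "clt \<in> space BP \<rightarrow> YS" by (simp add: clt_in)
  fix U assume "U \<in> {U. openin YT U}"
  then have "openin (top_of_set D) {p \<in> D. cl p \<in> U}" by (simp add: openin_YT)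
  then obtain T where T: "open T" "{p \<in> D. cl p \<in> U} = D \<inter> T" by (auto simp: openin_open)
  have "T \<in> sets BP" using borel_open[OF T(1)] unfolding borel_prod .
  then have DT: "D \<inter> T \<in> sets BP" by simp
  have iff: "p \<in> D \<and> cl p \<in> U \<longleftrightarrow> p \<in> D \<and> p \<in> T" for p using T(2) by blast
  have "clt -` U \<inter> space BP = (D \<inter> T) \<union> (if cl p0 \<in> U then space BP - D else {})"
  proof (rule set_eqI)
    fix p show "p \<in> clt -` U \<inter> space BP \<longleftrightarrow> p \<in> (D \<inter> T) \<union> (if cl p0 \<in> U then space BP - D else {})"
      using iff[of p] by (cases "p \<in> D") (simp_all add: clt_def space_pair_measure)
  qed
  also have "\<dots> \<in> sets BP" using DT by auto
  finally show "clt -` U \<inter> space BP \<in> sets BP" .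
qed

lemma clt_rp: "y \<in> YS \<Longrightarrow> clt (rp y) = y"
  using cl_rp[of y] rp_D[of y] by (simp add: clt_def)

subsection \<open>The semi-flow in coordinates\<close>

lemma flow_in: "0 \<le> t \<Longrightarrow> y \<in> YS \<Longrightarrow> \<theta> t y \<in> YS"
  and flow_add: "0 \<le> s \<Longrightarrow> 0 \<le> t \<Longrightarrow> y \<in> YS \<Longrightarrow> \<theta> (s + t) y = \<theta> s (\<theta> t y)"
  and flow_cl: "(x, s) \<in> D \<Longrightarrow> 0 \<le> t \<Longrightarrow> s + t \<le> \<tau> x \<Longrightarrow> \<theta> t (cl (x, s)) = cl (x, s + t)"
  using semiflow unfolding suspension_semiflow_def by blast+

lemma flow_below:
  assumes "y \<in> YS" "0 \<le> t" "Sc y + t \<le> \<tau> (Xc y)"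
  shows "\<theta> t y = cl (Xc y, Sc y + t)"
  using flow_cl[of "Xc y" "Sc y" t] assms rp_D[OF assms(1)] cl_rp[OF assms(1)] by simp

lemma flow_roof:
  assumes y: "y \<in> YS" and t: "\<tau> (Xc y) \<le> Sc y + t"
  shows "\<theta> t y = \<theta> (Sc y + t - \<tau> (Xc y)) (cl (shift_map (Xc y), 0))"
proof -
  define a where "a = \<tau> (Xc y) - Sc y"
  have a: "0 \<le> a" "0 \<le> t - a" using rp_props[OF y] t by (auto simp: a_def)
  have "\<theta> t y = \<theta> (t - a) (\<theta> a y)" using flow_add[OF a(2,1) y] by simp
  also have "\<theta> a y = cl (Xc y, \<tau> (Xc y))" using flow_below[OF y a(1)] by (simp add: a_def)
  also have "\<dots> = cl (shift_map (Xc y), 0)"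
    using rp_props[OF y] tau_pos by (intro suspension_class_glue) auto
  finally show ?thesis by (simp add: a_def algebra_simps)
qed

lemma shift_zero_D: "x \<in> Sg \<Longrightarrow> (shift_map x, 0) \<in> D"
  using tau_pos[OF shift_in_shift_space] by (simp add: in_D less_imp_le)

text \<open>Within time \<open>c\<close> the roof is crossed at most once, as every roof is higher
  than \<open>c\<close>.\<close>

lemma flow_short:
  assumes y: "y \<in> YS" and t: "0 \<le> t" "t \<le> c"
  shows "\<theta> t y = (if Sc y + t < \<tau> (Xc y) then clt (Xc y, Sc y + t) else clt (shift_map (Xc y), Sc y + t - \<tau> (Xc y)))"
proof (cases "Sc y + t < \<tau> (Xc y)")
  case True
  then have "(Xc y, Sc y + t) \<in> D" using rp_props[OF y] t by (simp add: in_D)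
  then show ?thesis using flow_below[OF y t(1)] True by (simp add: clt_def)
next
  case False
  let ?r = "Sc y + t - \<tau> (Xc y)"
  have x: "Xc y \<in> Sg" using rp_props[OF y] by simp
  have r: "0 \<le> ?r" "?r \<le> c" "?r \<le> \<tau> (shift_map (Xc y))"
    using False rp_props[OF y] t tau_gt_c[OF shift_in_shift_space[OF x]] by auto
  have "\<theta> t y = \<theta> ?r (cl (shift_map (Xc y), 0))" using flow_roof[OF y] False by simp
  also have "\<dots> = cl (shift_map (Xc y), 0 + ?r)"
    using r by (intro flow_cl shift_zero_D x) auto
  finally show ?thesis using False r x by (simp add: clt_def in_D)
qed

text \<open>The height rises at unit speed and is only lowered by crossings; longer times are split
  into steps of length at most \<open>c\<close>.\<close>

lemma Sc_flow_le:
  assumes "y \<in> YS" "0 \<le> t"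
  shows "Sc (\<theta> t y) \<le> Sc y + t"
proof -
  have short: "Sc (\<theta> t y) \<le> Sc y + t" if y: "y \<in> YS" and t: "0 \<le> t" "t \<le> c" for y t
  proof (cases "Sc y + t < \<tau> (Xc y)")
    case True
    then show ?thesis
      using flow_below[OF y t(1)] rp_props[OF y] t by (simp add: rp_cl_less)
  next
    case False
    let ?r = "Sc y + t - \<tau> (Xc y)"
    have x: "Xc y \<in> Sg" "0 \<le> Sc y" "Sc y < \<tau> (Xc y)" using rp_props[OF y] by auto
    have r: "0 \<le> ?r" "?r < \<tau> (shift_map (Xc y))"
      using False x t tau_gt_c[OF shift_in_shift_space[OF x(1)]] by auto
    then have "\<theta> t y = cl (shift_map (Xc y), ?r)"
      using flow_short[OF y t] False x by (simp add: clt_def in_D)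
    then show ?thesis using rp_cl_less[OF shift_in_shift_space[OF x(1)] r] tau_pos[OF x(1)] by simp
  qed
  have "Sc (\<theta> t y) \<le> Sc y + t" if "t \<le> real n * c" "y \<in> YS" "0 \<le> t" for n t y
    using that
  proof (induction n arbitrary: t y)
    case (Suc n)
    show ?case
    proof (cases "t \<le> c")
      case False
      have t: "0 \<le> t - c" "t - c \<le> real n * c" "0 \<le> c" using False Suc.prems c_pos by (auto simp: algebra_simps)
      have z: "\<theta> c y \<in> YS" using flow_in Suc.prems c_pos by simp
      have "\<theta> t y = \<theta> (t - c) (\<theta> c y)" using flow_add[OF t(1,3) Suc.prems(2)] by simp
      then have "Sc (\<theta> t y) \<le> Sc (\<theta> c y) + (t - c)" using Suc.IH[OF t(2) z t(1)] by simp
      also have "Sc (\<theta> c y) \<le> Sc y + c" using short[OF Suc.prems(2) t(3)] by simp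
      finally show ?thesis by simp
    qed (use Suc.prems short in blast)
  next
    case 0
    then show ?case using short[of y t] c_pos by simp
  qed
  moreover obtain n where "t \<le> real n * c"
    using reals_Archimedean3[OF c_pos] less_imp_le by blast
  ultimately show ?thesis using assms by blast
qed

text \<open>After the first crossing the height is bounded by the time elapsed since then. This is
  how the Palm argument recognises orbits that have crossed the roof.\<close>

lemma Sc_flow_roof_less:
  assumes y: "y \<in> YS" and t: "0 \<le> t" "\<tau> (Xc y) \<le> Sc y + t"
  shows "Sc (\<theta> t y) < t"
proof -
  let ?r = "Sc y + t - \<tau> (Xc y)"
  have x: "Xc y \<in> Sg" "0 \<le> Sc y" "Sc y < \<tau> (Xc y)" using rp_props[OF y] by auto
  have "Sc (\<theta> ?r (cl (shift_map (Xc y), 0))) \<le> Sc (cl (shift_map (Xc y), 0)) + ?r"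
    using t shift_zero_D[OF x(1)] by (intro Sc_flow_le cl_in) auto
  also have "Sc (cl (shift_map (Xc y), 0)) = 0"
    using x tau_pos[OF shift_in_shift_space[OF x(1)]] by (simp add: rp_cl_less)
  finally show ?thesis using flow_roof[OF y t(2)] x by simp
qed

lemma flow_short_measurable:
  assumes "0 \<le> t" "t \<le> c"
  shows "\<theta> t \<in> YM \<rightarrow>\<^sub>M YM"
proof (rule measurable_cong[THEN iffD2])
  show "\<theta> t y = (if Sc y + t < tb (Xc y) then clt (Xc y, Sc y + t) else clt (shift_map (Xc y), Sc y + t - tb (Xc y)))"
    if "y \<in> space YM" for y
    using flow_short[of y t] that assms rp_props[of y] by (simp add: tb_def)
  show "(\<lambda>y. if Sc y + t < tb (Xc y) then clt (Xc y, Sc y + t) else clt (shift_map (Xc y), Sc y + t - tb (Xc y))) \<in> YM \<rightarrow>\<^sub>M YM"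
    by measurable
qed

lemma flow_measurable:
  assumes t: "0 \<le> t" shows "\<theta> t \<in> YM \<rightarrow>\<^sub>M YM"
proof -
  have "\<theta> t \<in> YM \<rightarrow>\<^sub>M YM" if "t \<le> real n * c" "0 \<le> t" for n t
    using that
  proof (induction n arbitrary: t)
    case (Suc n)
    show ?case
    proof (cases "t \<le> c")
      case False
      have t: "0 \<le> t - c" "t - c \<le> real n * c" "0 \<le> c" using False Suc.prems c_pos by (auto simp: algebra_simps)
      have "(\<lambda>y. \<theta> (t - c) (\<theta> c y)) \<in> YM \<rightarrow>\<^sub>M YM"
        using Suc.IH[OF t(2,1)] flow_short_measurable[OF t(3) order_refl] by (rule measurable_compose[rotated])
      then show ?thesis
        by (rule measurable_cong[THEN iffD1, rotated]) (use flow_add[OF t(1,3)] in simp)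
    qed (use Suc.prems flow_short_measurable in blast)
  qed (use flow_short_measurable c_pos in auto)
  moreover obtain n where "t \<le> real n * c"
    using reals_Archimedean3[OF c_pos] less_imp_le by blast
  ultimately show ?thesis using t by blast
qed

end

subsection \<open>The base measure of an invariant measure\<close>

context susp
begin

lemma clt_less: "x \<in> Sg \<Longrightarrow> 0 \<le> s \<Longrightarrow> s < \<tau> x \<Longrightarrow> clt (x, s) = cl (x, s)"
  by (simp add: clt_def in_D)

lemma rp_clt: "x \<in> Sg \<Longrightarrow> 0 \<le> s \<Longrightarrow> s < \<tau> x \<Longrightarrow> rp (clt (x, s)) = (x, s)"
  by (simp add: clt_less rp_cl_less)

lemma nn_integral_shift: "f \<in> borel_measurable borel \<Longrightarrow> (\<integral>\<^sup>+s. f (t + s) \<partial>lborel) = (\<integral>\<^sup>+s. f s \<partial>(lborel :: real measure))"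
  using nn_integral_real_affine[of f 1 t] by simp

definition vert :: "(((nat \<Rightarrow> nat) \<times> real) set \<Rightarrow> ennreal) \<Rightarrow> (nat \<Rightarrow> nat) \<Rightarrow> ennreal" where
  "vert f x = (\<integral>\<^sup>+s. indicator {0..<tb x} s * f (clt (x, s)) \<partial>lborel)"

definition psi :: "((nat \<Rightarrow> nat) \<times> real) set measure \<Rightarrow> (nat \<Rightarrow> nat) measure" where
  "psi \<nu> = distr (density \<nu> (indicator {y \<in> YS. Sc y < c})) borel (\<lambda>y. Xc y)"

definition inv_meas :: "((nat \<Rightarrow> nat) \<times> real) set measure set" where
  "inv_meas = invariant_measures B \<tau> \<theta>"

lemma inv_measD:
  assumes "\<nu> \<in> inv_meas"
  shows "sets \<nu> = sets YM" "space \<nu> = YS" "prob_space \<nu>"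
    "0 \<le> t \<Longrightarrow> f \<in> borel_measurable YM \<Longrightarrow> (\<integral>\<^sup>+y. f (\<theta> t y) \<partial>\<nu>) = (\<integral>\<^sup>+y. f y \<partial>\<nu>)"
proof -
  show s: "sets \<nu> = sets YM" and "prob_space \<nu>"
    using assms by (auto simp: inv_meas_def invariant_measures_def prob_measures_on_def)
  show sp: "space \<nu> = YS" using sets_eq_imp_space_eq[OF s] by simp
  assume t: "0 \<le> t" and f: "f \<in> borel_measurable YM"
  have th: "\<theta> t \<in> \<nu> \<rightarrow>\<^sub>M \<nu>"
    using flow_measurable[OF t] unfolding measurable_cong_sets[OF s s] .
  have "distr \<nu> \<nu> (\<theta> t) = \<nu>"
  proof (rule measure_eqI)
    fix A assume "A \<in> sets (distr \<nu> \<nu> (\<theta> t))"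
    then have A: "A \<in> sets \<nu>" by simp
    then show "emeasure (distr \<nu> \<nu> (\<theta> t)) A = emeasure \<nu> A"
      using assms t by (simp add: emeasure_distr[OF th] inv_meas_def invariant_measures_def)
  qed simp
  moreover have "f \<in> borel_measurable \<nu>" using f unfolding measurable_cong_sets[OF s refl] .
  ultimately show "(\<integral>\<^sup>+y. f (\<theta> t y) \<partial>\<nu>) = (\<integral>\<^sup>+y. f y \<partial>\<nu>)"
    using nn_integral_distr[OF th, of f] by simp
qed

lemma measurable_inv_meas:
  "sets \<nu> = sets YM \<Longrightarrow> f \<in> YM \<rightarrow>\<^sub>M N \<Longrightarrow> f \<in> \<nu> \<rightarrow>\<^sub>M N"
  using measurable_cong_sets by blast

lemma Sc_less_sets: "{y \<in> YS. Sc y < c} \<in> sets YM"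
proof -
  have "{y \<in> space YM. Sc y < c} \<in> sets YM" by measurable
  then show ?thesis by simp
qed

lemma
  assumes s: "sets \<nu> = sets YM"
  shows sets_psi: "sets (psi \<nu>) = sets borel"
    and nn_integral_psi: "g \<in> borel_measurable borel \<Longrightarrow>
       (\<integral>\<^sup>+x. g x \<partial>psi \<nu>) = (\<integral>\<^sup>+y. indicator {y \<in> YS. Sc y < c} y * g (Xc y) \<partial>\<nu>)"
proof -
  show "sets (psi \<nu>) = sets borel" by (simp add: psi_def)
  let ?S = "{y \<in> YS. Sc y < c}"
  have S: "?S \<in> sets \<nu>" using Sc_less_sets s by simp
  have X: "(\<lambda>y. Xc y) \<in> density \<nu> (indicator ?S) \<rightarrow>\<^sub>M borel"
    by (rule measurable_inv_meas) (use s in simp, measurable)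
  assume g: "g \<in> borel_measurable borel"
  have gX: "(\<lambda>y. g (Xc y)) \<in> borel_measurable \<nu>"
    by (rule measurable_inv_meas[OF s]) (use g in measurable)
  have "(\<integral>\<^sup>+x. g x \<partial>psi \<nu>) = (\<integral>\<^sup>+y. g (Xc y) \<partial>density \<nu> (indicator ?S))"
    unfolding psi_def using g by (intro nn_integral_distr X) simp
  also have "\<dots> = (\<integral>\<^sup>+y. indicator ?S y * g (Xc y) \<partial>\<nu>)"
    using S gX by (intro nn_integral_density) auto
  finally show "(\<integral>\<^sup>+x. g x \<partial>psi \<nu>) = (\<integral>\<^sup>+y. indicator ?S y * g (Xc y) \<partial>\<nu>)" .
qed

lemma vert_measurable:
  assumes [measurable]: "f \<in> borel_measurable YM"
  shows "vert f \<in> borel_measurable borel"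
proof -
  have "(\<lambda>p. indicator {p \<in> space BP. 0 \<le> snd p \<and> snd p < tb (fst p)} p * f (clt p)) \<in> borel_measurable BP"
    by measurable
  then have "(\<lambda>x. \<integral>\<^sup>+s. indicator {p \<in> space BP. 0 \<le> snd p \<and> snd p < tb (fst p)} (x, s) * f (clt (x, s)) \<partial>lborel) \<in> borel_measurable borel"
    by (intro lborel.borel_measurable_nn_integral_fst) (simp add: measurable_cong_sets[OF sets_pair_measure_cong[OF refl sets_lborel] refl])
  also have "(\<lambda>x. \<integral>\<^sup>+s. indicator {p \<in> space BP. 0 \<le> snd p \<and> snd p < tb (fst p)} (x, s) * f (clt (x, s)) \<partial>lborel) = vert f"
    unfolding vert_def by (intro ext nn_integral_cong) (auto simp: indicator_def space_pair_measure)
  finally show ?thesis .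
qed

text \<open>Palm inversion above height \<open>c\<close>: integrate the time \<open>r\<close> that has passed since the orbit crossed
  the strip \<open>{Sc < c}\<close>.\<close>

lemma palm_deep:
  assumes \<nu>: "\<nu> \<in> inv_meas" and f [measurable]: "f \<in> borel_measurable YM"
  shows "ennreal c * (\<integral>\<^sup>+y. indicator {y. c \<le> Sc y} y * f y \<partial>\<nu>) =
    (\<integral>\<^sup>+y. indicator {y \<in> YS. Sc y < c} y * (\<integral>\<^sup>+s. indicator {c..<tb (Xc y)} s * f (clt (Xc y, s)) \<partial>lborel) \<partial>\<nu>)"
proof -
  note s = inv_measD(1)[OF \<nu>] and sp = inv_measD(2)[OF \<nu>]
  note [measurable_cong] = s
  interpret prob_space \<nu> by (rule inv_measD(3)[OF \<nu>])
  interpret pair_sigma_finite \<nu> "lborel :: real measure" ..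
  \<comment> \<open>The same event seen from both ends: \<open>H\<close> starts at \<open>y\<close>
    in the strip and looks ahead by time \<open>r\<close>, while \<open>G\<close> looks back from
    the endpoint \<open>z\<close>. They match along the flow as long as the roof is not crossed, and
    both vanish if it is.\<close>
  define H where "H y r = (if Sc y < c \<and> c \<le> Sc y + r \<and> Sc y + r < tb (Xc y) then f (clt (Xc y, Sc y + r)) else 0)" for y r
  define G where "G r z = (if r \<le> Sc z \<and> Sc z < r + c \<and> c \<le> Sc z then f z else 0)" for r z
  have H_meas: "case_prod H \<in> borel_measurable (\<nu> \<Otimes>\<^sub>M lborel)"
    unfolding H_def by measurable
  have G_meas: "(\<lambda>(r, z). G r z) \<in> borel_measurable (lborel \<Otimes>\<^sub>M \<nu>)"
    unfolding G_def by measurable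
  have G_meas': "case_prod (\<lambda>z r. G r z) \<in> borel_measurable (\<nu> \<Otimes>\<^sub>M lborel)"
    unfolding G_def by measurable
  have Gr: "G r \<in> borel_measurable YM" for r unfolding G_def by measurable
  have flow: "H y r = G r (\<theta> r y)" if y: "y \<in> YS" and r: "0 \<le> r" for y r
  proof -
    have x: "Xc y \<in> Sg" "0 \<le> Sc y" "Sc y < \<tau> (Xc y)" using rp_props[OF y] by auto
    have tb: "tb (Xc y) = \<tau> (Xc y)" using x by (simp add: tb_def)
    show ?thesis
    proof (cases "Sc y + r < \<tau> (Xc y)")
      case True
      have "\<theta> r y = clt (Xc y, Sc y + r)" using flow_below[OF y r] True x r by (simp add: clt_less)
      moreover have "rp (clt (Xc y, Sc y + r)) = (Xc y, Sc y + r)" using True x r by (intro rp_clt) auto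
      ultimately show ?thesis using True x by (auto simp: H_def G_def tb)
    next
      case False
      then have "Sc (\<theta> r y) < r" using Sc_flow_roof_less[OF y r] by simp
      then show ?thesis using False by (simp add: H_def G_def tb)
    qed
  qed
  have eq: "(\<integral>\<^sup>+y. H y r \<partial>\<nu>) = (\<integral>\<^sup>+z. G r z \<partial>\<nu>)" for r
  proof (cases "0 \<le> r")
    case True
    have "(\<integral>\<^sup>+y. H y r \<partial>\<nu>) = (\<integral>\<^sup>+y. G r (\<theta> r y) \<partial>\<nu>)"
      by (intro nn_integral_cong) (use flow True sp in simp)
    then show ?thesis using inv_measD(4)[OF \<nu> True Gr] by simp
  next
    case False
    then show ?thesis by (intro nn_integral_cong) (auto simp: H_def G_def)
  qed
  have "(\<integral>\<^sup>+y. indicator {y \<in> YS. Sc y < c} y * (\<integral>\<^sup>+s. indicator {c..<tb (Xc y)} s * f (clt (Xc y, s)) \<partial>lborel) \<partial>\<nu>) =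
      (\<integral>\<^sup>+y. \<integral>\<^sup>+r. H y r \<partial>lborel \<partial>\<nu>)"
  proof (rule nn_integral_cong)
    fix y assume "y \<in> space \<nu>"
    then have y: "y \<in> YS" using sp by simp
    have m: "(\<lambda>s. indicator {c..<tb (Xc y)} s * f (clt (Xc y, s))) \<in> borel_measurable borel" by measurable
    have "(\<integral>\<^sup>+s. indicator {c..<tb (Xc y)} s * f (clt (Xc y, s)) \<partial>lborel) =
        (\<integral>\<^sup>+s. indicator {c..<tb (Xc y)} (Sc y + s) * f (clt (Xc y, Sc y + s)) \<partial>lborel)"
      by (rule nn_integral_shift[OF m, symmetric])
    moreover have "(\<integral>\<^sup>+r. H y r \<partial>lborel) = (\<integral>\<^sup>+s. indicator {y \<in> YS. Sc y < c} y * (indicator {c..<tb (Xc y)} (Sc y + s) * f (clt (Xc y, Sc y + s))) \<partial>lborel)"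
      by (intro nn_integral_cong) (auto simp: H_def indicator_def y)
    moreover have "\<dots> = indicator {y \<in> YS. Sc y < c} y * (\<integral>\<^sup>+s. indicator {c..<tb (Xc y)} (Sc y + s) * f (clt (Xc y, Sc y + s)) \<partial>lborel)"
      by (rule nn_integral_cmult) measurable
    ultimately show "indicator {y \<in> YS. Sc y < c} y * (\<integral>\<^sup>+s. indicator {c..<tb (Xc y)} s * f (clt (Xc y, s)) \<partial>lborel) = (\<integral>\<^sup>+r. H y r \<partial>lborel)"
      by simp
  qed
  also have "\<dots> = (\<integral>\<^sup>+r. \<integral>\<^sup>+y. H y r \<partial>\<nu> \<partial>lborel)"
    by (rule Fubini'[OF H_meas, symmetric])
  also have "\<dots> = (\<integral>\<^sup>+r. \<integral>\<^sup>+z. G r z \<partial>\<nu> \<partial>lborel)" unfolding eq ..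
  also have "\<dots> = (\<integral>\<^sup>+z. \<integral>\<^sup>+r. G r z \<partial>lborel \<partial>\<nu>)"
    by (rule Fubini'[OF G_meas'])
  also have "\<dots> = (\<integral>\<^sup>+z. ennreal c * (indicator {y. c \<le> Sc y} z * f z) \<partial>\<nu>)"
  proof (rule nn_integral_cong)
    \<comment> \<open>For a fixed endpoint above height \<open>c\<close> the admissible times form
      an interval of length \<open>c\<close>.\<close>
    fix z
    have "(\<integral>\<^sup>+r. G r z \<partial>lborel) = (\<integral>\<^sup>+r. (indicator {y. c \<le> Sc y} z * f z) * indicator {Sc z - c<..Sc z} r \<partial>lborel)"
      by (intro nn_integral_cong) (auto simp: G_def indicator_def)
    also have "\<dots> = (indicator {y. c \<le> Sc y} z * f z) * ennreal c"
      using c_pos by (subst nn_integral_cmult_indicator) auto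
    finally show "(\<integral>\<^sup>+r. G r z \<partial>lborel) = ennreal c * (indicator {y. c \<le> Sc y} z * f z)"
      by (simp add: mult.commute)
  qed
  also have "\<dots> = ennreal c * (\<integral>\<^sup>+z. indicator {y. c \<le> Sc y} z * f z \<partial>\<nu>)"
  proof (rule nn_integral_cmult)
    have "(\<lambda>z. if c \<le> Sc z then f z else 0) \<in> borel_measurable \<nu>" by measurable
    also have "(\<lambda>z. if c \<le> Sc z then f z else 0) = (\<lambda>z. indicator {y. c \<le> Sc y} z * f z)"
      by (auto simp: indicator_def)
    finally show "(\<lambda>z. indicator {y. c \<le> Sc y} z * f z) \<in> borel_measurable \<nu>" .
  qed
  finally show ?thesis by simp
qed

text \<open>Above height \<open>c\<close> this is the previous lemma; the slab below
  \<open>c\<close> is first moved up by time \<open>c\<close>, and \<open>fp\<close> is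
  \<open>f\<close> read in the new position.\<close>

lemma palm:
  assumes \<nu>: "\<nu> \<in> inv_meas" and f [measurable]: "f \<in> borel_measurable YM"
  shows "ennreal c * (\<integral>\<^sup>+y. f y \<partial>\<nu>) = (\<integral>\<^sup>+x. vert f x \<partial>psi \<nu>)"
proof -
  note s = inv_measD(1)[OF \<nu>] and sp = inv_measD(2)[OF \<nu>]
  note [measurable_cong] = s
  define fp where "fp z = (if c \<le> Sc z \<and> Sc z < 2 * c then f (clt (Xc z, Sc z - c)) else 0)" for z
  have fp [measurable]: "fp \<in> borel_measurable YM" unfolding fp_def by measurable
  have low: "(\<integral>\<^sup>+y. indicator {y. Sc y < c} y * f y \<partial>\<nu>) = (\<integral>\<^sup>+y. indicator {y. c \<le> Sc y} y * fp y \<partial>\<nu>)"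
  proof -
    have "indicator {y. Sc y < c} y * f y = fp (\<theta> c y)" if y: "y \<in> YS" for y
    proof -
      have x: "Xc y \<in> Sg" "0 \<le> Sc y" "Sc y < \<tau> (Xc y)" using rp_props[OF y] by auto
      show ?thesis
      proof (cases "Sc y + c < \<tau> (Xc y)")
        case True
        have "\<theta> c y = clt (Xc y, Sc y + c)" using flow_below[OF y, of c] True x c_pos by (simp add: clt_less)
        moreover have "rp (clt (Xc y, Sc y + c)) = (Xc y, Sc y + c)" using True x c_pos by (intro rp_clt) auto
        ultimately show ?thesis using x clt_rp[OF y] by (auto simp: fp_def indicator_def)
      next
        case False
        then have "Sc (\<theta> c y) < c" using Sc_flow_roof_less[OF y, of c] c_pos by simp
        moreover have "\<not> Sc y < c" using False tau_2c[OF x(1)] by linarith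
        ultimately show ?thesis by (simp add: fp_def)
      qed
    qed
    then have "(\<integral>\<^sup>+y. indicator {y. Sc y < c} y * f y \<partial>\<nu>) = (\<integral>\<^sup>+y. fp (\<theta> c y) \<partial>\<nu>)"
      by (intro nn_integral_cong) (simp add: sp)
    also have "\<dots> = (\<integral>\<^sup>+y. fp y \<partial>\<nu>)" using c_pos by (intro inv_measD(4)[OF \<nu>] fp) simp
    also have "\<dots> = (\<integral>\<^sup>+y. indicator {y. c \<le> Sc y} y * fp y \<partial>\<nu>)"
      by (intro nn_integral_cong) (auto simp: fp_def indicator_def)
    finally show ?thesis .
  qed
  have split: "(\<integral>\<^sup>+y. f y \<partial>\<nu>) = (\<integral>\<^sup>+y. indicator {y. Sc y < c} y * f y \<partial>\<nu>) + (\<integral>\<^sup>+y. indicator {y. c \<le> Sc y} y * f y \<partial>\<nu>)"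
  proof -
    have e: "(\<lambda>z. indicator {y. c \<le> Sc y} z * f z) = (\<lambda>z. if c \<le> Sc z then f z else 0)"
      "(\<lambda>z. indicator {y. Sc y < c} z * f z) = (\<lambda>z. if Sc z < c then f z else 0)"
      by (auto simp: indicator_def)
    have "(\<integral>\<^sup>+y. f y \<partial>\<nu>) = (\<integral>\<^sup>+y. (if Sc y < c then f y else 0) + (if c \<le> Sc y then f y else 0) \<partial>\<nu>)"
      by (intro nn_integral_cong) auto
    also have "\<dots> = (\<integral>\<^sup>+y. (if Sc y < c then f y else 0) \<partial>\<nu>) + (\<integral>\<^sup>+y. (if c \<le> Sc y then f y else 0) \<partial>\<nu>)"
      by (rule nn_integral_add) measurable
    finally show ?thesis unfolding e .
  qed
  let ?I = "\<lambda>y. indicator {y \<in> YS. Sc y < c} y :: ennreal"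
  let ?a = "\<lambda>y. \<integral>\<^sup>+s. indicator {c..<tb (Xc y)} s * fp (clt (Xc y, s)) \<partial>lborel"
  let ?b = "\<lambda>y. \<integral>\<^sup>+s. indicator {c..<tb (Xc y)} s * f (clt (Xc y, s)) \<partial>lborel"
  have "ennreal c * (\<integral>\<^sup>+y. f y \<partial>\<nu>) = (\<integral>\<^sup>+y. ?I y * ?a y \<partial>\<nu>) + (\<integral>\<^sup>+y. ?I y * ?b y \<partial>\<nu>)"
    unfolding split low distrib_left by (simp only: palm_deep[OF \<nu> fp] palm_deep[OF \<nu> f])
  also have "\<dots> = (\<integral>\<^sup>+y. ?I y * ?a y + ?I y * ?b y \<partial>\<nu>)"
  proof (rule nn_integral_add[symmetric])
    have m: "(\<lambda>y. ?I y * (\<integral>\<^sup>+s. indicator {c..<tb (Xc y)} s * g (clt (Xc y, s)) \<partial>lborel)) \<in> borel_measurable \<nu>"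
      if [measurable]: "g \<in> borel_measurable YM" for g
    proof -
      have "(\<lambda>(y, s). if c \<le> s \<and> s < tb (Xc y) then g (clt (Xc y, s)) else 0) \<in> borel_measurable (\<nu> \<Otimes>\<^sub>M lborel)"
        by measurable
      then have "(\<lambda>y. \<integral>\<^sup>+s. (if c \<le> s \<and> s < tb (Xc y) then g (clt (Xc y, s)) else 0) \<partial>lborel) \<in> borel_measurable \<nu>"
        using lborel.borel_measurable_nn_integral_fst by fastforce
      also have "(\<lambda>y. \<integral>\<^sup>+s. (if c \<le> s \<and> s < tb (Xc y) then g (clt (Xc y, s)) else 0) \<partial>lborel) =
          (\<lambda>y. \<integral>\<^sup>+s. indicator {c..<tb (Xc y)} s * g (clt (Xc y, s)) \<partial>lborel)"
        by (intro ext nn_integral_cong) (auto simp: indicator_def)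
      finally have q: "(\<lambda>y. \<integral>\<^sup>+s. indicator {c..<tb (Xc y)} s * g (clt (Xc y, s)) \<partial>lborel) \<in> borel_measurable \<nu>" .
      show ?thesis
        by (rule borel_measurable_times_ennreal[OF borel_measurable_indicator q]) (simp add: Sc_less_sets s)
    qed
    show "(\<lambda>y. ?I y * ?a y) \<in> borel_measurable \<nu>" by (rule m[OF fp])
    show "(\<lambda>y. ?I y * ?b y) \<in> borel_measurable \<nu>" by (rule m[OF f])
  qed
  also have "\<dots> = (\<integral>\<^sup>+y. ?I y * vert f (Xc y) \<partial>\<nu>)"
  proof (rule nn_integral_cong)
    fix y assume "y \<in> space \<nu>"
    then have y: "y \<in> YS" using sp by simp
    have x: "Xc y \<in> Sg" using rp_props[OF y] by auto
    have tb: "tb (Xc y) = \<tau> (Xc y)" "2 * c \<le> \<tau> (Xc y)" using x tau_2c by (auto simp: tb_def)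
    have m: "(\<lambda>s. indicator {0..<c} s * f (clt (Xc y, s))) \<in> borel_measurable borel"
      "(\<lambda>s. indicator {c..<tb (Xc y)} s * f (clt (Xc y, s))) \<in> borel_measurable borel" by measurable
    have "?a y = (\<integral>\<^sup>+s. indicator {0..<c} (- c + s) * f (clt (Xc y, - c + s)) \<partial>lborel)"
    proof (rule nn_integral_cong)
      fix s
      show "indicator {c..<tb (Xc y)} s * fp (clt (Xc y, s)) = indicator {0..<c} (- c + s) * f (clt (Xc y, - c + s))"
      proof (cases "c \<le> s \<and> s < tb (Xc y)")
        case True
        then have "rp (clt (Xc y, s)) = (Xc y, s)" using x c_pos tb by (intro rp_clt) auto
        then show ?thesis using True tb by (auto simp: fp_def indicator_def)
      next
        case False
        then show ?thesis using tb by (auto simp: indicator_def)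
      qed
    qed
    also have "\<dots> = (\<integral>\<^sup>+s. indicator {0..<c} s * f (clt (Xc y, s)) \<partial>lborel)"
      by (rule nn_integral_shift[OF m(1)])
    finally have "?a y + ?b y = (\<integral>\<^sup>+s. indicator {0..<c} s * f (clt (Xc y, s)) + indicator {c..<tb (Xc y)} s * f (clt (Xc y, s)) \<partial>lborel)"
      using m by (simp add: nn_integral_add)
    also have "\<dots> = vert f (Xc y)"
      unfolding vert_def using tb c_pos by (intro nn_integral_cong) (auto simp: indicator_def)
    finally show "?I y * ?a y + ?I y * ?b y = ?I y * vert f (Xc y)" by (simp flip: distrib_left)
  qed
  also have "\<dots> = (\<integral>\<^sup>+x. vert f x \<partial>psi \<nu>)"
    by (rule nn_integral_psi[OF s vert_measurable[OF f], symmetric])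
  finally show ?thesis .
qed

lemma AE_psi: 
  assumes \<nu>: "\<nu> \<in> inv_meas" shows "AE x in psi \<nu>. x \<in> Sg"
proof -
  note s = inv_measD(1)[OF \<nu>]
  have "emeasure (psi \<nu>) (- Sg) = (\<integral>\<^sup>+x. indicator (- Sg) x \<partial>psi \<nu>)" by (simp add: sets_psi[OF s])
  also have "\<dots> = (\<integral>\<^sup>+y. indicator {y \<in> YS. Sc y < c} y * indicator (- Sg) (Xc y) \<partial>\<nu>)"
    by (rule nn_integral_psi[OF s]) simp
  also have "\<dots> = (\<integral>\<^sup>+y. 0 \<partial>\<nu>)"
    by (intro nn_integral_cong) (use rp_props in \<open>auto simp: indicator_def\<close>)
  finally show ?thesis
    using sets_psi[OF s] by (intro AE_I'[of "- Sg"]) (auto simp: null_sets_def)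
qed

lemma vert_strip:
  assumes "x \<in> Sg"
  shows "vert (indicator {y \<in> YS. Xc y \<in> A \<and> Sc y < c}) x = indicator A x * ennreal c"
proof -
  have "vert (indicator {y \<in> YS. Xc y \<in> A \<and> Sc y < c}) x = (\<integral>\<^sup>+s. indicator A x * indicator {0..<c} s \<partial>lborel)"
    unfolding vert_def
  proof (rule nn_integral_cong)
    fix s
    show "indicator {0..<tb x} s * indicator {y \<in> YS. Xc y \<in> A \<and> Sc y < c} (clt (x, s)) = (indicator A x * indicator {0..<c} s :: ennreal)"
    proof (cases "0 \<le> s \<and> s < \<tau> x")
      case True
      then show ?thesis using assms rp_clt[of x s] by (auto simp: indicator_def clt_in tb_def)
    next
      case False
      then show ?thesis using assms tau_gt_c[OF assms] by (auto simp: indicator_def tb_def)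
    qed
  qed
  also have "\<dots> = indicator A x * ennreal c"
    using c_pos by (subst nn_integral_cmult_indicator) auto
  finally show ?thesis .
qed

lemma strip_sets:
  assumes [measurable]: "A \<in> sets borel"
  shows "{y \<in> YS. Xc y \<in> A \<and> Sc y < c} \<in> sets YM"
proof -
  have "{y \<in> space YM. Xc y \<in> A \<and> Sc y < c} \<in> sets YM" by measurable
  then show ?thesis by simp
qed

lemma emeasure_psi:
  assumes s: "sets \<nu> = sets YM" and A: "A \<in> sets borel"
  shows "emeasure (psi \<nu>) A = emeasure \<nu> {y \<in> YS. Xc y \<in> A \<and> Sc y < c}"
proof -
  have "emeasure (psi \<nu>) A = (\<integral>\<^sup>+x. indicator A x \<partial>psi \<nu>)" using A by (simp add: sets_psi[OF s])
  also have "\<dots> = (\<integral>\<^sup>+y. indicator {y \<in> YS. Sc y < c} y * indicator A (Xc y) \<partial>\<nu>)"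
    using A by (intro nn_integral_psi[OF s]) simp
  also have "\<dots> = (\<integral>\<^sup>+y. indicator {y \<in> YS. Xc y \<in> A \<and> Sc y < c} y \<partial>\<nu>)"
    by (intro nn_integral_cong) (auto simp: indicator_def)
  also have "\<dots> = emeasure \<nu> {y \<in> YS. Xc y \<in> A \<and> Sc y < c}" using strip_sets[OF A] s by simp
  finally show ?thesis .
qed

text \<open>Flowing for time \<open>c\<close> moves the top slab of height \<open>c\<close> over the
  preimage of \<open>A\<close> onto the bottom slab over \<open>A\<close>. The flow preserves the
  mass, and Palm's formula expresses that of the top slab by the base mass of the preimage.\<close>

lemma psi_invariant:
  assumes \<nu>: "\<nu> \<in> inv_meas" and A: "A \<in> sets borel"
  shows "emeasure (psi \<nu>) (shift_map -` A) = emeasure (psi \<nu>) A"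
proof -
  note s = inv_measD(1)[OF \<nu>] and sp = inv_measD(2)[OF \<nu>]
  let ?E = "{y \<in> YS. Xc y \<in> A \<and> Sc y < c}"
  let ?F = "{y \<in> YS. shift_map (Xc y) \<in> A \<and> tb (Xc y) - c \<le> Sc y}"
  have sA: "shift_map -` A \<in> sets borel" using A by (rule measurable_sets_borel[OF shift_map_measurable])
  have F: "?F \<in> sets YM"
  proof -
    note [measurable] = A
    have "{y \<in> space YM. shift_map (Xc y) \<in> A \<and> tb (Xc y) - c \<le> Sc y} \<in> sets YM" by measurable
    then show ?thesis by simp
  qed
  have "emeasure (psi \<nu>) A = (\<integral>\<^sup>+y. indicator ?E y \<partial>\<nu>)"
    using emeasure_psi[OF s A] strip_sets[OF A] s by simp
  also have "\<dots> = (\<integral>\<^sup>+y. indicator ?E (\<theta> c y) \<partial>\<nu>)"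
    using strip_sets[OF A] c_pos by (intro inv_measD(4)[OF \<nu>, symmetric]) auto
  also have "\<dots> = (\<integral>\<^sup>+y. indicator ?F y \<partial>\<nu>)"
  proof (rule nn_integral_cong)
    fix y assume "y \<in> space \<nu>"
    then have y: "y \<in> YS" using sp by simp
    have x: "Xc y \<in> Sg" "0 \<le> Sc y" "Sc y < \<tau> (Xc y)" using rp_props[OF y] by auto
    have ty: "\<theta> c y \<in> YS" using flow_in[OF _ y, of c] c_pos by simp
    show "indicator ?E (\<theta> c y) = (indicator ?F y :: ennreal)"
    proof (cases "Sc y + c < \<tau> (Xc y)")
      case True
      have "\<theta> c y = clt (Xc y, Sc y + c)" using flow_below[OF y, of c] True x c_pos by (simp add: clt_less)
      moreover have "rp (clt (Xc y, Sc y + c)) = (Xc y, Sc y + c)" using True x c_pos by (intro rp_clt) auto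
      ultimately show ?thesis using True x by (auto simp: indicator_def tb_def)
    next
      case False
      let ?r = "Sc y + c - \<tau> (Xc y)"
      have r: "0 \<le> ?r" "?r < c" using False x by auto
      have "\<theta> c y = clt (shift_map (Xc y), ?r)" using flow_short[OF y, of c] False c_pos by simp
      moreover have "rp (clt (shift_map (Xc y), ?r)) = (shift_map (Xc y), ?r)"
        using r x tau_gt_c[OF shift_in_shift_space[OF x(1)]] by (intro rp_clt) auto
      ultimately show ?thesis using False x r y ty by (auto simp: indicator_def tb_def)
    qed
  qed
  also have "\<dots> = (\<integral>\<^sup>+x. indicator (shift_map -` A) x \<partial>psi \<nu>)"
  proof -
    have "vert (indicator ?F) x = indicator (shift_map -` A) x * ennreal c" if x: "x \<in> Sg" for x
    proof -
      have "vert (indicator ?F) x = (\<integral>\<^sup>+s. indicator (shift_map -` A) x * indicator {\<tau> x - c..<\<tau> x} s \<partial>lborel)"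
        unfolding vert_def
      proof (rule nn_integral_cong)
        fix s
        show "indicator {0..<tb x} s * indicator ?F (clt (x, s)) = (indicator (shift_map -` A) x * indicator {\<tau> x - c..<\<tau> x} s :: ennreal)"
        proof (cases "0 \<le> s \<and> s < \<tau> x")
          case True
          then show ?thesis using x rp_clt[of x s] by (auto simp: indicator_def clt_in tb_def)
        next
          case False
          then show ?thesis using x tau_gt_c[OF x] by (auto simp: indicator_def tb_def)
        qed
      qed
      also have "\<dots> = indicator (shift_map -` A) x * ennreal c"
        using c_pos by (subst nn_integral_cmult_indicator) auto
      finally show ?thesis .
    qed
    then have "(\<integral>\<^sup>+x. vert (indicator ?F) x \<partial>psi \<nu>) = (\<integral>\<^sup>+x. ennreal c * indicator (shift_map -` A) x \<partial>psi \<nu>)"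
      using AE_psi[OF \<nu>] by (intro nn_integral_cong_AE) (auto elim!: eventually_mono simp: mult.commute)
    also have "\<dots> = ennreal c * (\<integral>\<^sup>+x. indicator (shift_map -` A) x \<partial>psi \<nu>)"
      using sA sets_psi[OF s] by (intro nn_integral_cmult) auto
    finally have "ennreal c * (\<integral>\<^sup>+y. indicator ?F y \<partial>\<nu>) = ennreal c * (\<integral>\<^sup>+x. indicator (shift_map -` A) x \<partial>psi \<nu>)"
      using palm[OF \<nu>, of "indicator ?F"] F by simp
    then show ?thesis using c_pos by (simp add: ennreal_mult_cancel_left)
  qed
  also have "\<dots> = emeasure (psi \<nu>) (shift_map -` A)" using sA sets_psi[OF s] by simp
  finally show ?thesis by simp
qed

section \<open>From base measures back to flow-invariant measures\<close>

lemma vert_one: "vert (\<lambda>_. 1) x = ennreal (tb x)"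
proof -
  have "0 \<le> tb x" using tau_pos[of x] by (auto simp: tb_def less_imp_le)
  then show ?thesis by (simp add: vert_def)
qed

definition nu :: "(nat \<Rightarrow> nat) measure \<Rightarrow> ((nat \<Rightarrow> nat) \<times> real) set measure" where
  "nu m = distr (density (m \<Otimes>\<^sub>M lborel) (\<lambda>p. ennreal (1 / c) * indicator {p. 0 \<le> snd p \<and> snd p < tb (fst p)} p)) YM clt"

lemma nn_integral_nu:
  assumes m: "sets m = sets borel" and f [measurable]: "f \<in> borel_measurable YM"
  shows "(\<integral>\<^sup>+y. f y \<partial>nu m) = ennreal (1 / c) * (\<integral>\<^sup>+x. vert f x \<partial>m)"
proof -
  note [measurable_cong] = m
  let ?P = "m \<Otimes>\<^sub>M (lborel :: real measure)"
  let ?E = "{p. 0 \<le> snd p \<and> snd p < tb (fst p)}"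
  have sP: "sets ?P = sets BP" using m by (intro sets_pair_measure_cong) auto
  have spP: "space ?P = UNIV" using sets_eq_imp_space_eq[OF sP] by (simp add: space_pair_measure)
  have E: "?E \<in> sets ?P"
  proof -
    have "{p \<in> space BP. 0 \<le> snd p \<and> snd p < tb (fst p)} \<in> sets BP" by measurable
    then show ?thesis using sP by (simp add: space_pair_measure)
  qed
  have c1: "clt \<in> ?P \<rightarrow>\<^sub>M YM" using clt_measurable unfolding measurable_cong_sets[OF sP refl] .
  have fc: "(\<lambda>p. f (clt p)) \<in> borel_measurable ?P" using c1 f by measurable
  have "(\<integral>\<^sup>+y. f y \<partial>nu m) = (\<integral>\<^sup>+p. f (clt p) \<partial>density ?P (\<lambda>p. ennreal (1 / c) * indicator ?E p))"
    unfolding nu_def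
  proof (rule nn_integral_distr)
    show "clt \<in> density ?P (\<lambda>p. ennreal (1 / c) * indicator ?E p) \<rightarrow>\<^sub>M YM"
      using c1 unfolding measurable_cong_sets[OF sets_density refl] .
  qed (simp add: f)
  also have "\<dots> = (\<integral>\<^sup>+p. ennreal (1 / c) * indicator ?E p * f (clt p) \<partial>?P)"
    using E fc by (intro nn_integral_density) auto
  also have "\<dots> = ennreal (1 / c) * (\<integral>\<^sup>+p. indicator ?E p * f (clt p) \<partial>?P)"
    unfolding mult.assoc using E fc by (intro nn_integral_cmult) auto
  also have "(\<integral>\<^sup>+p. indicator ?E p * f (clt p) \<partial>?P) = (\<integral>\<^sup>+x. \<integral>\<^sup>+s. indicator ?E (x, s) * f (clt (x, s)) \<partial>lborel \<partial>m)"
    using E fc by (intro lborel.nn_integral_fst[symmetric]) auto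
  also have "\<dots> = (\<integral>\<^sup>+x. vert f x \<partial>m)"
    unfolding vert_def by (intro nn_integral_cong) (auto simp: indicator_def)
  finally show ?thesis .
qed

lemma sets_nu: "sets (nu m) = sets YM" and space_nu: "space (nu m) = YS"
  by (simp_all add: nu_def)

text \<open>For times \<open>t\<close> up to \<open>c\<close> the flow lifts each fibre by
  \<open>t\<close>, and the part pushed over the roof lands on the bottom piece of length
  \<open>t\<close> over the shifted point. Invariance of \<open>m\<close> under the shift puts that
  piece back; longer times are compositions.\<close>

lemma nu_in_inv_meas:
  assumes m: "sets m = sets borel" and AE: "AE x in m. x \<in> Sg" and inv: "distr m borel shift_map = m"
    and total: "(\<integral>\<^sup>+x. ennreal (tb x) \<partial>m) = ennreal c"
  shows "nu m \<in> inv_meas"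
proof -
  have prob: "prob_space (nu m)"
  proof (rule prob_spaceI)
    have "emeasure (nu m) (space (nu m)) = (\<integral>\<^sup>+y. 1 \<partial>nu m)" by simp
    also have "\<dots> = ennreal (1 / c) * (\<integral>\<^sup>+x. vert (\<lambda>_. 1) x \<partial>m)" by (rule nn_integral_nu[OF m]) simp
    finally show "emeasure (nu m) (space (nu m)) = 1"
      unfolding vert_one using total c_pos by (simp add: ennreal_mult'[symmetric])
  qed
  have shift: "(\<integral>\<^sup>+x. u (shift_map x) \<partial>m) = (\<integral>\<^sup>+x. u x \<partial>m)" if u: "u \<in> borel_measurable borel" for u
  proof -
    have sm: "shift_map \<in> m \<rightarrow>\<^sub>M borel" using shift_map_measurable m measurable_cong_sets by blast
    have "u \<in> borel_measurable m" using u m measurable_cong_sets by blast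
    then show ?thesis using nn_integral_distr[OF sm, of u] u inv by simp
  qed
  have short: "(\<integral>\<^sup>+y. f (\<theta> t y) \<partial>nu m) = (\<integral>\<^sup>+y. f y \<partial>nu m)"
    if t: "0 \<le> t" "t \<le> c" and f [measurable]: "f \<in> borel_measurable YM" for t f
  proof -
    define u where "u x = (\<integral>\<^sup>+s. indicator {0..<t} s * f (clt (x, s)) \<partial>lborel)" for x
    define v where "v x = (\<integral>\<^sup>+s. indicator {t..<tb x} s * f (clt (x, s)) \<partial>lborel)" for x
    have um: "u \<in> borel_measurable borel" and vm: "v \<in> borel_measurable borel"
    proof -
      have "(\<lambda>(x, s). if 0 \<le> s \<and> s < t then f (clt (x, s)) else 0) \<in> borel_measurable (borel \<Otimes>\<^sub>M lborel)"
        "(\<lambda>(x, s). if t \<le> s \<and> s < tb x then f (clt (x, s)) else 0) \<in> borel_measurable (borel \<Otimes>\<^sub>M lborel)"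
        by measurable
      from this[THEN lborel.borel_measurable_nn_integral_fst]
      show "u \<in> borel_measurable borel" "v \<in> borel_measurable borel"
        unfolding u_def v_def by (auto simp: indicator_def if_distrib[of "\<lambda>a. a * _"] cong: if_cong)
    qed
    have th: "\<theta> t \<in> YM \<rightarrow>\<^sub>M YM" by (rule flow_measurable[OF t(1)])
    have fth: "(\<lambda>y. f (\<theta> t y)) \<in> borel_measurable YM" using th by measurable
    have v1: "vert (\<lambda>y. f (\<theta> t y)) x = v x + u (shift_map x)" if x: "x \<in> Sg" for x
    proof -
      have tb: "tb x = \<tau> x" "t < \<tau> x" using x tau_gt_c[OF x] t by (auto simp: tb_def)
      have tb': "t < \<tau> (shift_map x)" using tau_gt_c[OF shift_in_shift_space[OF x]] t by simp
      have m1: "(\<lambda>s. indicator {t..<tb x} s * f (clt (x, s))) \<in> borel_measurable borel"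
        "(\<lambda>s. indicator {0..<t} s * f (clt (shift_map x, s))) \<in> borel_measurable borel" by measurable
      have "vert (\<lambda>y. f (\<theta> t y)) x = (\<integral>\<^sup>+s. indicator {t..<tb x} (t + s) * f (clt (x, t + s)) +
          indicator {0..<t} ((t - \<tau> x) + s) * f (clt (shift_map x, (t - \<tau> x) + s)) \<partial>lborel)"
        unfolding vert_def
      proof (rule nn_integral_cong)
        fix s
        show "indicator {0..<tb x} s * f (\<theta> t (clt (x, s))) = indicator {t..<tb x} (t + s) * f (clt (x, t + s)) +
          indicator {0..<t} ((t - \<tau> x) + s) * f (clt (shift_map x, (t - \<tau> x) + s))"
        proof (cases "0 \<le> s \<and> s < \<tau> x")
          case True
          then have "rp (clt (x, s)) = (x, s)" using x by (intro rp_clt) auto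
          then have "\<theta> t (clt (x, s)) = (if s + t < \<tau> x then clt (x, s + t) else clt (shift_map x, s + t - \<tau> x))"
            using flow_short[OF clt_in t, of "(x, s)"] by simp
          then show ?thesis using True tb by (auto simp: indicator_def add.commute algebra_simps)
        next
          case False
          then show ?thesis using tb t by (auto simp: indicator_def)
        qed
      qed
      also have "\<dots> = (\<integral>\<^sup>+s. indicator {t..<tb x} (t + s) * f (clt (x, t + s)) \<partial>lborel) +
          (\<integral>\<^sup>+s. indicator {0..<t} ((t - \<tau> x) + s) * f (clt (shift_map x, (t - \<tau> x) + s)) \<partial>lborel)"
        by (rule nn_integral_add) measurable
      also have "\<dots> = v x + u (shift_map x)"
        unfolding u_def v_def nn_integral_shift[OF m1(1)] nn_integral_shift[OF m1(2)] ..
      finally show ?thesis .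
    qed
    have v2: "vert f x = v x + u x" if x: "x \<in> Sg" for x
    proof -
      have tb: "tb x = \<tau> x" "t < \<tau> x" using x tau_gt_c[OF x] t by (auto simp: tb_def)
      have "vert f x = (\<integral>\<^sup>+s. indicator {t..<tb x} s * f (clt (x, s)) + indicator {0..<t} s * f (clt (x, s)) \<partial>lborel)"
        unfolding vert_def using tb t by (intro nn_integral_cong) (auto simp: indicator_def)
      also have "\<dots> = v x + u x"
        unfolding u_def v_def by (rule nn_integral_add) measurable
      finally show ?thesis .
    qed
    have bm: "g \<in> borel_measurable borel \<Longrightarrow> g \<in> borel_measurable m" for g :: "_ \<Rightarrow> ennreal"
      using m measurable_cong_sets by blast
    have "(\<integral>\<^sup>+x. vert (\<lambda>y. f (\<theta> t y)) x \<partial>m) = (\<integral>\<^sup>+x. v x + u (shift_map x) \<partial>m)"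
      using AE by (intro nn_integral_cong_AE) (auto elim!: eventually_mono simp: v1)
    also have "\<dots> = (\<integral>\<^sup>+x. v x \<partial>m) + (\<integral>\<^sup>+x. u (shift_map x) \<partial>m)"
      by (intro nn_integral_add bm vm measurable_compose[OF shift_map_measurable um])
    also have "(\<integral>\<^sup>+x. u (shift_map x) \<partial>m) = (\<integral>\<^sup>+x. u x \<partial>m)" by (rule shift[OF um])
    also have "(\<integral>\<^sup>+x. v x \<partial>m) + (\<integral>\<^sup>+x. u x \<partial>m) = (\<integral>\<^sup>+x. v x + u x \<partial>m)"
      by (intro nn_integral_add[symmetric] bm um vm)
    also have "\<dots> = (\<integral>\<^sup>+x. vert f x \<partial>m)"
      using AE by (intro nn_integral_cong_AE) (auto elim!: eventually_mono simp: v2)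
    finally show ?thesis unfolding nn_integral_nu[OF m f] nn_integral_nu[OF m fth] by simp
  qed
  have long: "(\<integral>\<^sup>+y. f (\<theta> t y) \<partial>nu m) = (\<integral>\<^sup>+y. f y \<partial>nu m)"
    if "0 \<le> t" "t \<le> real n * c" "f \<in> borel_measurable YM" for n t f
    using that
  proof (induction n arbitrary: t f)
    case 0
    then show ?case using short[of t f] c_pos by simp
  next
    case (Suc n)
    show ?case
    proof (cases "t \<le> c")
      case False
      have t: "0 \<le> t - c" "t - c \<le> real n * c" "0 \<le> c" using False Suc.prems c_pos by (auto simp: algebra_simps)
      have "(\<integral>\<^sup>+y. f (\<theta> t y) \<partial>nu m) = (\<integral>\<^sup>+y. f (\<theta> (t - c) (\<theta> c y)) \<partial>nu m)"
        using flow_add[OF t(1,3)] by (intro nn_integral_cong) (simp add: space_nu)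
      also have "\<dots> = (\<integral>\<^sup>+y. f (\<theta> (t - c) y) \<partial>nu m)"
        by (rule short[OF t(3) order_refl measurable_compose[OF flow_measurable[OF t(1)] Suc.prems(3)]])
      also have "\<dots> = (\<integral>\<^sup>+y. f y \<partial>nu m)" using Suc.IH[OF t(1,2) Suc.prems(3)] .
      finally show ?thesis .
    qed (use short Suc.prems in blast)
  qed
  show ?thesis
    unfolding inv_meas_def invariant_measures_def prob_measures_on_def
  proof (intro CollectI conjI allI impI ballI sets_nu prob)
    fix t :: real and A assume t: "0 \<le> t" and A: "A \<in> sets (nu m)"
    obtain n where n: "t \<le> real n * c" using reals_Archimedean3[OF c_pos] less_imp_le by blast
    have A': "A \<in> sets YM" using A sets_nu by simp
    have P: "\<theta> t -` A \<inter> space (nu m) \<in> sets (nu m)"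
      using measurable_sets[OF flow_measurable[OF t] A'] by (simp add: sets_nu space_nu)
    have "emeasure (nu m) (\<theta> t -` A \<inter> space (nu m)) = (\<integral>\<^sup>+y. indicator (\<theta> t -` A \<inter> space (nu m)) y \<partial>nu m)" using P by simp
    also have "\<dots> = (\<integral>\<^sup>+y. indicator A (\<theta> t y) \<partial>nu m)" by (intro nn_integral_cong) (auto simp: indicator_def)
    also have "\<dots> = (\<integral>\<^sup>+y. indicator A y \<partial>nu m)" using A' by (intro long[OF t n]) simp
    also have "\<dots> = emeasure (nu m) A" using A by simp
    finally show "emeasure (nu m) (\<theta> t -` A \<inter> space (nu m)) = emeasure (nu m) A" .
  qed
qed

lemma psi_nu:
  assumes m: "sets m = sets borel" and AE: "AE x in m. x \<in> Sg"
  shows "psi (nu m) = m"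
proof (rule measure_eqI)
  show "sets (psi (nu m)) = sets m" using sets_psi[OF sets_nu] m by simp
  fix A assume "A \<in> sets (psi (nu m))"
  then have A: "A \<in> sets borel" using sets_psi[OF sets_nu] by simp
  let ?E = "{y \<in> YS. Xc y \<in> A \<and> Sc y < c}"
  have "emeasure (psi (nu m)) A = (\<integral>\<^sup>+y. indicator ?E y \<partial>nu m)"
    using emeasure_psi[OF sets_nu A] strip_sets[OF A] by (simp add: sets_nu)
  also have "\<dots> = ennreal (1 / c) * (\<integral>\<^sup>+x. vert (indicator ?E) x \<partial>m)"
    using strip_sets[OF A] by (intro nn_integral_nu[OF m]) simp
  also have "(\<integral>\<^sup>+x. vert (indicator ?E) x \<partial>m) = (\<integral>\<^sup>+x. ennreal c * indicator A x \<partial>m)"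
    using AE by (intro nn_integral_cong_AE) (auto elim!: eventually_mono simp: vert_strip mult.commute)
  also have "\<dots> = ennreal c * emeasure m A" using A m by (subst nn_integral_cmult_indicator) auto
  finally show "emeasure (psi (nu m)) A = emeasure m A"
    using c_pos by (simp add: mult.assoc[symmetric] ennreal_mult'[symmetric])
qed

lemma psi_inj:
  assumes \<nu>: "\<nu> \<in> inv_meas" "\<nu>' \<in> inv_meas" and eq: "psi \<nu> = psi \<nu>'"
  shows "\<nu> = \<nu>'"
proof (rule measure_eqI)
  note s = inv_measD(1)[OF \<nu>(1)] inv_measD(1)[OF \<nu>(2)]
  show "sets \<nu> = sets \<nu>'" by (simp add: s)
  fix A assume "A \<in> sets \<nu>"
  then have A: "A \<in> sets YM" using s by simp
  have "ennreal c * (\<integral>\<^sup>+y. indicator A y \<partial>\<nu>) = ennreal c * (\<integral>\<^sup>+y. indicator A y \<partial>\<nu>')"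
    using palm[OF \<nu>(1), of "indicator A"] palm[OF \<nu>(2), of "indicator A"] A eq by simp
  then show "emeasure \<nu> A = emeasure \<nu>' A"
    using A s c_pos by (simp add: ennreal_mult_cancel_left)
qed

end

subsection \<open>The affine homeomorphism\<close>

lemma topspace_weak_star [simp]: "topspace (weak_star_topology X) = prob_measures_on X"
proof -
  have "prob_measures_on X \<in> {{\<nu> \<in> prob_measures_on X. (\<integral>y. f y \<partial>\<nu>) \<in> W} | f W.
          continuous_map X euclideanreal f \<and> bounded (f ` topspace X) \<and> open W}"
  proof (intro CollectI exI conjI)
    show "prob_measures_on X = {\<nu> \<in> prob_measures_on X. (\<integral>y. (0::real) \<partial>\<nu>) \<in> UNIV}" by simp
    show "bounded ((\<lambda>y. 0::real) ` topspace X)" by (auto simp: bounded_iff)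
  qed auto
  then show ?thesis
    unfolding weak_star_topology_def topology_generated_by_topspace by blast
qed

lemma continuous_map_integral:
  assumes "continuous_map X euclideanreal f" "bounded (f ` topspace X)"
  shows "continuous_map (weak_star_topology X) euclideanreal (\<lambda>\<nu>. \<integral>y. f y \<partial>\<nu>)"
  unfolding continuous_map_def
proof (intro conjI allI impI)
  fix W :: "real set" assume "openin euclideanreal W"
  then have "{\<nu> \<in> prob_measures_on X. (\<integral>y. f y \<partial>\<nu>) \<in> W} \<in>
      {{\<nu> \<in> prob_measures_on X. (\<integral>y. f y \<partial>\<nu>) \<in> W} | f W.
          continuous_map X euclideanreal f \<and> bounded (f ` topspace X) \<and> open W}"
    using assms by auto
  then show "openin (weak_star_topology X) {\<nu> \<in> topspace (weak_star_topology X). (\<integral>y. f y \<partial>\<nu>) \<in> W}"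
    unfolding topspace_weak_star by (subst weak_star_topology_def) (rule topology_generated_by_Basis)
qed simp

lemma continuous_map_into_weak_star:
  fixes S :: "'b::metric_space set"
  assumes g: "\<And>y. y \<in> S \<Longrightarrow> g y \<in> prob_measures_on X"
    and cont: "\<And>f. continuous_map X euclideanreal f \<Longrightarrow> bounded (f ` topspace X) \<Longrightarrow> continuous_on S (\<lambda>y. \<integral>z. f z \<partial>g y)"
  shows "continuous_map (top_of_set S) (weak_star_topology X) g"
  unfolding weak_star_topology_def
proof (rule continuous_on_generated_topo)
  fix U assume "U \<in> {{\<nu> \<in> prob_measures_on X. (\<integral>y. f y \<partial>\<nu>) \<in> W} | f W.
          continuous_map X euclideanreal f \<and> bounded (f ` topspace X) \<and> open W}"
  then obtain f W where f: "continuous_map X euclideanreal f" "bounded (f ` topspace X)" and W: "open W"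
    and U: "U = {\<nu> \<in> prob_measures_on X. (\<integral>y. f y \<partial>\<nu>) \<in> W}" by blast
  have "g -` U \<inter> S = S \<inter> (\<lambda>y. \<integral>z. f z \<partial>g y) -` W" using g U by auto
  then show "openin (top_of_set S) (g -` U \<inter> topspace (top_of_set S))"
    using continuous_openin_preimage_gen[OF cont[OF f] W] by simp
next
  have "g ` S \<subseteq> topspace (weak_star_topology X)" using g by auto
  then show "g ` topspace (top_of_set S) \<subseteq> \<Union>{{\<nu> \<in> prob_measures_on X. (\<integral>y. f y \<partial>\<nu>) \<in> W} | f W.
          continuous_map X euclideanreal f \<and> bounded (f ` topspace X) \<and> open W}"
    unfolding weak_star_topology_def topology_generated_by_topspace by simp
qed

context susp
begin

lemma cont_bounded_integrable:
  assumes \<nu>: "\<nu> \<in> inv_meas" and f: "continuous_map YT euclideanreal f" "bounded (f ` YS)"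
  shows "integrable \<nu> f"
proof -
  interpret prob_space \<nu> by (rule inv_measD(3)[OF \<nu>])
  obtain C where C: "\<And>y. y \<in> YS \<Longrightarrow> norm (f y) \<le> C" using f(2) by (auto simp: bounded_iff)
  have "f \<in> borel_measurable \<nu>"
    by (rule measurable_inv_meas[OF inv_measD(1)[OF \<nu>] continuous_map_borel_of[OF f(1)]])
  then show ?thesis
    by (intro integrable_const_bound[of _ C] AE_I2) (use C inv_measD(2)[OF \<nu>] in auto)
qed

text \<open>Fatou's lemma on the fibres: the roof is continuous, so every height below \<open>\<tau> x\<close> is also below
  \<open>\<tau> y\<close> for \<open>y\<close> near \<open>x\<close>.\<close>

lemma vert_lsc:
  assumes f: "continuous_map YT euclideanreal f" and x: "x \<in> Sg" and a: "a < vert (\<lambda>y. ennreal (f y)) x"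
  shows "\<exists>N. \<forall>y\<in>Sg. (\<forall>j<N. y j = x j) \<longrightarrow> a < vert (\<lambda>y. ennreal (f y)) y"
proof (rule ccontr)
  assume "\<not> ?thesis"
  then have "\<forall>N. \<exists>y. y \<in> Sg \<and> (\<forall>j<N. y j = x j) \<and> vert (\<lambda>y. ennreal (f y)) y \<le> a" by (auto simp: not_less)
  then obtain y where y: "\<And>N. y N \<in> Sg" "\<And>N j. j < N \<Longrightarrow> y N j = x j" "\<And>N. vert (\<lambda>y. ennreal (f y)) (y N) \<le> a"
    by metis
  have lim: "y \<longlonglongrightarrow> x"
    unfolding tendsto_fun_iff
  proof (intro allI tendsto_eventually)
    show "\<forall>\<^sub>F n in sequentially. y n i = x i" for i
      using eventually_gt_at_top[of i] by eventually_elim (rule y(2))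
  qed
  have tau_lim: "(\<lambda>n. \<tau> (y n)) \<longlonglongrightarrow> \<tau> x"
    using x y(1) by (intro continuous_on_tendsto_compose[OF cont_tau lim]) auto
  note [measurable] = continuous_map_borel_of[OF f]
  define t where "t n s = indicator {0..<tb (y n)} s * ennreal (f (clt (y n, s)))" for n s
  have point: "indicator {0..<tb x} s * ennreal (f (clt (x, s))) \<le> liminf (\<lambda>n. t n s)" for s
  proof (cases "0 \<le> s \<and> s < \<tau> x")
    case True
    then have ev: "\<forall>\<^sub>F n in sequentially. s < \<tau> (y n)" using order_tendstoD(1)[OF tau_lim] by blast
    have "(\<lambda>n. f (clt (y n, s))) \<longlonglongrightarrow> f (clt (x, s))"
    proof -
      have "\<forall>\<^sub>F n in sequentially. (y n, s) \<in> D" using ev by eventually_elim (use True y(1) in \<open>simp add: in_D\<close>)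
      moreover have "(\<lambda>n. (y n, s)) \<longlonglongrightarrow> (x, s)" by (intro tendsto_Pair lim tendsto_const)
      ultimately have "(\<lambda>n. f (cl (y n, s))) \<longlonglongrightarrow> f (cl (x, s))"
        using True x by (intro continuous_on_tendsto_compose[OF continuous_on_cl[OF f]]) (auto simp: in_D)
      moreover have "\<forall>\<^sub>F n in sequentially. f (cl (y n, s)) = f (clt (y n, s))"
        using ev by eventually_elim (use True y(1) in \<open>simp add: clt_less\<close>)
      ultimately show ?thesis using True x by (simp add: clt_less tendsto_cong)
    qed
    then have "(\<lambda>n. ennreal (f (clt (y n, s)))) \<longlonglongrightarrow> ennreal (f (clt (x, s)))" by (rule tendsto_ennrealI)
    moreover have "\<forall>\<^sub>F n in sequentially. ennreal (f (clt (y n, s))) = t n s"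
      using ev by eventually_elim (use True y(1) in \<open>simp add: t_def tb_def\<close>)
    ultimately have "(\<lambda>n. t n s) \<longlonglongrightarrow> ennreal (f (clt (x, s)))" by (rule Lim_transform_eventually)
    then have "liminf (\<lambda>n. t n s) = ennreal (f (clt (x, s)))" by (intro lim_imp_Liminf) auto
    then show ?thesis by (simp add: indicator_def)
  qed (use x in \<open>auto simp: tb_def indicator_def\<close>)
  have "vert (\<lambda>y. ennreal (f y)) x \<le> (\<integral>\<^sup>+s. liminf (\<lambda>n. t n s) \<partial>lborel)"
    unfolding vert_def by (intro nn_integral_mono point)
  also have "\<dots> \<le> liminf (\<lambda>n. \<integral>\<^sup>+s. t n s \<partial>lborel)"
    unfolding t_def by (intro nn_integral_liminf) measurable
  also have "\<dots> = liminf (\<lambda>n. vert (\<lambda>y. ennreal (f y)) (y n))" by (simp add: t_def vert_def)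
  also have "\<dots> \<le> a" by (intro Liminf_le always_eventually allI y(3)) simp
  finally show False using a by simp
qed

text \<open>Weighting the fibre over \<open>x\<close> by \<open>6 s (\<tau> x - s) / \<tau> x^3\<close>, a probability density that vanishes at both
  ends, recovers the masses of cylinders from bounded continuous functions.\<close>

definition bump :: "nat list \<Rightarrow> (nat \<Rightarrow> nat) \<times> real \<Rightarrow> real" where
  "bump w p = c * indicator (cyl w) (fst p) * (6 * snd p * (\<tau> (fst p) - snd p) / \<tau> (fst p) ^ 3)"

lemma bump_bounds:
  assumes "p \<in> D" shows "0 \<le> bump w p" "bump w p \<le> 3"
proof -
  let ?t = "\<tau> (fst p)" and ?s = "snd p"
  have p: "0 \<le> ?s" "?s \<le> ?t" "2 * c \<le> ?t" "0 < ?t"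
    using assms tau_2c[of "fst p"] tau_pos[of "fst p"] by (auto simp: suspension_domain_def)
  show "0 \<le> bump w p" unfolding bump_def using p c_pos by (intro mult_nonneg_nonneg divide_nonneg_nonneg) auto
  have "c * (6 * ?s * (?t - ?s) / ?t ^ 3) = (6 * c) * (?s * (?t - ?s)) / ?t ^ 3" by simp
  also have "\<dots> \<le> (3 * ?t) * (?t * ?t) / ?t ^ 3"
  proof (rule divide_right_mono)
    have "?s * (?t - ?s) \<le> ?t * ?t" using p by (intro mult_mono) auto
    moreover have "6 * c \<le> 3 * ?t" "0 \<le> ?s * (?t - ?s)" using p by auto
    ultimately show "(6 * c) * (?s * (?t - ?s)) \<le> (3 * ?t) * (?t * ?t)" using p by (intro mult_mono[of "6 * c" "3 * ?t"]) auto
  qed (use p in simp)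
  also have "\<dots> = 3" using p by (simp add: power3_eq_cube)
  finally have "c * (6 * ?s * (?t - ?s) / ?t ^ 3) \<le> 3" .
  then show "bump w p \<le> 3" by (simp add: bump_def indicator_def)
qed

lemma bump_continuous: "continuous_map YT euclideanreal (\<lambda>y. bump w (rp y))"
proof (rule continuous_map_YT)
  show "continuous_on D (bump w)"
    unfolding bump_def by (intro continuous_intros cont_tau_fst cont_ind_fst) (use tau_ne0 in simp)
  show "bump w (x, \<tau> x) = bump w (shift_map x, 0)" if "x \<in> Sg" for x by (simp add: bump_def)
qed

lemma bump_bounded: "bounded ((\<lambda>y. bump w (rp y)) ` YS)"
  unfolding bounded_iff using bump_bounds[OF rp_D] by (intro exI[of _ 3]) auto

lemma vert_bump:
  assumes x: "x \<in> Sg" shows "vert (\<lambda>y. ennreal (bump w (rp y))) x = ennreal c * indicator (cyl w) x"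
proof -
  let ?t = "\<tau> x" and ?k = "c * indicator (cyl w) x"
  have t: "0 < ?t" by (rule tau_pos[OF x])
  have "vert (\<lambda>y. ennreal (bump w (rp y))) x = (\<integral>\<^sup>+s. ennreal (bump w (x, s)) * indicator {0..?t} s \<partial>lborel)"
    unfolding vert_def
  proof (rule nn_integral_cong)
    fix s
    show "indicator {0..<tb x} s * ennreal (bump w (rp (clt (x, s)))) = ennreal (bump w (x, s)) * indicator {0..?t} s"
    proof (cases "0 \<le> s \<and> s < ?t")
      case True
      then show ?thesis using x rp_clt[OF x] by (simp add: tb_def indicator_def)
    next
      case False
      then show ?thesis using x by (auto simp: tb_def indicator_def bump_def)
    qed
  qed
  also have "\<dots> = ennreal (?k * (3 * ?t * ?t ^ 2 - 2 * ?t ^ 3) / ?t ^ 3 - ?k * (3 * ?t * 0 ^ 2 - 2 * 0 ^ 3) / ?t ^ 3)"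
  proof (rule nn_integral_FTC_Icc[where F = "\<lambda>s. ?k * (3 * ?t * s ^ 2 - 2 * s ^ 3) / ?t ^ 3"])
    show "(\<lambda>s. bump w (x, s)) \<in> borel_measurable borel" unfolding bump_def by simp
    show "((\<lambda>s. ?k * (3 * ?t * s ^ 2 - 2 * s ^ 3) / ?t ^ 3) has_real_derivative bump w (x, s)) (at s)" for s
      using t unfolding bump_def by (auto intro!: derivative_eq_intros simp: field_simps power2_eq_square)
    show "0 \<le> bump w (x, s)" if "s \<in> {0..?t}" for s
      using bump_bounds(1)[of "(x, s)"] that x by (simp add: in_D)
  qed (use t in auto)
  also have "\<dots> = ennreal ?k" using t by (simp add: field_simps power2_eq_square power3_eq_cube)
  finally show ?thesis using c_pos by (simp add: indicator_def)
qed

lemma integral_bump: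
  assumes \<nu>: "\<nu> \<in> inv_meas" shows "(\<integral>y. bump w (rp y) \<partial>\<nu>) = measure (psi \<nu>) (cyl w)"
proof -
  note s = inv_measD(1)[OF \<nu>]
  have m: "(\<lambda>y. bump w (rp y)) \<in> borel_measurable YM" by (rule continuous_map_borel_of[OF bump_continuous])
  have "ennreal c * (\<integral>\<^sup>+y. ennreal (bump w (rp y)) \<partial>\<nu>) = (\<integral>\<^sup>+x. vert (\<lambda>y. ennreal (bump w (rp y))) x \<partial>psi \<nu>)"
    using m by (intro palm[OF \<nu>]) simp
  also have "\<dots> = (\<integral>\<^sup>+x. ennreal c * indicator (cyl w) x \<partial>psi \<nu>)"
    using AE_psi[OF \<nu>] by (intro nn_integral_cong_AE) (auto elim!: eventually_mono simp: vert_bump)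
  also have "\<dots> = ennreal c * emeasure (psi \<nu>) (cyl w)"
    using sets_psi[OF s] by (subst nn_integral_cmult_indicator) auto
  finally have "(\<integral>\<^sup>+y. ennreal (bump w (rp y)) \<partial>\<nu>) = emeasure (psi \<nu>) (cyl w)"
    using c_pos by (simp add: ennreal_mult_cancel_left)
  moreover have "(\<integral>y. bump w (rp y) \<partial>\<nu>) = enn2real (\<integral>\<^sup>+y. ennreal (bump w (rp y)) \<partial>\<nu>)"
    using bump_bounds(1)[OF rp_D] inv_measD(2)[OF \<nu>]
    by (intro integral_eq_nn_integral measurable_inv_meas[OF s m] AE_I2) simp
  ultimately show ?thesis by (simp add: measure_def)
qed

lemma psi_convex_comb:
  assumes "\<mu> \<in> inv_meas" "\<nu> \<in> inv_meas"
  shows "psi (convex_comb_measure u \<mu> \<nu>) = convex_comb_measure u (psi \<mu>) (psi \<nu>)"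
proof (rule measure_eqI)
  note s = inv_measD(1)[OF assms(1)] inv_measD(1)[OF assms(2)]
  have eq: "sets \<mu> = sets \<nu>" by (simp add: s)
  have sc: "sets (convex_comb_measure u \<mu> \<nu>) = sets YM" using sets_convex_comb_measure[OF eq] s by simp
  have sp: "sets (psi \<mu>) = sets (psi \<nu>)" using s by (simp add: sets_psi)
  show "sets (psi (convex_comb_measure u \<mu> \<nu>)) = sets (convex_comb_measure u (psi \<mu>) (psi \<nu>))"
    using sets_convex_comb_measure[OF sp] by (simp add: sets_psi sc s)
  fix A assume "A \<in> sets (psi (convex_comb_measure u \<mu> \<nu>))"
  then have "A \<in> sets borel" by (simp add: sets_psi sc)
  then show "emeasure (psi (convex_comb_measure u \<mu> \<nu>)) A = emeasure (convex_comb_measure u (psi \<mu>) (psi \<nu>)) A"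
    by (simp add: emeasure_psi sc s emeasure_convex_comb_measure[OF eq] emeasure_convex_comb_measure[OF sp])
qed

end

text \<open>Dividing the roof by \<open>c\<close> turns Palm's normalisation, roof mass
  \<open>c\<close>, into roof mass one.\<close>

locale flow_system = susp B \<tau> c \<theta> + roof_system B ts V for B \<tau> c \<theta> ts V +
  assumes ts: "ts x = (if x \<in> shift_space B then \<tau> x / c else 1)"
begin

lemma integral_ts:
  assumes s: "sets m = sets borel" and AE: "AE x in m. x \<in> Sg"
  shows "ennreal c * (\<integral>\<^sup>+x. ts x \<partial>m) = (\<integral>\<^sup>+x. tb x \<partial>m)"
proof -
  have "ts \<in> borel_measurable m" using tau_measurable s measurable_cong_sets by blast
  then have "ennreal c * (\<integral>\<^sup>+x. ts x \<partial>m) = (\<integral>\<^sup>+x. ennreal c * ts x \<partial>m)" by (simp add: nn_integral_cmult)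
  also have "\<dots> = (\<integral>\<^sup>+x. tb x \<partial>m)"
    using AE
  proof (intro nn_integral_cong_AE, eventually_elim)
    case (elim x)
    then show ?case using c_pos tau_pos[of x] by (simp add: ts tb_def ennreal_mult'[symmetric])
  qed
  finally show ?thesis .
qed

text \<open>The roof mass comes from Palm's formula for the constant function one.\<close>

lemma psi_IM:
  assumes \<nu>: "\<nu> \<in> inv_meas" shows "psi \<nu> \<in> IM" "(\<integral>\<^sup>+x. ts x \<partial>psi \<nu>) = 1"
proof -
  note s = inv_measD(1)[OF \<nu>]
  interpret prob_space \<nu> by (rule inv_measD(3)[OF \<nu>])
  have sp: "space (psi \<nu>) = UNIV" using sets_eq_imp_space_eq[OF sets_psi[OF s]] by simp
  have "ennreal c * (\<integral>\<^sup>+x. ts x \<partial>psi \<nu>) = (\<integral>\<^sup>+x. vert (\<lambda>_. 1) x \<partial>psi \<nu>)"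
    unfolding vert_one by (rule integral_ts[OF sets_psi[OF s] AE_psi[OF \<nu>]])
  also have "\<dots> = ennreal c * (\<integral>\<^sup>+y. 1 \<partial>\<nu>)" by (rule palm[OF \<nu>, symmetric]) simp
  finally have "ennreal c * (\<integral>\<^sup>+x. ts x \<partial>psi \<nu>) = ennreal c * 1" by (simp add: emeasure_space_1)
  then show 1: "(\<integral>\<^sup>+x. ts x \<partial>psi \<nu>) = 1" using c_pos unfolding ennreal_mult_cancel_left by simp
  have "emeasure (psi \<nu>) UNIV \<le> 1"
    using emeasure_psi[OF s, of UNIV] emeasure_le_1 by simp
  then have "finite_measure (psi \<nu>)"
    by (intro finite_measureI) (auto simp: sp top_unique)
  then have "invm (psi \<nu>)"
    by (intro invmI sets_psi[OF s] AE_psi[OF \<nu>] psi_invariant[OF \<nu>]) auto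
  then show "psi \<nu> \<in> IM" using 1 by (simp add: IM_def)
qed

lemma nu_IM:
  assumes m: "m \<in> IM" and one: "(\<integral>\<^sup>+x. ts x \<partial>m) = 1"
  shows "nu m \<in> inv_meas" "psi (nu m) = m"
proof -
  note im = IM_D(1)[OF m]
  show "nu m \<in> inv_meas"
    using invmD(1,4,5)[OF im] integral_ts[OF invmD(1,4)[OF im]] one by (intro nu_in_inv_meas) auto
  show "psi (nu m) = m" by (rule psi_nu[OF invmD(1,4)[OF im]])
qed

definition hom :: "((nat \<Rightarrow> nat) \<times> real) set measure \<Rightarrow> nat \<Rightarrow>\<^sub>C real" where
  "hom \<nu> = emb (wt (psi \<nu>))"

lemma hom_inj: "inj_on hom inv_meas"
  by (rule inj_onI) (auto simp: hom_def emb_wt_inj psi_IM intro: psi_inj)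

lemma emb_scale:
  assumes m: "m \<in> IM" and l: "0 \<le> l" and le: "ennreal l * (\<integral>\<^sup>+x. ts x \<partial>m) \<le> 1"
  shows "emb (wt (scale_measure l m)) = l *\<^sub>R emb (wt m)"
proof (rule bcontfun_eqI)
  note sc = scale_IM[OF IM_D(1)[OF m] l le]
  show "apply_bcontfun (emb (wt (scale_measure l m))) k = apply_bcontfun (l *\<^sub>R emb (wt m)) k" for k
    by (simp add: emb_apply_cube[OF wt_in_cube[OF sc(1)]] emb_apply_cube[OF wt_in_cube[OF m]] sc(2) scaleR_bcontfun.rep_eq)
qed

text \<open>Scaling by a factor below one pushes the roof mass below one, so no proper combination
  with \<open>0\<close> is reached. Conversely a roof mass below one leaves room to scale up inside
  \<open>K\<close>.\<close>

lemma hom_image: "hom ` inv_meas = K - {l *\<^sub>R x + (1 - l) *\<^sub>R 0 | x l. x \<in> K \<and> 0 \<le> l \<and> l < 1}"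
proof (intro equalityI subsetI)
  fix y assume "y \<in> hom ` inv_meas"
  then obtain \<nu> where \<nu>: "\<nu> \<in> inv_meas" "y = emb (wt (psi \<nu>))" by (auto simp: hom_def)
  have "l *\<^sub>R x \<noteq> y" if x: "x \<in> K" and l: "0 \<le> l" "l < 1" for x l
  proof
    assume eq: "l *\<^sub>R x = y"
    obtain m where m: "m \<in> IM" "x = emb (wt m)" using x by (auto simp: K_def)
    have "ennreal l * (\<integral>\<^sup>+x. ts x \<partial>m) \<le> ennreal l * 1" using IM_D(2)[OF m(1)] by (intro mult_left_mono) auto
    then have le: "ennreal l * (\<integral>\<^sup>+x. ts x \<partial>m) < 1" using l ennreal_less_one_iff[of l] by (metis le_less_trans mult.right_neutral)
    note sc = scale_IM[OF IM_D(1)[OF m(1)] l(1) less_imp_le[OF le]]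
    have "emb (wt (scale_measure l m)) = emb (wt (psi \<nu>))"
      using emb_scale[OF m(1) l(1) less_imp_le[OF le]] eq m(2) \<nu>(2) by simp
    then have "scale_measure l m = psi \<nu>" using emb_wt_inj[OF sc(1) psi_IM(1)[OF \<nu>(1)]] by simp
    then show False using sc(3) le psi_IM(2)[OF \<nu>(1)] by simp
  qed
  moreover have "y \<in> K" using \<nu> psi_IM by (auto simp: K_def)
  ultimately show "y \<in> K - {l *\<^sub>R x + (1 - l) *\<^sub>R 0 | x l. x \<in> K \<and> 0 \<le> l \<and> l < 1}" by force
next
  fix y assume y: "y \<in> K - {l *\<^sub>R x + (1 - l) *\<^sub>R 0 | x l. x \<in> K \<and> 0 \<le> l \<and> l < 1}"
  then obtain m where m: "m \<in> IM" "y = emb (wt m)" by (auto simp: K_def)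
  have "(\<integral>\<^sup>+x. ts x \<partial>m) = 1"
  proof (rule ccontr)
    assume "(\<integral>\<^sup>+x. ts x \<partial>m) \<noteq> 1"
    then have "(\<integral>\<^sup>+x. ts x \<partial>m) < 1" using IM_D(2)[OF m(1)] by simp
    then obtain r where r: "0 \<le> r" "r < 1" "(\<integral>\<^sup>+x. ts x \<partial>m) = ennreal r"
      by (cases "\<integral>\<^sup>+x. ts x \<partial>m") auto
    \<comment> \<open>The mean of \<open>r\<close> and one lies above \<open>r\<close>, yet stays
      positive when \<open>r\<close> vanishes.\<close>
    define l where "l = (r + 1) / 2"
    have l: "0 < l" "l < 1" "1 / l * r \<le> 1" using r by (auto simp: l_def field_simps)
    have le: "ennreal (1 / l) * (\<integral>\<^sup>+x. ts x \<partial>m) \<le> 1"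
      using l r by (simp add: ennreal_mult'[symmetric])
    have "emb (wt (scale_measure (1 / l) m)) = (1 / l) *\<^sub>R y"
      using emb_scale[OF m(1) _ le] l m(2) by simp
    moreover have "emb (wt (scale_measure (1 / l) m)) \<in> K"
      unfolding K_def using scale_IM(1)[OF IM_D(1)[OF m(1)] _ le] l by auto
    ultimately have "(1 / l) *\<^sub>R y \<in> K" by simp
    moreover have "y = l *\<^sub>R ((1 / l) *\<^sub>R y) + (1 - l) *\<^sub>R 0" using l by simp
    ultimately show False using y l less_imp_le by blast
  qed
  from nu_IM[OF m(1) this] show "y \<in> hom ` inv_meas" using m(2) by (auto simp: hom_def intro!: image_eqI[of _ _ "nu m"])
qed

lemma hom_affine: "affine_on_measures inv_meas hom"
  unfolding affine_on_measures_def hom_def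
proof (intro ballI)
  fix \<mu> \<nu> and u :: real assume "\<mu> \<in> inv_meas" "\<nu> \<in> inv_meas" "u \<in> {0..1}"
  then show "emb (wt (psi (convex_comb_measure u \<mu> \<nu>))) = u *\<^sub>R emb (wt (psi \<mu>)) + (1 - u) *\<^sub>R emb (wt (psi \<nu>))"
    by (simp add: psi_convex_comb K_comb psi_IM)
qed

lemma inv_meas_prob: "inv_meas \<subseteq> prob_measures_on YT"
  by (auto simp: inv_meas_def invariant_measures_def)

lemma hom_continuous:
  "continuous_map (subtopology (weak_star_topology YT) inv_meas) euclidean hom"
proof -
  let ?W = "subtopology (weak_star_topology YT) inv_meas"
  have "continuous_map ?W (product_topology (\<lambda>_. euclidean) UNIV) (\<lambda>\<nu> w. \<integral>y. bump w (rp y) \<partial>\<nu>)"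
    unfolding continuous_map_componentwise_UNIV
    by (intro allI continuous_map_from_subtopology continuous_map_integral bump_continuous bump_bounded)
  then have "continuous_map ?W euclidean (\<lambda>\<nu> w. \<integral>y. bump w (rp y) \<partial>\<nu>)"
    by (simp only: euclidean_product_topology)
  moreover have "continuous_map euclidean euclidean emb"
    using continuous_emb[of UNIV] by simp
  ultimately have "continuous_map ?W euclidean (emb \<circ> (\<lambda>\<nu> w. \<integral>y. bump w (rp y) \<partial>\<nu>))"
    by (rule continuous_map_compose)
  then show ?thesis
  proof (rule continuous_map_eq)
    fix \<nu> assume "\<nu> \<in> topspace ?W"
    then have "\<nu> \<in> inv_meas" by simp
    then have "(\<lambda>w. \<integral>y. bump w (rp y) \<partial>\<nu>) = wt (psi \<nu>)" by (simp add: integral_bump wt_def fun_eq_iff)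
    then show "(emb \<circ> (\<lambda>\<nu> w. \<integral>y. bump w (rp y) \<partial>\<nu>)) \<nu> = hom \<nu>" by (simp add: hom_def)
  qed
qed

text \<open>By Palm's formula the integral of \<open>g\<close> is, up to the factor
  \<open>c\<close>, that of its fibre integrals over the base, and these are lower
  semicontinuous.\<close>

lemma integral_liminf:
  assumes \<nu>: "\<And>n. \<nu> n \<in> inv_meas" "\<mu> \<in> inv_meas" and lim: "(\<lambda>n. hom (\<nu> n)) \<longlonglongrightarrow> hom \<mu>"
    and g: "continuous_map YT euclideanreal g" "bounded (g ` YS)" "\<And>y. y \<in> YS \<Longrightarrow> 0 \<le> g y" and e: "a < (\<integral>y. g y \<partial>\<mu>)"
  shows "\<forall>\<^sub>F n in sequentially. a < (\<integral>y. g y \<partial>\<nu> n)"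
proof -
  have wl: "(\<lambda>n. wt (psi (\<nu> n)) w) \<longlonglongrightarrow> wt (psi \<mu>) w" for w
    using lim \<nu> by (intro emb_tendsto_iff wt_in_cube psi_IM) (auto simp: hom_def)
  have nn: "0 \<le> (\<integral>y. g y \<partial>\<rho>)" and
    eq: "ennreal (c * (\<integral>y. g y \<partial>\<rho>)) = (\<integral>\<^sup>+x. vert (\<lambda>y. ennreal (g y)) x \<partial>psi \<rho>)" if \<rho>: "\<rho> \<in> inv_meas" for \<rho>
  proof -
    have AE: "AE y in \<rho>. 0 \<le> g y" using g(3) inv_measD(2)[OF \<rho>] by (intro AE_I2) simp
    show "0 \<le> (\<integral>y. g y \<partial>\<rho>)" using AE by (rule integral_nonneg_AE)
    have "(\<integral>\<^sup>+y. ennreal (g y) \<partial>\<rho>) = ennreal (\<integral>y. g y \<partial>\<rho>)"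
      by (rule nn_integral_eq_integral[OF cont_bounded_integrable[OF \<rho> g(1,2)] AE])
    then show "ennreal (c * (\<integral>y. g y \<partial>\<rho>)) = (\<integral>\<^sup>+x. vert (\<lambda>y. ennreal (g y)) x \<partial>psi \<rho>)"
      using palm[OF \<rho>, of "\<lambda>y. ennreal (g y)"] continuous_map_borel_of[OF g(1)] c_pos
      by (simp add: ennreal_mult')
  qed
  have "(\<integral>\<^sup>+x. vert (\<lambda>y. ennreal (g y)) x \<partial>psi \<mu>) \<le> liminf (\<lambda>n. \<integral>\<^sup>+x. vert (\<lambda>y. ennreal (g y)) x \<partial>psi (\<nu> n))"
  proof (rule nn_integral_liminf_cyl[where X = Sg])
    show "sets (psi (\<nu> n)) = sets borel" "sets (psi \<mu>) = sets borel" for n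
      by (intro IM_sets psi_IM \<nu>)+
    show "AE x in psi (\<nu> n). x \<in> Sg" "AE x in psi \<mu>. x \<in> Sg" for n
      by (intro AE_psi \<nu>)+
    show "\<exists>N. \<forall>y\<in>Sg. (\<forall>j<N. y j = x j) \<longrightarrow> a < vert (\<lambda>y. ennreal (g y)) y"
      if "x \<in> Sg" "a < vert (\<lambda>y. ennreal (g y)) x" for x a by (rule vert_lsc[OF g(1) that])
    show "(\<lambda>n. emeasure (psi (\<nu> n)) (cyl w)) \<longlonglongrightarrow> emeasure (psi \<mu>) (cyl w)" for w
      using tendsto_ennrealI[OF wl] by (simp add: emeasure_cyl IM_finite psi_IM \<nu>)
  qed
  then have le: "ennreal (c * (\<integral>y. g y \<partial>\<mu>)) \<le> liminf (\<lambda>n. ennreal (c * (\<integral>y. g y \<partial>\<nu> n)))"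
    by (simp add: eq \<nu>)
  show ?thesis
  \<comment> \<open>Negative levels are invisible in \<open>ennreal\<close> and are treated
    separately.\<close>
  proof (cases "a < 0")
    case True
    then show ?thesis using nn[OF \<nu>(1)] by (intro always_eventually allI) (meson less_le_trans)
  next
    case False
    then have "ennreal (c * a) < ennreal (c * (\<integral>y. g y \<partial>\<mu>))"
      using e c_pos by (simp add: ennreal_less_iff)
    then have "\<forall>\<^sub>F n in sequentially. ennreal (c * a) < ennreal (c * (\<integral>y. g y \<partial>\<nu> n))"
      using le by (intro less_LiminfD) simp
    then show ?thesis
      by eventually_elim (use False c_pos in \<open>simp add: ennreal_less_iff\<close>)
  qed
qed

lemma integral_tendsto:
  assumes \<nu>: "\<And>n. \<nu> n \<in> inv_meas" "\<mu> \<in> inv_meas" and lim: "(\<lambda>n. hom (\<nu> n)) \<longlonglongrightarrow> hom \<mu>"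
    and f: "continuous_map YT euclideanreal f" "bounded (f ` YS)"
  shows "(\<lambda>n. \<integral>y. f y \<partial>\<nu> n) \<longlonglongrightarrow> (\<integral>y. f y \<partial>\<mu>)"
proof -
  obtain C where C: "\<And>y. y \<in> YS \<Longrightarrow> \<bar>f y\<bar> \<le> C" using f(2) by (auto simp: bounded_iff)
  have int: "(\<integral>y. C + f y \<partial>\<rho>) = C + (\<integral>y. f y \<partial>\<rho>)" "(\<integral>y. C - f y \<partial>\<rho>) = C - (\<integral>y. f y \<partial>\<rho>)"
    if \<rho>: "\<rho> \<in> inv_meas" for \<rho>
  proof -
    interpret prob_space \<rho> by (rule inv_measD(3)[OF \<rho>])
    have "integrable \<rho> f" by (rule cont_bounded_integrable[OF \<rho> f])
    then show "(\<integral>y. C + f y \<partial>\<rho>) = C + (\<integral>y. f y \<partial>\<rho>)" "(\<integral>y. C - f y \<partial>\<rho>) = C - (\<integral>y. f y \<partial>\<rho>)"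
      by (simp_all add: prob_space)
  qed
  have bp: "bounded ((\<lambda>y. C + f y) ` YS)"
    unfolding bounded_iff
  proof (intro exI[of _ "\<bar>C\<bar> + C"] ballI)
    fix z assume "z \<in> (\<lambda>y. C + f y) ` YS" then show "norm z \<le> \<bar>C\<bar> + C" using C by fastforce
  qed
  have bm: "bounded ((\<lambda>y. C - f y) ` YS)"
    unfolding bounded_iff
  proof (intro exI[of _ "\<bar>C\<bar> + C"] ballI)
    fix z assume "z \<in> (\<lambda>y. C - f y) ` YS" then show "norm z \<le> \<bar>C\<bar> + C" using C by fastforce
  qed
  have cp: "continuous_map YT euclideanreal (\<lambda>y. C + f y)"
    by (intro continuous_map_add f(1)) simp
  have cm: "continuous_map YT euclideanreal (\<lambda>y. C - f y)"
    by (intro continuous_map_diff f(1)) simp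
  have np: "0 \<le> C + f y" "0 \<le> C - f y" if "y \<in> YS" for y using C[OF that] by auto
  show ?thesis
  proof (rule order_tendstoI)
    fix a assume "a < (\<integral>y. f y \<partial>\<mu>)"
    then have "C + a < (\<integral>y. C + f y \<partial>\<mu>)" by (simp add: int \<nu>)
    from integral_liminf[OF \<nu> lim cp bp np(1) this]
    show "\<forall>\<^sub>F n in sequentially. a < (\<integral>y. f y \<partial>\<nu> n)" by (simp add: int \<nu>)
  next
    fix a assume "(\<integral>y. f y \<partial>\<mu>) < a"
    then have "C - a < (\<integral>y. C - f y \<partial>\<mu>)" by (simp add: int \<nu>)
    from integral_liminf[OF \<nu> lim cm bm np(2) this]
    show "\<forall>\<^sub>F n in sequentially. (\<integral>y. f y \<partial>\<nu> n) < a" by (simp add: int \<nu>)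
  qed
qed

text \<open>The image is metric, so continuity of the inverse may be tested along sequences.\<close>

lemma hom_homeomorphic:
  "homeomorphic_map (subtopology (weak_star_topology YT) inv_meas) (top_of_set (hom ` inv_meas)) hom"
proof -
  let ?S = "hom ` inv_meas" and ?g = "inv_into inv_meas hom"
  have gh: "?g (hom \<nu>) = \<nu>" if "\<nu> \<in> inv_meas" for \<nu> using hom_inj that by simp
  have "continuous_map (top_of_set ?S) (weak_star_topology YT) ?g"
  proof (rule continuous_map_into_weak_star)
    show "?g y \<in> prob_measures_on YT" if "y \<in> ?S" for y using inv_into_into[OF that] inv_meas_prob by blast
    fix f assume f: "continuous_map YT euclideanreal f" "bounded (f ` YS)"
    show "continuous_on ?S (\<lambda>y. \<integral>z. f z \<partial>?g y)"
      unfolding continuous_on_sequentially comp_def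
    proof (intro allI ballI impI, elim conjE)
      fix u y assume y: "y \<in> ?S" and u: "\<forall>n. u n \<in> ?S" and lim: "u \<longlonglongrightarrow> y"
      show "(\<lambda>n. \<integral>z. f z \<partial>?g (u n)) \<longlonglongrightarrow> (\<integral>z. f z \<partial>?g y)"
        by (rule integral_tendsto[OF _ _ _ f])
          (use y u lim in \<open>auto simp: f_inv_into_f inv_into_into\<close>)
    qed
  qed
  then have g: "continuous_map (top_of_set ?S) (subtopology (weak_star_topology YT) inv_meas) ?g"
    by (auto simp: continuous_map_in_subtopology inv_into_into)
  have h: "continuous_map (subtopology (weak_star_topology YT) inv_meas) (top_of_set ?S) hom"
    using hom_continuous by (auto simp: continuous_map_in_subtopology)
  show ?thesis
    unfolding homeomorphic_map_maps homeomorphic_maps_def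
    using g h gh by (intro exI[of _ ?g]) (auto simp: f_inv_into_f)
qed

end

section \<open>Assembly from the hypotheses on the shift and the roof\<close>

lemma variation_bound:
  assumes fin: "variation B 2 \<phi> < \<infinity>" and n: "2 \<le> n"
    and xy: "x \<in> shift_space B" "y \<in> shift_space B" "\<And>i. i < n \<Longrightarrow> x i = y i"
  shows "\<bar>\<phi> x - \<phi> y\<bar> \<le> enn2real (variation B n \<phi>)"
proof -
  \<comment> \<open>The variations decrease in \<open>n\<close>, so they are finite from index two
    on and \<open>enn2real\<close> loses nothing.\<close>
  have "variation B n \<phi> \<le> variation B 2 \<phi>"
    unfolding variation_def using n by (intro SUP_subset_mono) auto
  then have "variation B n \<phi> < \<infinity>" using fin by (rule le_less_trans)
  moreover have "ennreal \<bar>\<phi> x - \<phi> y\<bar> \<le> variation B n \<phi>"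
    unfolding variation_def using xy by (intro SUP_upper2[of "(x, y)"]) auto
  ultimately have "enn2real (ennreal \<bar>\<phi> x - \<phi> y\<bar>) \<le> enn2real (variation B n \<phi>)"
    by (intro enn2real_mono) auto
  then show ?thesis by simp
qed

lemma starting_point:
  assumes "transition_matrix B" shows "\<exists>x\<in>shift_space B. x 0 = i"
proof -
  obtain s where s: "\<And>i. B i (s i) \<noteq> 0"
    using assms unfolding transition_matrix_def by metis
  have "B i (s i) = 1" for i
  proof -
    have "B i (s i) \<in> {0, 1}" using assms unfolding transition_matrix_def by blast
    then show ?thesis using s[of i] by auto
  qed
  then show ?thesis
    by (intro bexI[of _ "\<lambda>n. (s ^^ n) i"]) (auto simp: shift_space_def)
qed

lemma shift_map_funpow: "(shift_map ^^ n) x = (\<lambda>k. x (n + k))"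
  by (induction n) (auto simp: shift_map_def fun_eq_iff)

lemma transitive_connect:
  assumes "transition_matrix B" "transitive_shift B"
  shows "\<exists>x\<in>shift_space B. x 0 = i \<and> (\<exists>n\<ge>1. x n = j)"
proof -
  have ne: "cylinder B [k] \<noteq> {}" for k
    using starting_point[OF assms(1), of k] by (auto simp: cylinder_def)
  have op: "openin (shift_topology B) (cylinder B [k])" for k
    unfolding shift_topology_def by (rule topology_generated_by_Basis) blast
  obtain n :: nat where n: "n \<ge> 1" "cylinder B [i] \<inter> (shift_map ^^ n) -` cylinder B [j] \<noteq> {}"
    using assms(2) ne op unfolding transitive_shift_def by meson
  then obtain x where "x \<in> cylinder B [i]" "(shift_map ^^ n) x \<in> cylinder B [j]" by blast
  then show ?thesis using n(1) by (auto simp: cylinder_def shift_map_funpow)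
qed

theorem theorem6p18:
  fixes B :: "nat \<Rightarrow> nat \<Rightarrow> nat"
    and \<tau> :: "(nat \<Rightarrow> nat) \<Rightarrow> real"
    and \<theta> :: "real \<Rightarrow> ((nat \<Rightarrow> nat) \<times> real) set \<Rightarrow> ((nat \<Rightarrow> nat) \<times> real) set"
  assumes "transition_matrix B"
    and "transitive_shift B"
    and "\<tau> \<in> class_R B"
    and "suspension_semiflow B \<tau> \<theta>"
  shows "\<exists>(K :: (nat \<Rightarrow>\<^sub>C real) set) v h.
           poulsen_simplex K \<and> v extreme_point_of K \<and>
           homeomorphic_map
             (subtopology (weak_star_topology (suspension_topology B \<tau>)) (invariant_measures B \<tau> \<theta>))
             (top_of_set (K - {l *\<^sub>R x + (1 - l) *\<^sub>R v | x l. x \<in> K \<and> 0 \<le> l \<and> l < 1}))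
             h \<and>
           affine_on_measures (invariant_measures B \<tau> \<theta>) h"
proof -
  obtain c0 where c0: "0 < c0" "\<And>x. x \<in> shift_space B \<Longrightarrow> c0 \<le> \<tau> x"
    using assms(3) unfolding class_R_def by blast+
  have var_lim: "(\<lambda>n. variation B n \<tau>) \<longlonglongrightarrow> 0" and var_fin: "variation B 2 \<tau> < \<infinity>"
    and inf: "(\<lambda>k. INF x\<in>{x \<in> shift_space B. k \<le> x 0}. ereal (\<tau> x)) \<longlonglongrightarrow> \<infinity>"
    using assms(3) unfolding class_R_def by blast+
  define c where "c = c0 / 2"
  have c: "0 < c" "\<And>x. x \<in> shift_space B \<Longrightarrow> 2 * c \<le> \<tau> x" using c0 by (simp_all add: c_def)
  define ts where "ts x = (if x \<in> shift_space B then \<tau> x / c else 1)" for x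
  have E: "(\<lambda>n. enn2real (variation B n \<tau>)) \<longlonglongrightarrow> 0"
    using tendsto_enn2real[of "\<lambda>n. variation B n \<tau>" 0 sequentially] var_lim by simp
  have cont: "continuous_on (shift_space B) \<tau>"
    by (rule continuous_on_variation[OF variation_bound[OF var_fin] E])
  interpret flow_system B \<tau> c \<theta> ts "\<lambda>n. enn2real (variation B n \<tau>) / c"
  proof
    show "0 < c" by (rule c(1))
    show "2 * c \<le> \<tau> x" if "x \<in> shift_space B" for x by (rule c(2)[OF that])
    show "shift_space B \<noteq> {}" using starting_point[OF assms(1)] by blast
    show "1 \<le> ts x" for x using c(1) c(2)[of x] by (auto simp: ts_def)
    show "\<bar>ts x - ts y\<bar> \<le> enn2real (variation B n \<tau>) / c"
      if "2 \<le> n" "x \<in> shift_space B" "y \<in> shift_space B" "\<And>i. i < n \<Longrightarrow> x i = y i" for n x y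
    proof -
      have "\<bar>ts x - ts y\<bar> = \<bar>\<tau> x - \<tau> y\<bar> / c" using that c(1) by (simp add: ts_def diff_divide_distrib[symmetric])
      also have "\<dots> \<le> enn2real (variation B n \<tau>) / c"
        using variation_bound[OF var_fin that] c(1) by (intro divide_right_mono) auto
      finally show ?thesis .
    qed
    show "(\<lambda>n. enn2real (variation B n \<tau>) / c) \<longlonglongrightarrow> 0" using tendsto_divide_zero[OF E] .
    show "\<exists>k. \<forall>x\<in>shift_space B. k \<le> x 0 \<longrightarrow> r \<le> ts x" for r
    proof -
      have "\<forall>\<^sub>F k in sequentially. ereal (r * c) < (INF x\<in>{x \<in> shift_space B. k \<le> x 0}. ereal (\<tau> x))"
        using inf by (rule order_tendstoD) simp
      then obtain k where k: "ereal (r * c) < (INF x\<in>{x \<in> shift_space B. k \<le> x 0}. ereal (\<tau> x))"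
        by (auto simp: eventually_sequentially)
      have "r \<le> ts x" if "x \<in> shift_space B" "k \<le> x 0" for x
      proof -
        have "ereal (r * c) < ereal (\<tau> x)" using less_INF_D[OF k, of x] that by simp
        then show ?thesis using that c(1) by (simp add: ts_def pos_le_divide_eq less_imp_le)
      qed
      then show ?thesis by blast
    qed
    show "\<exists>x\<in>shift_space B. x 0 = i \<and> (\<exists>n\<ge>1. x n = j)" for i j
      by (rule transitive_connect[OF assms(1,2)])
  qed (simp_all add: cont assms(4) ts_def)
  show ?thesis
    using poulsen_K zero_extreme hom_homeomorphic[unfolded hom_image, unfolded inv_meas_def] hom_affine[unfolded inv_meas_def]
    by (intro exI[of _ K] exI[of _ 0] exI[of _ hom] conjI)
qed

end
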